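(* Let $Y$ be a projective variety over $\mathbf{k}$ covered by open affine subsets $U_i$, each of which is a flexible normal affine variety, such that for every $i$ the complement $Y\setminus U_i$ is (the support of) an effective divisor $D_i$ linearly equivalent to a very ample divisor $H$ on $Y$ (the same $H$ for all $i$). Then the affine cone $X=\operatorname{AffCone}_H Y$ is flexible.
   Context: The base field $\mathbf{k}$ is algebraically closed of characteristic zero; varieties are irreducible. $\mathbb{G}_a=(\mathbf{k},+)$ is the additive group. For an affine variety $X$, $\operatorname{SAut}(X)\subset\operatorname{Aut}(X)$ is the subgroup generated by all (images of) algebraic $\mathbb{G}_a$-actions on $X$. An irreducible affine variety $X$ is called flexible if $\operatorname{SAut}(X)$ acts transitively on the regular locus $X_{\mathrm{reg}}$ (equivalently, the tangent space at every $x\in X_{\mathrm{reg}}$ is spanned by tangent vectors to orbits of $\mathbb{G}_a$-actions on $X$). For a very ample divisor $H$ on a projective variety $Y$, $\operatorname{AffCone}_H Y\subset\mathbb{A}^{n+1}$ denotes the affine cone over the image of $Y$ under the embedding $Y\hookrightarrow\mathbb{P}^n$ given by the complete linear system $|H|$. *)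

theory Defs
  imports
    "HOL-Analysis.Function_Topology"
    "HOL-Algebra.Bij"
    "HOL-Algebra.Generated_Groups"
    "HOL-Computational_Algebra.Polynomial"
    "HOL-Library.Poly_Mapping"
    "HOL-Library.Function_Algebras"
    "HOL-Library.Extended_Nat"
begin

section \<open>Polynomials in the variables 0, 1, 2, ...\<close>

text \<open>A vector of length \<open>n\<close> is a function \<open>nat \<Rightarrow> 'k\<close> that vanishes from index \<open>n\<close> on. The variables
  of a polynomial are not bounded: evaluated at such a vector, a variable of index \<open>\<ge> n\<close> is 0.\<close>

type_synonym 'k mpol = "(nat \<Rightarrow>\<^sub>0 nat) \<Rightarrow>\<^sub>0 'k"

definition mp_eval :: "'k::field mpol \<Rightarrow> (nat \<Rightarrow> 'k) \<Rightarrow> 'k" where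
  "mp_eval p v = (\<Sum>m\<in>Poly_Mapping.keys p.
     Poly_Mapping.lookup p m * (\<Prod>i\<in>Poly_Mapping.keys m. v i ^ Poly_Mapping.lookup m i))"

definition mp_homogeneous :: "nat \<Rightarrow> 'k::field mpol \<Rightarrow> bool" where
  "mp_homogeneous d p \<longleftrightarrow> (\<forall>m\<in>Poly_Mapping.keys p.
     (\<Sum>i\<in>Poly_Mapping.keys m. Poly_Mapping.lookup m i) = d)"

definition mp_deriv :: "nat \<Rightarrow> 'k::field mpol \<Rightarrow> 'k mpol" where
  "mp_deriv i p = (\<Sum>m\<in>Poly_Mapping.keys p.
     Poly_Mapping.single (m - Poly_Mapping.single i 1)
       (of_nat (Poly_Mapping.lookup m i) * Poly_Mapping.lookup p m))"

section \<open>Spaces with functions\<close>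

text \<open>A topological space together with the \<open>'k\<close>-valued regular functions on each of its open
  sets. Values of a regular function outside its open set are irrelevant.\<close>

record ('p, 'k) fspace =
  ztop :: "'p topology"
  regs :: "'p set \<Rightarrow> ('p \<Rightarrow> 'k) set"

abbreviation points :: "('p, 'k) fspace \<Rightarrow> 'p set" where
  "points X \<equiv> topspace (ztop X)"

text \<open>The reduced induced structure on a closed subset, and the restriction to an open subset:
  functions that locally extend to regular functions of the ambient space.\<close>

definition subvar :: "('p, 'k) fspace \<Rightarrow> 'p set \<Rightarrow> ('p, 'k) fspace" where
  "subvar P Z = \<lparr>ztop = subtopology (ztop P) Z,
     regs = (\<lambda>V. {f. \<forall>x\<in>V. \<exists>W g. openin (ztop P) W \<and> x \<in> W \<and> g \<in> regs P W
                          \<and> (\<forall>y\<in>W \<inter> V. f y = g y)})\<rparr>"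

definition morphism :: "('p, 'k) fspace \<Rightarrow> ('q, 'k) fspace \<Rightarrow> ('p \<Rightarrow> 'q) \<Rightarrow> bool" where
  "morphism X Y \<phi> \<longleftrightarrow> continuous_map (ztop X) (ztop Y) \<phi> \<and>
     (\<forall>V g. openin (ztop Y) V \<and> g \<in> regs Y V \<longrightarrow> g \<circ> \<phi> \<in> regs X {x \<in> points X. \<phi> x \<in> V})"

definition isomorphism :: "('p, 'k) fspace \<Rightarrow> ('q, 'k) fspace \<Rightarrow> ('p \<Rightarrow> 'q) \<Rightarrow> bool" where
  "isomorphism X Y \<phi> \<longleftrightarrow> morphism X Y \<phi> \<and>
     (\<exists>\<psi>. morphism Y X \<psi> \<and> (\<forall>x\<in>points X. \<psi> (\<phi> x) = x) \<and> (\<forall>y\<in>points Y. \<phi> (\<psi> y) = y))"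

definition irreducible_space :: "'p topology \<Rightarrow> bool" where
  "irreducible_space T \<longleftrightarrow> topspace T \<noteq> {} \<and>
     (\<forall>A B. closedin T A \<and> closedin T B \<and> A \<union> B = topspace T \<longrightarrow> A = topspace T \<or> B = topspace T)"

definition krull_dim :: "'p topology \<Rightarrow> enat" where
  "krull_dim T = Sup {enat d | d. \<exists>Z. (\<forall>i\<le>d. closedin T (Z i) \<and> irreducible_space (subtopology T (Z i)))
                                    \<and> (\<forall>i<d. Z i \<subset> Z (Suc i))}"

section \<open>Affine and projective space\<close>

definition affine_points :: "nat \<Rightarrow> (nat \<Rightarrow> 'k::field) set" where
  "affine_points n = {v. \<forall>i\<ge>n. v i = 0}"

definition affine_space :: "nat \<Rightarrow> (nat \<Rightarrow> 'k::field, 'k) fspace" where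
  "affine_space n = (let T = topology_generated_by {{v \<in> affine_points n. mp_eval p v \<noteq> 0} | p. True} in
     \<lparr>ztop = T,
      regs = (\<lambda>U. {f. \<forall>x\<in>U. \<exists>V p q. openin T V \<and> x \<in> V \<and> V \<subseteq> U \<and>
                (\<forall>v\<in>V. mp_eval q v \<noteq> 0 \<and> f v = mp_eval p v / mp_eval q v)})\<rparr>)"

text \<open>A point of projective space is a line through the origin, with the origin removed.\<close>

definition proj_point :: "(nat \<Rightarrow> 'k::field) \<Rightarrow> (nat \<Rightarrow> 'k) set" where
  "proj_point v = {(\<lambda>i. c * v i) | c. c \<noteq> 0}"

definition proj_points :: "nat \<Rightarrow> (nat \<Rightarrow> 'k::field) set set" where
  "proj_points n = proj_point ` (affine_points (Suc n) - {\<lambda>i. 0})"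

definition proj_space :: "nat \<Rightarrow> ((nat \<Rightarrow> 'k::field) set, 'k) fspace" where
  "proj_space n = (let T = topology_generated_by
       {{x \<in> proj_points n. \<forall>v\<in>x. mp_eval p v \<noteq> 0} | p. \<exists>d. mp_homogeneous d p} in
     \<lparr>ztop = T,
      regs = (\<lambda>U. {f. \<forall>x\<in>U. \<exists>V p q d. openin T V \<and> x \<in> V \<and> V \<subseteq> U \<and>
                mp_homogeneous d p \<and> mp_homogeneous d q \<and>
                (\<forall>y\<in>V. \<forall>v\<in>y. mp_eval q v \<noteq> 0 \<and> f y = mp_eval p v / mp_eval q v)})\<rparr>)"

abbreviation affvar :: "nat \<Rightarrow> (nat \<Rightarrow> 'k::field) set \<Rightarrow> (nat \<Rightarrow> 'k, 'k) fspace" where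
  "affvar n X \<equiv> subvar (affine_space n) X"

abbreviation projvar :: "nat \<Rightarrow> (nat \<Rightarrow> 'k::field) set set \<Rightarrow> ((nat \<Rightarrow> 'k) set, 'k) fspace" where
  "projvar n Y \<equiv> subvar (proj_space n) Y"

definition affine_variety :: "nat \<Rightarrow> (nat \<Rightarrow> 'k::field) set \<Rightarrow> bool" where
  "affine_variety n X \<longleftrightarrow> closedin (ztop (affine_space n)) X \<and> irreducible_space (ztop (affvar n X))"

definition projective_variety :: "nat \<Rightarrow> (nat \<Rightarrow> 'k::field) set set \<Rightarrow> bool" where
  "projective_variety n Y \<longleftrightarrow> closedin (ztop (proj_space n)) Y \<and> irreducible_space (ztop (projvar n Y))"

section \<open>Flexibility\<close>

definition tangent_space :: "nat \<Rightarrow> (nat \<Rightarrow> 'k::field) set \<Rightarrow> (nat \<Rightarrow> 'k) \<Rightarrow> (nat \<Rightarrow> 'k) set" where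
  "tangent_space n X x = {v \<in> affine_points n.
     \<forall>p. (\<forall>y\<in>X. mp_eval p y = 0) \<longrightarrow> (\<Sum>i<n. mp_eval (mp_deriv i p) x * v i) = 0}"

definition regular_locus :: "nat \<Rightarrow> (nat \<Rightarrow> 'k::field) set \<Rightarrow> (nat \<Rightarrow> 'k) set" where
  "regular_locus n X = {x \<in> X.
     enat (vector_space.dim (\<lambda>c v i. c * v i) (tangent_space n X x)) = krull_dim (ztop (affvar n X))}"

text \<open>The product of the affine line with \<open>X\<close>, inside affine \<open>(n+1)\<close>-space, has the points
  \<open>case_nat t x\<close>, i.e. \<open>t\<close> followed by the coordinates of \<open>x\<close>.\<close>

definition line_times :: "(nat \<Rightarrow> 'k) set \<Rightarrow> (nat \<Rightarrow> 'k) set" where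
  "line_times X = {case_nat t x | t x. x \<in> X}"

definition Ga_action :: "nat \<Rightarrow> (nat \<Rightarrow> 'k::field) set \<Rightarrow> ('k \<Rightarrow> (nat \<Rightarrow> 'k) \<Rightarrow> (nat \<Rightarrow> 'k)) \<Rightarrow> bool" where
  "Ga_action n X \<phi> \<longleftrightarrow>
     morphism (affvar (Suc n) (line_times X)) (affvar n X) (\<lambda>w. \<phi> (w 0) (\<lambda>i. w (Suc i))) \<and>
     (\<forall>x\<in>X. \<phi> 0 x = x) \<and> (\<forall>s t. \<forall>x\<in>X. \<phi> (s + t) x = \<phi> s (\<phi> t x))"

text \<open>\<open>BijGroup X\<close> contains Aut(X) as a subgroup, so the subgroup generated by the images of the
  actions is the same in both.\<close>

definition SAut :: "nat \<Rightarrow> (nat \<Rightarrow> 'k::field) set \<Rightarrow> ((nat \<Rightarrow> 'k) \<Rightarrow> (nat \<Rightarrow> 'k)) set" where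
  "SAut n X = generate (BijGroup X) {restrict (\<phi> t) X | \<phi> t. Ga_action n X \<phi>}"

definition flexible :: "nat \<Rightarrow> (nat \<Rightarrow> 'k::field) set \<Rightarrow> bool" where
  "flexible n X \<longleftrightarrow> affine_variety n X \<and>
     (\<forall>x\<in>regular_locus n X. \<forall>y\<in>regular_locus n X. \<exists>g\<in>SAut n X. g x = y)"

definition flexible_affine :: "('p, 'k::field) fspace \<Rightarrow> bool" where
  "flexible_affine U \<longleftrightarrow> (\<exists>n X \<phi>. flexible n X \<and> isomorphism U (affvar n X) \<phi>)"

section \<open>Rational functions on an irreducible space\<close>

text \<open>A rational function is represented by a pair of a nonempty open set and a regular function
  on it; \<open>rat_eq\<close> is the equivalence of representatives.\<close>

type_synonym ('p, 'k) ratfun = "'p set \<times> ('p \<Rightarrow> 'k)"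

definition ratfuns :: "('p, 'k) fspace \<Rightarrow> ('p, 'k) ratfun set" where
  "ratfuns X = {(U, f). openin (ztop X) U \<and> U \<noteq> {} \<and> f \<in> regs X U}"

definition rat_eq :: "('p, 'k) ratfun \<Rightarrow> ('p, 'k) ratfun \<Rightarrow> bool" where
  "rat_eq r s \<longleftrightarrow> (\<forall>x\<in>fst r \<inter> fst s. snd r x = snd s x)"

definition rat_nonzero :: "('p, 'k::field) ratfun \<Rightarrow> bool" where
  "rat_nonzero r \<longleftrightarrow> (\<exists>x\<in>fst r. snd r x \<noteq> 0)"

definition rat_mult :: "('p, 'k::field) ratfun \<Rightarrow> ('p, 'k) ratfun \<Rightarrow> ('p, 'k) ratfun" where
  "rat_mult r s = (fst r \<inter> fst s, \<lambda>x. snd r x * snd s x)"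

definition rat_div :: "('p, 'k::field) ratfun \<Rightarrow> ('p, 'k) ratfun \<Rightarrow> ('p, 'k) ratfun" where
  "rat_div r s = (fst r \<inter> {x \<in> fst s. snd s x \<noteq> 0}, \<lambda>x. snd r x / snd s x)"

definition rat_lincomb :: "nat \<Rightarrow> (nat \<Rightarrow> 'k::field) \<Rightarrow> (nat \<Rightarrow> ('p, 'k) ratfun) \<Rightarrow> ('p, 'k) ratfun" where
  "rat_lincomb n c s = (\<Inter>j\<le>n. fst (s j), \<lambda>x. \<Sum>j\<le>n. c j * snd (s j) x)"

text \<open>Membership in the local ring at \<open>x\<close>, in its group of units, and the value at \<open>x\<close>.\<close>

definition rat_regular :: "('p, 'k) fspace \<Rightarrow> ('p, 'k) ratfun \<Rightarrow> 'p \<Rightarrow> bool" where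
  "rat_regular X r x \<longleftrightarrow> (\<exists>s\<in>ratfuns X. rat_eq r s \<and> x \<in> fst s)"

definition rat_unit :: "('p, 'k::field) fspace \<Rightarrow> ('p, 'k) ratfun \<Rightarrow> 'p \<Rightarrow> bool" where
  "rat_unit X r x \<longleftrightarrow> (\<exists>s\<in>ratfuns X. rat_eq r s \<and> x \<in> fst s \<and> snd s x \<noteq> 0)"

definition rat_value :: "('p, 'k) fspace \<Rightarrow> ('p, 'k) ratfun \<Rightarrow> 'p \<Rightarrow> 'k" where
  "rat_value X r x = (THE c. \<exists>s\<in>ratfuns X. rat_eq r s \<and> x \<in> fst s \<and> c = snd s x)"

text \<open>All local rings are integrally closed in the function field. The displayed equation is
  \<open>r^d + a (d-1) * r^(d-1) + ... + a 0 = 0\<close> in the function field.\<close>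

definition normal_variety :: "('p, 'k::field) fspace \<Rightarrow> bool" where
  "normal_variety X \<longleftrightarrow> irreducible_space (ztop X) \<and>
     (\<forall>x\<in>points X. \<forall>r\<in>ratfuns X. \<forall>d a.
        (\<forall>i<d. a i \<in> ratfuns X \<and> rat_regular X (a i) x) \<and>
        (\<forall>y\<in>fst r \<inter> (\<Inter>i<d. fst (a i)). snd r y ^ d + (\<Sum>i<d. snd (a i) y * snd r y ^ i) = 0)
        \<longrightarrow> rat_regular X r x)"

section \<open>Divisors\<close>

text \<open>A Cartier divisor is a global section of \<open>K\<^sup>*/O\<^sup>*\<close>, where \<open>K\<close> is the constant sheaf of rational
  functions: \<open>D x\<close> is a local equation at \<open>x\<close>, and it is a local equation at all points of some
  neighbourhood of \<open>x\<close>. Local equations at \<open>x\<close> matter only up to units of the local ring at \<open>x\<close>.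
  On a normal variety a Weil divisor linearly equivalent to a Cartier divisor is Cartier, with the
  same support and effectivity.\<close>

type_synonym ('p, 'k) divisor = "'p \<Rightarrow> ('p, 'k) ratfun"

definition cartier :: "('p, 'k::field) fspace \<Rightarrow> ('p, 'k) divisor \<Rightarrow> bool" where
  "cartier Y D \<longleftrightarrow> (\<forall>x\<in>points Y. D x \<in> ratfuns Y \<and> rat_nonzero (D x) \<and>
     (\<exists>V. openin (ztop Y) V \<and> x \<in> V \<and> (\<forall>z\<in>V. rat_unit Y (rat_div (D z) (D x)) z)))"

definition effective :: "('p, 'k::field) fspace \<Rightarrow> ('p, 'k) divisor \<Rightarrow> bool" where
  "effective Y D \<longleftrightarrow> (\<forall>x\<in>points Y. rat_regular Y (D x) x)"

definition div_support :: "('p, 'k::field) fspace \<Rightarrow> ('p, 'k) divisor \<Rightarrow> 'p set" where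
  "div_support Y D = {x \<in> points Y. \<not> rat_unit Y (D x) x}"

definition lin_equiv :: "('p, 'k::field) fspace \<Rightarrow> ('p, 'k) divisor \<Rightarrow> ('p, 'k) divisor \<Rightarrow> bool" where
  "lin_equiv Y D E \<longleftrightarrow> (\<exists>r\<in>ratfuns Y. rat_nonzero r \<and>
     (\<forall>x\<in>points Y. rat_unit Y (rat_div (D x) (rat_mult r (E x))) x))"

text \<open>The space of global sections of \<open>O(H)\<close>, and its bases \<open>s 0, ..., s n\<close>.\<close>

definition sections :: "('p, 'k::field) fspace \<Rightarrow> ('p, 'k) divisor \<Rightarrow> ('p, 'k) ratfun set" where
  "sections Y H = {r \<in> ratfuns Y. \<forall>x\<in>points Y. rat_regular Y (rat_mult r (H x)) x}"

definition section_basis ::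
  "('p, 'k::field) fspace \<Rightarrow> ('p, 'k) divisor \<Rightarrow> nat \<Rightarrow> (nat \<Rightarrow> ('p, 'k) ratfun) \<Rightarrow> bool" where
  "section_basis Y H n s \<longleftrightarrow>
     (\<forall>j\<le>n. s j \<in> sections Y H) \<and>
     (\<forall>c. \<not> rat_nonzero (rat_lincomb n c s) \<longrightarrow> (\<forall>j\<le>n. c j = 0)) \<and>
     (\<forall>r\<in>sections Y H. \<exists>c. rat_eq r (rat_lincomb n c s))"

text \<open>The map \<open>y \<mapsto> [s 0 (y) : ... : s n (y)]\<close> of the complete linear system \<open>|H|\<close>, where the
  sections are trivialised at \<open>y\<close> by the local equation of \<open>H\<close>. At a base point the value is \<open>{0}\<close>,
  which is not a point of projective space.\<close>

definition linsys_map ::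
  "('p, 'k::field) fspace \<Rightarrow> ('p, 'k) divisor \<Rightarrow> nat \<Rightarrow> (nat \<Rightarrow> ('p, 'k) ratfun) \<Rightarrow> 'p \<Rightarrow> (nat \<Rightarrow> 'k) set" where
  "linsys_map Y H n s y =
     proj_point (\<lambda>j. if j \<le> n then rat_value Y (rat_mult (s j) (H y)) y else 0)"

definition closed_embedding ::
  "('p, 'k::field) fspace \<Rightarrow> nat \<Rightarrow> ('p \<Rightarrow> (nat \<Rightarrow> 'k) set) \<Rightarrow> bool" where
  "closed_embedding Y n \<phi> \<longleftrightarrow> closedin (ztop (proj_space n)) (\<phi> ` points Y) \<and>
     isomorphism Y (projvar n (\<phi> ` points Y)) \<phi>"

definition very_ample :: "('p, 'k::field) fspace \<Rightarrow> ('p, 'k) divisor \<Rightarrow> bool" where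
  "very_ample Y H \<longleftrightarrow> cartier Y H \<and>
     (\<exists>n s. section_basis Y H n s \<and> closed_embedding Y n (linsys_map Y H n s))"

text \<open>The affine cone in affine \<open>(n+1)\<close>-space; it depends on the basis \<open>s\<close> only up to a linear
  change of coordinates.\<close>

definition aff_cone ::
  "('p, 'k::field) fspace \<Rightarrow> ('p, 'k) divisor \<Rightarrow> nat \<Rightarrow> (nat \<Rightarrow> ('p, 'k) ratfun) \<Rightarrow> (nat \<Rightarrow> 'k) set" where
  "aff_cone Y H n s = insert (\<lambda>i. 0) (\<Union>(linsys_map Y H n s ` points Y))"

end

theory Submission
  imports Defs
begin

text \<open>Off its vertex the cone \<open>X\<close> is covered by the sets \<open>X\<^sub>i = {l\<^sub>i \<noteq> 0}\<close> for linear forms \<open>l\<^sub>i\<close> whose divisors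
  are the \<open>D\<^sub>i\<close>, and \<open>X\<^sub>i\<close> is the product of \<open>U\<^sub>i\<close> with the punctured line, \<open>l\<^sub>i\<close> being the second
  coordinate. An additive action on \<open>U\<^sub>i\<close> extends to \<open>X\<close> after its time is multiplied by a high power of \<open>l\<^sub>i\<close>,
  so the regular points of \<open>X\<^sub>i\<close> on which \<open>l\<^sub>i\<close> has a given nonzero value lie in one orbit. A nonconstant
  orbit of an additive group in \<open>U\<^sub>i\<close> is a polynomial curve in \<open>{l\<^sub>i = 1}\<close>, and the vector of its top
  coefficients is a nonzero point of \<open>X\<close> where \<open>l\<^sub>i\<close> vanishes. Some other \<open>l\<^sub>j\<close> does not vanish there, so
  \<open>l\<^sub>j\<close> is a nonconstant polynomial along the curve and takes all values; hence all levels of \<open>l\<^sub>i\<close> are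
  joined through levels of \<open>l\<^sub>j\<close>. The vertex is regular only if \<open>X\<close> is the whole affine space.

  The dimension theory behind the regular locus is elementary: for a maximal set of variables that is
  algebraically independent modulo a prime ideal, its size equals both the generic dimension of
  the tangent space and the Krull dimension.\<close>
section \<open>Polynomial functions\<close>

text \<open>The lifted actions preserve \<open>l_i\<close>, so one chart can never change the level
  of its own form; this is why a curve in one chart has to be viewed through the form of another.

  Regularity is defined by embedded tangent spaces, while \<open>U_i\<close> comes with an embedding
  of its own. Along the product structure tangent dimensions differ by exactly one, the radial
  direction. For Krull dimensions the same follows by comparison at one point regular on both sides,
  so the regular points must be known to contain a nonempty open set.

  Two cases escape the argument with curves. If \<open>X\<close> is affine space, translations
  suffice. If a chart is a single point, it has no nonconstant orbit, but then \<open>X\<close>,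
  lying in no hyperplane, is again affine space.

  The cone belongs to the given basis of sections, very ampleness to some other one; both are
  carried along, with linear maps between them.

  Polynomials are functions on sequences with a set of permitted variables. Over an infinite field
  this loses nothing, and substitution becomes plain composition.\<close>

inductive_set polyf :: "nat set \<Rightarrow> ((nat \<Rightarrow> 'k::field) \<Rightarrow> 'k) set" for V where
  const: "(\<lambda>v. c) \<in> polyf V"
| var: "i \<in> V \<Longrightarrow> (\<lambda>v. v i) \<in> polyf V"
| add: "f \<in> polyf V \<Longrightarrow> g \<in> polyf V \<Longrightarrow> (\<lambda>v. f v + g v) \<in> polyf V"
| mult: "f \<in> polyf V \<Longrightarrow> g \<in> polyf V \<Longrightarrow> (\<lambda>v. f v * g v) \<in> polyf V"

lemma polyf_uminus: "f \<in> polyf V \<Longrightarrow> (\<lambda>v. - f v) \<in> polyf V"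
  using polyf.mult[OF polyf.const[of "-1"], of f] by simp

lemma polyf_diff: "f \<in> polyf V \<Longrightarrow> g \<in> polyf V \<Longrightarrow> (\<lambda>v. f v - g v) \<in> polyf V"
  using polyf.add[OF _ polyf_uminus, of f V g] by simp

lemma polyf_sum: "(\<And>i. i \<in> F \<Longrightarrow> f i \<in> polyf V) \<Longrightarrow> (\<lambda>v. \<Sum>i\<in>F. f i v) \<in> polyf V"
  by (induction F rule: infinite_finite_induct) (auto intro: polyf.intros)

lemma polyf_prod: "(\<And>i. i \<in> F \<Longrightarrow> f i \<in> polyf V) \<Longrightarrow> (\<lambda>v. \<Prod>i\<in>F. f i v) \<in> polyf V"
  by (induction F rule: infinite_finite_induct) (auto intro: polyf.intros)

lemma polyf_power: "f \<in> polyf V \<Longrightarrow> (\<lambda>v. f v ^ k) \<in> polyf V"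
  by (induction k) (auto intro: polyf.intros)

lemmas polyf_intros = polyf.intros polyf_uminus polyf_diff polyf_sum polyf_prod polyf_power

lemma polyf_mono: "f \<in> polyf V \<Longrightarrow> V \<subseteq> W \<Longrightarrow> f \<in> polyf W"
  by (induction rule: polyf.induct) (auto intro: polyf.intros)

lemma polyf_UNIV: "f \<in> polyf V \<Longrightarrow> f \<in> polyf UNIV"
  by (rule polyf_mono) auto

lemma polyf_cong: "f \<in> polyf V \<Longrightarrow> (\<And>i. i \<in> V \<Longrightarrow> v i = w i) \<Longrightarrow> f v = f w"
  by (induction rule: polyf.induct) auto

lemma polyf_subst:
  "f \<in> polyf V \<Longrightarrow> (\<And>i. i \<in> V \<Longrightarrow> g i \<in> polyf W) \<Longrightarrow> (\<lambda>v. f (\<lambda>i. g i v)) \<in> polyf W"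
  by (induction rule: polyf.induct) (auto intro: polyf.intros)

lemma polyf_upd_const:
  assumes "f \<in> polyf V"
  shows "(\<lambda>v. f (v(j := c))) \<in> polyf (V - {j})"
proof -
  have "(\<lambda>v. f (\<lambda>i. (if i = j then (\<lambda>v. c) else (\<lambda>v. v i)) v)) \<in> polyf (V - {j})"
    by (rule polyf_subst[OF assms]) (auto intro: polyf.intros)
  moreover have "(\<lambda>i. (if i = j then (\<lambda>v. c) else (\<lambda>v. v i)) v) = v(j := c)" for v :: "nat \<Rightarrow> 'a"
    by auto
  ultimately show ?thesis by simp
qed

lemma polyf_line:
  "f \<in> polyf V \<Longrightarrow> \<exists>q. \<forall>t. poly q t = f (\<lambda>i. x i + t * w i)"
proof (induction rule: polyf.induct)
  case (const c) then show ?case by (intro exI[of _ "[:c:]"]) simp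
next
  case (var i) then show ?case by (intro exI[of _ "[:x i, w i:]"]) simp
next
  case (add f g)
  then obtain p q where "\<forall>t. poly p t = f (\<lambda>i. x i + t * w i)" "\<forall>t. poly q t = g (\<lambda>i. x i + t * w i)"
    by blast
  then show ?case by (intro exI[of _ "p + q"]) simp
next
  case (mult f g)
  then obtain p q where "\<forall>t. poly p t = f (\<lambda>i. x i + t * w i)" "\<forall>t. poly q t = g (\<lambda>i. x i + t * w i)"
    by blast
  then show ?case by (intro exI[of _ "p * q"]) simp
qed

lemma poly_curve:
  assumes "f \<in> polyf V"
  shows "\<exists>q. \<forall>t. poly q t = f (\<lambda>i. poly (c i) t)"
  using assms
proof (induction rule: polyf.induct)
  case (const a) then show ?case by (intro exI[of _ "[:a:]"]) simp
next
  case (var i) then show ?case by (intro exI[of _ "c i"]) simp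
next
  case (add f g)
  then obtain p q where "\<forall>t. poly p t = f (\<lambda>i. poly (c i) t)" "\<forall>t. poly q t = g (\<lambda>i. poly (c i) t)"
    by blast
  then show ?case by (intro exI[of _ "p + q"]) simp
next
  case (mult f g)
  then obtain p q where "\<forall>t. poly p t = f (\<lambda>i. poly (c i) t)" "\<forall>t. poly q t = g (\<lambda>i. poly (c i) t)"
    by blast
  then show ?case by (intro exI[of _ "p * q"]) simp
qed

lemma poly_ext_infinite:
  fixes p q :: "'k::field_char_0 poly"
  assumes "infinite A" "\<And>t. t \<in> A \<Longrightarrow> poly p t = poly q t"
  shows "p = q"
proof (rule ccontr)
  assume "p \<noteq> q"
  then have "finite {t. poly (p - q) t = 0}" by (intro poly_roots_finite) simp
  moreover have "A \<subseteq> {t. poly (p - q) t = 0}" using assms by auto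
  ultimately show False using assms finite_subset by blast
qed

lemma infinite_UNIV_field_char_0: "infinite (UNIV :: 'k::field_char_0 set)"
  by (rule infinite_UNIV_char_0)

lemma poly_ext_UNIV:
  fixes p q :: "'k::field_char_0 poly"
  shows "(\<And>t. poly p t = poly q t) \<Longrightarrow> p = q"
  by (rule poly_ext_infinite[OF infinite_UNIV_field_char_0])

text \<open>On the line joining a point where \<open>f\<close> is nonzero to one where
  \<open>g\<close> is nonzero, both restrict to nonzero univariate polynomials, whose product cannot
  vanish.\<close>

lemma polyf_mult_eq_0:
  fixes f g :: "(nat \<Rightarrow> 'k::field_char_0) \<Rightarrow> 'k"
  assumes f: "f \<in> polyf V" and g: "g \<in> polyf W" and "\<And>v. f v * g v = 0" and "f x \<noteq> 0"
  shows "g = (\<lambda>v. 0)"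
proof (rule ccontr)
  assume "g \<noteq> (\<lambda>v. 0)"
  then obtain y where y: "g y \<noteq> 0" by auto
  obtain p where p: "\<And>t. poly p t = f (\<lambda>i. x i + t * (y i - x i))" using polyf_line[OF f] by metis
  obtain q where q: "\<And>t. poly q t = g (\<lambda>i. x i + t * (y i - x i))" using polyf_line[OF g] by metis
  have "poly (p * q) t = poly 0 t" for t using assms(3) by (simp add: p q)
  then have "p * q = 0" by (rule poly_ext_UNIV)
  moreover have "poly p 0 \<noteq> 0" "poly q 1 \<noteq> 0" using assms(4) y by (auto simp: p q)
  ultimately show False by auto
qed

section \<open>Directional derivatives\<close>

text \<open>The linear coefficient of the restriction to a line, so that no bound on the variables
  enters. For \<open>f\<close> in \<open>polyf\<close> such a polynomial exists, and it is unique
  because a field of characteristic zero is infinite.\<close>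

definition dd :: "((nat \<Rightarrow> 'k::field) \<Rightarrow> 'k) \<Rightarrow> (nat \<Rightarrow> 'k) \<Rightarrow> (nat \<Rightarrow> 'k) \<Rightarrow> 'k" where
  "dd f x w = coeff (THE q. \<forall>t. poly q t = f (\<lambda>i. x i + t * w i)) 1"

lemma dd_eqI:
  fixes f :: "(nat \<Rightarrow> 'k::field_char_0) \<Rightarrow> 'k"
  assumes "\<And>t. poly q t = f (\<lambda>i. x i + t * w i)"
  shows "dd f x w = coeff q 1"
proof -
  have "(THE q. \<forall>t. poly q t = f (\<lambda>i. x i + t * w i)) = q"
    using assms by (intro the_equality) (auto intro: poly_ext_UNIV)
  then show ?thesis by (simp add: dd_def)
qed

context
  fixes x w :: "nat \<Rightarrow> 'k::field_char_0"
begin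

lemma dd_const [simp]: "dd (\<lambda>v. c) x w = 0"
  by (subst dd_eqI[of "[:c:]"]) auto

lemma dd_var [simp]: "dd (\<lambda>v. v i) x w = w i"
  by (subst dd_eqI[of "[:x i, w i:]"]) auto

lemma dd_add:
  assumes "f \<in> polyf UNIV" "g \<in> polyf UNIV"
  shows "dd (\<lambda>v. f v + g v) x w = dd f x w + dd g x w"
proof -
  obtain p where p: "\<And>t. poly p t = f (\<lambda>i. x i + t * w i)" using polyf_line[OF assms(1)] by metis
  obtain q where q: "\<And>t. poly q t = g (\<lambda>i. x i + t * w i)" using polyf_line[OF assms(2)] by metis
  show ?thesis
    by (subst dd_eqI[of "p + q"]) (auto simp: p q dd_eqI[OF p] dd_eqI[OF q])
qed

lemma dd_mult:
  assumes "f \<in> polyf UNIV" "g \<in> polyf UNIV"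
  shows "dd (\<lambda>v. f v * g v) x w = f x * dd g x w + g x * dd f x w"
proof -
  obtain p where p: "\<And>t. poly p t = f (\<lambda>i. x i + t * w i)" using polyf_line[OF assms(1)] by metis
  obtain q where q: "\<And>t. poly q t = g (\<lambda>i. x i + t * w i)" using polyf_line[OF assms(2)] by metis
  have "coeff p 0 = f x" "coeff q 0 = g x" by (simp_all add: poly_0_coeff_0[symmetric] p q)
  moreover have "dd (\<lambda>v. f v * g v) x w = coeff (p * q) 1"
    by (rule dd_eqI) (simp add: p q)
  moreover have "coeff (p * q) 1 = coeff p 0 * coeff q 1 + coeff q 0 * coeff p 1"
    by (simp add: coeff_mult atMost_Suc mult.commute)
  ultimately show ?thesis
    by (simp add: dd_eqI[OF p] dd_eqI[OF q])
qed

lemma dd_uminus: "f \<in> polyf UNIV \<Longrightarrow> dd (\<lambda>v. - f v) x w = - dd f x w"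
  using dd_mult[OF polyf.const[of "-1"], of f] by simp

lemma dd_diff:
  "f \<in> polyf UNIV \<Longrightarrow> g \<in> polyf UNIV \<Longrightarrow> dd (\<lambda>v. f v - g v) x w = dd f x w - dd g x w"
  using dd_add[OF _ polyf_uminus, of f g] dd_uminus[of g] by simp

lemma dd_sum:
  "(\<And>i. i \<in> F \<Longrightarrow> f i \<in> polyf UNIV) \<Longrightarrow> dd (\<lambda>v. \<Sum>i\<in>F. f i v) x w = (\<Sum>i\<in>F. dd (f i) x w)"
proof (induction F rule: infinite_finite_induct)
  case (insert i F)
  then show ?case by (simp add: dd_add polyf_sum)
qed auto

lemma dd_power:
  assumes f: "f \<in> polyf UNIV"
  shows "dd (\<lambda>v. f v ^ k) x w = of_nat k * f x ^ (k - 1) * dd f x w"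
proof (induction k)
  case (Suc k)
  have "dd (\<lambda>v. f v ^ Suc k) x w = f x * dd (\<lambda>v. f v ^ k) x w + f x ^ k * dd f x w"
    using dd_mult[OF f polyf_power[OF f, of k]] by simp
  also have "\<dots> = of_nat (Suc k) * f x ^ (Suc k - 1) * dd f x w"
    unfolding Suc by (cases k) (auto simp: algebra_simps)
  finally show ?case .
qed simp

lemma dd_prod:
  assumes "finite F" "\<And>i. i \<in> F \<Longrightarrow> f i \<in> polyf UNIV"
  shows "dd (\<lambda>v. \<Prod>i\<in>F. f i v) x w = (\<Sum>i\<in>F. dd (f i) x w * (\<Prod>k\<in>F-{i}. f k x))"
  using assms
proof (induction F rule: finite_induct)
  case (insert j F)
  have "(\<Sum>i\<in>F. dd (f i) x w * (\<Prod>k\<in>insert j F-{i}. f k x))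
      = (\<Sum>i\<in>F. dd (f i) x w * (f j x * (\<Prod>k\<in>F-{i}. f k x)))"
    by (intro sum.cong) (use insert in \<open>auto simp: insert_Diff_if\<close>)
  also have "\<dots> = f j x * (\<Sum>i\<in>F. dd (f i) x w * (\<Prod>k\<in>F-{i}. f k x))"
    by (simp add: sum_distrib_left algebra_simps)
  finally show ?case using insert
    by (simp add: dd_mult polyf_prod)
qed auto

end

lemma dd_cong:
  "(\<And>t. f (\<lambda>i. x i + t * w i) = g (\<lambda>i. x i + t * w i)) \<Longrightarrow> dd f x w = dd g x w"
  by (simp add: dd_def)

lemma dd_chain:
  fixes x w :: "nat \<Rightarrow> 'k::field_char_0"
  assumes "f \<in> polyf V" "\<And>i. i \<in> V \<Longrightarrow> g i \<in> polyf UNIV"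
  shows "dd (\<lambda>v. f (\<lambda>i. g i v)) x w = dd f (\<lambda>i. g i x) (\<lambda>i. dd (g i) x w)"
  using assms
proof (induction rule: polyf.induct)
  case (add f h)
  then show ?case
    by (simp add: dd_add polyf_UNIV[of _ V] polyf_subst[of f V g] polyf_subst[of h V g])
next
  case (mult f h)
  then show ?case
    by (simp add: dd_mult polyf_UNIV[of _ V] polyf_subst[of f V g] polyf_subst[of h V g])
qed auto

lemma dd_linear:
  fixes x w :: "nat \<Rightarrow> 'k::field_char_0"
  shows "f \<in> polyf UNIV \<Longrightarrow> dd f x (\<lambda>i. a * w i + b * u i) = a * dd f x w + b * dd f x u"
  by (induction rule: polyf.induct) (auto simp: dd_add dd_mult algebra_simps)

lemma dd_dir_cong:
  fixes x w :: "nat \<Rightarrow> 'k::field_char_0"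
  shows "f \<in> polyf V \<Longrightarrow> (\<And>i. i \<in> V \<Longrightarrow> w i = u i) \<Longrightarrow> dd f x w = dd f x u"
  by (induction rule: polyf.induct) (auto simp: dd_add dd_mult polyf_UNIV[of _ V])

lemma dd_0 [simp]:
  fixes x :: "nat \<Rightarrow> 'k::field_char_0"
  shows "f \<in> polyf UNIV \<Longrightarrow> dd f x (\<lambda>i. 0) = 0"
  using dd_linear[of f x 0 _ 0] by simp

lemma dd_add_dir:
  fixes x w :: "nat \<Rightarrow> 'k::field_char_0"
  shows "f \<in> polyf UNIV \<Longrightarrow> dd f x (\<lambda>i. w i + u i) = dd f x w + dd f x u"
  using dd_linear[of f x 1 w 1 u] by simp

lemma dd_scale_dir:
  fixes x w :: "nat \<Rightarrow> 'k::field_char_0"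
  shows "f \<in> polyf UNIV \<Longrightarrow> dd f x (\<lambda>i. a * w i) = a * dd f x w"
  using dd_linear[of f x a w 0 w] by simp

section \<open>Evaluation of polynomials\<close>

lemma mp_eval_superset:
  assumes "finite K" "Poly_Mapping.keys p \<subseteq> K"
  shows "mp_eval p v = (\<Sum>m\<in>K. Poly_Mapping.lookup p m * (\<Prod>i\<in>Poly_Mapping.keys m. v i ^ Poly_Mapping.lookup m i))"
  unfolding mp_eval_def by (rule sum.mono_neutral_left) (use assms in \<open>auto simp: in_keys_iff\<close>)

lemma monomial_superset:
  assumes "finite K" "Poly_Mapping.keys m \<subseteq> K"
  shows "(\<Prod>i\<in>Poly_Mapping.keys m. (v i :: 'k::field) ^ Poly_Mapping.lookup m i) = (\<Prod>i\<in>K. v i ^ Poly_Mapping.lookup m i)"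
  by (rule prod.mono_neutral_left) (use assms in \<open>auto simp: in_keys_iff\<close>)

lemma mp_eval_0 [simp]: "mp_eval 0 v = 0"
  by (simp add: mp_eval_def)

lemma mp_eval_add: "mp_eval (p + q) v = mp_eval p v + mp_eval q v"
proof -
  let ?K = "Poly_Mapping.keys p \<union> Poly_Mapping.keys q"
  have "Poly_Mapping.keys (p + q) \<subseteq> ?K" by (rule Poly_Mapping.keys_add)
  then show ?thesis
    by (simp add: mp_eval_superset[of ?K] lookup_add sum.distrib algebra_simps)
qed

lemma mp_eval_single:
  "mp_eval (Poly_Mapping.single m a) v = a * (\<Prod>i\<in>Poly_Mapping.keys m. v i ^ Poly_Mapping.lookup m i)"
  by (simp add: mp_eval_def)

lemma mpol_induct [case_names zero single add]:
  fixes p :: "'a \<Rightarrow>\<^sub>0 'b::comm_monoid_add"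
  assumes "Q 0" "\<And>m a. Q (Poly_Mapping.single m a)" "\<And>p q. Q p \<Longrightarrow> Q q \<Longrightarrow> Q (p + q)"
  shows "Q p"
proof (induction p rule: update_induct)
  case const show ?case by (rule assms(1))
next
  case (update f a b)
  have "Poly_Mapping.update a b f = f + Poly_Mapping.single a b"
    by (rule poly_mapping_eqI)
       (use update in \<open>auto simp: lookup_update lookup_add lookup_single in_keys_iff when_def\<close>)
  then show ?case using update assms by simp
qed

lemma mp_eval_mult: "mp_eval (p * q) v = mp_eval p v * mp_eval q v"
proof (induction p rule: mpol_induct)
  case (single m a)
  show ?case
  proof (induction q rule: mpol_induct)
    case (single n b)
    let ?K = "Poly_Mapping.keys m \<union> Poly_Mapping.keys n"
    have "Poly_Mapping.keys (m + n) \<subseteq> ?K" by (rule Poly_Mapping.keys_add)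
    then have "(\<Prod>i\<in>Poly_Mapping.keys (m + n). v i ^ Poly_Mapping.lookup (m + n) i)
        = (\<Prod>i\<in>?K. v i ^ Poly_Mapping.lookup (m + n) i)"
      by (intro monomial_superset) auto
    then show ?case
      by (simp add: mult_single mp_eval_single monomial_superset[of ?K m] monomial_superset[of ?K n]
          lookup_add power_add prod.distrib)
  qed (simp_all add: mp_eval_add algebra_simps)
qed (simp_all add: mp_eval_add algebra_simps)

lemma mp_eval_polyf: "mp_eval p \<in> polyf UNIV"
proof -
  have "(\<lambda>v. mp_eval p v) \<in> polyf UNIV"
    unfolding mp_eval_def by (intro polyf_intros) auto
  then show ?thesis by simp
qed

definition mp_const :: "'k::field \<Rightarrow> 'k mpol" where "mp_const c = Poly_Mapping.single 0 c"
definition mp_var :: "nat \<Rightarrow> 'k::field mpol" where "mp_var i = Poly_Mapping.single (Poly_Mapping.single i 1) 1"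

lemma mp_eval_const [simp]: "mp_eval (mp_const c) v = c"
  by (simp add: mp_const_def mp_eval_single)

lemma mp_eval_var [simp]: "mp_eval (mp_var i) v = v i"
  by (simp add: mp_var_def mp_eval_single)

lemma polyf_imp_mp_eval: "f \<in> polyf V \<Longrightarrow> \<exists>p. f = mp_eval p"
proof (induction rule: polyf.induct)
  case (const c) show ?case by (intro exI[of _ "mp_const c"]) auto
next
  case (var i) show ?case by (intro exI[of _ "mp_var i"]) auto
next
  case (add f g)
  then obtain p q where "f = mp_eval p" "g = mp_eval q" by blast
  then show ?case by (intro exI[of _ "p + q"]) (auto simp: mp_eval_add)
next
  case (mult f g)
  then obtain p q where "f = mp_eval p" "g = mp_eval q" by blast
  then show ?case by (intro exI[of _ "p * q"]) (auto simp: mp_eval_mult)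
qed

lemma mp_deriv_superset:
  assumes "finite K" "Poly_Mapping.keys p \<subseteq> K"
  shows "mp_deriv i p = (\<Sum>m\<in>K. Poly_Mapping.single (m - Poly_Mapping.single i 1)
       (of_nat (Poly_Mapping.lookup m i) * Poly_Mapping.lookup p m))"
  unfolding mp_deriv_def by (rule sum.mono_neutral_left) (use assms in \<open>auto simp: in_keys_iff\<close>)

lemma mp_deriv_add: "mp_deriv i (p + q) = mp_deriv i p + mp_deriv i q"
proof -
  let ?K = "Poly_Mapping.keys p \<union> Poly_Mapping.keys q"
  have "Poly_Mapping.keys (p + q) \<subseteq> ?K" by (rule Poly_Mapping.keys_add)
  then show ?thesis
    by (simp add: mp_deriv_superset[of ?K] lookup_add sum.distrib algebra_simps single_add)
qed

lemma mp_deriv_single: "mp_deriv i (Poly_Mapping.single m a)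
   = Poly_Mapping.single (m - Poly_Mapping.single i 1) (of_nat (Poly_Mapping.lookup m i) * a)"
  by (simp add: mp_deriv_def)

text \<open>Identifies the formal gradient in the definition of \<open>tangent_space\<close> with
  \<open>dd\<close>. By additivity only a monomial matters, where it is the product rule. Since
  \<open>w\<close> vanishes from index \<open>n\<close> on, the sum over \<open>i < n\<close> misses
  nothing.\<close>

lemma mp_eval_deriv:
  fixes x w :: "nat \<Rightarrow> 'k::field_char_0"
  assumes "w \<in> affine_points n"
  shows "(\<Sum>i<n. mp_eval (mp_deriv i p) x * w i) = dd (mp_eval p) x w"
proof (induction p rule: mpol_induct)
  case zero
  then show ?case by (simp add: mp_deriv_def mp_eval_def)
next
  case (add p q)
  have "dd (mp_eval (p + q)) x w = dd (\<lambda>v. mp_eval p v + mp_eval q v) x w"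
    by (simp add: mp_eval_add[abs_def])
  also have "\<dots> = dd (mp_eval p) x w + dd (mp_eval q) x w"
    using mp_eval_polyf by (rule dd_add) (rule mp_eval_polyf)
  finally have dd: "dd (mp_eval (p + q)) x w = dd (mp_eval p) x w + dd (mp_eval q) x w" .
  show ?case unfolding dd by (simp add: mp_deriv_add mp_eval_add distrib_right sum.distrib add)
next
  case (single m a)
  let ?K = "Poly_Mapping.keys m"
  let ?g = "\<lambda>i v. v i ^ Poly_Mapping.lookup m i"
  have g: "?g i \<in> polyf UNIV" for i by (intro polyf_intros) auto
  have eval: "mp_eval (mp_deriv i (Poly_Mapping.single m a)) x
    = a * of_nat (Poly_Mapping.lookup m i) * x i ^ (Poly_Mapping.lookup m i - 1) * (\<Prod>k\<in>?K-{i}. ?g k x)"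
    if "i \<in> ?K" for i
  proof -
    have "(\<Prod>k\<in>Poly_Mapping.keys (m - Poly_Mapping.single i 1). x k ^ Poly_Mapping.lookup (m - Poly_Mapping.single i 1) k)
       = (\<Prod>k\<in>?K. x k ^ Poly_Mapping.lookup (m - Poly_Mapping.single i 1) k)"
      by (rule monomial_superset) (auto simp: in_keys_iff lookup_minus)
    also have "\<dots> = x i ^ (Poly_Mapping.lookup m i - 1) * (\<Prod>k\<in>?K-{i}. x k ^ Poly_Mapping.lookup (m - Poly_Mapping.single i 1) k)"
      using that by (subst prod.remove[of _ i]) (auto simp: lookup_minus)
    also have "(\<Prod>k\<in>?K-{i}. x k ^ Poly_Mapping.lookup (m - Poly_Mapping.single i 1) k) = (\<Prod>k\<in>?K-{i}. ?g k x)"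
      by (intro prod.cong) (auto simp: lookup_minus lookup_single)
    finally show ?thesis by (simp add: mp_deriv_single mp_eval_single)
  qed
  have "dd (mp_eval (Poly_Mapping.single m a)) x w = dd (\<lambda>v. a * (\<Prod>i\<in>?K. ?g i v)) x w"
    by (simp add: mp_eval_single[abs_def])
  also have "\<dots> = a * dd (\<lambda>v. \<Prod>i\<in>?K. ?g i v) x w"
    using g by (subst dd_mult) (use g in \<open>auto intro!: polyf.const polyf_prod[of _ ?g]\<close>)
  also have "dd (\<lambda>v. \<Prod>i\<in>?K. ?g i v) x w = (\<Sum>i\<in>?K. dd (?g i) x w * (\<Prod>k\<in>?K-{i}. ?g k x))"
    by (rule dd_prod) (use g in auto)
  also have "\<dots> = (\<Sum>i\<in>?K. of_nat (Poly_Mapping.lookup m i) * x i ^ (Poly_Mapping.lookup m i - 1) * w i * (\<Prod>k\<in>?K-{i}. ?g k x))"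
    by (intro sum.cong) (auto simp: dd_power polyf.var)
  also have "a * \<dots> = (\<Sum>i\<in>?K. mp_eval (mp_deriv i (Poly_Mapping.single m a)) x * w i)"
    by (simp add: eval sum_distrib_left mult_ac)
  also have "\<dots> = (\<Sum>i\<in>?K \<inter> {..<n}. mp_eval (mp_deriv i (Poly_Mapping.single m a)) x * w i)"
    by (rule sum.mono_neutral_right) (use assms in \<open>auto simp: affine_points_def not_less[symmetric]\<close>)
  also have "\<dots> = (\<Sum>i<n. mp_eval (mp_deriv i (Poly_Mapping.single m a)) x * w i)"
    by (rule sum.mono_neutral_left) (auto simp: mp_deriv_single in_keys_iff intro!: gr0I)
  finally show ?case by simp
qed

text \<open>Tangent vectors only see directions inside affine \<open>n\<close>-space, so the polynomials in the
  first \<open>n\<close> variables suffice.\<close>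

definition trunc :: "nat \<Rightarrow> (nat \<Rightarrow> 'k::field) \<Rightarrow> nat \<Rightarrow> 'k" where
  "trunc n v = (\<lambda>i. if i < n then v i else 0)"

lemma trunc_affine [simp]: "trunc n v \<in> affine_points n"
  by (simp add: trunc_def affine_points_def)

lemma trunc_id: "v \<in> affine_points n \<Longrightarrow> trunc n v = v"
  by (auto simp: trunc_def affine_points_def)

lemma polyf_trunc_eq: "f \<in> polyf {..<n} \<Longrightarrow> f (trunc n v) = f v"
  by (rule polyf_cong) (auto simp: trunc_def)

lemma polyf_trunc:
  assumes "f \<in> polyf V" shows "(\<lambda>v. f (trunc n v)) \<in> polyf {..<n}"
proof -
  have "(\<lambda>v. f (\<lambda>i. (if i < n then (\<lambda>v. v i) else (\<lambda>v. 0)) v)) \<in> polyf {..<n}"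
    by (rule polyf_subst[OF assms]) (auto intro: polyf.intros)
  moreover have "(\<lambda>i. (if i < n then (\<lambda>v. v i) else (\<lambda>v. 0)) v) = trunc n v" for v :: "nat \<Rightarrow> 'a"
    by (auto simp: trunc_def)
  ultimately show ?thesis by simp
qed

lemma affine_points_line: "x \<in> affine_points n \<Longrightarrow> w \<in> affine_points n \<Longrightarrow> (\<lambda>i. x i + t * w i) \<in> affine_points n"
  by (auto simp: affine_points_def)

definition ideal_of :: "nat \<Rightarrow> (nat \<Rightarrow> 'k::field) set \<Rightarrow> ((nat \<Rightarrow> 'k) \<Rightarrow> 'k) set" where
  "ideal_of n X = {f \<in> polyf {..<n}. \<forall>x\<in>X. f x = 0}"

lemma tangent_space_iff:
  fixes X :: "(nat \<Rightarrow> 'k::field_char_0) set"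
  assumes "X \<subseteq> affine_points n" "x \<in> X"
  shows "w \<in> tangent_space n X x \<longleftrightarrow> w \<in> affine_points n \<and> (\<forall>f\<in>ideal_of n X. dd f x w = 0)"
proof (cases "w \<in> affine_points n")
  case True
  have xa: "x \<in> affine_points n" using assms by auto
  have "dd f x w = 0" if "\<forall>p. (\<forall>y\<in>X. mp_eval p y = 0) \<longrightarrow> dd (mp_eval p) x w = 0" "f \<in> ideal_of n X" for f
    using that polyf_imp_mp_eval[of f "{..<n}"] by (auto simp: ideal_of_def)
  moreover have "dd (mp_eval p) x w = 0" if *: "\<forall>f\<in>ideal_of n X. dd f x w = 0" "\<forall>y\<in>X. mp_eval p y = 0" for p
  proof -
    have "(\<lambda>v. mp_eval p (trunc n v)) \<in> ideal_of n X"
      using that assms polyf_trunc[OF mp_eval_polyf, of p n]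
      by (auto simp: ideal_of_def trunc_id subset_iff)
    with * have "dd (\<lambda>v. mp_eval p (trunc n v)) x w = 0" by blast
    moreover have "dd (\<lambda>v. mp_eval p (trunc n v)) x w = dd (mp_eval p) x w"
      by (rule dd_cong) (simp add: trunc_id affine_points_line[OF xa True])
    ultimately show ?thesis by simp
  qed
  ultimately show ?thesis using True by (auto simp: tangent_space_def mp_eval_deriv)
qed (simp add: tangent_space_def)

section \<open>Polynomials in one distinguished variable\<close>

text \<open>The bound on the degree is strict: \<open>pdeg V j 0\<close> is zero, and a polynomial
  with leading term \<open>c * x_j ^ d\<close> appears as \<open>g + c * x_j ^ d\<close> with
  \<open>g\<close> in \<open>pdeg V j d\<close>. This shape is used for all equations below.\<close>

definition pdeg :: "nat set \<Rightarrow> nat \<Rightarrow> nat \<Rightarrow> ((nat \<Rightarrow> 'k::field) \<Rightarrow> 'k) set" where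
  "pdeg V j d = {f. \<exists>c. (\<forall>k. c k \<in> polyf V) \<and> f = (\<lambda>v. \<Sum>k<d. c k v * v j ^ k)}"

lemma pdeg_0 [simp]: "pdeg V j 0 = {\<lambda>v. 0}"
  by (auto simp: pdeg_def intro: polyf.const)

lemma pdeg_Suc:
  "f \<in> pdeg V j (Suc d) \<longleftrightarrow> (\<exists>g\<in>pdeg V j d. \<exists>c\<in>polyf V. f = (\<lambda>v. g v + c v * v j ^ d))"
proof
  assume "f \<in> pdeg V j (Suc d)"
  then obtain c where "\<forall>k. c k \<in> polyf V" "f = (\<lambda>v. \<Sum>k<Suc d. c k v * v j ^ k)"
    by (auto simp: pdeg_def)
  then show "\<exists>g\<in>pdeg V j d. \<exists>c\<in>polyf V. f = (\<lambda>v. g v + c v * v j ^ d)"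
    by (intro bexI[of _ "\<lambda>v. \<Sum>k<d. c k v * v j ^ k"] bexI[of _ "c d"]) (auto simp: pdeg_def)
next
  assume "\<exists>g\<in>pdeg V j d. \<exists>c\<in>polyf V. f = (\<lambda>v. g v + c v * v j ^ d)"
  then obtain c c' where c: "\<forall>k. c k \<in> polyf V" "c' \<in> polyf V"
      "f = (\<lambda>v. (\<Sum>k<d. c k v * v j ^ k) + c' v * v j ^ d)"
    by (auto simp: pdeg_def)
  then show "f \<in> pdeg V j (Suc d)"
    unfolding pdeg_def by (intro CollectI exI[of _ "c(d := c')"]) auto
qed

lemma pdeg_SucI: "g \<in> pdeg V j d \<Longrightarrow> c \<in> polyf V \<Longrightarrow> (\<lambda>v. g v + c v * v j ^ d) \<in> pdeg V j (Suc d)"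
  by (auto simp: pdeg_Suc)

lemma pdeg_SucE:
  assumes "f \<in> pdeg V j (Suc d)"
  obtains g c where "g \<in> pdeg V j d" "c \<in> polyf V" "f = (\<lambda>v. g v + c v * v j ^ d)"
  using assms by (auto simp: pdeg_Suc)

lemma pdeg_Suc_mono: "f \<in> pdeg V j d \<Longrightarrow> f \<in> pdeg V j (Suc d)"
  using pdeg_SucI[of f V j d "\<lambda>v. 0"] by (simp add: polyf.const)

lemma pdeg_mono:
  assumes "d \<le> e" "f \<in> pdeg V j d" shows "f \<in> pdeg V j e"
  using assms(1)
proof (induction rule: dec_induct)
  case (step n)
  show ?case by (rule pdeg_Suc_mono[OF step.IH])
qed (rule assms(2))

lemma pdeg_mono_vars: "f \<in> pdeg V j d \<Longrightarrow> V \<subseteq> W \<Longrightarrow> f \<in> pdeg W j d"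
  unfolding pdeg_def using polyf_mono[of _ V W] by fastforce

lemma pdeg_zero: "(\<lambda>v. 0) \<in> pdeg V j d"
  using pdeg_mono[of 0 d "\<lambda>v. 0" V j] by simp

lemma pdeg_add: "f \<in> pdeg V j d \<Longrightarrow> g \<in> pdeg V j d \<Longrightarrow> (\<lambda>v. f v + g v) \<in> pdeg V j d"
  unfolding pdeg_def
proof clarsimp
  fix c c' :: "nat \<Rightarrow> (nat \<Rightarrow> 'a) \<Rightarrow> 'a"
  assume "\<forall>k. c k \<in> polyf V" "\<forall>k. c' k \<in> polyf V"
  then show "\<exists>c''. (\<forall>k. c'' k \<in> polyf V) \<and> (\<lambda>v. (\<Sum>k<d. c k v * v j ^ k) + (\<Sum>k<d. c' k v * v j ^ k)) =
            (\<lambda>v. \<Sum>k<d. c'' k v * v j ^ k)"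
    by (intro exI[of _ "\<lambda>k v. c k v + c' k v"]) (auto intro: polyf.add simp: sum.distrib algebra_simps)
qed

lemma pdeg_scale: "f \<in> pdeg V j d \<Longrightarrow> a \<in> polyf V \<Longrightarrow> (\<lambda>v. a v * f v) \<in> pdeg V j d"
  unfolding pdeg_def
proof clarsimp
  fix c :: "nat \<Rightarrow> (nat \<Rightarrow> 'a) \<Rightarrow> 'a"
  assume "\<forall>k. c k \<in> polyf V" "a \<in> polyf V"
  then show "\<exists>c''. (\<forall>k. c'' k \<in> polyf V) \<and> (\<lambda>v. a v * (\<Sum>k<d. c k v * v j ^ k)) =
            (\<lambda>v. \<Sum>k<d. c'' k v * v j ^ k)"
    by (intro exI[of _ "\<lambda>k v. a v * c k v"]) (auto intro: polyf.mult simp: sum_distrib_left algebra_simps)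
qed

lemma pdeg_diff: "f \<in> pdeg V j d \<Longrightarrow> g \<in> pdeg V j d \<Longrightarrow> (\<lambda>v. f v - g v) \<in> pdeg V j d"
  using pdeg_add[of f V j d "\<lambda>v. -1 * g v"] pdeg_scale[of g V j d "\<lambda>v. -1"] by (simp add: polyf.const)

lemma pdeg_shift: "f \<in> pdeg V j d \<Longrightarrow> (\<lambda>v. f v * v j ^ k) \<in> pdeg V j (d + k)"
proof (induction d arbitrary: f)
  case 0 then show ?case by (auto simp: pdeg_zero)
next
  case (Suc d)
  then obtain g c where gc: "g \<in> pdeg V j d" "c \<in> polyf V" "f = (\<lambda>v. g v + c v * v j ^ d)"
    by (auto elim: pdeg_SucE)
  have "(\<lambda>v. g v * v j ^ k + c v * v j ^ (d + k)) \<in> pdeg V j (Suc (d + k))"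
    using gc Suc.IH by (intro pdeg_SucI) auto
  then show ?case by (simp add: gc algebra_simps power_add)
qed

lemma pdeg_polyf: "f \<in> pdeg V j d \<Longrightarrow> f \<in> polyf (insert j V)"
  unfolding pdeg_def by (clarify, intro polyf_intros) (auto intro: polyf_mono[of _ V "insert j V"])

lemma pdeg_mult:
  "f \<in> pdeg V j d \<Longrightarrow> g \<in> pdeg V j e \<Longrightarrow> (\<lambda>v. f v * g v) \<in> pdeg V j (d + e)"
proof (induction d arbitrary: f)
  case 0 then show ?case by (auto simp: pdeg_zero)
next
  case (Suc d)
  then obtain h c where hc: "h \<in> pdeg V j d" "c \<in> polyf V" "f = (\<lambda>v. h v + c v * v j ^ d)"
    by (auto elim: pdeg_SucE)
  have "(\<lambda>v. h v * g v + c v * (g v * v j ^ d)) \<in> pdeg V j (Suc d + e)"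
  proof (rule pdeg_add)
    show "(\<lambda>v. h v * g v) \<in> pdeg V j (Suc d + e)"
      using Suc hc by (auto intro: pdeg_mono[of "d + e"])
    have "(\<lambda>v. g v * v j ^ d) \<in> pdeg V j (Suc d + e)"
      using pdeg_mono[OF _ pdeg_shift[OF Suc.prems(2), of d], of "Suc d + e"] by simp
    then show "(\<lambda>v. c v * (g v * v j ^ d)) \<in> pdeg V j (Suc d + e)"
      using hc by (intro pdeg_scale[of "\<lambda>v. g v * v j ^ d"])
  qed
  then show ?case by (simp add: hc algebra_simps)
qed

lemma polyf_pdeg: "f \<in> polyf (insert j V) \<Longrightarrow> \<exists>d. f \<in> pdeg V j d"
proof (induction rule: polyf.induct)
  case (const c)
  show ?case using pdeg_SucI[of "\<lambda>v. 0" V j 0 "\<lambda>v. c"] by (auto simp: polyf.const)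
next
  case (var i)
  show ?case
  proof (cases "i = j")
    case True
    show ?thesis using pdeg_SucI[of "\<lambda>v. 0" V j 1 "\<lambda>v. 1"] True pdeg_zero[of V j 1] by (auto simp: polyf.const)
  next
    case False
    then show ?thesis using pdeg_SucI[of "\<lambda>v. 0" V j 0 "\<lambda>v. v i"] var by (auto simp: polyf.var)
  qed
next
  case (add f g)
  then obtain d e where "f \<in> pdeg V j d" "g \<in> pdeg V j e" by blast
  then have "f \<in> pdeg V j (max d e)" "g \<in> pdeg V j (max d e)" by (auto intro: pdeg_mono[of d] pdeg_mono[of e])
  then show ?case by (blast intro: pdeg_add)
next
  case (mult f g)
  then show ?case by (blast intro: pdeg_mult)
qed

text \<open>The leading coefficient \<open>c\<close> is not invertible, so every cancellation of a
  top term costs one factor \<open>c\<close>. Truncated subtraction in \<open>D - d\<close> makes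
  the quotient zero when there is nothing to divide.\<close>

lemma pseudo_division:
  assumes g0: "g0 \<in> pdeg V j d" and c: "c \<in> polyf V" and g: "\<And>v. g v = g0 v + c v * v j ^ d"
  shows "f \<in> pdeg V j D \<Longrightarrow> \<exists>n q r. q \<in> pdeg V j (D - d) \<and> r \<in> pdeg V j d \<and> (\<forall>v. c v ^ n * f v = q v * g v + r v)"
proof (induction D arbitrary: f)
  case 0
  then show ?case by (intro exI[of _ 0] exI[of _ "\<lambda>v. 0"]) (auto simp: pdeg_zero)
next
  case (Suc D)
  show ?case
  proof (cases "Suc D \<le> d")
    case True
    then show ?thesis using Suc.prems
      by (intro exI[of _ 0] exI[of _ "\<lambda>v. 0"] exI[of _ f]) (auto simp: pdeg_zero intro: pdeg_mono[of "Suc D"])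
  next
    case False
    then have D: "d \<le> D" by simp
    obtain f0 a where f: "f0 \<in> pdeg V j D" "a \<in> polyf V" "f = (\<lambda>v. f0 v + a v * v j ^ D)"
      using Suc.prems by (auto elim: pdeg_SucE)
    \<comment> \<open>What is left of \<open>c * f - a * x_j ^ (D - d) * g\<close> once the two top
      terms have cancelled.\<close>
    define h where "h = (\<lambda>v. c v * f0 v - a v * (g0 v * v j ^ (D - d)))"
    have "h \<in> pdeg V j D"
      unfolding h_def using pdeg_shift[OF g0, of "D - d"] f c D by (intro pdeg_diff pdeg_scale[of f0] pdeg_scale[of "\<lambda>v. g0 v * v j ^ (D - d)"]) auto
    then obtain n q r where qr: "q \<in> pdeg V j (D - d)" "r \<in> pdeg V j d" "\<And>v. c v ^ n * h v = q v * g v + r v"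
      using Suc.IH by blast
    have pw: "v j ^ (D - d) * v j ^ d = v j ^ D" for v :: "nat \<Rightarrow> 'a" using D by (simp flip: power_add)
    have hv: "c v * f v = h v + a v * v j ^ (D - d) * g v" for v
      by (simp add: f h_def g algebra_simps flip: pw)
    have "c v ^ Suc n * f v = (q v + (c v ^ n * a v) * v j ^ (D - d)) * g v + r v" for v
    proof -
      have "c v ^ Suc n * f v = c v ^ n * h v + c v ^ n * (a v * v j ^ (D - d) * g v)"
        unfolding power_Suc2 mult.assoc hv by (simp add: algebra_simps)
      then show ?thesis unfolding qr by (simp add: algebra_simps)
    qed
    moreover have "(\<lambda>v. q v + (c v ^ n * a v) * v j ^ (D - d)) \<in> pdeg V j (Suc D - d)"
      unfolding Suc_diff_le[OF D] using qr c f by (intro pdeg_SucI polyf_intros)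
    ultimately show ?thesis using qr by blast
  qed
qed

text \<open>The second part keeps the top coefficient \<open>d * c\<close> of the derivative
  visible; in characteristic zero it vanishes modulo an ideal only if \<open>c\<close> does (for
  \<open>d > 0\<close>), which is how the separant will be seen to be nonzero.\<close>

lemma pdeg_partial_derivative:
  fixes f :: "(nat \<Rightarrow> 'k::field_char_0) \<Rightarrow> 'k"
  assumes "j \<notin> V"
  shows "f \<in> pdeg V j d \<Longrightarrow> (\<lambda>z. dd f z (\<lambda>i. if i = j then 1 else 0)) \<in> pdeg V j (d - 1)"
    and "f \<in> pdeg V j d \<Longrightarrow> c \<in> polyf V \<Longrightarrow> dd (\<lambda>v. f v + c v * v j ^ d) z (\<lambda>i. if i = j then 1 else 0)
        = dd f z (\<lambda>i. if i = j then 1 else 0) + of_nat d * c z * z j ^ (d - 1)"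
proof -
  let ?e = "\<lambda>i. if i = j then 1 else 0 :: 'k"
  have *: "dd (\<lambda>v. f v + c v * v j ^ d) z ?e = dd f z ?e + of_nat d * c z * z j ^ (d - 1)"
    if "f \<in> pdeg V j d" "c \<in> polyf V" for f c z d
  proof -
    have "dd c z ?e = dd c z (\<lambda>i. 0)" by (rule dd_dir_cong[OF that(2)]) (use assms in auto)
    moreover have "(\<lambda>v. v j ^ d) \<in> polyf UNIV" "f \<in> polyf UNIV" "c \<in> polyf UNIV"
      using that pdeg_polyf polyf_UNIV by (blast intro: polyf_intros)+
    ultimately show ?thesis
      by (subst dd_add[OF _ polyf.mult], simp_all, subst dd_mult, simp_all,
          subst dd_power, simp_all add: polyf.var)
  qed
  show "(\<lambda>z. dd f z ?e) \<in> pdeg V j (d - 1)" if "f \<in> pdeg V j d"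
    using that
  proof (induction d arbitrary: f)
    case (Suc d)
    then obtain g c where gc: "g \<in> pdeg V j d" "c \<in> polyf V" "f = (\<lambda>v. g v + c v * v j ^ d)"
      by (auto elim: pdeg_SucE)
    show ?case
    proof (cases d)
      case 0
      then show ?thesis using gc Suc.IH *[of g d c] by (auto simp: 0)
    next
      case (Suc d')
      have "(\<lambda>z. dd g z ?e + (of_nat d * c z) * z j ^ d') \<in> pdeg V j (Suc d')"
        using Suc.IH[OF gc(1)] Suc gc by (intro pdeg_SucI polyf_intros) auto
      then show ?thesis using *[OF gc(1,2)] gc(3) Suc by (simp add: mult.assoc)
    qed
  qed simp
  show "f \<in> pdeg V j d \<Longrightarrow> c \<in> polyf V \<Longrightarrow> dd (\<lambda>v. f v + c v * v j ^ d) z ?e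
        = dd f z ?e + of_nat d * c z * z j ^ (d - 1)"
    by (rule *)
qed

section \<open>Ideals of polynomial functions\<close>

locale poly_ideal =
  fixes N :: nat and P :: "((nat \<Rightarrow> 'k::field) \<Rightarrow> 'k) set"
  assumes sub: "P \<subseteq> polyf {..<N}"
    and zero: "(\<lambda>v. 0) \<in> P"
    and add: "f \<in> P \<Longrightarrow> g \<in> P \<Longrightarrow> (\<lambda>v. f v + g v) \<in> P"
    and absorb: "f \<in> polyf {..<N} \<Longrightarrow> g \<in> P \<Longrightarrow> (\<lambda>v. f v * g v) \<in> P"
begin

lemma absorb2: "f \<in> polyf {..<N} \<Longrightarrow> g \<in> P \<Longrightarrow> (\<lambda>v. g v * f v) \<in> P"
  using absorb by (simp add: mult.commute)

lemma diff: "f \<in> P \<Longrightarrow> g \<in> P \<Longrightarrow> (\<lambda>v. f v - g v) \<in> P"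
  using add[of f "\<lambda>v. -1 * g v"] absorb[of "\<lambda>v. -1" g] by (simp add: polyf.const)

lemma uminus: "f \<in> P \<Longrightarrow> (\<lambda>v. - f v) \<in> P"
  using diff[OF zero] by simp

end

locale poly_prime = poly_ideal N P for N and P :: "((nat \<Rightarrow> 'k::field) \<Rightarrow> 'k) set" +
  assumes proper: "(\<lambda>v. 1) \<notin> P"
    and prime: "f \<in> polyf {..<N} \<Longrightarrow> g \<in> polyf {..<N} \<Longrightarrow> (\<lambda>v. f v * g v) \<in> P \<Longrightarrow> f \<in> P \<or> g \<in> P"

text \<open>By Zorn there is an ideal maximal among those that contain \<open>J\<close> and avoid
  the multiplicative set \<open>M\<close>; such an ideal is prime.\<close>

lemma prime_ideal_exists:
  assumes J: "poly_ideal N J" and M: "M \<subseteq> polyf {..<N}" "(\<lambda>v. 1) \<in> M"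
    and mult: "\<And>f g. f \<in> M \<Longrightarrow> g \<in> M \<Longrightarrow> (\<lambda>v. f v * g v) \<in> M" and disj: "J \<inter> M = {}"
  obtains P where "poly_prime N P" "J \<subseteq> P" "P \<inter> M = {}"
proof -
  define A where "A = {P. poly_ideal N P \<and> J \<subseteq> P \<and> P \<inter> M = {}}"
  have "\<exists>P\<in>A. \<forall>Q\<in>A. P \<subseteq> Q \<longrightarrow> Q = P"
  proof (rule subset_Zorn_nonempty)
    show "A \<noteq> {}" using J disj by (auto simp: A_def)
    fix C assume C: "C \<noteq> {}" "subset.chain A C"
    have two: "\<exists>Z\<in>C. f \<in> Z \<and> g \<in> Z" if fg: "f \<in> \<Union>C" "g \<in> \<Union>C" for f g
    proof -
      obtain X Y where XY: "X \<in> C" "Y \<in> C" "f \<in> X" "g \<in> Y" using fg by blast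
      then have "X \<subseteq> Y \<or> Y \<subseteq> X" using C by (auto simp: subset.chain_def)
      then show ?thesis using XY by blast
    qed
    have CA: "poly_ideal N Z" "J \<subseteq> Z" "Z \<inter> M = {}" if "Z \<in> C" for Z
      using that C by (auto simp: subset.chain_def A_def)
    have "poly_ideal N (\<Union>C)"
    proof
      show "\<Union>C \<subseteq> polyf {..<N}" using CA(1) poly_ideal.sub by blast
      show "(\<lambda>v. 0) \<in> \<Union>C" using CA(1) C(1) poly_ideal.zero by blast
      show "(\<lambda>v. f v + g v) \<in> \<Union>C" if "f \<in> \<Union>C" "g \<in> \<Union>C" for f g
        using two[OF that] CA(1) poly_ideal.add by blast
      show "(\<lambda>v. f v * g v) \<in> \<Union>C" if "f \<in> polyf {..<N}" "g \<in> \<Union>C" for f g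
        using that CA(1) poly_ideal.absorb by blast
    qed
    then show "\<Union>C \<in> A" using CA C(1) unfolding A_def by blast
  qed
  then obtain P where P: "P \<in> A" and max: "\<And>Q. Q \<in> A \<Longrightarrow> P \<subseteq> Q \<Longrightarrow> Q = P" by blast
  interpret poly_ideal N P using P by (simp add: A_def)
  \<comment> \<open>Maximality in the form needed: adjoining any element outside \<open>P\<close>
    produces an element of \<open>M\<close>.\<close>
  have ext: "\<exists>p\<in>P. \<exists>h\<in>polyf {..<N}. (\<lambda>v. p v + h v * f v) \<in> M" if f: "f \<in> polyf {..<N}" "f \<notin> P" for f
  proof (rule ccontr)
    assume no: "\<not> ?thesis"
    define Q where "Q = {(\<lambda>v. p v + h v * f v) | p h. p \<in> P \<and> h \<in> polyf {..<N}}"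
    have "poly_ideal N Q"
    proof
      show "Q \<subseteq> polyf {..<N}" using sub f by (auto simp: Q_def intro!: polyf_intros)
      show "(\<lambda>v. 0) \<in> Q" unfolding Q_def
        by (intro CollectI exI[of _ "\<lambda>v. 0"]) (auto simp: zero polyf.const)
      show "(\<lambda>v. a v + b v) \<in> Q" if ab: "a \<in> Q" "b \<in> Q" for a b
      proof -
        obtain p h p' h' where "p \<in> P" "h \<in> polyf {..<N}" "a = (\<lambda>v. p v + h v * f v)"
           "p' \<in> P" "h' \<in> polyf {..<N}" "b = (\<lambda>v. p' v + h' v * f v)" using ab unfolding Q_def by blast
        then show ?thesis unfolding Q_def
          by (intro CollectI exI[of _ "\<lambda>v. p v + p' v"] exI[of _ "\<lambda>v. h v + h' v"])
             (auto simp: algebra_simps intro: add polyf.add)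
      qed
      show "(\<lambda>v. a v * b v) \<in> Q" if ab: "a \<in> polyf {..<N}" "b \<in> Q" for a b
      proof -
        obtain p h where "p \<in> P" "h \<in> polyf {..<N}" "b = (\<lambda>v. p v + h v * f v)" using ab unfolding Q_def by blast
        then show ?thesis unfolding Q_def using ab
          by (intro CollectI exI[of _ "\<lambda>v. a v * p v"] exI[of _ "\<lambda>v. a v * h v"])
             (auto simp: algebra_simps intro: absorb polyf.mult)
      qed
    qed
    moreover have "P \<subseteq> Q"
    proof
      fix p assume "p \<in> P"
      then show "p \<in> Q" unfolding Q_def
        by (intro CollectI exI[of _ p] exI[of _ "\<lambda>v. 0"]) (auto simp: polyf.const)
    qed
    moreover have "Q \<inter> M = {}" using no by (auto simp: Q_def)
    moreover have "J \<subseteq> P" using P by (auto simp: A_def)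
    ultimately have "Q = P" by (intro max) (auto simp: A_def)
    moreover have "f \<in> Q" unfolding Q_def
      by (intro CollectI exI[of _ "\<lambda>v. 0"] exI[of _ "\<lambda>v. 1"]) (auto simp: polyf.const zero)
    ultimately show False using f by simp
  qed
  have "poly_prime N P"
  proof
    show "(\<lambda>v. 1) \<notin> P" using P M by (auto simp: A_def)
    fix f g assume fg: "f \<in> polyf {..<N}" "g \<in> polyf {..<N}" "(\<lambda>v. f v * g v) \<in> P"
    show "f \<in> P \<or> g \<in> P"
    proof (rule ccontr)
      assume "\<not> ?thesis"
      then obtain p h p' h' where ph: "p \<in> P" "h \<in> polyf {..<N}" "(\<lambda>v. p v + h v * f v) \<in> M"
        "p' \<in> P" "h' \<in> polyf {..<N}" "(\<lambda>v. p' v + h' v * g v) \<in> M" using ext fg by blast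
      have "(\<lambda>v. (p v + h v * f v) * (p' v + h' v * g v)) \<in> M" using mult[OF ph(3,6)] .
      \<comment> \<open>Every term of the expanded product contains \<open>p\<close>,
        \<open>p'\<close> or \<open>f * g\<close>, so an element of \<open>M\<close> lies in
        \<open>P\<close>.\<close>
      moreover have "(\<lambda>v. p v * (p' v + h' v * g v) + (h v * f v) * p' v + (h v * h' v) * (f v * g v)) \<in> P"
        using ph fg sub by (intro add absorb2[of _ p] absorb[of _ p'] absorb[of _ "\<lambda>v. f v * g v"] polyf_intros) auto
      moreover have "(\<lambda>v. p v * (p' v + h' v * g v) + (h v * f v) * p' v + (h v * h' v) * (f v * g v))
         = (\<lambda>v. (p v + h v * f v) * (p' v + h' v * g v))" by (auto simp: algebra_simps)
      ultimately show False using P by (auto simp: A_def)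
    qed
  qed
  then show ?thesis using that P by (auto simp: A_def)
qed

section \<open>Algebraic variables modulo a prime ideal\<close>

definition vanishing :: "nat \<Rightarrow> ((nat \<Rightarrow> 'k::field) \<Rightarrow> 'k) set \<Rightarrow> (nat \<Rightarrow> 'k) set" where
  "vanishing n F = {v \<in> affine_points n. \<forall>f\<in>F. f v = 0}"

context poly_prime
begin

text \<open>The coordinate \<open>x_j\<close> is algebraic over the polynomials in \<open>V\<close>
  modulo \<open>P\<close>. Degree 0 excludes itself, since the equation would then be
  \<open>c\<close>, which is not in \<open>P\<close>.\<close>

definition alg :: "nat set \<Rightarrow> nat \<Rightarrow> bool" where
  "alg V j \<longleftrightarrow> (\<exists>d. \<exists>f\<in>pdeg V j d. \<exists>c\<in>polyf V. c \<notin> P \<and> (\<lambda>v. f v + c v * v j ^ d) \<in> P)"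

definition indep :: "nat set \<Rightarrow> bool" where
  "indep S \<longleftrightarrow> S \<subseteq> {..<N} \<and> P \<inter> polyf S = {\<lambda>v. 0}"

text \<open>A transcendence basis, consisting of coordinates, of the fraction field of the
  polynomials modulo \<open>P\<close>.\<close>

definition basis :: "nat set \<Rightarrow> bool" where
  "basis S \<longleftrightarrow> indep S \<and> (\<forall>j\<in>{..<N} - S. alg S j)"

lemma one_notin: "(\<lambda>v. c) \<in> P \<longleftrightarrow> c = 0"
proof
  assume "(\<lambda>v. c) \<in> P"
  then have "(\<lambda>v. inverse c * c) \<in> P" by (rule absorb[OF polyf.const])
  then show "c = 0" using proper by (cases "c = 0") auto
qed (simp add: zero)

lemma power_notin:
  assumes "f \<in> polyf {..<N}" "f \<notin> P" shows "(\<lambda>v. f v ^ k) \<notin> P"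
proof (induction k)
  case (Suc k)
  then show ?case using prime[OF assms(1) polyf_power[OF assms(1), of k]] assms by auto
qed (simp add: proper)

lemma mult_notin: "f \<in> polyf {..<N} \<Longrightarrow> g \<in> polyf {..<N} \<Longrightarrow> f \<notin> P \<Longrightarrow> g \<notin> P \<Longrightarrow> (\<lambda>v. f v * g v) \<notin> P"
  using prime by blast

lemma eq_mod:
  assumes "(\<lambda>v. f v - g v) \<in> P" shows "f \<in> P \<longleftrightarrow> g \<in> P"
proof
  assume "f \<in> P" from diff[OF this assms] show "g \<in> P" by simp
next
  assume "g \<in> P" from add[OF assms this] show "f \<in> P" by simp
qed

lemma alg_mono:
  assumes "alg S j" "S \<subseteq> V" shows "alg V j"
proof -
  obtain d f c where "f \<in> pdeg S j d" "c \<in> polyf S" "c \<notin> P" "(\<lambda>v. f v + c v * v j ^ d) \<in> P"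
    using assms unfolding alg_def by blast
  then show ?thesis
    unfolding alg_def using pdeg_mono_vars[OF _ assms(2)] polyf_mono[OF _ assms(2)] by blast
qed

text \<open>An equation of least degree replaces the minimal polynomial over the fraction field.
  Minimality reads: in an element of \<open>P\<close> written with lower degree, the top coefficient
  already lies in \<open>P\<close>.\<close>

lemma alg_minimal:
  assumes "alg V j"
  obtains m0 e c where "m0 \<in> pdeg V j e" "c \<in> polyf V" "c \<notin> P" "(\<lambda>v. m0 v + c v * v j ^ e) \<in> P"
    "0 < e" "\<forall>d<e. \<forall>f\<in>pdeg V j d. \<forall>a\<in>polyf V. (\<lambda>v. f v + a v * v j ^ d) \<in> P \<longrightarrow> a \<in> P"
proof -
  let ?Q = "\<lambda>d. \<exists>f\<in>pdeg V j d. \<exists>c\<in>polyf V. c \<notin> P \<and> (\<lambda>v. f v + c v * v j ^ d) \<in> P"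
  define e where "e = (LEAST d. ?Q d)"
  have e: "?Q e" unfolding e_def using assms unfolding alg_def by (rule LeastI_ex)
  have m: "\<not> ?Q d" if "d < e" for d using that unfolding e_def by (rule not_less_Least)
  have "0 < e" using e by (cases e) (auto simp: fun_eq_iff[symmetric] eta_contract_eq)
  with e m that show thesis by blast
qed

text \<open>The top coefficient lies in \<open>P\<close> by minimality; subtracting its term leaves
  an element of \<open>P\<close> of smaller degree, and so on downwards.\<close>

lemma small_degree_coeffs:
  assumes min: "\<forall>d<e. \<forall>f\<in>pdeg V j d. \<forall>a\<in>polyf V. (\<lambda>v. f v + a v * v j ^ d) \<in> P \<longrightarrow> a \<in> P"
    and V: "insert j V \<subseteq> {..<N}"
  shows "d \<le> e \<Longrightarrow> r \<in> pdeg V j d \<Longrightarrow> r \<in> P \<Longrightarrow>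
     \<exists>c. (\<forall>k. c k \<in> P \<inter> polyf V) \<and> (\<forall>v. r v = (\<Sum>k<d. c k v * v j ^ k))"
proof (induction d arbitrary: r)
  case 0
  then show ?case by (intro exI[of _ "\<lambda>k v. 0"]) (auto simp: zero polyf.const)
next
  case (Suc d)
  then obtain f a where fa: "f \<in> pdeg V j d" "a \<in> polyf V" "r = (\<lambda>v. f v + a v * v j ^ d)"
    by (auto elim: pdeg_SucE)
  then have a: "a \<in> P" using min[rule_format, of d f a] Suc.prems by auto
  have "(\<lambda>v. v j ^ d * a v) \<in> P" using V a by (intro absorb polyf_intros) auto
  with Suc.prems(3) have "(\<lambda>v. r v - v j ^ d * a v) \<in> P" by (rule diff)
  then have "f \<in> P" using fa by (simp add: algebra_simps)
  with Suc.IH[of f] fa Suc.prems obtain c where c: "\<forall>k. c k \<in> P \<inter> polyf V" "\<forall>v. f v = (\<Sum>k<d. c k v * v j ^ k)"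
    by auto
  then show ?case using a fa by (intro exI[of _ "c(d := a)"]) auto
qed

lemma alg_of_dependent:
  assumes "indep S" and f: "f \<in> P" "f \<in> polyf (insert j S)" "f \<noteq> (\<lambda>v. 0)"
  shows "alg S j"
proof -
  have "alg S j" if "f \<in> pdeg S j d" "f \<in> P" "f \<noteq> (\<lambda>v. 0)" for f d
    using that
  proof (induction d arbitrary: f)
    case (Suc d)
    then obtain g c where gc: "g \<in> pdeg S j d" "c \<in> polyf S" "f = (\<lambda>v. g v + c v * v j ^ d)"
      by (auto elim: pdeg_SucE)
    show ?case
    proof (cases "c \<in> P")
      case True
      then have "c = (\<lambda>v. 0)" using gc assms(1) by (auto simp: indep_def)
      then show ?thesis using Suc gc by simp
    qed (use gc Suc in \<open>auto simp: alg_def\<close>)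
  qed simp
  then show ?thesis using f polyf_pdeg by blast
qed

lemma indep_empty: "indep {}"
proof -
  have "f = (\<lambda>v. 0)" if "f \<in> P" "f \<in> polyf {}" for f
  proof -
    have "f = (\<lambda>v. f (\<lambda>i. 0))" using polyf_cong[OF that(2)] by auto
    then show ?thesis using that(1) one_notin[of "f (\<lambda>i. 0)"] by metis
  qed
  then show ?thesis by (auto simp: indep_def zero polyf.const)
qed

lemma basis_extend:
  assumes "indep S0" obtains S where "basis S" "S0 \<subseteq> S"
proof -
  let ?A = "{S. indep S \<and> S0 \<subseteq> S}"
  have "finite ?A" by (rule finite_subset[of _ "Pow {..<N}"]) (auto simp: indep_def)
  moreover have "?A \<noteq> {}" using assms by auto
  ultimately obtain S where S: "S \<in> ?A" "\<And>T. T \<in> ?A \<Longrightarrow> S \<subseteq> T \<Longrightarrow> S = T"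
    using finite_has_maximal[of ?A] by auto
  have "alg S j" if j: "j \<in> {..<N} - S" for j
  proof -
    have "\<not> indep (insert j S)" using S j by auto
    then obtain f where "f \<in> P" "f \<in> polyf (insert j S)" "f \<noteq> (\<lambda>v. 0)"
      using S j by (auto simp: indep_def zero polyf.const)
    then show ?thesis using alg_of_dependent S by blast
  qed
  then have "basis S" using S by (simp add: basis_def)
  then show ?thesis using that S by blast
qed

text \<open>Euclid's algorithm modulo \<open>P\<close>: among the multiples of \<open>a\<close> with
  leading coefficient outside \<open>P\<close>, one of least degree is compared with the minimal
  equation of \<open>x_j\<close> by division in both directions. Its degree must be 0, so
  \<open>x_j\<close> has been eliminated.\<close>

lemma inverse_step:
  assumes alg: "alg V j" and V: "insert j V \<subseteq> {..<N}" and a: "a \<in> polyf (insert j V)" "a \<notin> P"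
  shows "\<exists>a'\<in>polyf (insert j V). \<exists>b\<in>polyf V. b \<notin> P \<and> (\<lambda>v. a v * a' v - b v) \<in> P"
proof -
  let ?R = "polyf (insert j V)"
  have Rsub: "f \<in> ?R \<Longrightarrow> f \<in> polyf {..<N}" for f by (rule polyf_mono[OF _ V])
  have VR: "f \<in> polyf V \<Longrightarrow> f \<in> ?R" for f by (rule polyf_mono[of f V]) auto
  have VN: "f \<in> polyf V \<Longrightarrow> f \<in> polyf {..<N}" for f using VR Rsub by blast
  have xR: "(\<lambda>v. v j ^ k) \<in> ?R" for k by (intro polyf_intros) auto
  have pR: "f \<in> pdeg V j d \<Longrightarrow> f \<in> ?R" for f d by (rule pdeg_polyf)
  obtain m0 e cm where m: "m0 \<in> pdeg V j e" "cm \<in> polyf V" "cm \<notin> P" "(\<lambda>v. m0 v + cm v * v j ^ e) \<in> P"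
    "0 < e" and min: "\<forall>d<e. \<forall>f\<in>pdeg V j d. \<forall>a\<in>polyf V. (\<lambda>v. f v + a v * v j ^ d) \<in> P \<longrightarrow> a \<in> P"
    using alg_minimal[OF alg] by blast
  \<comment> \<open>Congruent modulo \<open>P\<close> to a multiple of \<open>a\<close>; remainders
    of such polynomials by elements of \<open>P\<close> keep this property.\<close>
  define multiple where "multiple r \<longleftrightarrow> (\<exists>a'\<in>?R. (\<lambda>v. r v - a v * a' v) \<in> P)" for r
  define Q where "Q d \<longleftrightarrow> (\<exists>p0\<in>pdeg V j d. \<exists>c\<in>polyf V. c \<notin> P \<and> (\<lambda>v. p0 v + c v * v j ^ d) \<notin> P \<and>
      multiple (\<lambda>v. p0 v + c v * v j ^ d))" for d
  \<comment> \<open>Leading coefficients in \<open>P\<close> are dropped, which changes neither the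
    class modulo \<open>P\<close> nor being a multiple.\<close>
  have Q_below: "\<exists>d<D. Q d" if "r \<in> pdeg V j D" "r \<notin> P" "multiple r" for r D
    using that
  proof (induction D arbitrary: r)
    case 0 then show ?case using zero by simp
  next
    case (Suc D)
    then obtain f c where fc: "f \<in> pdeg V j D" "c \<in> polyf V" "r = (\<lambda>v. f v + c v * v j ^ D)"
      by (auto elim: pdeg_SucE)
    show ?case
    proof (cases "c \<in> P")
      case True
      have xc: "(\<lambda>v. v j ^ D * c v) \<in> P" by (rule absorb[OF Rsub[OF xR] True])
      have "f \<notin> P" using Suc.prems(2) add[OF _ xc, of f] by (auto simp: fc mult.commute)
      moreover obtain a' where a': "a' \<in> ?R" "(\<lambda>v. r v - a v * a' v) \<in> P" using Suc.prems by (auto simp: multiple_def)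
      have "(\<lambda>v. (r v - a v * a' v) - v j ^ D * c v) \<in> P" by (rule diff[OF a'(2) xc])
      then have "multiple f" using a' by (auto simp: fc multiple_def algebra_simps)
      ultimately show ?thesis using Suc.IH[of f] fc by (meson less_SucI)
    next
      case False
      then show ?thesis using fc Suc.prems unfolding Q_def by auto
    qed
  qed
  obtain D where "a \<in> pdeg V j D" using polyf_pdeg[OF a(1)] by blast
  moreover have "multiple a" unfolding multiple_def
    by (intro bexI[of _ "\<lambda>v. 1"]) (auto simp: zero polyf.const)
  ultimately have "\<exists>d. Q d" using Q_below a by blast
  define d where "d = (LEAST d. Q d)"
  have Qd: "Q d" unfolding d_def using \<open>\<exists>d. Q d\<close> by (rule LeastI_ex)
  have nQ: "\<not> Q d'" if "d' < d" for d' using that unfolding d_def by (rule not_less_Least)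
  obtain p0 c a' where p: "p0 \<in> pdeg V j d" "c \<in> polyf V" "c \<notin> P" "(\<lambda>v. p0 v + c v * v j ^ d) \<notin> P"
     "a' \<in> ?R" "(\<lambda>v. p0 v + c v * v j ^ d - a v * a' v) \<in> P"
    using Qd unfolding Q_def multiple_def by blast
  let ?p = "\<lambda>v. p0 v + c v * v j ^ d" and ?m = "\<lambda>v. m0 v + cm v * v j ^ e"
  have pR': "?p \<in> ?R" using p pR VR xR by (intro polyf_intros) auto
  \<comment> \<open>Dividing the candidate by the minimal equation leaves a remainder of degree
    below \<open>e\<close> that is still a multiple of \<open>a\<close> outside
    \<open>P\<close>.\<close>
  have "d < e"
  proof -
    have "?p \<in> pdeg V j (Suc d)" using p by (intro pdeg_SucI)
    then obtain n q r where qr: "q \<in> pdeg V j (Suc d - e)" "r \<in> pdeg V j e" "\<And>v. cm v ^ n * ?p v = q v * ?m v + r v"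
      using pseudo_division[OF m(1,2), of ?m ?p "Suc d"] by blast
    have r: "r = (\<lambda>v. cm v ^ n * ?p v - q v * ?m v)" using qr(3) by simp
    have qm: "(\<lambda>v. q v * ?m v) \<in> P" by (rule absorb[OF Rsub[OF pR[OF qr(1)]] m(4)])
    have "(\<lambda>v. cm v ^ n * ?p v) \<notin> P"
      by (rule mult_notin[OF polyf_power[OF VN[OF m(2)]] Rsub[OF pR'] power_notin[OF VN[OF m(2)] m(3)] p(4)])
    moreover have "(\<lambda>v. cm v ^ n * ?p v - r v) \<in> P" using qm by (simp add: r)
    ultimately have "r \<notin> P" using eq_mod[of "\<lambda>v. cm v ^ n * ?p v" r] by simp
    moreover have "multiple r" unfolding multiple_def
    proof
      have "(\<lambda>v. cm v ^ n * (?p v - a v * a' v) - q v * ?m v) \<in> P"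
        by (rule diff[OF absorb[OF polyf_power[OF VN[OF m(2)]] p(6)] qm])
      then show "(\<lambda>v. r v - a v * (cm v ^ n * a' v)) \<in> P" by (simp add: r algebra_simps)
      show "(\<lambda>v. cm v ^ n * a' v) \<in> ?R" using m p VR by (intro polyf_intros) auto
    qed
    ultimately obtain d' where "d' < e" "Q d'" using Q_below qr by blast
    then show ?thesis using nQ[of d'] by linarith
  qed
  \<comment> \<open>Conversely, dividing the minimal equation by the candidate leaves a multiple of
    \<open>a\<close> of degree below \<open>d\<close>, which must lie in \<open>P\<close>. Then
    \<open>h\<close> times the candidate lies in \<open>P\<close>, so \<open>h\<close> does by
    primality; but \<open>h\<close> has degree \<open>e - d < e\<close> and leading coefficient
    outside \<open>P\<close>.\<close>
  have "d = 0"
  proof (rule ccontr)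
    assume "d \<noteq> 0"
    \<comment> \<open>The top term of the minimal equation is cancelled beforehand, so the quotient
      \<open>q\<close> has degree below \<open>e - d\<close> and \<open>h\<close> gets the leading
      coefficient \<open>c ^ n * cm\<close> exactly.\<close>
    define f1 where "f1 = (\<lambda>v. c v * m0 v - cm v * (p0 v * v j ^ (e - d)))"
    have "f1 \<in> pdeg V j e" unfolding f1_def
      using pdeg_shift[OF p(1), of "e - d"] m p \<open>d < e\<close>
      by (intro pdeg_diff pdeg_scale[of m0] pdeg_scale[of "\<lambda>v. p0 v * v j ^ (e - d)"]) auto
    then obtain n q r where qr: "q \<in> pdeg V j (e - d)" "r \<in> pdeg V j d" "\<And>v. c v ^ n * f1 v = q v * ?p v + r v"
      using pseudo_division[OF p(1,2), of ?p f1 e] by blast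
    define h where "h = (\<lambda>v. q v + (c v ^ n * cm v) * v j ^ (e - d))"
    have hR: "h \<in> ?R" unfolding h_def using qr p m pR VR xR by (intro polyf_intros) auto
    have pw: "v j ^ (e - d) * v j ^ d = v j ^ e" for v :: "nat \<Rightarrow> 'k" using \<open>d < e\<close> by (simp flip: power_add)
    have f1: "f1 v = c v * ?m v - cm v * v j ^ (e - d) * ?p v" for v
      by (simp add: f1_def algebra_simps flip: pw)
    have r: "r v = (c v ^ n * c v) * ?m v - h v * ?p v" for v
    proof -
      have "r v = c v ^ n * f1 v - q v * ?p v" using qr(3)[of v] by simp
      then show ?thesis unfolding f1 h_def by (simp add: algebra_simps)
    qed
    have "multiple r" unfolding multiple_def
    proof
      have "(\<lambda>v. (c v ^ n * c v) * ?m v - h v * (?p v - a v * a' v)) \<in> P"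
        by (rule diff[OF absorb[OF _ m(4)] absorb[OF Rsub[OF hR] p(6)]])
          (intro polyf.mult polyf_power VN p(2))
      then show "(\<lambda>v. r v - a v * (- h v * a' v)) \<in> P" by (simp add: r algebra_simps)
      show "(\<lambda>v. - h v * a' v) \<in> ?R" using hR p by (intro polyf_intros) auto
    qed
    then have "r \<in> P" using Q_below[OF qr(2)] nQ by blast
    have cm: "(\<lambda>v. (c v ^ n * c v) * ?m v) \<in> P" by (rule absorb[OF _ m(4)]) (intro polyf.mult polyf_power VN p(2))
    have "(\<lambda>v. h v * ?p v) \<in> P" using diff[OF cm \<open>r \<in> P\<close>] by (simp add: r)
    then have "h \<in> P" using prime[OF Rsub[OF hR] Rsub[OF pR']] p(4) by blast
    then have "(\<lambda>v. c v ^ n * cm v) \<in> P"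
      using min[rule_format, OF _ qr(1) polyf.mult[OF polyf_power[OF p(2)] m(2)]] \<open>d \<noteq> 0\<close> \<open>d < e\<close>
      by (simp add: h_def)
    moreover have "(\<lambda>v. c v ^ n * cm v) \<notin> P"
      by (rule mult_notin[OF polyf_power[OF VN[OF p(2)]] VN[OF m(2)] power_notin[OF VN[OF p(2)] p(3)] m(3)])
    ultimately show False by blast
  qed
  then have "p0 = (\<lambda>v. 0)" using p by simp
  then have "(\<lambda>v. - (c v - a v * a' v)) \<in> P" using uminus[OF p(6)] \<open>d = 0\<close> by simp
  then show ?thesis using p by (intro bexI[of _ a'] bexI[of _ c]) auto
qed

lemma inverse_tower:
  assumes "finite W" "\<And>j. j \<in> W \<Longrightarrow> alg S j" "S \<union> W \<subseteq> {..<N}"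
  shows "a \<in> polyf (S \<union> W) \<Longrightarrow> a \<notin> P \<Longrightarrow>
     \<exists>a'\<in>polyf (S \<union> W). \<exists>b\<in>polyf S. b \<notin> P \<and> (\<lambda>v. a v * a' v - b v) \<in> P"
  using assms
proof (induction W arbitrary: a rule: finite_induct)
  case empty
  then show ?case by (intro bexI[of _ "\<lambda>v. 1"] bexI[of _ a]) (auto simp: zero polyf.const)
next
  case (insert j W)
  have "alg (S \<union> W) j" using insert by (auto intro: alg_mono[of S])
  then obtain a1 b1 where 1: "a1 \<in> polyf (insert j (S \<union> W))" "b1 \<in> polyf (S \<union> W)" "b1 \<notin> P"
      "(\<lambda>v. a v * a1 v - b1 v) \<in> P"
    using inverse_step[of "S \<union> W" j a] insert.prems by auto
  then obtain a2 b where 2: "a2 \<in> polyf (S \<union> W)" "b \<in> polyf S" "b \<notin> P" "(\<lambda>v. b1 v * a2 v - b v) \<in> P"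
    using insert.IH[of b1] insert.prems by auto
  have a2: "a2 \<in> polyf (S \<union> insert j W)" using 2(1) by (rule polyf_mono) auto
  moreover have "S \<union> insert j W \<subseteq> {..<N}" using insert.prems by blast
  ultimately have a2N: "a2 \<in> polyf {..<N}" by (rule polyf_mono)
  have "(\<lambda>v. a2 v * (a v * a1 v - b1 v) + (b1 v * a2 v - b v)) \<in> P"
    by (rule add[OF absorb[OF a2N 1(4)] 2(4)])
  then have "(\<lambda>v. a v * (a1 v * a2 v) - b v) \<in> P" by (simp add: algebra_simps)
  then show ?case using 1 2 a2
    by (intro bexI[of _ "\<lambda>v. a1 v * a2 v"] bexI[of _ b]) (auto intro: polyf_intros)
qed

lemma basis_inverse:
  assumes "basis S" "a \<in> polyf {..<N}" "a \<notin> P"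
  obtains a' b where "a' \<in> polyf {..<N}" "b \<in> polyf S" "b \<notin> P" "(\<lambda>v. a v * a' v - b v) \<in> P"
proof -
  have "S \<union> ({..<N} - S) = {..<N}" using assms by (auto simp: basis_def indep_def)
  then show ?thesis using that inverse_tower[of "{..<N} - S" S a] assms by (auto simp: basis_def)
qed

end

section \<open>Linear algebra of coordinate vectors\<close>

interpretation fvs: vector_space "\<lambda>(c::'k::field) (v::nat \<Rightarrow> 'k) i. c * v i"
  by unfold_locales (auto simp: fun_eq_iff algebra_simps)

lemma sum_apply: "(\<Sum>a\<in>A. f a) i = (\<Sum>a\<in>A. f a i)" for f :: "'a \<Rightarrow> 'b \<Rightarrow> 'c::comm_monoid_add"
  by (induction A rule: infinite_finite_induct) auto

text \<open>Projection to the coordinates in \<open>S\<close> is then an isomorphism of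
  \<open>T\<close> onto the space of all vectors indexed by \<open>S\<close>.\<close>

lemma dim_by_coordinates:
  fixes T :: "(nat \<Rightarrow> 'k::field) set"
  assumes T: "fvs.subspace T" and S: "finite S"
    and ex: "\<And>u. \<exists>w\<in>T. \<forall>i\<in>S. w i = u i" and un: "\<And>w. w \<in> T \<Longrightarrow> (\<And>i. i \<in> S \<Longrightarrow> w i = 0) \<Longrightarrow> w = 0"
  shows "fvs.dim T = card S"
proof -
  have "\<exists>w\<in>T. \<forall>i\<in>S. w i = (if i = s then 1 else 0)" for s using ex .
  then obtain W where W: "\<And>s. W s \<in> T" "\<And>s i. i \<in> S \<Longrightarrow> W s i = (if i = s then 1 else 0)" by metis
  have inj: "inj_on W S"
  proof
    fix s t assume "s \<in> S" "t \<in> S" "W s = W t"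
    then have "W s s = W t s" by simp
    then show "s = t" using W(2)[OF \<open>s \<in> S\<close>] by (auto split: if_splits)
  qed
  have coord: "(\<Sum>t\<in>S. (\<lambda>i. c t * W t i)) s = c s" if "s \<in> S" for c s
    using S that by (simp add: sum_apply W(2) if_distrib[of "\<lambda>x. _ * x"] cong: if_cong)
  have "u (W s) = 0" if "s \<in> S" "(\<Sum>v\<in>W ` S. (\<lambda>i. u v * v i)) = 0" for u s
  proof -
    have "(\<Sum>t\<in>S. (\<lambda>i. u (W t) * W t i)) = 0" using that(2) inj by (simp add: sum.reindex)
    then show ?thesis using coord[OF that(1), of "\<lambda>t. u (W t)"] by simp
  qed
  then have "fvs.independent (W ` S)"
    using S by (auto simp: fvs.dependent_finite)
  moreover have "T \<subseteq> fvs.span (W ` S)"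
  proof
    fix w assume w: "w \<in> T"
    let ?w = "\<Sum>t\<in>S. (\<lambda>i. w t * W t i)"
    have sp: "?w \<in> fvs.span (W ` S)"
      by (intro fvs.span_sum fvs.span_scale fvs.span_base) auto
    have "?w \<in> T" by (intro fvs.subspace_sum[OF T] fvs.subspace_scale[OF T] W)
    then have "w - ?w \<in> T" using w T fvs.subspace_diff by blast
    then have "w - ?w = 0" by (rule un) (simp add: coord)
    then show "w \<in> fvs.span (W ` S)" using sp by simp
  qed
  ultimately have "fvs.dim T = card (W ` S)"
    using W(1) by (intro fvs.dim_unique[OF _ _ _ refl]) auto
  then show ?thesis using inj by (simp add: card_image)
qed

definition tangent :: "nat \<Rightarrow> ((nat \<Rightarrow> 'k::field) \<Rightarrow> 'k) set \<Rightarrow> (nat \<Rightarrow> 'k) \<Rightarrow> (nat \<Rightarrow> 'k) set" where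
  "tangent n F z = {w \<in> affine_points n. \<forall>f\<in>F. dd f z w = 0}"

lemma tangent_subspace:
  fixes F :: "((nat \<Rightarrow> 'k::field_char_0) \<Rightarrow> 'k) set"
  assumes "F \<subseteq> polyf UNIV" shows "fvs.subspace (tangent n F z)"
  using assms by (auto simp: fvs.subspace_def tangent_def affine_points_def dd_scale_dir dd_add_dir
      subset_iff zero_fun_def plus_fun_def)

section \<open>Points and tangent vectors over a generic point of the basis coordinates\<close>

locale poly_prime_ac = poly_prime N P for N and P :: "((nat \<Rightarrow> 'k::{alg_closed_field, field_char_0}) \<Rightarrow> 'k) set"
begin

text \<open>Each new coordinate is a root of its minimal equation, which exists over an
  algebraically closed field when the leading coefficient is nonzero at the point. All other
  equations in \<open>P\<close> then hold as well, because their pseudo-remainders have coefficients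
  in \<open>P\<close> that involve only earlier variables.\<close>

lemma extend_point_tower:
  assumes "finite W" "indep S" "\<And>j. j \<in> W \<Longrightarrow> alg S j" "S \<union> W \<subseteq> {..<N}" "S \<inter> W = {}"
  shows "\<exists>q\<in>polyf S. q \<notin> P \<and> (\<forall>v. q v \<noteq> 0 \<longrightarrow> (\<exists>w. (\<forall>i\<in>S. w i = v i) \<and> (\<forall>f\<in>P \<inter> polyf (S \<union> W). f w = 0)))"
  using assms
proof (induction W rule: finite_induct)
  case empty
  then show ?case by (intro bexI[of _ "\<lambda>v. 1"]) (auto simp: proper polyf.const indep_def)
next
  case (insert j W)
  let ?V = "S \<union> W"
  have j: "j \<notin> ?V" and VN: "insert j ?V \<subseteq> {..<N}" using insert by auto
  have poV: "f w = f (w(j := \<xi>))" if "f \<in> polyf ?V" for f w \<xi>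
    using j by (intro polyf_cong[OF that]) auto
  obtain q where q: "q \<in> polyf S" "q \<notin> P"
     "\<And>v. q v \<noteq> 0 \<Longrightarrow> \<exists>w. (\<forall>i\<in>S. w i = v i) \<and> (\<forall>f\<in>P \<inter> polyf ?V. f w = 0)"
    using insert by auto
  have "alg ?V j" using insert by (auto intro: alg_mono[of S])
  then obtain m0 e c where m: "m0 \<in> pdeg ?V j e" "c \<in> polyf ?V" "c \<notin> P" "(\<lambda>v. m0 v + c v * v j ^ e) \<in> P"
    "0 < e" and min: "\<forall>d<e. \<forall>f\<in>pdeg ?V j d. \<forall>a\<in>polyf ?V. (\<lambda>v. f v + a v * v j ^ d) \<in> P \<longrightarrow> a \<in> P"
    using alg_minimal by blast
  \<comment> \<open>The leading coefficient \<open>c\<close> may involve variables from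
    \<open>W\<close>, whereas the condition on \<open>v\<close> may involve only those of
    \<open>S\<close>. A multiple \<open>b\<close> of \<open>c\<close> modulo \<open>P\<close> that
    lies in \<open>polyf S\<close> controls it.\<close>
  have "\<exists>a'\<in>polyf ?V. \<exists>b\<in>polyf S. b \<notin> P \<and> (\<lambda>v. c v * a' v - b v) \<in> P"
    using insert m by (intro inverse_tower) auto
  then obtain c' b where b: "c' \<in> polyf ?V" "b \<in> polyf S" "b \<notin> P" "(\<lambda>v. c v * c' v - b v) \<in> P" by blast
  have SN: "f \<in> polyf S \<Longrightarrow> f \<in> polyf {..<N}" for f using insert polyf_mono[of f S "{..<N}"] by auto
  have bV: "b \<in> polyf ?V" using b(2) by (rule polyf_mono) auto
  have ext: "\<exists>w. (\<forall>i\<in>S. w i = v i) \<and> (\<forall>f\<in>P \<inter> polyf (S \<union> insert j W). f w = 0)" if v: "q v * b v \<noteq> 0" for v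
  proof -
    obtain w where w: "\<And>i. i \<in> S \<Longrightarrow> w i = v i" "\<And>f. f \<in> P \<Longrightarrow> f \<in> polyf ?V \<Longrightarrow> f w = 0"
      using q(3)[of v] v by auto
    have "b w = b v" using w(1) by (intro polyf_cong[OF b(2)])
    moreover have "c w * c' w - b w = 0"
      using w(2)[OF b(4) polyf_diff[OF polyf.mult[OF m(2) b(1)] bV]] by simp
    ultimately have cw: "c w \<noteq> 0" using v by auto
    obtain a where a: "\<And>k. a k \<in> polyf ?V" "m0 = (\<lambda>v. \<Sum>k<e. a k v * v j ^ k)"
      using m(1) by (auto simp: pdeg_def)
    obtain \<xi> where "(\<Sum>k\<le>e. (if k = e then c w else a k w) * \<xi> ^ k) = 0"
      using alg_closed[of e "\<lambda>k. if k = e then c w else a k w"] m(5) cw by auto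
    then have xi: "(\<Sum>k<e. a k w * \<xi> ^ k) + c w * \<xi> ^ e = 0"
      by (simp add: lessThan_Suc_atMost[symmetric])
    let ?w = "w(j := \<xi>)"
    have m0w: "m0 ?w + c ?w * ?w j ^ e = 0"
      using xi poV[OF a(1)] poV[OF m(2)] by (simp add: a(2))
    have "f ?w = 0" if f: "f \<in> P" "f \<in> polyf (insert j ?V)" for f
    proof -
      obtain D where "f \<in> pdeg ?V j D" using polyf_pdeg[OF f(2)] by blast
      then obtain n q r where qr: "q \<in> pdeg ?V j (D - e)" "r \<in> pdeg ?V j e"
          "\<And>v. c v ^ n * f v = q v * (m0 v + c v * v j ^ e) + r v"
        using pseudo_division[OF m(1,2), of "\<lambda>v. m0 v + c v * v j ^ e" f D] by blast
      have qN: "q \<in> polyf {..<N}" by (rule polyf_mono[OF pdeg_polyf[OF qr(1)] VN])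
      have cN: "c \<in> polyf {..<N}" by (rule polyf_mono[OF m(2)]) (use VN in auto)
      have "(\<lambda>v. c v ^ n * f v - q v * (m0 v + c v * v j ^ e)) \<in> P"
        by (rule diff[OF absorb[OF polyf_power[OF cN] f(1)] absorb[OF qN m(4)]])
      then have "r \<in> P" by (simp add: qr(3))
      then obtain d where d: "\<forall>k. d k \<in> P \<inter> polyf ?V" "\<forall>v. r v = (\<Sum>k<e. d k v * v j ^ k)"
        using small_degree_coeffs[OF min VN order_refl qr(2)] by blast
      have "d k ?w = 0" for k using d(1) w(2)[of "d k"] poV[of "d k" w \<xi>] by auto
      then have "r ?w = 0" using d(2) by simp
      then have "c ?w ^ n * f ?w = 0" using qr(3)[of ?w] m0w by simp
      moreover have "c ?w \<noteq> 0" using cw poV[OF m(2)] by simp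
      ultimately show ?thesis by simp
    qed
    moreover have "?w i = v i" if "i \<in> S" for i using w(1) that j by auto
    ultimately show ?thesis by (intro exI[of _ ?w]) auto
  qed
  show ?case
  proof (intro bexI conjI allI impI)
    show "(\<lambda>v. q v * b v) \<in> polyf S" using q b by (intro polyf_intros)
    show "(\<lambda>v. q v * b v) \<notin> P" using mult_notin[OF SN SN] q b by blast
    show "\<exists>w. (\<forall>i\<in>S. w i = v i) \<and> (\<forall>f\<in>P \<inter> polyf (S \<union> insert j W). f w = 0)"
      if "q v * b v \<noteq> 0" for v using ext[OF that] .
  qed
qed

lemma extend_point:
  assumes "basis S"
  obtains q where "q \<in> polyf S" "q \<notin> P" "\<And>v. q v \<noteq> 0 \<Longrightarrow> \<exists>w\<in>vanishing N P. \<forall>i\<in>S. w i = v i"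
proof -
  let ?W = "{..<N} - S"
  have S: "S \<union> ?W = {..<N}" "indep S" using assms by (auto simp: basis_def indep_def)
  have "\<exists>q\<in>polyf S. q \<notin> P \<and> (\<forall>v. q v \<noteq> 0 \<longrightarrow> (\<exists>w. (\<forall>i\<in>S. w i = v i) \<and> (\<forall>f\<in>P \<inter> polyf (S \<union> ?W). f w = 0)))"
    by (rule extend_point_tower) (use assms in \<open>auto simp: basis_def indep_def\<close>)
  then obtain q where q: "q \<in> polyf S" "q \<notin> P"
     "\<And>v. q v \<noteq> 0 \<Longrightarrow> \<exists>w. (\<forall>i\<in>S. w i = v i) \<and> (\<forall>f\<in>P \<inter> polyf {..<N}. f w = 0)"
    unfolding S(1) by blast
  have "\<exists>w\<in>vanishing N P. \<forall>i\<in>S. w i = v i" if v: "q v \<noteq> 0" for v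
  proof -
    obtain w where w: "\<forall>i\<in>S. w i = v i" "\<forall>f\<in>P \<inter> polyf {..<N}. f w = 0" using q(3)[OF v] by blast
    have "f (trunc N w) = 0" if "f \<in> P" for f
      using w(2) that sub polyf_trunc_eq[of f N w] by auto
    moreover have "trunc N w i = v i" if "i \<in> S" for i
      using w(1) that S(2) by (auto simp: indep_def trunc_def)
    ultimately show ?thesis by (intro bexI[of _ "trunc N w"]) (auto simp: vanishing_def)
  qed
  then show thesis using that q by blast
qed

text \<open>Modulo \<open>P\<close>, \<open>f\<close> divides a polynomial \<open>b\<close> outside
  \<open>P\<close> in the basis variables alone. A point of the variety over a place with
  \<open>b\<close> nonzero, supplied by \<open>extend_point\<close>, cannot be a zero of
  \<open>f\<close>.\<close>

lemma nullstellensatz: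
  assumes "f \<in> polyf {..<N}" "f \<notin> P" obtains w where "w \<in> vanishing N P" "f w \<noteq> 0"
proof -
  obtain S where S: "basis S" using basis_extend[OF indep_empty] by blast
  then have SN: "g \<in> polyf S \<Longrightarrow> g \<in> polyf {..<N}" for g using polyf_mono[of g S "{..<N}"] by (auto simp: basis_def indep_def)
  obtain q where q: "q \<in> polyf S" "q \<notin> P" "\<And>v. q v \<noteq> 0 \<Longrightarrow> \<exists>w\<in>vanishing N P. \<forall>i\<in>S. w i = v i"
    using extend_point[OF S] by metis
  obtain f' b where b: "f' \<in> polyf {..<N}" "b \<in> polyf S" "b \<notin> P" "(\<lambda>v. f v * f' v - b v) \<in> P"
    using basis_inverse[OF S assms] by metis
  have "(\<lambda>v. q v * b v) \<notin> P" using q b SN by (intro mult_notin) auto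
  then have "(\<lambda>v. q v * b v) \<noteq> (\<lambda>v. 0)" using zero by metis
  then obtain v where v: "q v * b v \<noteq> 0" by blast
  then obtain w where w: "w \<in> vanishing N P" "\<forall>i\<in>S. w i = v i" using q(3)[of v] by auto
  have "b w = b v" using w by (intro polyf_cong[OF b(2)]) auto
  moreover have "f w * f' w - b w = 0" using w(1) b(4) by (auto simp: vanishing_def)
  ultimately have "f w \<noteq> 0" using v by auto
  then show ?thesis using that[OF w(1)] by blast
qed

lemma ideal_of_vanishing: "ideal_of N (vanishing N P) = P"
proof
  show "ideal_of N (vanishing N P) \<subseteq> P"
  proof
    fix f assume f: "f \<in> ideal_of N (vanishing N P)"
    show "f \<in> P"
    proof (rule ccontr)
      assume "f \<notin> P"
      with f obtain w where "w \<in> vanishing N P" "f w \<noteq> 0"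
        using nullstellensatz[of f] by (auto simp: ideal_of_def)
      with f show False by (simp add: ideal_of_def)
    qed
  qed
  show "P \<subseteq> ideal_of N (vanishing N P)" using sub by (auto simp: ideal_of_def vanishing_def)
qed

text \<open>Over a point where the leading coefficient and the separant of the minimal equation of
  \<open>x\<^sub>j\<close> do not vanish, a tangent vector extends uniquely to the next variable.\<close>

lemma extend_tangent_tower:
  assumes "finite W" "indep S" "\<And>j. j \<in> W \<Longrightarrow> alg S j" "S \<union> W \<subseteq> {..<N}" "S \<inter> W = {}"
  shows "\<exists>q\<in>polyf {..<N}. q \<notin> P \<and> (\<forall>z\<in>vanishing N P. q z \<noteq> 0 \<longrightarrow>
     (\<forall>u. \<exists>w. (\<forall>i\<in>S. w i = u i) \<and> (\<forall>f\<in>P \<inter> polyf (S \<union> W). dd f z w = 0)) \<and>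
     (\<forall>w. (\<forall>i\<in>S. w i = 0) \<and> (\<forall>f\<in>P \<inter> polyf (S \<union> W). dd f z w = 0) \<longrightarrow> (\<forall>i\<in>W. w i = 0)))"
  using assms
proof (induction W rule: finite_induct)
  case empty
  then show ?case by (intro bexI[of _ "\<lambda>v. 1"]) (auto simp: proper polyf.const indep_def)
next
  case (insert j W)
  let ?V = "S \<union> W" and ?e = "\<lambda>i. if i = j then 1 else 0 :: 'k"
  have j: "j \<notin> ?V" and VN: "insert j ?V \<subseteq> {..<N}" using insert by auto
  obtain q where q: "q \<in> polyf {..<N}" "q \<notin> P"
     "\<And>z u. z \<in> vanishing N P \<Longrightarrow> q z \<noteq> 0 \<Longrightarrow> \<exists>w. (\<forall>i\<in>S. w i = u i) \<and> (\<forall>f\<in>P \<inter> polyf ?V. dd f z w = 0)"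
     "\<And>z w. z \<in> vanishing N P \<Longrightarrow> q z \<noteq> 0 \<Longrightarrow> \<forall>i\<in>S. w i = 0 \<Longrightarrow> \<forall>f\<in>P \<inter> polyf ?V. dd f z w = 0 \<Longrightarrow> \<forall>i\<in>W. w i = 0"
    using insert by auto
  have "alg ?V j" using insert by (auto intro: alg_mono[of S])
  then obtain m0 e c where m0: "m0 \<in> pdeg ?V j e" "c \<in> polyf ?V" "c \<notin> P" "(\<lambda>v. m0 v + c v * v j ^ e) \<in> P"
    "0 < e" and min: "\<forall>d<e. \<forall>f\<in>pdeg ?V j d. \<forall>a\<in>polyf ?V. (\<lambda>v. f v + a v * v j ^ d) \<in> P \<longrightarrow> a \<in> P"
    using alg_minimal by blast
  define m where "m = (\<lambda>v. m0 v + c v * v j ^ e)"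
  define s where "s = (\<lambda>z. dd m z ?e)"
  have mP: "m \<in> P" using m0 by (simp add: m_def)
  have mpd: "m \<in> pdeg ?V j (Suc e)" unfolding m_def using m0 by (intro pdeg_SucI)
  have mV: "m \<in> polyf (insert j ?V)" using mpd by (rule pdeg_polyf)
  have mU: "m \<in> polyf UNIV" using mV by (rule polyf_UNIV)
  have cN: "c \<in> polyf {..<N}" by (rule polyf_mono[OF m0(2)]) (use VN in auto)
  have sN: "s \<in> polyf {..<N}"
    using pdeg_polyf[OF pdeg_partial_derivative(1)[OF j mpd]] VN unfolding s_def by (rule polyf_mono)
  \<comment> \<open>The top coefficient of the separant is \<open>e * c\<close> in degree
    \<open>e - 1\<close>. Minimality would put it into \<open>P\<close>, and \<open>e\<close> is
    invertible in characteristic zero.\<close>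
  have "s \<notin> P"
  proof
    assume "s \<in> P"
    obtain e' where e': "e = Suc e'" using m0(5) by (cases e) auto
    have s: "s = (\<lambda>z. dd m0 z ?e + (of_nat e * c z) * z j ^ e')"
      unfolding s_def m_def using pdeg_partial_derivative(2)[OF j m0(1,2)] e' by (simp add: mult.assoc)
    have "(\<lambda>z. of_nat e * c z) \<in> P"
      using min[rule_format, of e' "\<lambda>z. dd m0 z ?e" "\<lambda>z. of_nat e * c z"] \<open>s \<in> P\<close>
        pdeg_partial_derivative(1)[OF j m0(1)] e' polyf.mult[OF polyf.const m0(2), of "of_nat e"] unfolding s by simp
    then have "(\<lambda>z. inverse (of_nat e) * (of_nat e * c z)) \<in> P" by (rule absorb[OF polyf.const])
    then have "c \<in> P" using m0(5) by (simp flip: mult.assoc)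
    then show False using m0 by simp
  qed
  have split: "dd m z w = dd m z (w(j := 0)) + w j * s z" for z w
  proof -
    have "w = (\<lambda>i. 1 * (w(j := 0)) i + w j * ?e i)" by auto
    then have "dd m z w = dd m z (\<lambda>i. 1 * (w(j := 0)) i + w j * ?e i)" by (rule arg_cong)
    also have "\<dots> = 1 * dd m z (w(j := 0)) + w j * dd m z ?e" by (rule dd_linear[OF mU])
    finally show ?thesis by (simp only: s_def mult_1_left)
  qed
  have ddV: "dd f z (w(j := t)) = dd f z w" if "f \<in> polyf ?V" for f :: "(nat \<Rightarrow> 'k) \<Rightarrow> 'k" and z w t
    by (rule dd_dir_cong[OF that]) (use j in auto)
  show ?case
  proof (intro bexI conjI ballI impI allI)
    show "(\<lambda>v. q v * (c v * s v)) \<in> polyf {..<N}" using q cN sN by (intro polyf_intros)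
    show "(\<lambda>v. q v * (c v * s v)) \<notin> P"
      by (rule mult_notin[OF q(1) polyf.mult[OF cN sN] q(2) mult_notin[OF cN sN m0(3) \<open>s \<notin> P\<close>]])
    fix z assume z: "z \<in> vanishing N P" "q z * (c z * s z) \<noteq> 0"
    then have Pz: "\<And>f. f \<in> P \<Longrightarrow> f z = 0" and nz: "c z \<noteq> 0" "s z \<noteq> 0" "q z \<noteq> 0" by (auto simp: vanishing_def)
    {
      fix u
      obtain w where w: "\<forall>i\<in>S. w i = u i" "\<forall>f\<in>P \<inter> polyf ?V. dd f z w = 0" using q(3)[OF z(1) nz(3)] by blast
      \<comment> \<open>The only value of the new coordinate for which the derivative of the minimal
        equation vanishes; the separant is the coefficient of that coordinate.\<close>
      let ?w = "w(j := - dd m z (w(j := 0)) / s z)"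
      have dm: "dd m z ?w = 0" using split[of z ?w] nz by simp
      \<comment> \<open>Differentiate \<open>c ^ n * f = q * m + r\<close> at a zero of
        \<open>P\<close>. On the left only \<open>c ^ n\<close> times the derivative of
        \<open>f\<close> survives; on the right \<open>m\<close> and its derivative vanish, and so
        do the coefficients of \<open>r\<close> and their derivatives.\<close>
      have "dd f z ?w = 0" if f: "f \<in> P" "f \<in> polyf (insert j ?V)" for f
      proof -
        obtain D where "f \<in> pdeg ?V j D" using polyf_pdeg[OF f(2)] by blast
        then obtain n q r where qr: "q \<in> pdeg ?V j (D - e)" "r \<in> pdeg ?V j e"
            "\<And>v. c v ^ n * f v = q v * m v + r v"
          using pseudo_division[OF m0(1,2), of m f D] m_def by blast
        have qN: "q \<in> polyf {..<N}" by (rule polyf_mono[OF pdeg_polyf[OF qr(1)] VN])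
        have "(\<lambda>v. c v ^ n * f v - q v * m v) \<in> P"
          by (rule diff[OF absorb[OF polyf_power[OF cN] f(1)] absorb[OF qN mP]])
        then have "r \<in> P" by (simp add: qr(3))
        then obtain d where d: "\<forall>k. d k \<in> P \<inter> polyf ?V" "\<forall>v. r v = (\<Sum>k<e. d k v * v j ^ k)"
          using small_degree_coeffs[OF min VN order_refl qr(2)] by blast
        have dU: "d k \<in> polyf UNIV" "(\<lambda>v. v j ^ k) \<in> polyf UNIV" for k
          using d(1) by (auto intro: polyf_UNIV intro!: polyf_power polyf.var)
        have "dd (d k) z ?w = 0" "d k z = 0" for k using d(1) w(2) ddV[of "d k"] Pz by auto
        then have "dd (\<lambda>v. d k v * v j ^ k) z ?w = 0" for k
          using dd_mult[OF dU, of k k z ?w] by simp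
        then have "dd (\<lambda>v. \<Sum>k<e. d k v * v j ^ k) z ?w = 0"
          by (subst dd_sum[of _ "\<lambda>k v. d k v * v j ^ k"]) (use polyf.mult[OF dU] in auto)
        moreover have "r = (\<lambda>v. \<Sum>k<e. d k v * v j ^ k)" using d(2) by auto
        ultimately have "dd r z ?w = 0" by simp
        moreover have "dd (\<lambda>v. c v ^ n * f v) z ?w = c z ^ n * dd f z ?w"
          using Pz[OF f(1)] polyf_UNIV[OF cN] polyf_UNIV[OF f(2)] by (simp add: dd_mult polyf_power)
        moreover have "dd (\<lambda>v. q v * m v + r v) z ?w = dd r z ?w"
          using Pz[OF mP] dm polyf_UNIV[OF qN] mU polyf_UNIV[OF pdeg_polyf[OF qr(2)]]
          by (simp add: dd_add dd_mult polyf.mult)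
        ultimately have "c z ^ n * dd f z ?w = 0" by (simp add: qr(3))
        then show ?thesis using nz by simp
      qed
      moreover have "?w i = u i" if "i \<in> S" for i using w(1) that j by auto
      ultimately show "\<exists>w. (\<forall>i\<in>S. w i = u i) \<and> (\<forall>f\<in>P \<inter> polyf (S \<union> insert j W). dd f z w = 0)"
        by (intro exI[of _ ?w]) auto
    }
    fix w i assume w: "(\<forall>i\<in>S. w i = 0) \<and> (\<forall>f\<in>P \<inter> polyf (S \<union> insert j W). dd f z w = 0)" and i: "i \<in> insert j W"
    have mono: "f \<in> polyf ?V \<Longrightarrow> f \<in> polyf (S \<union> insert j W)" for f by (rule polyf_mono) auto
    have wW: "\<forall>i\<in>W. w i = 0" using q(4)[OF z(1) nz(3), of w] w mono by blast
    have "dd m z w = 0" using w mP mV by auto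
    moreover have "dd m z (w(j := 0)) = dd m z (\<lambda>i. 0)"
      by (rule dd_dir_cong[OF mV]) (use w wW in auto)
    ultimately have "w j = 0" using split[of z w] nz mU by simp
    then show "w i = 0" using i wW by auto
  qed
qed

lemma generic_tangent:
  assumes "basis S"
  obtains q where "q \<in> polyf {..<N}" "q \<notin> P"
    "\<And>z. z \<in> vanishing N P \<Longrightarrow> q z \<noteq> 0 \<Longrightarrow> fvs.dim (tangent N P z) = card S"
proof -
  let ?W = "{..<N} - S"
  have S: "S \<union> ?W = {..<N}" "indep S" and fin: "finite S" using assms finite_subset by (auto simp: basis_def indep_def)
  have "\<exists>q\<in>polyf {..<N}. q \<notin> P \<and> (\<forall>z\<in>vanishing N P. q z \<noteq> 0 \<longrightarrow>
     (\<forall>u. \<exists>w. (\<forall>i\<in>S. w i = u i) \<and> (\<forall>f\<in>P \<inter> polyf (S \<union> ?W). dd f z w = 0)) \<and>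
     (\<forall>w. (\<forall>i\<in>S. w i = 0) \<and> (\<forall>f\<in>P \<inter> polyf (S \<union> ?W). dd f z w = 0) \<longrightarrow> (\<forall>i\<in>?W. w i = 0)))"
    by (rule extend_tangent_tower) (use assms in \<open>auto simp: basis_def indep_def\<close>)
  moreover have P: "P \<inter> polyf {..<N} = P" using sub by auto
  ultimately obtain q where q: "q \<in> polyf {..<N}" "q \<notin> P" and qq: "\<forall>z\<in>vanishing N P. q z \<noteq> 0 \<longrightarrow>
     (\<forall>u. \<exists>w. (\<forall>i\<in>S. w i = u i) \<and> (\<forall>f\<in>P. dd f z w = 0)) \<and>
     (\<forall>w. (\<forall>i\<in>S. w i = 0) \<and> (\<forall>f\<in>P. dd f z w = 0) \<longrightarrow> (\<forall>i\<in>?W. w i = 0))"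
    unfolding S(1) P by blast
  have "fvs.dim (tangent N P z) = card S" if z: "z \<in> vanishing N P" "q z \<noteq> 0" for z
  proof (rule dim_by_coordinates[OF _ fin])
    show "fvs.subspace (tangent N P z)" using sub polyf_UNIV by (intro tangent_subspace) blast
    show "\<exists>w\<in>tangent N P z. \<forall>i\<in>S. w i = u i" for u
    proof -
      obtain w where w: "\<forall>i\<in>S. w i = u i" "\<forall>f\<in>P. dd f z w = 0" using qq z by blast
      have "dd f z (trunc N w) = dd f z w" if "f \<in> P" for f
        using sub that by (intro dd_dir_cong[of f "{..<N}"]) (auto simp: trunc_def)
      then show ?thesis using w S trunc_affine[of N w]
        by (intro bexI[of _ "trunc N w"]) (auto simp: tangent_def, auto simp: trunc_def indep_def)
    qed
    show "w = 0" if "w \<in> tangent N P z" "\<And>i. i \<in> S \<Longrightarrow> w i = 0" for w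
    proof
      fix i
      have "\<forall>i\<in>?W. w i = 0" using qq z that by (auto simp: tangent_def)
      then show "w i = 0 i" using that by (cases "i < N"; cases "i \<in> S") (auto simp: tangent_def affine_points_def)
    qed
  qed
  then show thesis using that q by blast
qed

text \<open>At a point where both generic conditions hold, the dimension of the tangent space equals
  \<open>card S\<close> and \<open>card T\<close>. This takes the place of the exchange
  argument.\<close>

lemma basis_card_unique:
  assumes "basis S" "basis T" shows "card S = card T"
proof -
  obtain q where q: "q \<in> polyf {..<N}" "q \<notin> P"
    "\<And>z. z \<in> vanishing N P \<Longrightarrow> q z \<noteq> 0 \<Longrightarrow> fvs.dim (tangent N P z) = card S" by (rule generic_tangent[OF assms(1)]) blast
  obtain r where r: "r \<in> polyf {..<N}" "r \<notin> P"
    "\<And>z. z \<in> vanishing N P \<Longrightarrow> r z \<noteq> 0 \<Longrightarrow> fvs.dim (tangent N P z) = card T" by (rule generic_tangent[OF assms(2)]) blast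
  obtain z where "z \<in> vanishing N P" "q z * r z \<noteq> 0"
    using nullstellensatz[OF polyf.mult[OF q(1) r(1)]] mult_notin q r by metis
  then show ?thesis using q r by force
qed

end

section \<open>Affine varieties and dimension\<close>

lemma openin_generated_base:
  assumes "\<And>A B. A \<in> \<S> \<Longrightarrow> B \<in> \<S> \<Longrightarrow> A \<inter> B \<in> \<S>"
  shows "openin (topology_generated_by \<S>) U \<longleftrightarrow> (\<forall>x\<in>U. \<exists>A\<in>\<S>. x \<in> A \<and> A \<subseteq> U)"
proof
  assume "openin (topology_generated_by \<S>) U"
  then have "generate_topology_on \<S> U" by (rule openin_topology_generated_by)
  then show "\<forall>x\<in>U. \<exists>A\<in>\<S>. x \<in> A \<and> A \<subseteq> U"
  proof (induction rule: generate_topology_on.induct)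
    case (Int a b)
    show ?case
    proof
      fix x assume "x \<in> a \<inter> b"
      then obtain A B where "A \<in> \<S>" "x \<in> A" "A \<subseteq> a" "B \<in> \<S>" "x \<in> B" "B \<subseteq> b" using Int by blast
      then show "\<exists>A\<in>\<S>. x \<in> A \<and> A \<subseteq> a \<inter> b" using assms by (intro bexI[of _ "A \<inter> B"]) auto
    qed
  next
    case (UN K)
    show ?case
    proof
      fix x assume "x \<in> \<Union>K"
      then obtain k where k: "k \<in> K" "x \<in> k" by blast
      then obtain A where "A \<in> \<S>" "x \<in> A" "A \<subseteq> k" using UN.IH[OF k(1)] by blast
      then show "\<exists>A\<in>\<S>. x \<in> A \<and> A \<subseteq> \<Union>K" using k(1) by (intro bexI[of _ A]) auto
    qed
  next
    case (Basis s)
    then show ?case by (auto intro: bexI[of _ s])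
  qed simp
next
  assume r: "\<forall>x\<in>U. \<exists>A\<in>\<S>. x \<in> A \<and> A \<subseteq> U"
  then have "U = \<Union>{A \<in> \<S>. A \<subseteq> U}" by blast
  moreover have "openin (topology_generated_by \<S>) (\<Union>{A \<in> \<S>. A \<subseteq> U})"
    by (intro openin_Union) (auto simp: topology_generated_by_Basis)
  ultimately show "openin (topology_generated_by \<S>) U" by simp
qed

lemma ztop_affine: "ztop (affine_space n) = topology_generated_by {{v \<in> affine_points n. mp_eval p v \<noteq> 0} | p. True}"
  by (simp add: affine_space_def Let_def)

lemma topspace_affine [simp]: "topspace (ztop (affine_space n)) = affine_points n"
proof -
  have "\<exists>p. mp_eval p v \<noteq> 0" for v :: "nat \<Rightarrow> 'a" by (rule exI[of _ "mp_const 1"]) simp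
  then show ?thesis unfolding ztop_affine by (auto simp: topology_generated_by_topspace)
qed

lemma ztop_subvar [simp]: "ztop (subvar P Z) = subtopology (ztop P) Z"
  by (simp add: subvar_def)

lemma openin_affine_mp:
  "openin (ztop (affine_space n)) U \<longleftrightarrow>
     (\<forall>x\<in>U. \<exists>p. x \<in> affine_points n \<and> mp_eval p x \<noteq> 0 \<and> {v \<in> affine_points n. mp_eval p v \<noteq> 0} \<subseteq> U)"
proof -
  let ?B = "{{v \<in> affine_points n. mp_eval p v \<noteq> 0} | p. True}"
  have "openin (ztop (affine_space n)) U \<longleftrightarrow> (\<forall>x\<in>U. \<exists>A\<in>?B. x \<in> A \<and> A \<subseteq> U)"
    unfolding ztop_affine
  proof (rule openin_generated_base)
    fix A B :: "(nat \<Rightarrow> 'a) set"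
    assume "A \<in> {{v \<in> affine_points n. mp_eval p v \<noteq> 0} | p. True}" "B \<in> {{v \<in> affine_points n. mp_eval p v \<noteq> 0} | p. True}"
    then obtain p q where "A = {v \<in> affine_points n. mp_eval p v \<noteq> 0}" "B = {v \<in> affine_points n. mp_eval q v \<noteq> 0}" by blast
    then have "A \<inter> B = {v \<in> affine_points n. mp_eval (p * q) v \<noteq> 0}" by (auto simp: mp_eval_mult)
    then show "A \<inter> B \<in> {{v \<in> affine_points n. mp_eval p v \<noteq> 0} | p. True}" by blast
  qed
  also have "\<dots> \<longleftrightarrow> (\<forall>x\<in>U. \<exists>p. x \<in> affine_points n \<and> mp_eval p x \<noteq> 0 \<and> {v \<in> affine_points n. mp_eval p v \<noteq> 0} \<subseteq> U)"
  proof (rule ball_cong[OF refl])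
    fix x
    show "(\<exists>A\<in>?B. x \<in> A \<and> A \<subseteq> U) \<longleftrightarrow> (\<exists>p. x \<in> affine_points n \<and> mp_eval p x \<noteq> 0 \<and> {v \<in> affine_points n. mp_eval p v \<noteq> 0} \<subseteq> U)"
      unfolding Bex_def mem_Collect_eq by (rule iffI; elim exE conjE; blast)
  qed
  finally show ?thesis .
qed

lemma openin_affine:
  "openin (ztop (affine_space n)) U \<longleftrightarrow>
     (\<forall>x\<in>U. \<exists>f\<in>polyf {..<n}. x \<in> affine_points n \<and> f x \<noteq> 0 \<and> {v \<in> affine_points n. f v \<noteq> 0} \<subseteq> U)"
proof
  assume o: "openin (ztop (affine_space n)) U"
  show "\<forall>x\<in>U. \<exists>f\<in>polyf {..<n}. x \<in> affine_points n \<and> f x \<noteq> 0 \<and> {v \<in> affine_points n. f v \<noteq> 0} \<subseteq> U"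
  proof
    fix x assume "x \<in> U"
    then obtain p where p: "x \<in> affine_points n" "mp_eval p x \<noteq> 0" "{v \<in> affine_points n. mp_eval p v \<noteq> 0} \<subseteq> U"
      using o by (auto simp: openin_affine_mp)
    then show "\<exists>f\<in>polyf {..<n}. x \<in> affine_points n \<and> f x \<noteq> 0 \<and> {v \<in> affine_points n. f v \<noteq> 0} \<subseteq> U"
      using polyf_trunc[OF mp_eval_polyf, of p n]
      by (intro bexI[of _ "\<lambda>v. mp_eval p (trunc n v)"]) (auto simp: trunc_id)
  qed
next
  assume r: "\<forall>x\<in>U. \<exists>f\<in>polyf {..<n}. x \<in> affine_points n \<and> f x \<noteq> 0 \<and> {v \<in> affine_points n. f v \<noteq> 0} \<subseteq> U"
  show "openin (ztop (affine_space n)) U" unfolding openin_affine_mp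
  proof
    fix x assume "x \<in> U"
    then obtain f where f: "f \<in> polyf {..<n}" "x \<in> affine_points n" "f x \<noteq> 0" "{v \<in> affine_points n. f v \<noteq> 0} \<subseteq> U"
      using r by blast
    then obtain p where "f = mp_eval p" using polyf_imp_mp_eval by blast
    then show "\<exists>p. x \<in> affine_points n \<and> mp_eval p x \<noteq> 0 \<and> {v \<in> affine_points n. mp_eval p v \<noteq> 0} \<subseteq> U" using f by blast
  qed
qed

lemma closedin_vanishing:
  assumes "F \<subseteq> polyf {..<n}" shows "closedin (ztop (affine_space n)) (vanishing n F)"
  unfolding closedin_def topspace_affine
proof
  show "vanishing n F \<subseteq> affine_points n" by (auto simp: vanishing_def)
  show "openin (ztop (affine_space n)) (affine_points n - vanishing n F)"
    unfolding openin_affine using assms by (fastforce simp: vanishing_def)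
qed

lemma closedin_affine_iff:
  "closedin (ztop (affine_space n)) C \<longleftrightarrow> vanishing n (ideal_of n C) = C"
proof
  assume C: "closedin (ztop (affine_space n)) C"
  then have sub: "C \<subseteq> affine_points n" using closedin_subset by fastforce
  have "v \<in> C" if v: "v \<in> vanishing n (ideal_of n C)" for v
  proof (rule ccontr)
    assume "v \<notin> C"
    moreover have "v \<in> affine_points n" using v by (simp add: vanishing_def)
    moreover have "openin (ztop (affine_space n)) (affine_points n - C)" using C by (simp add: closedin_def)
    ultimately obtain f where "f \<in> polyf {..<n}" "f v \<noteq> 0" "{v \<in> affine_points n. f v \<noteq> 0} \<subseteq> affine_points n - C"
      unfolding openin_affine by blast
    then have "f \<in> ideal_of n C" using sub by (auto simp: ideal_of_def)
    then show False using v \<open>f v \<noteq> 0\<close> by (auto simp: vanishing_def)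
  qed
  moreover have "C \<subseteq> vanishing n (ideal_of n C)" using sub by (auto simp: vanishing_def ideal_of_def)
  ultimately show "vanishing n (ideal_of n C) = C" by blast
next
  assume "vanishing n (ideal_of n C) = C"
  then show "closedin (ztop (affine_space n)) C"
    using closedin_vanishing[of "ideal_of n C" n] by (auto simp: ideal_of_def)
qed

lemma poly_ideal_ideal_of: "poly_ideal n (ideal_of n X)"
  by unfold_locales (auto simp: ideal_of_def intro: polyf_intros)

lemma irreducible_iff_prime:
  assumes Z: "closedin (ztop (affine_space n)) Z"
  shows "irreducible_space (subtopology (ztop (affine_space n)) Z) \<longleftrightarrow> poly_prime n (ideal_of n Z)"
proof -
  let ?T = "ztop (affine_space n)"
  have Zsub: "Z \<subseteq> affine_points n" using Z closedin_subset by fastforce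
  have top: "topspace (subtopology ?T Z) = Z" using Zsub by auto
  show ?thesis
  proof
    assume irr: "irreducible_space (subtopology ?T Z)"
    interpret poly_ideal n "ideal_of n Z" by (rule poly_ideal_ideal_of)
    show "poly_prime n (ideal_of n Z)"
    proof
      show "(\<lambda>v. 1) \<notin> ideal_of n Z" using irr unfolding irreducible_space_def top by (auto simp: ideal_of_def)
      fix f g assume fg: "f \<in> polyf {..<n}" "g \<in> polyf {..<n}" "(\<lambda>v. f v * g v) \<in> ideal_of n Z"
      have cl: "closedin (subtopology ?T Z) (Z \<inter> vanishing n {h})" if "h \<in> polyf {..<n}" for h
        using closedin_vanishing[of "{h}" n] that by (auto simp: closedin_subtopology)
      have "(Z \<inter> vanishing n {f}) \<union> (Z \<inter> vanishing n {g}) = Z"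
      proof (intro equalityI subsetI)
        fix x assume x: "x \<in> Z"
        then have "x \<in> affine_points n" using Zsub by blast
        moreover have "f x = 0 \<or> g x = 0" using fg(3) x by (auto simp: ideal_of_def)
        ultimately show "x \<in> (Z \<inter> vanishing n {f}) \<union> (Z \<inter> vanishing n {g})"
          using x by (auto simp: vanishing_def)
      qed auto
      then have "Z \<inter> vanishing n {f} = Z \<or> Z \<inter> vanishing n {g} = Z"
        using irr cl[OF fg(1)] cl[OF fg(2)] unfolding irreducible_space_def top by blast
      then show "f \<in> ideal_of n Z \<or> g \<in> ideal_of n Z" using fg by (auto simp: ideal_of_def vanishing_def)
    qed
  next
    assume "poly_prime n (ideal_of n Z)"
    then interpret poly_prime n "ideal_of n Z" .
    have "Z \<noteq> {}" using proper by (auto simp: ideal_of_def polyf.const)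
    moreover have "A = Z \<or> B = Z" if AB: "closedin (subtopology ?T Z) A" "closedin (subtopology ?T Z) B" "A \<union> B = Z" for A B
    proof (rule ccontr)
      have cl: "closedin ?T A" "closedin ?T B" by (rule closedin_trans_full[OF AB(1) Z], rule closedin_trans_full[OF AB(2) Z])
      assume "\<not> ?thesis"
      then obtain x y where xy: "x \<in> Z - A" "y \<in> Z - B" using AB by blast
      have "x \<notin> vanishing n (ideal_of n A)" "y \<notin> vanishing n (ideal_of n B)"
        using cl xy by (auto simp: closedin_affine_iff)
      then obtain f g where fg: "f \<in> ideal_of n A" "f x \<noteq> 0" "g \<in> ideal_of n B" "g y \<noteq> 0"
        using xy Zsub by (auto simp: vanishing_def)
      then have "(\<lambda>v. f v * g v) \<in> ideal_of n Z" unfolding AB(3)[symmetric] by (auto simp: ideal_of_def intro: polyf_intros)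
      then have "f \<in> ideal_of n Z \<or> g \<in> ideal_of n Z" using fg by (intro prime) (auto simp: ideal_of_def)
      then show False using fg xy by (auto simp: ideal_of_def)
    qed
    ultimately show "irreducible_space (subtopology ?T Z)" unfolding irreducible_space_def top by blast
  qed
qed

lemma affine_variety_iff:
  "affine_variety n X \<longleftrightarrow> vanishing n (ideal_of n X) = X \<and> poly_prime n (ideal_of n X)"
  using irreducible_iff_prime[of n X] by (auto simp: affine_variety_def closedin_affine_iff)

lemma affine_variety_sub: "affine_variety n X \<Longrightarrow> X \<subseteq> affine_points n"
  unfolding affine_variety_iff by (auto simp: vanishing_def)

lemma affine_variety_mult_0:
  assumes "affine_variety n X" "f \<in> polyf {..<n}" "g \<in> polyf {..<n}" "\<And>x. x \<in> X \<Longrightarrow> f x * g x = 0"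
  shows "(\<forall>x\<in>X. f x = 0) \<or> (\<forall>x\<in>X. g x = 0)"
  using poly_prime.prime[of n "ideal_of n X" f g] assms
  by (auto simp: affine_variety_iff ideal_of_def polyf.mult)

lemma affine_variety_common_nonzero:
  assumes "affine_variety n X" "f \<in> polyf {..<n}" "g \<in> polyf {..<n}" "x \<in> X" "f x \<noteq> 0" "y \<in> X" "g y \<noteq> 0"
  obtains z where "z \<in> X" "f z \<noteq> 0" "g z \<noteq> 0"
  using affine_variety_mult_0[OF assms(1-3)] assms(4-) by (metis mult_eq_0_iff)

lemma affine_variety_of_prime:
  fixes P :: "((nat \<Rightarrow> 'k::{alg_closed_field, field_char_0}) \<Rightarrow> 'k) set"
  assumes "poly_prime n P" shows "affine_variety n (vanishing n P)" "ideal_of n (vanishing n P) = P"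
proof -
  interpret poly_prime_ac n P using assms by (simp add: poly_prime_ac_def)
  show "ideal_of n (vanishing n P) = P" by (rule ideal_of_vanishing)
  then show "affine_variety n (vanishing n P)" using assms by (simp add: affine_variety_iff)
qed

lemma variety_prime_ac:
  fixes X :: "(nat \<Rightarrow> 'k::{alg_closed_field, field_char_0}) set"
  shows "affine_variety n X \<Longrightarrow> poly_prime_ac n (ideal_of n X)"
  by (simp add: affine_variety_iff poly_prime_ac_def)

section \<open>Krull dimension: chains of varieties and cardinalities of bases\<close>

abbreviation "vbasis n X \<equiv> poly_prime.basis n (ideal_of n X)"
abbreviation "vindep n X \<equiv> poly_prime.indep n (ideal_of n X)"

text \<open>\<open>X\<close> is cut with a hyperplane on which the coordinate \<open>s\<close> has a
  value occurring in generic position. Almost every point of this hyperplane in the coordinates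
  \<open>S\<close> still lifts to \<open>X\<close>, so the slice satisfies no relation among the
  remaining ones. A prime containing its ideal and avoiding their nonzero polynomials gives
  \<open>X'\<close>.\<close>

lemma variety_hyperplane_section:
  fixes X :: "(nat \<Rightarrow> 'k::{alg_closed_field, field_char_0}) set"
  assumes X: "affine_variety n X" and S: "vbasis n X S" and s: "s \<in> S"
  obtains X' where "affine_variety n X'" "X' \<subset> X" "vindep n X' (S - {s})"
proof -
  interpret poly_prime_ac n "ideal_of n X" using X by (rule variety_prime_ac)
  have Sn: "S \<subseteq> {..<n}" and SI: "ideal_of n X \<inter> polyf S = {\<lambda>v. 0}" using S by (auto simp: basis_def indep_def)
  have VX: "vanishing n (ideal_of n X) = X" using X by (simp add: affine_variety_iff)
  obtain q where q: "q \<in> polyf S" "q \<notin> ideal_of n X"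
    "\<And>v. q v \<noteq> 0 \<Longrightarrow> \<exists>w\<in>vanishing n (ideal_of n X). \<forall>i\<in>S. w i = v i"
    by (rule extend_point[OF S]) blast
  have "q \<noteq> (\<lambda>v. 0)" using q(2) zero by metis
  then obtain v0 where v0: "q v0 \<noteq> 0" by blast
  define J where "J = ideal_of n (X \<inter> {v. v s = v0 s})"
  let ?S = "S - {s}"
  define M :: "((nat \<Rightarrow> 'k) \<Rightarrow> 'k) set" where "M = polyf ?S - {\<lambda>v. 0}"
  have MJ: "J \<inter> M = {}"
  proof -
    have "b = (\<lambda>v. 0)" if b: "b \<in> J" "b \<in> polyf ?S" for b
    proof -
      \<comment> \<open>If \<open>q\<close> is nonzero there, the point \<open>v(s := v0 s)\<close>
        lifts to the slice, where \<open>b\<close> vanishes; as \<open>b\<close> does not involve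
        \<open>s\<close>, its value there is \<open>b v\<close>.\<close>
      have "b v * q (v(s := v0 s)) = 0" for v
      proof (cases "q (v(s := v0 s)) = 0")
        case False
        then obtain w where w: "w \<in> X" "\<forall>i\<in>S. w i = (v(s := v0 s)) i" using q(3) unfolding VX by blast
        then have "b w = 0" using b(1) s by (auto simp: J_def ideal_of_def)
        moreover have "b w = b v" using w by (intro polyf_cong[OF b(2)]) auto
        ultimately show ?thesis by simp
      qed simp
      then have "\<And>v. q (v(s := v0 s)) * b v = 0" by (simp add: mult.commute)
      moreover have "q (v0(s := v0 s)) \<noteq> 0" using v0 by simp
      ultimately show ?thesis using polyf_mult_eq_0[OF polyf_upd_const[OF q(1)] b(2)] by blast
    qed
    then show ?thesis by (auto simp: M_def)
  qed
  obtain P where P: "poly_prime n P" "J \<subseteq> P" "P \<inter> M = {}"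
  proof (rule prime_ideal_exists[OF _ _ _ _ MJ])
    show "poly_ideal n J" unfolding J_def by (rule poly_ideal_ideal_of)
    show "M \<subseteq> polyf {..<n}" using Sn polyf_mono[of _ ?S "{..<n}"] by (auto simp: M_def)
    show "(\<lambda>v. 1) \<in> M" by (auto simp: M_def polyf.const fun_eq_iff)
    show "(\<lambda>v. f v * g v) \<in> M" if fg: "f \<in> M" "g \<in> M" for f g
    proof -
      obtain x where "f x \<noteq> 0" using fg by (auto simp: M_def)
      then have "(\<lambda>v. f v * g v) \<noteq> (\<lambda>v. 0)"
        using fg polyf_mult_eq_0[of f ?S g ?S x] by (auto simp: M_def fun_eq_iff)
      then show ?thesis using fg by (auto simp: M_def polyf.mult)
    qed
  qed blast
  let ?X = "vanishing n P"
  note PV = affine_variety_of_prime[OF P(1)]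
  have XP: "ideal_of n X \<subseteq> P" using P(2) by (auto simp: J_def ideal_of_def)
  then have "?X \<subseteq> X" using VX by (auto simp: vanishing_def)
  moreover have "?X \<noteq> X"
  proof
    assume "?X = X"
    have x: "(\<lambda>v. v s - v0 s) \<in> polyf S" using s by (intro polyf_intros)
    moreover have "(\<lambda>v. v s - v0 s) \<in> P" using P(2) Sn s
      by (auto simp: J_def ideal_of_def intro!: subsetD[OF P(2)] polyf_intros)
    ultimately have "(\<lambda>v. v s - v0 s) = (\<lambda>v. 0)" using SI PV(2) \<open>?X = X\<close> by auto
    from fun_cong[OF this, of "\<lambda>i. v0 s + 1"] show False by simp
  qed
  moreover have "poly_prime.indep n (ideal_of n ?X) ?S"
    unfolding PV(2) poly_prime.indep_def[OF P(1)]
    using Sn P(3) poly_ideal.zero[of n P] P(1) by (auto simp: M_def poly_prime_def polyf.const)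
  ultimately show thesis using that PV(1) by blast
qed

text \<open>\<open>S\<close> stays independent on the larger variety and extends to a basis
  \<open>T\<close> there. If \<open>S = T\<close>, a function \<open>f\<close> vanishing on
  \<open>X\<close> but not on \<open>X'\<close> would divide, modulo the ideal of \<open>X'\<close>,
  some \<open>b\<close> in \<open>polyf S\<close> outside that ideal; but \<open>b\<close> vanishes
  on \<open>X\<close>, so it is zero by independence.\<close>

lemma vbasis_card_strict_mono:
  fixes X :: "(nat \<Rightarrow> 'k::{alg_closed_field, field_char_0}) set"
  assumes X: "affine_variety n X" "affine_variety n X'" "X \<subset> X'" and S: "vbasis n X S" "vbasis n X' S'"
  shows "card S < card S'"
proof -
  interpret A: poly_prime_ac n "ideal_of n X" using X by (intro variety_prime_ac)
  interpret B: poly_prime_ac n "ideal_of n X'" using X by (intro variety_prime_ac)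
  have sub: "ideal_of n X' \<subseteq> ideal_of n X" using X by (auto simp: ideal_of_def)
  have SI: "ideal_of n X \<inter> polyf S = {\<lambda>v. 0}" using S by (auto simp: A.basis_def A.indep_def)
  have "B.indep S" using S(1) sub B.zero by (auto simp: A.basis_def A.indep_def B.indep_def)
  then obtain T where T: "B.basis T" "S \<subseteq> T" by (rule B.basis_extend)
  have "S \<noteq> T"
  proof
    assume "S = T"
    have "\<not> ideal_of n X \<subseteq> ideal_of n X'"
    proof
      assume "ideal_of n X \<subseteq> ideal_of n X'"
      then have "vanishing n (ideal_of n X') \<subseteq> vanishing n (ideal_of n X)" by (auto simp: vanishing_def)
      then show False using X by (auto simp: affine_variety_iff)
    qed
    then obtain f where f: "f \<in> ideal_of n X" "f \<notin> ideal_of n X'" by blast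
    then have "f \<in> polyf {..<n}" by (simp add: ideal_of_def)
    then obtain f' b where b: "f' \<in> polyf {..<n}" "b \<in> polyf T" "b \<notin> ideal_of n X'" "(\<lambda>v. f v * f' v - b v) \<in> ideal_of n X'"
      using B.basis_inverse[OF T(1) _ f(2)] by metis
    have "(\<lambda>v. f v * f' v - (f v * f' v - b v)) \<in> ideal_of n X"
      by (rule A.diff[OF A.absorb2[OF b(1) f(1)] subsetD[OF sub b(4)]])
    then have "b \<in> ideal_of n X" by simp
    then have "b = (\<lambda>v. 0)" using SI b(2) \<open>S = T\<close> by auto
    then show False using b(3) B.zero by simp
  qed
  moreover have "finite T" using T finite_subset by (auto simp: B.basis_def B.indep_def)
  ultimately have "card S < card T" using T(2) by (intro psubset_card_mono) auto
  then show ?thesis using B.basis_card_unique[OF T(1) S(2)] by simp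
qed

lemma vbasis_exists:
  fixes X :: "(nat \<Rightarrow> 'k::{alg_closed_field, field_char_0}) set"
  assumes "affine_variety n X" obtains S where "vbasis n X S"
proof -
  interpret A: poly_prime_ac n "ideal_of n X" using assms by (intro variety_prime_ac)
  show thesis by (rule A.basis_extend[OF A.indep_empty]) (rule that)
qed

text \<open>A cut costs only one element of the basis: \<open>S - {s}\<close> extends to a basis of
  \<open>X'\<close>, so enough elements remain for the other \<open>r\<close> cuts.\<close>

lemma variety_chain_exists:
  fixes X :: "(nat \<Rightarrow> 'k::{alg_closed_field, field_char_0}) set"
  assumes "affine_variety n X" "vbasis n X S" "r \<le> card S"
  shows "\<exists>Z. (\<forall>i\<le>r. affine_variety n (Z i) \<and> Z i \<subseteq> X) \<and> (\<forall>i<r. Z i \<subset> Z (Suc i))"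
  using assms
proof (induction r arbitrary: X S)
  case 0
  then show ?case by (intro exI[of _ "\<lambda>i. X"]) auto
next
  case (Suc r)
  then have "S \<noteq> {}" by auto
  then obtain s where s: "s \<in> S" by blast
  obtain X' where X': "affine_variety n X'" "X' \<subset> X" "vindep n X' (S - {s})"
    using variety_hyperplane_section[OF Suc.prems(1,2) s] by blast
  interpret A: poly_prime_ac n "ideal_of n X'" using X' by (intro variety_prime_ac)
  obtain T where T: "vbasis n X' T" "S - {s} \<subseteq> T" by (rule A.basis_extend[OF X'(3)])
  have "finite T" using T finite_subset by (auto simp: A.basis_def A.indep_def)
  then have "card (S - {s}) \<le> card T" using T by (intro card_mono)
  then have "r \<le> card T" using Suc.prems(3) s by (simp add: card_Diff_singleton)
  then obtain Z where Z: "\<forall>i\<le>r. affine_variety n (Z i) \<and> Z i \<subseteq> X'" "\<forall>i<r. Z i \<subset> Z (Suc i)"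
    using Suc.IH[OF X'(1) T(1)] by blast
  let ?Z = "\<lambda>i. if i \<le> r then Z i else X"
  have "affine_variety n (?Z i) \<and> ?Z i \<subseteq> X" for i
  proof (cases "i \<le> r")
    case True
    then have "affine_variety n (Z i) \<and> Z i \<subseteq> X'" using Z(1) by blast
    then show ?thesis using True X'(2) by auto
  qed (use Suc.prems(1) in simp)
  then have "\<forall>i\<le>Suc r. affine_variety n (?Z i) \<and> ?Z i \<subseteq> X" by blast
  moreover have "\<forall>i<Suc r. ?Z i \<subset> ?Z (Suc i)"
    using Z subset_psubset_trans[OF _ X'(2), of "Z r"] by (auto simp: less_Suc_eq)
  ultimately show ?case by (intro exI[of _ ?Z] conjI)
qed

lemma vbasis_card_mono:
  fixes X :: "(nat \<Rightarrow> 'k::{alg_closed_field, field_char_0}) set"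
  assumes X: "affine_variety n X" "affine_variety n X'" "X \<subseteq> X'" and S: "vbasis n X S" "vbasis n X' S'"
  shows "card S \<le> card S'"
proof (cases "X = X'")
  case True
  interpret A: poly_prime_ac n "ideal_of n X" using X by (intro variety_prime_ac)
  show ?thesis using A.basis_card_unique[of S S'] S True by simp
next
  case False
  then show ?thesis using vbasis_card_strict_mono[OF X(1,2) _ S] X(3) by (simp add: psubset_eq)
qed

lemma variety_chain_length:
  fixes X :: "(nat \<Rightarrow> 'k::{alg_closed_field, field_char_0}) set"
  assumes X: "affine_variety n X" "vbasis n X S"
    and Z: "\<forall>i\<le>r. affine_variety n (Z i) \<and> Z i \<subseteq> X" "\<forall>i<r. Z i \<subset> Z (Suc i)"
  shows "r \<le> card S"
proof -
  have "i \<le> r \<Longrightarrow> vbasis n (Z i) T \<Longrightarrow> i \<le> card T" for i T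
  proof (induction i arbitrary: T)
    case (Suc i)
    obtain U where U: "vbasis n (Z i) U" using vbasis_exists[of n "Z i"] Z(1) Suc by auto
    then have "card U < card T"
      using vbasis_card_strict_mono[of n "Z i" "Z (Suc i)" U T] Z Suc.prems by auto
    moreover have "i \<le> card U" using Suc U by auto
    ultimately show ?case by linarith
  qed simp
  moreover obtain T where T: "vbasis n (Z r) T" using vbasis_exists[of n "Z r"] Z(1) by auto
  ultimately have "r \<le> card T" by auto
  then show ?thesis using vbasis_card_mono[of n "Z r" X T S] Z X T by auto
qed

lemma krull_dim_variety:
  fixes X :: "(nat \<Rightarrow> 'k::{alg_closed_field, field_char_0}) set"
  assumes X: "affine_variety n X" and S: "vbasis n X S"
  shows "krull_dim (ztop (affvar n X)) = enat (card S)"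
proof -
  let ?T = "ztop (affine_space n)"
  have clX: "closedin ?T X" using X by (simp add: affine_variety_def)
  have sub: "X \<subseteq> affine_points n" using X by (rule affine_variety_sub)
  have eq: "closedin (subtopology ?T X) C \<and> irreducible_space (subtopology (subtopology ?T X) C)
    \<longleftrightarrow> affine_variety n C \<and> C \<subseteq> X" for C
  proof -
    have "closedin (subtopology ?T X) C \<longleftrightarrow> closedin ?T C \<and> C \<subseteq> X"
      using clX by (rule closedin_closed_subtopology)
    moreover have "subtopology (subtopology ?T X) C = subtopology ?T C" if "C \<subseteq> X"
      using that by (simp add: subtopology_subtopology Int_absorb1)
    ultimately show ?thesis by (auto simp: affine_variety_def)
  qed
  let ?D = "{enat d | d. \<exists>Z. (\<forall>i\<le>d. affine_variety n (Z i) \<and> Z i \<subseteq> X) \<and> (\<forall>i<d. Z i \<subset> Z (Suc i))}"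
  have "krull_dim (ztop (affvar n X)) = Sup ?D"
    unfolding krull_dim_def ztop_subvar eq ..
  also have "Sup ?D = enat (card S)"
  proof (rule antisym)
    show "Sup ?D \<le> enat (card S)" using variety_chain_length[OF X S] by (intro Sup_least) auto
    show "enat (card S) \<le> Sup ?D" using variety_chain_exists[OF X S order_refl] by (intro Sup_upper) auto
  qed
  finally show ?thesis .
qed

lemma tangent_space_eq:
  fixes X :: "(nat \<Rightarrow> 'k::field_char_0) set"
  assumes "X \<subseteq> affine_points n" "x \<in> X"
  shows "tangent_space n X x = tangent n (ideal_of n X) x"
  using tangent_space_iff[OF assms] by (auto simp: tangent_def)

lemma regular_locus_iff:
  fixes X :: "(nat \<Rightarrow> 'k::field_char_0) set"
  assumes "X \<subseteq> affine_points n"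
  shows "x \<in> regular_locus n X \<longleftrightarrow>
    x \<in> X \<and> enat (fvs.dim (tangent n (ideal_of n X) x)) = krull_dim (ztop (affvar n X))"
  using tangent_space_eq[OF assms, of x] by (auto simp: regular_locus_def)

lemma regular_locus_generic:
  fixes X :: "(nat \<Rightarrow> 'k::{alg_closed_field, field_char_0}) set"
  assumes X: "affine_variety n X"
  obtains q x where "q \<in> polyf {..<n}" "x \<in> X" "q x \<noteq> 0" "\<And>z. z \<in> X \<Longrightarrow> q z \<noteq> 0 \<Longrightarrow> z \<in> regular_locus n X"
proof -
  obtain S where S: "vbasis n X S" using vbasis_exists[OF X] .
  interpret A: poly_prime_ac n "ideal_of n X" using X by (intro variety_prime_ac)
  obtain q where q: "q \<in> polyf {..<n}" "q \<notin> ideal_of n X"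
    "\<And>z. z \<in> vanishing n (ideal_of n X) \<Longrightarrow> q z \<noteq> 0 \<Longrightarrow> fvs.dim (tangent n (ideal_of n X) z) = card S"
    by (rule A.generic_tangent[OF S]) blast
  have VX: "vanishing n (ideal_of n X) = X" using X by (simp add: affine_variety_iff)
  have "z \<in> regular_locus n X" if "z \<in> X" "q z \<noteq> 0" for z
    using that q(3)[of z] VX krull_dim_variety[OF X S] by (simp add: regular_locus_iff affine_variety_sub[OF X])
  then show thesis using that q by (auto simp: ideal_of_def)
qed

section \<open>Regular functions and morphisms of affine varieties\<close>

text \<open>The neighbourhoods in the definition of a regular function are absorbed into
  denominators: a fraction represents \<open>f\<close> at every point of \<open>V\<close> where its
  own denominator is nonzero.\<close>

definition loc_frac :: "nat \<Rightarrow> (nat \<Rightarrow> 'k::field) set \<Rightarrow> ((nat \<Rightarrow> 'k) \<Rightarrow> 'k) \<Rightarrow> bool" where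
  "loc_frac n V f \<longleftrightarrow> (\<forall>x\<in>V. \<exists>p\<in>polyf {..<n}. \<exists>q\<in>polyf {..<n}. q x \<noteq> 0 \<and>
     (\<forall>y\<in>V. q y \<noteq> 0 \<longrightarrow> f y = p y / q y))"

text \<open>The polynomials whose product with \<open>f\<close> is polynomial on the locus
  \<open>l \<noteq> 0\<close> form an ideal \<open>J\<close>. If no power of \<open>l\<close>
  belonged to it, a prime containing \<open>J\<close> and avoiding the powers would have a zero in
  \<open>X\<close> with \<open>l \<noteq> 0\<close>, yet the denominator of \<open>f\<close> at that
  point yields an element of \<open>J\<close> that is nonzero there.\<close>

lemma loc_frac_principal_open:
  fixes X :: "(nat \<Rightarrow> 'k::{alg_closed_field, field_char_0}) set"
  assumes X: "closedin (ztop (affine_space n)) X" and l: "l \<in> polyf {..<n}"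
    and f: "loc_frac n {x \<in> X. l x \<noteq> 0} f"
  obtains M p where "p \<in> polyf {..<n}" "\<And>x. x \<in> X \<Longrightarrow> l x \<noteq> 0 \<Longrightarrow> l x ^ M * f x = p x"
proof -
  define J where "J = {g \<in> polyf {..<n}. \<exists>p\<in>polyf {..<n}. \<forall>x\<in>X. l x \<noteq> 0 \<longrightarrow> g x * f x = p x}"
  define M where "M = range (\<lambda>k v. l v ^ k)"
  have J: "poly_ideal n J"
  proof
    show "J \<subseteq> polyf {..<n}" by (auto simp: J_def)
    show "(\<lambda>v. 0) \<in> J" by (auto simp: J_def polyf.const intro!: bexI[of _ "\<lambda>v. 0"])
    show "(\<lambda>v. g v + h v) \<in> J" if gh: "g \<in> J" "h \<in> J" for g h
    proof -
      obtain p r where "p \<in> polyf {..<n}" "\<forall>x\<in>X. l x \<noteq> 0 \<longrightarrow> g x * f x = p x"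
        "r \<in> polyf {..<n}" "\<forall>x\<in>X. l x \<noteq> 0 \<longrightarrow> h x * f x = r x" using gh by (auto simp: J_def)
      then show ?thesis using gh
        by (auto simp: J_def polyf.add distrib_right intro!: bexI[of _ "\<lambda>v. p v + r v"])
    qed
    show "(\<lambda>v. g v * h v) \<in> J" if gh: "g \<in> polyf {..<n}" "h \<in> J" for g h
    proof -
      obtain r where "r \<in> polyf {..<n}" "\<forall>x\<in>X. l x \<noteq> 0 \<longrightarrow> h x * f x = r x" using gh by (auto simp: J_def)
      then show ?thesis using gh
        by (auto simp: J_def polyf.mult mult.assoc intro!: bexI[of _ "\<lambda>v. g v * r v"])
    qed
  qed
  have "J \<inter> M \<noteq> {}"
  proof
    assume JM: "J \<inter> M = {}"
    obtain P where P: "poly_prime n P" "J \<subseteq> P" "P \<inter> M = {}"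
    proof (rule prime_ideal_exists[OF J _ _ _ JM])
      show "M \<subseteq> polyf {..<n}" using l by (auto simp: M_def intro: polyf_power)
      show "(\<lambda>v. 1) \<in> M" by (auto simp: M_def intro: image_eqI[of _ _ 0])
      show "(\<lambda>v. g v * h v) \<in> M" if gh: "g \<in> M" "h \<in> M" for g h
      proof -
        obtain i j where "g = (\<lambda>v. l v ^ i)" "h = (\<lambda>v. l v ^ j)" using gh by (auto simp: M_def)
        then show ?thesis unfolding M_def by (intro image_eqI[of _ _ "i + j"]) (auto simp: power_add)
      qed
    qed blast
    interpret poly_prime_ac n P using P by (simp add: poly_prime_ac_def)
    have "l \<in> M" unfolding M_def by (rule image_eqI[of _ _ 1]) auto
    then have "l \<notin> P" using P(3) by auto
    then obtain v where v: "v \<in> vanishing n P" "l v \<noteq> 0" using nullstellensatz l by blast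
    have "ideal_of n X \<subseteq> J"
      by (auto simp: J_def ideal_of_def polyf.const intro!: bexI[of _ "\<lambda>v. 0"])
    then have "v \<in> vanishing n (ideal_of n X)" using v P(2) by (auto simp: vanishing_def)
    then have vX: "v \<in> X" using X by (simp add: closedin_affine_iff)
    obtain p q where pq: "p \<in> polyf {..<n}" "q \<in> polyf {..<n}" "q v \<noteq> 0"
       "\<forall>y\<in>{x \<in> X. l x \<noteq> 0}. q y \<noteq> 0 \<longrightarrow> f y = p y / q y"
      using f vX v(2) by (auto simp: loc_frac_def)
    \<comment> \<open>The square is taken because the fraction says nothing where \<open>q\<close>
      vanishes; \<open>q * q * f = q * p\<close> holds there too.\<close>
    have "(\<lambda>v. q v * q v) \<in> J" unfolding J_def
    proof (intro CollectI conjI bexI ballI impI)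
      fix x assume "x \<in> X" "l x \<noteq> 0"
      then show "q x * q x * f x = q x * p x" using pq(4) by (cases "q x = 0") auto
    qed (use pq in \<open>auto intro: polyf.mult\<close>)
    then have qP: "(\<lambda>v. q v * q v) \<in> P" by (rule subsetD[OF P(2)])
    have "\<forall>f\<in>P. f v = 0" using v(1) by (simp add: vanishing_def)
    from bspec[OF this qP] have "q v * q v = 0" by simp
    then show False using pq by simp
  qed
  then obtain k where "(\<lambda>v. l v ^ k) \<in> J" by (auto simp: M_def)
  then show thesis using that[of _ k] by (auto simp: J_def)
qed

lemma loc_frac_global:
  fixes X :: "(nat \<Rightarrow> 'k::{alg_closed_field, field_char_0}) set"
  assumes "closedin (ztop (affine_space n)) X" "loc_frac n X f"
  obtains p where "p \<in> polyf {..<n}" "\<And>x. x \<in> X \<Longrightarrow> f x = p x"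
  by (rule loc_frac_principal_open[OF assms(1) polyf.const[of 1], of f]) (use assms(2) in auto)

lemma openin_principal: "f \<in> polyf {..<n} \<Longrightarrow> openin (ztop (affine_space n)) {v \<in> affine_points n. f v \<noteq> 0}"
  unfolding openin_affine by blast

lemma regs_affine_space:
  "f \<in> regs (affine_space n) U \<longleftrightarrow> (\<forall>x\<in>U. \<exists>V p q. openin (ztop (affine_space n)) V \<and> x \<in> V \<and> V \<subseteq> U \<and>
     (\<forall>v\<in>V. mp_eval q v \<noteq> 0 \<and> f v = mp_eval p v / mp_eval q v))"
  by (simp add: affine_space_def Let_def)

lemma regs_affine_iff:
  assumes V: "V \<subseteq> affine_points n"
  shows "f \<in> regs (affvar n X) V \<longleftrightarrow> loc_frac n V f"
proof
  assume f: "f \<in> regs (affvar n X) V"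
  show "loc_frac n V f" unfolding loc_frac_def
  proof
    fix x assume x: "x \<in> V"
    let ?T = "ztop (affine_space n)"
    obtain W g where W: "openin ?T W" "x \<in> W" "g \<in> regs (affine_space n) W" "\<forall>y\<in>W \<inter> V. f y = g y"
      using f x unfolding subvar_def by auto
    then obtain V' p q where V': "openin ?T V'" "x \<in> V'" "V' \<subseteq> W"
        "\<forall>v\<in>V'. mp_eval q v \<noteq> 0 \<and> g v = mp_eval p v / mp_eval q v"
      using W(3)[unfolded regs_affine_space, rule_format, OF W(2)] by (elim exE conjE) (rule that)
    obtain h where h: "h \<in> polyf {..<n}" "h x \<noteq> 0" "{v \<in> affine_points n. h v \<noteq> 0} \<subseteq> V'"
      using V'(1,2) unfolding openin_affine by blast
    \<comment> \<open>The factor \<open>h\<close> confines the nonvanishing of the denominator to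
      the neighbourhood on which the fraction is valid.\<close>
    let ?p = "\<lambda>v. mp_eval p (trunc n v) * h v" and ?q = "\<lambda>v. mp_eval q (trunc n v) * h v"
    have pq: "?p \<in> polyf {..<n}" "?q \<in> polyf {..<n}"
      using h polyf_trunc[OF mp_eval_polyf, of p n] polyf_trunc[OF mp_eval_polyf, of q n] by (auto intro: polyf.mult)
    have "?q x \<noteq> 0" using h V' x V by (auto simp: trunc_id subset_iff)
    moreover have "f y = ?p y / ?q y" if "y \<in> V" "?q y \<noteq> 0" for y
    proof -
      have y: "y \<in> affine_points n" using that V by auto
      then have "y \<in> V'" using that h by auto
      then show ?thesis using that V'(3,4) W(4) y by (auto simp: trunc_id)
    qed
    ultimately show "\<exists>p\<in>polyf {..<n}. \<exists>q\<in>polyf {..<n}. q x \<noteq> 0 \<and> (\<forall>y\<in>V. q y \<noteq> 0 \<longrightarrow> f y = p y / q y)"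
      by (intro bexI[OF _ pq(1)] bexI[OF _ pq(2)] conjI ballI impI)
  qed
next
  assume f: "loc_frac n V f"
  have "\<exists>W g. openin (ztop (affine_space n)) W \<and> x \<in> W \<and> g \<in> regs (affine_space n) W \<and> (\<forall>y\<in>W \<inter> V. f y = g y)"
    if x: "x \<in> V" for x
  proof -
    obtain p q where pq: "p \<in> polyf {..<n}" "q \<in> polyf {..<n}" "q x \<noteq> 0" "\<forall>y\<in>V. q y \<noteq> 0 \<longrightarrow> f y = p y / q y"
      using f x unfolding loc_frac_def by blast
    obtain p' q' where pq': "p = mp_eval p'" "q = mp_eval q'" using polyf_imp_mp_eval pq by blast
    let ?W = "{v \<in> affine_points n. q v \<noteq> 0}"
    have W: "openin (ztop (affine_space n)) ?W" using pq(2) by (rule openin_principal)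
    have "(\<lambda>v. p v / q v) \<in> regs (affine_space n) ?W"
      unfolding regs_affine_space using W pq' by (intro ballI exI[of _ ?W] exI[of _ p'] exI[of _ q']) auto
    then show ?thesis using W pq x V
      by (intro exI[of _ ?W] exI[of _ "\<lambda>v. p v / q v"]) auto
  qed
  then show "f \<in> regs (affvar n X) V" unfolding subvar_def by simp
qed

lemma loc_frac_polyf: "f \<in> polyf {..<n} \<Longrightarrow> loc_frac n V f"
  unfolding loc_frac_def by (intro ballI bexI[of _ f] bexI[of _ "\<lambda>v. 1"]) (auto intro: polyf.const)

lemma morphism_affineI:
  assumes X: "X \<subseteq> affine_points n" and Y: "Y \<subseteq> affine_points m"
    and \<phi>: "\<And>x. x \<in> X \<Longrightarrow> \<phi> x \<in> Y" "\<And>j. \<exists>f\<in>polyf {..<n}. \<forall>x\<in>X. \<phi> x j = f x"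
  shows "morphism (affvar n X) (affvar m Y) \<phi>"
proof -
  have topX: "points (affvar n X) = X" and topY: "points (affvar m Y) = Y" using X Y by auto
  obtain F where F: "\<And>j. F j \<in> polyf {..<n}" "\<And>j x. x \<in> X \<Longrightarrow> \<phi> x j = F j x" using \<phi>(2) by metis
  have sub: "(\<lambda>v. h (\<lambda>i. F i v)) \<in> polyf {..<n}" if "h \<in> polyf {..<m}" for h
    by (rule polyf_subst[OF that]) (rule F)
  have eq: "h (\<lambda>i. F i x) = h (\<phi> x)" if "x \<in> X" for h :: "(nat \<Rightarrow> 'a) \<Rightarrow> 'a" and x
  proof -
    have "(\<lambda>i. F i x) = \<phi> x" using F(2)[OF that] by auto
    then show ?thesis by simp
  qed
  have "openin (ztop (affvar n X)) {x \<in> X. \<phi> x \<in> V}" if V: "openin (ztop (affvar m Y)) V" for V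
  proof -
    obtain W where W: "openin (ztop (affine_space m)) W" "V = W \<inter> Y" using V by (auto simp: openin_subtopology)
    have "\<exists>U. openin (ztop (affine_space n)) U \<and> x \<in> U \<and> U \<inter> X \<subseteq> {x \<in> X. \<phi> x \<in> V}" if x: "x \<in> X" "\<phi> x \<in> V" for x
    proof -
      obtain h where h: "h \<in> polyf {..<m}" "h (\<phi> x) \<noteq> 0" "{v \<in> affine_points m. h v \<noteq> 0} \<subseteq> W"
        using W x unfolding openin_affine by blast
      let ?h = "\<lambda>v. h (\<lambda>i. F i v)"
      have "openin (ztop (affine_space n)) {v \<in> affine_points n. ?h v \<noteq> 0}" using sub[OF h(1)] by (rule openin_principal)
      moreover have "x \<in> {v \<in> affine_points n. ?h v \<noteq> 0}" using x X h by (auto simp: eq)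
      moreover have "{v \<in> affine_points n. ?h v \<noteq> 0} \<inter> X \<subseteq> {x \<in> X. \<phi> x \<in> V}"
      proof
        fix y assume y: "y \<in> {v \<in> affine_points n. ?h v \<noteq> 0} \<inter> X"
        then have "h (\<phi> y) \<noteq> 0" "\<phi> y \<in> Y" using eq[of y h] \<phi>(1) by auto
        then have "\<phi> y \<in> W" using h(3) Y by blast
        then show "y \<in> {x \<in> X. \<phi> x \<in> V}" using y \<open>\<phi> y \<in> Y\<close> W(2) by auto
      qed
      ultimately show ?thesis by blast
    qed
    note nbhd = this
    show ?thesis
    proof (subst openin_subopen, intro ballI)
      fix x assume "x \<in> {x \<in> X. \<phi> x \<in> V}"
      then obtain U where U: "openin (ztop (affine_space n)) U" "x \<in> U" "U \<inter> X \<subseteq> {x \<in> X. \<phi> x \<in> V}" "x \<in> X"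
        using nbhd by blast
      then have "openin (ztop (affvar n X)) (U \<inter> X)" unfolding ztop_subvar openin_subtopology by blast
      then show "\<exists>T. openin (ztop (affvar n X)) T \<and> x \<in> T \<and> T \<subseteq> {x \<in> X. \<phi> x \<in> V}"
        using U by (intro exI[of _ "U \<inter> X"]) auto
    qed
  qed
  then have cont: "continuous_map (ztop (affvar n X)) (ztop (affvar m Y)) \<phi>"
    using \<phi>(1) unfolding continuous_map_def topX topY by auto
  have "g \<circ> \<phi> \<in> regs (affvar n X) {x \<in> X. \<phi> x \<in> V}"
    if V: "openin (ztop (affvar m Y)) V" "g \<in> regs (affvar m Y) V" for V g
  proof -
    have VY: "V \<subseteq> Y" using openin_subset[OF V(1)] by simp
    then have g: "loc_frac m V g" using V(2) Y regs_affine_iff[of V m g Y] by blast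
    have "loc_frac n {x \<in> X. \<phi> x \<in> V} (g \<circ> \<phi>)" unfolding loc_frac_def
    proof
      fix x assume x: "x \<in> {x \<in> X. \<phi> x \<in> V}"
      then obtain p q where pq: "p \<in> polyf {..<m}" "q \<in> polyf {..<m}" "q (\<phi> x) \<noteq> 0" "\<forall>y\<in>V. q y \<noteq> 0 \<longrightarrow> g y = p y / q y"
        using g unfolding loc_frac_def by blast
      then show "\<exists>p\<in>polyf {..<n}. \<exists>q\<in>polyf {..<n}. q x \<noteq> 0 \<and> (\<forall>y\<in>{x \<in> X. \<phi> x \<in> V}. q y \<noteq> 0 \<longrightarrow> (g \<circ> \<phi>) y = p y / q y)"
        using x by (intro bexI[OF _ sub[OF pq(1)]] bexI[OF _ sub[OF pq(2)]]) (auto simp: eq)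
    qed
    then show ?thesis using X by (subst regs_affine_iff) auto
  qed
  then show ?thesis unfolding morphism_def topX using cont by blast
qed

lemma morphism_affineD:
  fixes X :: "(nat \<Rightarrow> 'k::{alg_closed_field, field_char_0}) set"
  assumes X: "closedin (ztop (affine_space n)) X" and Y: "Y \<subseteq> affine_points m"
    and \<phi>: "morphism (affvar n X) (affvar m Y) \<phi>"
  shows "\<And>x. x \<in> X \<Longrightarrow> \<phi> x \<in> Y" "\<exists>f\<in>polyf {..<n}. \<forall>x\<in>X. \<phi> x j = f x"
proof -
  have sub: "X \<subseteq> affine_points n" using closedin_subset[OF X] by simp
  have topX: "points (affvar n X) = X" and topY: "points (affvar m Y) = Y" using sub Y by auto
  have "continuous_map (ztop (affvar n X)) (ztop (affvar m Y)) \<phi>" using \<phi> by (simp add: morphism_def)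
  then show im: "\<phi> x \<in> Y" if "x \<in> X" for x using that unfolding continuous_map_def topX topY by auto
  show "\<exists>f\<in>polyf {..<n}. \<forall>x\<in>X. \<phi> x j = f x"
  proof (cases "j < m")
    case True
    then have "(\<lambda>v. v j) \<in> regs (affvar m Y) Y"
      using Y by (subst regs_affine_iff) (auto intro: loc_frac_polyf polyf.var)
    moreover have "openin (ztop (affvar m Y)) Y" using openin_topspace[of "ztop (affvar m Y)"] topY by simp
    ultimately have "(\<lambda>v. v j) \<circ> \<phi> \<in> regs (affvar n X) {x \<in> X. \<phi> x \<in> Y}"
      using \<phi> unfolding morphism_def topX by blast
    moreover have "{x \<in> X. \<phi> x \<in> Y} = X" using im by auto
    ultimately have "loc_frac n X (\<lambda>x. \<phi> x j)" using sub by (simp add: regs_affine_iff comp_def)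
    then obtain f where "f \<in> polyf {..<n}" "\<And>x. x \<in> X \<Longrightarrow> \<phi> x j = f x" by (rule loc_frac_global[OF X]) blast
    then show ?thesis by blast
  next
    case False
    then have "\<phi> x j = 0" if "x \<in> X" for x using im[OF that] Y by (auto simp: affine_points_def)
    then show ?thesis by (intro bexI[of _ "\<lambda>v. 0"]) (auto intro: polyf.const)
  qed
qed

section \<open>Actions of the additive group\<close>

lemma case_nat_shift [simp]: "(\<lambda>i. case_nat t x (Suc i)) = x"
  by simp

lemma line_times_sub: "X \<subseteq> affine_points n \<Longrightarrow> line_times X \<subseteq> affine_points (Suc n)"
  by (auto simp: line_times_def affine_points_def split: nat.split)

lemma line_times_closed:
  assumes X: "closedin (ztop (affine_space n)) X"
  shows "closedin (ztop (affine_space (Suc n))) (line_times X)"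
proof -
  let ?F = "(\<lambda>f w. f (\<lambda>i. w (Suc i))) ` ideal_of n X"
  have "?F \<subseteq> polyf {..<Suc n}"
  proof
    fix g assume "g \<in> ?F"
    then obtain f where f: "f \<in> polyf {..<n}" "g = (\<lambda>w. f (\<lambda>i. w (Suc i)))" by (auto simp: ideal_of_def)
    show "g \<in> polyf {..<Suc n}" unfolding f(2)
      by (rule polyf_subst[OF f(1), of "\<lambda>i w. w (Suc i)"]) (auto intro: polyf.var)
  qed
  moreover have "line_times X = vanishing (Suc n) ?F"
  proof -
    have "w \<in> line_times X \<longleftrightarrow> w \<in> affine_points (Suc n) \<and> (\<lambda>i. w (Suc i)) \<in> X" for w :: "nat \<Rightarrow> 'a"
    proof
      assume "w \<in> line_times X"
      then show "w \<in> affine_points (Suc n) \<and> (\<lambda>i. w (Suc i)) \<in> X"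
        using line_times_sub[of X n] closedin_subset[OF X] by (auto simp: line_times_def)
    next
      assume "w \<in> affine_points (Suc n) \<and> (\<lambda>i. w (Suc i)) \<in> X"
      then show "w \<in> line_times X" unfolding line_times_def
        by (intro CollectI exI[of _ "w 0"] exI[of _ "\<lambda>i. w (Suc i)"]) (auto split: nat.split)
    qed
    moreover have "x \<in> X \<longleftrightarrow> x \<in> vanishing n (ideal_of n X)" for x
      using X by (simp add: closedin_affine_iff)
    ultimately show ?thesis
      by (auto simp: vanishing_def affine_points_def)
  qed
  ultimately show ?thesis using closedin_vanishing by metis
qed

lemma polyf_case_nat:
  assumes "f \<in> polyf {..<Suc n}"
  obtains d c where "\<And>k. c k \<in> polyf {..<n}" "\<And>t x. f (case_nat t x) = (\<Sum>k<d. c k x * t ^ k)"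
proof -
  \<comment> \<open>Variable 0 is the time, in whose powers the polynomial is expanded; the other
    indices are shifted by one.\<close>
  have "{..<Suc n} = insert 0 {1..<Suc n}" by auto
  then obtain d where "f \<in> pdeg {1..<Suc n} 0 d" using polyf_pdeg[of f 0 "{1..<Suc n}"] assms by auto
  then obtain c where c: "\<And>k. c k \<in> polyf {1..<Suc n}" "f = (\<lambda>v. \<Sum>k<d. c k v * v 0 ^ k)"
    by (auto simp: pdeg_def)
  define c' where "c' = (\<lambda>k x. c k (\<lambda>i. x (i - 1)))"
  have "c' k \<in> polyf {..<n}" for k unfolding c'_def
    by (rule polyf_subst[OF c(1), of "\<lambda>i x. x (i - 1)"]) (auto intro: polyf.var)
  moreover have "c k (case_nat t x) = c' k x" for k t x unfolding c'_def
    by (rule polyf_cong[OF c(1)]) (auto split: nat.split)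
  ultimately show thesis using that[of c' d] by (simp add: c(2))
qed

lemma Ga_action_sub:
  assumes X: "X \<subseteq> affine_points n" and \<phi>: "Ga_action n X \<phi>" "x \<in> X"
  shows "\<phi> t x \<in> X"
proof -
  let ?f = "\<lambda>w. \<phi> (w 0) (\<lambda>i. w (Suc i))"
  have "continuous_map (ztop (affvar (Suc n) (line_times X))) (ztop (affvar n X)) ?f"
    using \<phi> by (simp add: Ga_action_def morphism_def)
  then have "?f \<in> points (affvar (Suc n) (line_times X)) \<rightarrow> points (affvar n X)" by (simp add: continuous_map_def)
  moreover have "points (affvar (Suc n) (line_times X)) = line_times X" "points (affvar n X) = X"
    using X line_times_sub[OF X] by auto
  ultimately have "?f \<in> line_times X \<rightarrow> X" by simp
  moreover have "case_nat t x \<in> line_times X" using \<phi> by (auto simp: line_times_def)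
  ultimately have "?f (case_nat t x) \<in> X" by (rule funcset_mem)
  then show ?thesis by simp
qed

lemma Ga_action_polynomial:
  fixes X :: "(nat \<Rightarrow> 'k::{alg_closed_field, field_char_0}) set"
  assumes X: "closedin (ztop (affine_space n)) X" and \<phi>: "Ga_action n X \<phi>"
  obtains f where "f \<in> polyf {..<Suc n}" "\<And>t x. x \<in> X \<Longrightarrow> \<phi> t x j = f (case_nat t x)"
proof -
  have "\<exists>f\<in>polyf {..<Suc n}. \<forall>w\<in>line_times X. (\<lambda>w. \<phi> (w 0) (\<lambda>i. w (Suc i))) w j = f w"
    by (rule morphism_affineD(2)[OF line_times_closed[OF X] _ ])
       (use \<phi> closedin_subset[OF X] in \<open>auto simp: Ga_action_def\<close>)
  then obtain f where f: "f \<in> polyf {..<Suc n}" "\<And>w. w \<in> line_times X \<Longrightarrow> \<phi> (w 0) (\<lambda>i. w (Suc i)) j = f w" by blast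
  have "\<phi> t x j = f (case_nat t x)" if "x \<in> X" for t x
    using f(2)[of "case_nat t x"] that by (auto simp: line_times_def)
  then show thesis using that f(1) by blast
qed

lemma Ga_actionI:
  assumes X: "X \<subseteq> affine_points n"
    and "\<And>t x. x \<in> X \<Longrightarrow> \<phi> t x \<in> X" "\<And>j. \<exists>f\<in>polyf {..<Suc n}. \<forall>t. \<forall>x\<in>X. \<phi> t x j = f (case_nat t x)"
    and "\<And>x. x \<in> X \<Longrightarrow> \<phi> 0 x = x" "\<And>s t x. x \<in> X \<Longrightarrow> \<phi> (s + t) x = \<phi> s (\<phi> t x)"
  shows "Ga_action n X \<phi>"
proof -
  have "morphism (affvar (Suc n) (line_times X)) (affvar n X) (\<lambda>w. \<phi> (w 0) (\<lambda>i. w (Suc i)))"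
  proof (rule morphism_affineI[OF line_times_sub[OF X] X])
    fix w assume "w \<in> line_times X"
    then show "\<phi> (w 0) (\<lambda>i. w (Suc i)) \<in> X" using assms(2) by (auto simp: line_times_def)
  next
    fix j
    show "\<exists>f\<in>polyf {..<Suc n}. \<forall>w\<in>line_times X. \<phi> (w 0) (\<lambda>i. w (Suc i)) j = f w"
      using assms(3)[of j] by (auto simp: line_times_def)
  qed
  then show ?thesis using assms(4,5) by (simp add: Ga_action_def)
qed

section \<open>Orbits of SAut as chains of steps\<close>

definition ga_step :: "nat \<Rightarrow> (nat \<Rightarrow> 'k::field) set \<Rightarrow> (nat \<Rightarrow> 'k) \<Rightarrow> (nat \<Rightarrow> 'k) \<Rightarrow> bool" where
  "ga_step n X x y \<longleftrightarrow> (\<exists>\<phi> t. Ga_action n X \<phi> \<and> y = \<phi> t x)"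

lemma ga_steps_action: "Ga_action n X \<phi> \<Longrightarrow> (ga_step n X)\<^sup>*\<^sup>* x (\<phi> t x)"
  by (rule r_into_rtranclp) (auto simp: ga_step_def)

lemma ga_step_sub: "X \<subseteq> affine_points n \<Longrightarrow> x \<in> X \<Longrightarrow> ga_step n X x y \<Longrightarrow> y \<in> X"
  by (auto simp: ga_step_def Ga_action_sub)

lemma ga_steps_sub: "(ga_step n X)\<^sup>*\<^sup>* x y \<Longrightarrow> X \<subseteq> affine_points n \<Longrightarrow> x \<in> X \<Longrightarrow> y \<in> X"
  by (induction rule: rtranclp_induct) (auto intro: ga_step_sub)

lemma Ga_action_inverse:
  assumes "Ga_action n X \<phi>" "x \<in> X" shows "\<phi> (- t) (\<phi> t x) = x"
proof -
  have "\<phi> (- t + t) x = \<phi> (- t) (\<phi> t x)" using assms unfolding Ga_action_def by blast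
  then show ?thesis using assms by (simp add: Ga_action_def)
qed

lemma ga_steps_sym:
  assumes X: "X \<subseteq> affine_points n"
  shows "(ga_step n X)\<^sup>*\<^sup>* x y \<Longrightarrow> x \<in> X \<Longrightarrow> (ga_step n X)\<^sup>*\<^sup>* y x"
proof (induction rule: rtranclp_induct)
  case (step y z)
  then have "y \<in> X" using ga_steps_sub X by blast
  with step.hyps(2) have "ga_step n X z y" using Ga_action_inverse unfolding ga_step_def by metis
  then show ?case using step by (meson converse_rtranclp_into_rtranclp)
qed simp

lemma Ga_action_Bij:
  assumes X: "X \<subseteq> affine_points n" and \<phi>: "Ga_action n X \<phi>"
  shows "restrict (\<phi> t) X \<in> Bij X"
proof -
  have "bij_betw (restrict (\<phi> t) X) X X"
  proof (rule bij_betwI[of _ _ _ "\<phi> (- t)"])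
    show "restrict (\<phi> t) X \<in> X \<rightarrow> X" "\<phi> (- t) \<in> X \<rightarrow> X" using Ga_action_sub[OF X \<phi>] by auto
    show "\<phi> (- t) (restrict (\<phi> t) X x) = x" if "x \<in> X" for x using Ga_action_inverse[OF \<phi> that] that by simp
    show "restrict (\<phi> t) X (\<phi> (- t) x) = x" if "x \<in> X" for x
      using Ga_action_inverse[OF \<phi> that, of "- t"] Ga_action_sub[OF X \<phi> that] by simp
  qed
  then show ?thesis by (simp add: Bij_def)
qed

text \<open>The inverse of the map at time \<open>t\<close> is the map at time \<open>-t\<close>,
  again a generator, so the words in the generated group amount to chains of single steps.\<close>

lemma SAut_orbit:
  assumes X: "X \<subseteq> affine_points n" and x: "x \<in> X"
  shows "(\<exists>g\<in>SAut n X. g x = y) \<longleftrightarrow> (ga_step n X)\<^sup>*\<^sup>* x y"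
proof
  let ?H = "{restrict (\<phi> t) X | \<phi> t. Ga_action n X \<phi>}"
  have "g \<in> Bij X \<and> (\<forall>x\<in>X. (ga_step n X)\<^sup>*\<^sup>* x (g x))" if "g \<in> generate (BijGroup X) ?H" for g
    using that
  proof (induction rule: generate.induct)
    case one
    have "\<one>\<^bsub>BijGroup X\<^esub> = (\<lambda>x\<in>X. x)" by (simp add: BijGroup_def)
    then show ?case using id_Bij[of X] by (simp only:) simp
  next
    case (incl h)
    then obtain \<phi> t where h: "h = restrict (\<phi> t) X" "Ga_action n X \<phi>" by blast
    have "h \<in> Bij X" unfolding h(1) by (rule Ga_action_Bij[OF X h(2)])
    moreover have "\<forall>x\<in>X. (ga_step n X)\<^sup>*\<^sup>* x (h x)" using h ga_steps_action by auto
    ultimately show ?case by blast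
  next
    case (inv h)
    then obtain \<phi> t where h: "h = restrict (\<phi> t) X" "Ga_action n X \<phi>" by blast
    have B: "h \<in> Bij X" unfolding h(1) by (rule Ga_action_Bij[OF X h(2)])
    have "inv_into X h x = \<phi> (- t) x" if "x \<in> X" for x
    proof (rule inv_into_f_eq)
      show "inj_on h X" using B by (simp add: Bij_def bij_betw_def)
      show "\<phi> (- t) x \<in> X" using Ga_action_sub[OF X h(2) that] .
      then show "h (\<phi> (- t) x) = x" using Ga_action_inverse[OF h(2) that, of "- t"] h by simp
    qed
    then have "\<forall>x\<in>X. (ga_step n X)\<^sup>*\<^sup>* x (inv_into X h x)"
      using ga_steps_action[OF h(2)] by simp
    then have "\<forall>x\<in>X. (ga_step n X)\<^sup>*\<^sup>* x ((inv\<^bsub>BijGroup X\<^esub> h) x)"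
      unfolding inv_BijGroup[OF B] by simp
    moreover have "inv\<^bsub>BijGroup X\<^esub> h \<in> Bij X"
      unfolding inv_BijGroup[OF B] by (rule restrict_inv_into_Bij[OF B])
    ultimately show ?case by blast
  next
    case (eng g h)
    have "(ga_step n X)\<^sup>*\<^sup>* x (g (h x))" if "x \<in> X" for x
    proof -
      have "h x \<in> X" using eng that Bij_imp_funcset by blast
      then show ?thesis using eng that by (meson rtranclp_trans)
    qed
    moreover have "g \<otimes>\<^bsub>BijGroup X\<^esub> h = compose X g h" using eng by (simp add: BijGroup_def)
    ultimately show ?case using eng compose_Bij[of g X h] by (simp add: compose_eq)
  qed
  moreover assume "\<exists>g\<in>SAut n X. g x = y"
  ultimately show "(ga_step n X)\<^sup>*\<^sup>* x y" using x by (auto simp: SAut_def)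
next
  let ?H = "{restrict (\<phi> t) X | \<phi> t. Ga_action n X \<phi>}"
  interpret group "BijGroup X" by (rule group_BijGroup)
  have Hc: "?H \<subseteq> carrier (BijGroup X)" using Ga_action_Bij[OF X] by (auto simp: BijGroup_def)
  assume "(ga_step n X)\<^sup>*\<^sup>* x y"
  then show "\<exists>g\<in>SAut n X. g x = y"
  proof (induction rule: rtranclp_induct)
    case base
    have "\<one>\<^bsub>BijGroup X\<^esub> \<in> SAut n X" unfolding SAut_def by (rule generate.one)
    moreover have "\<one>\<^bsub>BijGroup X\<^esub> x = x" using x by (simp add: BijGroup_def)
    ultimately show ?case by blast
  next
    case (step y z)
    then obtain g where g: "g \<in> SAut n X" "g x = y" by blast
    obtain \<phi> t where h: "Ga_action n X \<phi>" "z = \<phi> t y" using step by (auto simp: ga_step_def)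
    have m: "restrict (\<phi> t) X \<otimes>\<^bsub>BijGroup X\<^esub> g \<in> SAut n X"
      unfolding SAut_def
    proof (rule generate.eng)
      show "restrict (\<phi> t) X \<in> generate (BijGroup X) ?H" using h by (intro generate.incl) auto
      show "g \<in> generate (BijGroup X) ?H" using g by (simp add: SAut_def)
    qed
    have "g \<in> Bij X" using generate_in_carrier[OF Hc, of g] g by (simp add: SAut_def BijGroup_def)
    moreover have "y \<in> X" using funcset_mem[OF Bij_imp_funcset[OF \<open>g \<in> Bij X\<close>] x] g(2) by simp
    ultimately have "(restrict (\<phi> t) X \<otimes>\<^bsub>BijGroup X\<^esub> g) x = z"
      using Ga_action_Bij[OF X h(1), of t] x g h by (simp add: BijGroup_def compose_eq)
    with m show ?case by blast
  qed
qed

lemma flexible_iff: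
  assumes "affine_variety n X"
  shows "flexible n X \<longleftrightarrow> (\<forall>x\<in>regular_locus n X. \<forall>y\<in>regular_locus n X. (ga_step n X)\<^sup>*\<^sup>* x y)"
  using SAut_orbit[OF affine_variety_sub[OF assms]] assms
  by (auto simp: flexible_def regular_locus_def)

section \<open>A principal open subset of a cone as a product\<close>

interpretation fvp: vector_space_pair "\<lambda>(c::'k::field) (v::nat \<Rightarrow> 'k) i. c * v i" "\<lambda>(c::'k::field) (v::nat \<Rightarrow> 'k) i. c * v i"
  by unfold_locales

lemma affine_points_span:
  "(affine_points n :: (nat \<Rightarrow> 'k::field) set) \<subseteq> fvs.span ((\<lambda>i k. if k = i then 1 else 0) ` {..<n})"
proof
  fix w :: "nat \<Rightarrow> 'k" assume w: "w \<in> affine_points n"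
  have "w = (\<Sum>i<n. (\<lambda>k. w i * (if k = i then 1 else 0)))"
  proof
    fix k
    show "w k = (\<Sum>i<n. (\<lambda>k. w i * (if k = i then 1 else 0))) k"
      using w by (auto simp: sum_apply affine_points_def if_distrib[of "\<lambda>x. _ * x"] not_less[symmetric] cong: if_cong)
  qed
  moreover have "(\<Sum>i<n. (\<lambda>k. w i * (if k = i then 1 else 0))) \<in> fvs.span ((\<lambda>i k. if k = i then 1 else 0) ` {..<n})"
    by (intro fvs.span_sum fvs.span_scale fvs.span_base) auto
  ultimately show "w \<in> fvs.span ((\<lambda>i k. if k = i then 1 else 0) ` {..<n})" by simp
qed

lemma finite_independent_affine:
  assumes "fvs.independent B" "B \<subseteq> affine_points n" shows "finite B"
proof -
  have "finite ((\<lambda>i k. if k = i then 1 else 0 :: 'a) ` {..<n})" by simp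
  moreover have "B \<subseteq> fvs.span ((\<lambda>i k. if k = i then 1 else 0 :: 'a) ` {..<n})"
    using assms(2) affine_points_span by (rule subset_trans)
  ultimately show ?thesis using fvs.independent_span_bound[OF _ assms(1)] by blast
qed

definition lin :: "nat \<Rightarrow> (nat \<Rightarrow> 'k::field) \<Rightarrow> (nat \<Rightarrow> 'k) \<Rightarrow> 'k" where
  "lin n c v = (\<Sum>i<n. c i * v i)"

lemma lin_polyf: "lin n c \<in> polyf {..<n}"
proof -
  have "(\<lambda>v. lin n c v) \<in> polyf {..<n}" unfolding lin_def by (intro polyf_intros) auto
  then show ?thesis by simp
qed

lemma lin_scale: "lin n c (\<lambda>i. a * v i) = a * lin n c v"
  by (simp add: lin_def sum_distrib_left mult_ac)

lemma lin_add: "lin n c (\<lambda>i. v i + w i) = lin n c v + lin n c w"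
  by (simp add: lin_def sum.distrib algebra_simps)

lemma dd_lin:
  fixes c :: "nat \<Rightarrow> 'k::field_char_0"
  shows "dd (lin n c) x w = lin n c w"
proof (subst dd_eqI[of "[:lin n c x, lin n c w:]"])
  show "poly [:lin n c x, lin n c w:] t = lin n c (\<lambda>i. x i + t * w i)" for t
    using lin_add[of n c x "\<lambda>i. t * w i"] by (simp add: lin_scale)
qed simp

text \<open>The locus \<open>l \<noteq> 0\<close> of the cone as the product of \<open>Z\<close>
  with the punctured line: \<open>x\<close> corresponds to \<open>(\<alpha> x, l x)\<close> and
  \<open>(z, c)\<close> to \<open>c * \<beta> z\<close>, where \<open>\<beta>\<close> maps
  \<open>Z\<close> into the level \<open>l = 1\<close>. One denominator \<open>l ^ M\<close> serves
  all coordinates of \<open>\<alpha>\<close>. Constancy of \<open>\<alpha>\<close> on rays is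
  derived in \<open>\<alpha>_scale\<close>.\<close>

locale cone_chart =
  fixes n N :: nat and X Z :: "(nat \<Rightarrow> 'k::{alg_closed_field, field_char_0}) set"
    and lc :: "nat \<Rightarrow> 'k" and a b :: "nat \<Rightarrow> (nat \<Rightarrow> 'k) \<Rightarrow> 'k" and M :: nat
  assumes X: "affine_variety n X" and Z: "affine_variety N Z"
    and cone: "x \<in> X \<Longrightarrow> (\<lambda>i. c * x i) \<in> X"
    and a: "a k \<in> polyf {..<n}" and a0: "k \<ge> N \<Longrightarrow> a k = (\<lambda>v. 0)"
    and b: "b j \<in> polyf {..<N}" and b0: "j \<ge> n \<Longrightarrow> b j = (\<lambda>v. 0)"
    and alpha_mem: "x \<in> X \<Longrightarrow> lin n lc x \<noteq> 0 \<Longrightarrow> (\<lambda>k. a k x / lin n lc x ^ M) \<in> Z"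
    and beta_mem: "z \<in> Z \<Longrightarrow> (\<lambda>j. b j z) \<in> X"
    and lin_beta: "z \<in> Z \<Longrightarrow> lin n lc (\<lambda>j. b j z) = 1"
    and alpha_beta: "z \<in> Z \<Longrightarrow> a k (\<lambda>j. b j z) = z k"
    and beta_alpha: "x \<in> X \<Longrightarrow> lin n lc x \<noteq> 0 \<Longrightarrow> lin n lc x * b j (\<lambda>k. a k x / lin n lc x ^ M) = x j"
begin

abbreviation "l \<equiv> lin n lc"

definition "\<alpha> x = (\<lambda>k. a k x / l x ^ M)"
definition "\<beta> z = (\<lambda>j. b j z)"
text \<open>The derivative of \<open>a k / l ^ M\<close> along \<open>w\<close>, by the quotient
  rule; \<open>dd\<close> itself handles only polynomials.\<close>

definition "d\<alpha> x w = (\<lambda>k. (dd (a k) x w - of_nat M * (a k x / l x) * l w) / l x ^ M)"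

lemma Xsub: "X \<subseteq> affine_points n" using affine_variety_sub[OF X] .
lemma Zsub: "Z \<subseteq> affine_points N" using affine_variety_sub[OF Z] .

lemma \<alpha>_Z: "x \<in> X \<Longrightarrow> l x \<noteq> 0 \<Longrightarrow> \<alpha> x \<in> Z" unfolding \<alpha>_def by (rule alpha_mem)
lemma \<beta>_X: "z \<in> Z \<Longrightarrow> \<beta> z \<in> X" unfolding \<beta>_def by (rule beta_mem)
lemma l_\<beta>: "z \<in> Z \<Longrightarrow> l (\<beta> z) = 1" unfolding \<beta>_def by (rule lin_beta)
lemma a_\<beta>: "z \<in> Z \<Longrightarrow> a k (\<beta> z) = z k" unfolding \<beta>_def by (rule alpha_beta)
lemma \<alpha>_\<beta>: "z \<in> Z \<Longrightarrow> \<alpha> (\<beta> z) = z" by (simp add: \<alpha>_def l_\<beta> a_\<beta>)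
lemma b_\<alpha>: "x \<in> X \<Longrightarrow> l x \<noteq> 0 \<Longrightarrow> l x * b j (\<alpha> x) = x j" unfolding \<alpha>_def by (rule beta_alpha)
lemma \<beta>_\<alpha>: "x \<in> X \<Longrightarrow> l x \<noteq> 0 \<Longrightarrow> (\<lambda>j. l x * \<beta> (\<alpha> x) j) = x" unfolding \<beta>_def by (simp add: b_\<alpha>)
lemma l_poly: "l \<in> polyf {..<n}" by (rule lin_polyf)

text \<open>With \<open>x = c * \<beta> z\<close>, reconstructing \<open>x\<close> from its image
  gives \<open>c * \<beta> (\<alpha> x) = c * \<beta> z\<close>. After cancelling \<open>c\<close>,
  injectivity of \<open>\<beta>\<close> gives the claim.\<close>

lemma \<alpha>_scale:
  assumes "z \<in> Z" "c \<noteq> 0" shows "\<alpha> (\<lambda>i. c * \<beta> z i) = z" "l (\<lambda>i. c * \<beta> z i) = c"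
proof -
  let ?x = "\<lambda>i. c * \<beta> z i"
  have x: "?x \<in> X" using assms by (intro cone \<beta>_X)
  show l: "l ?x = c" using assms by (simp add: lin_scale l_\<beta>)
  have "c * \<beta> (\<alpha> ?x) j = c * \<beta> z j" for j using \<beta>_\<alpha>[OF x] assms l by (auto dest: fun_cong[of _ _ j])
  then have "\<beta> (\<alpha> ?x) = \<beta> z" using assms(2) by auto
  moreover have "\<alpha> ?x \<in> Z" using \<alpha>_Z[OF x] l assms by simp
  ultimately show "\<alpha> ?x = z" using \<alpha>_\<beta> assms(1) by metis
qed

text \<open>Clears the denominators of the composite of \<open>p\<close> with
  \<open>\<alpha>\<close>. The last clause is the product rule for \<open>l ^ m\<close> times this
  composite, multiplied by \<open>l\<close> to avoid the exponent \<open>m - 1\<close>; it allows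
  rational maps to be differentiated through polynomials.\<close>

lemma polyf_homogenise:
  assumes "p \<in> polyf V"
  obtains m P where "P \<in> polyf {..<n}" "\<And>x. l x \<noteq> 0 \<Longrightarrow> P x = l x ^ m * p (\<alpha> x)"
    "\<And>x w. l x \<noteq> 0 \<Longrightarrow> l x * dd P x w = l x ^ m * (l x * dd p (\<alpha> x) (d\<alpha> x w) + of_nat m * l w * p (\<alpha> x))"
proof -
  have lU: "(\<lambda>v. l v ^ k) \<in> polyf UNIV" for k by (rule polyf_power[OF polyf_UNIV[OF l_poly]])
  have dl: "l x * dd (\<lambda>v. l v ^ k) x w = of_nat k * l x ^ k * l w" for x w k
    unfolding dd_power[OF polyf_UNIV[OF l_poly]] dd_lin by (cases k) auto
  have "\<exists>m P. P \<in> polyf {..<n} \<and> (\<forall>x. l x \<noteq> 0 \<longrightarrow> P x = l x ^ m * p (\<alpha> x)) \<and>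
     (\<forall>x w. l x \<noteq> 0 \<longrightarrow> l x * dd P x w = l x ^ m * (l x * dd p (\<alpha> x) (d\<alpha> x w) + of_nat m * l w * p (\<alpha> x)))"
    using assms
  proof (induction rule: polyf.induct)
    case (const c)
    show ?case by (intro exI[of _ 0] exI[of _ "\<lambda>v. c"]) (auto intro: polyf.const)
  next
    case (var k)
    show ?case
    proof (intro exI[of _ M] exI[of _ "a k"] conjI allI impI)
      fix x w assume "l x \<noteq> 0"
      then show "l x * dd (a k) x w = l x ^ M * (l x * dd (\<lambda>v. v k) (\<alpha> x) (d\<alpha> x w) + of_nat M * l w * \<alpha> x k)"
        by (simp add: d\<alpha>_def \<alpha>_def field_simps)
    qed (simp_all add: a \<alpha>_def)
  next
    case (add f g)
    from add.IH(1) obtain m1 P1 where 1: "P1 \<in> polyf {..<n}" "\<And>x. l x \<noteq> 0 \<Longrightarrow> P1 x = l x ^ m1 * f (\<alpha> x)"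
       "\<And>x w. l x \<noteq> 0 \<Longrightarrow> l x * dd P1 x w = l x ^ m1 * (l x * dd f (\<alpha> x) (d\<alpha> x w) + of_nat m1 * l w * f (\<alpha> x))"
      by blast
    from add.IH(2) obtain m2 P2 where 2: "P2 \<in> polyf {..<n}" "\<And>x. l x \<noteq> 0 \<Longrightarrow> P2 x = l x ^ m2 * g (\<alpha> x)"
       "\<And>x w. l x \<noteq> 0 \<Longrightarrow> l x * dd P2 x w = l x ^ m2 * (l x * dd g (\<alpha> x) (d\<alpha> x w) + of_nat m2 * l w * g (\<alpha> x))"
      by blast
    note U = polyf_UNIV[OF 1(1)] polyf_UNIV[OF 2(1)] polyf_UNIV[OF add.hyps(1)] polyf_UNIV[OF add.hyps(2)]
    let ?P = "\<lambda>v. l v ^ m2 * P1 v + l v ^ m1 * P2 v"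
    show ?case
    proof (intro exI[of _ "m1 + m2"] exI[of _ ?P] conjI allI impI)
      show "?P \<in> polyf {..<n}" using 1 2 l_poly by (intro polyf_intros)
      fix x w assume x: "l x \<noteq> 0"
      show "?P x = l x ^ (m1 + m2) * (f (\<alpha> x) + g (\<alpha> x))" using x 1 2 by (simp add: power_add algebra_simps)
      have "dd ?P x w = dd (\<lambda>v. l v ^ m2 * P1 v) x w + dd (\<lambda>v. l v ^ m1 * P2 v) x w"
        by (rule dd_add) (rule polyf.mult[OF lU U(1)] polyf.mult[OF lU U(2)])+
      also have "dd (\<lambda>v. l v ^ m2 * P1 v) x w = l x ^ m2 * dd P1 x w + P1 x * dd (\<lambda>v. l v ^ m2) x w"
        by (rule dd_mult[OF lU U(1)])
      also have "dd (\<lambda>v. l v ^ m1 * P2 v) x w = l x ^ m1 * dd P2 x w + P2 x * dd (\<lambda>v. l v ^ m1) x w"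
        by (rule dd_mult[OF lU U(2)])
      finally have "l x * dd ?P x w = l x ^ m2 * (l x * dd P1 x w) + P1 x * (l x * dd (\<lambda>v. l v ^ m2) x w)
         + (l x ^ m1 * (l x * dd P2 x w) + P2 x * (l x * dd (\<lambda>v. l v ^ m1) x w))"
        by (simp add: algebra_simps)
      also have "\<dots> = l x ^ (m1 + m2) * (l x * (dd f (\<alpha> x) (d\<alpha> x w) + dd g (\<alpha> x) (d\<alpha> x w)) + of_nat (m1 + m2) * l w * (f (\<alpha> x) + g (\<alpha> x)))"
        unfolding dl 1(3)[OF x] 2(3)[OF x] 1(2)[OF x] 2(2)[OF x] by (simp add: power_add algebra_simps)
      also have "dd f (\<alpha> x) (d\<alpha> x w) + dd g (\<alpha> x) (d\<alpha> x w) = dd (\<lambda>v. f v + g v) (\<alpha> x) (d\<alpha> x w)"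
        by (rule dd_add[OF U(3,4), symmetric])
      finally show "l x * dd ?P x w = l x ^ (m1 + m2) * (l x * dd (\<lambda>v. f v + g v) (\<alpha> x) (d\<alpha> x w) + of_nat (m1 + m2) * l w * (f (\<alpha> x) + g (\<alpha> x)))" .
    qed
  next
    case (mult f g)
    from mult.IH(1) obtain m1 P1 where 1: "P1 \<in> polyf {..<n}" "\<And>x. l x \<noteq> 0 \<Longrightarrow> P1 x = l x ^ m1 * f (\<alpha> x)"
       "\<And>x w. l x \<noteq> 0 \<Longrightarrow> l x * dd P1 x w = l x ^ m1 * (l x * dd f (\<alpha> x) (d\<alpha> x w) + of_nat m1 * l w * f (\<alpha> x))"
      by blast
    from mult.IH(2) obtain m2 P2 where 2: "P2 \<in> polyf {..<n}" "\<And>x. l x \<noteq> 0 \<Longrightarrow> P2 x = l x ^ m2 * g (\<alpha> x)"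
       "\<And>x w. l x \<noteq> 0 \<Longrightarrow> l x * dd P2 x w = l x ^ m2 * (l x * dd g (\<alpha> x) (d\<alpha> x w) + of_nat m2 * l w * g (\<alpha> x))"
      by blast
    note U = polyf_UNIV[OF 1(1)] polyf_UNIV[OF 2(1)] polyf_UNIV[OF mult.hyps(1)] polyf_UNIV[OF mult.hyps(2)]
    let ?P = "\<lambda>v. P1 v * P2 v"
    show ?case
    proof (intro exI[of _ "m1 + m2"] exI[of _ ?P] conjI allI impI)
      show "?P \<in> polyf {..<n}" using 1 2 by (intro polyf_intros)
      fix x w assume x: "l x \<noteq> 0"
      show "?P x = l x ^ (m1 + m2) * (f (\<alpha> x) * g (\<alpha> x))" using x 1 2 by (simp add: power_add algebra_simps)
      have "l x * dd ?P x w = P1 x * (l x * dd P2 x w) + P2 x * (l x * dd P1 x w)"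
        by (simp add: dd_mult[OF U(1,2)] algebra_simps)
      also have "\<dots> = l x ^ (m1 + m2) * (l x * (f (\<alpha> x) * dd g (\<alpha> x) (d\<alpha> x w) + g (\<alpha> x) * dd f (\<alpha> x) (d\<alpha> x w)) + of_nat (m1 + m2) * l w * (f (\<alpha> x) * g (\<alpha> x)))"
        unfolding 1(3)[OF x] 2(3)[OF x] 1(2)[OF x] 2(2)[OF x] by (simp add: power_add algebra_simps)
      also have "f (\<alpha> x) * dd g (\<alpha> x) (d\<alpha> x w) + g (\<alpha> x) * dd f (\<alpha> x) (d\<alpha> x w) = dd (\<lambda>v. f v * g v) (\<alpha> x) (d\<alpha> x w)"
        by (rule dd_mult[OF U(3,4), symmetric])
      finally show "l x * dd ?P x w = l x ^ (m1 + m2) * (l x * dd (\<lambda>v. f v * g v) (\<alpha> x) (d\<alpha> x w) + of_nat (m1 + m2) * l w * (f (\<alpha> x) * g (\<alpha> x)))" .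
    qed
  qed
  then show thesis using that by blast
qed

section \<open>Tangent spaces and regular points of the cone and of a chart\<close>

abbreviation "TX \<equiv> tangent n (ideal_of n X)"
abbreviation "TZ \<equiv> tangent N (ideal_of N Z)"

lemma ideal_UNIV: "f \<in> ideal_of m Y \<Longrightarrow> f \<in> polyf UNIV"
  by (auto simp: ideal_of_def polyf_UNIV)

text \<open>If \<open>p\<close> vanishes on \<open>Z\<close>, its cleared pullback vanishes on the
  part of \<open>X\<close> with \<open>l \<noteq> 0\<close>. One more factor \<open>l\<close> makes
  it vanish on all of \<open>X\<close>, so tangent vectors of \<open>X\<close> annihilate
  it.\<close>

lemma d\<alpha>_tangent:
  assumes x: "x \<in> X" "l x \<noteq> 0" and w: "w \<in> TX x"
  shows "d\<alpha> x w \<in> TZ (\<alpha> x)"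
  unfolding tangent_def
proof (intro CollectI conjI ballI)
  show "d\<alpha> x w \<in> affine_points N" by (auto simp: affine_points_def d\<alpha>_def a0)
  fix p assume p: "p \<in> ideal_of N Z"
  then have "p \<in> polyf {..<N}" by (simp add: ideal_of_def)
  then obtain m P where P: "P \<in> polyf {..<n}" "\<And>x. l x \<noteq> 0 \<Longrightarrow> P x = l x ^ m * p (\<alpha> x)"
    "\<And>x w. l x \<noteq> 0 \<Longrightarrow> l x * dd P x w = l x ^ m * (l x * dd p (\<alpha> x) (d\<alpha> x w) + of_nat m * l w * p (\<alpha> x))"
    by (rule polyf_homogenise) blast
  have pz: "p (\<alpha> y) = 0" if "y \<in> X" "l y \<noteq> 0" for y using p \<alpha>_Z[OF that] by (simp add: ideal_of_def)
  have "l y * P y = 0" if "y \<in> X" for y using pz[OF that] P(2)[of y] by (cases "l y = 0") auto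
  then have "(\<lambda>v. l v * P v) \<in> ideal_of n X"
    using polyf.mult[OF l_poly P(1)] by (simp add: ideal_of_def)
  then have "dd (\<lambda>v. l v * P v) x w = 0" using w by (simp add: tangent_def)
  then have "l x * dd P x w + P x * l w = 0"
    by (simp add: dd_mult[OF polyf_UNIV[OF l_poly] polyf_UNIV[OF P(1)]] dd_lin)
  then have "l x * dd P x w = 0" using P(2) pz x by simp
  then show "dd p (\<alpha> x) (d\<alpha> x w) = 0" using P(3)[OF x(2), of w] pz[OF x] x(2) by simp
qed

text \<open>The derivative of the identity \<open>x_j = l x * b j (\<alpha> x)\<close>. The first
  summand runs along the chart, the second is radial.\<close>

lemma tangent_decompose:
  assumes x: "x \<in> X" "l x \<noteq> 0" and w: "w \<in> TX x"
  shows "w j = l x * dd (b j) (\<alpha> x) (d\<alpha> x w) + (l w / l x) * x j"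
proof (cases "j < n")
  case True
  obtain m P where P: "P \<in> polyf {..<n}" "\<And>x. l x \<noteq> 0 \<Longrightarrow> P x = l x ^ m * b j (\<alpha> x)"
    "\<And>x w. l x \<noteq> 0 \<Longrightarrow> l x * dd P x w = l x ^ m * (l x * dd (b j) (\<alpha> x) (d\<alpha> x w) + of_nat m * l w * b j (\<alpha> x))"
    by (rule polyf_homogenise[OF b[of j]]) blast
  \<comment> \<open>The identity with denominators cleared. It holds only where
    \<open>l \<noteq> 0\<close>, hence the additional factor \<open>l\<close> below.\<close>
  define Q where "Q = (\<lambda>v. l v * P v - l v ^ m * v j)"
  have jp: "(\<lambda>v. v j) \<in> polyf {..<n}" using True by (intro polyf.var) auto
  have lU: "l \<in> polyf UNIV" and lkU: "(\<lambda>v. l v ^ m) \<in> polyf UNIV" and PU: "P \<in> polyf UNIV" and jU: "(\<lambda>v. v j) \<in> polyf UNIV"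
    using polyf_UNIV[OF l_poly] polyf_UNIV[OF P(1)] by (auto intro: polyf_power polyf.var)
  have Q0: "Q y = 0" if "y \<in> X" "l y \<noteq> 0" for y
  proof -
    have "Q y = l y ^ m * (l y * b j (\<alpha> y)) - l y ^ m * y j" unfolding Q_def P(2)[OF that(2)] by (simp add: algebra_simps)
    then show ?thesis by (simp add: b_\<alpha>[OF that])
  qed
  have Qp: "Q \<in> polyf {..<n}" unfolding Q_def by (intro polyf_intros l_poly P jp) (use True in auto)
  have "l y * Q y = 0" if "y \<in> X" for y using Q0[OF that] by (cases "l y = 0") auto
  then have "(\<lambda>v. l v * Q v) \<in> ideal_of n X"
    using polyf.mult[OF l_poly Qp] by (simp add: ideal_of_def)
  then have "dd (\<lambda>v. l v * Q v) x w = 0" using w by (simp add: tangent_def)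
  then have "dd Q x w = 0" using Q0[OF x] x(2) by (simp add: dd_mult[OF lU polyf_UNIV[OF Qp]])
  moreover have "dd Q x w = l x * dd P x w + P x * l w - (l x ^ m * w j + x j * dd (\<lambda>v. l v ^ m) x w)"
    unfolding Q_def by (subst dd_diff[OF polyf.mult[OF lU PU] polyf.mult[OF lkU jU]])
      (simp add: dd_mult[OF lU PU] dd_mult[OF lkU jU] dd_lin)
  moreover have "l x * dd (\<lambda>v. l v ^ m) x w = of_nat m * l x ^ m * l w"
    unfolding dd_power[OF lU] dd_lin by (cases m) auto
  ultimately have eq: "l x * dd P x w + P x * l w = l x ^ m * w j + x j * dd (\<lambda>v. l v ^ m) x w"
    and dl: "l x * dd (\<lambda>v. l v ^ m) x w = of_nat m * l x ^ m * l w" by simp_all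
  have "l x * (l x * dd P x w) + l x * P x * l w = l x * (l x * dd P x w + P x * l w)"
    by (simp add: distrib_left mult.assoc)
  also have "\<dots> = l x ^ m * l x * w j + x j * (l x * dd (\<lambda>v. l v ^ m) x w)"
    unfolding eq by (simp add: distrib_left mult_ac)
  finally have "l x * (l x * dd P x w) + l x * P x * l w = l x ^ m * l x * w j + x j * (of_nat m * l x ^ m * l w)"
    unfolding dl .
  then have "l x * (l x ^ m * (l x * dd (b j) (\<alpha> x) (d\<alpha> x w) + of_nat m * l w * b j (\<alpha> x))) + l x * (l x ^ m * b j (\<alpha> x)) * l w
     = l x ^ m * l x * w j + x j * (of_nat m * l x ^ m * l w)"
    unfolding P(2)[OF x(2)] P(3)[OF x(2)] .
  then have "l x ^ m * (l x * (l x * dd (b j) (\<alpha> x) (d\<alpha> x w)) + of_nat m * l w * (l x * b j (\<alpha> x)) + (l x * b j (\<alpha> x)) * l w)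
     = l x ^ m * (l x * w j + x j * of_nat m * l w)" by (simp add: algebra_simps)
  then have "l x * (l x * dd (b j) (\<alpha> x) (d\<alpha> x w)) + of_nat m * l w * (l x * b j (\<alpha> x)) + (l x * b j (\<alpha> x)) * l w
     = l x * w j + x j * of_nat m * l w"
    using x(2) by (simp only: mult_cancel_left power_eq_0_iff simp_thms)
  then have "l x * (l x * dd (b j) (\<alpha> x) (d\<alpha> x w)) + x j * l w = l x * w j"
    unfolding b_\<alpha>[OF x] by (simp add: algebra_simps)
  then show ?thesis using x(2) by (simp add: field_simps)
next
  case False
  then have "x j = 0" "w j = 0" using x w Xsub by (auto simp: tangent_def affine_points_def)
  then show ?thesis using False b0[of j] by simp
qed

lemma d\<beta>_tangent:
  assumes z: "z \<in> Z" and u: "u \<in> TZ z"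
  shows "(\<lambda>i. c * dd (b i) z u) \<in> TX (\<lambda>i. c * \<beta> z i)"
  unfolding tangent_def
proof (intro CollectI conjI ballI)
  show "(\<lambda>i. c * dd (b i) z u) \<in> affine_points n" by (auto simp: affine_points_def b0)
  fix q assume q: "q \<in> ideal_of n X"
  then have qn: "q \<in> polyf {..<n}" by (simp add: ideal_of_def)
  have bc: "(\<lambda>v. c * b i v) \<in> polyf {..<N}" for i by (intro polyf_intros b)
  have bU: "b i \<in> polyf UNIV" for i by (rule polyf_UNIV[OF b])
  have "(\<lambda>v. q (\<lambda>i. c * b i v)) \<in> ideal_of N Z"
    using q polyf_subst[OF qn bc] cone[OF \<beta>_X] by (auto simp: ideal_of_def \<beta>_def)
  then have "dd (\<lambda>v. q (\<lambda>i. c * b i v)) z u = 0" using u by (simp add: tangent_def)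
  moreover have "dd (\<lambda>v. q (\<lambda>i. c * b i v)) z u = dd q (\<lambda>i. c * b i z) (\<lambda>i. dd (\<lambda>v. c * b i v) z u)"
    by (rule dd_chain[OF qn]) (rule polyf_UNIV[OF bc])
  moreover have "(\<lambda>i. dd (\<lambda>v. c * b i v) z u) = (\<lambda>i. c * dd (b i) z u)"
    by (simp add: dd_mult[OF polyf.const bU])
  ultimately show "dd q (\<lambda>i. c * \<beta> z i) (\<lambda>i. c * dd (b i) z u) = 0" by (simp add: \<beta>_def)
qed

text \<open>The line through the origin and \<open>x\<close> lies in \<open>X\<close>, and moving
  from \<open>x\<close> in direction \<open>x\<close> stays on it.\<close>

lemma radial_tangent:
  assumes x: "x \<in> X" shows "x \<in> TX x"
  unfolding tangent_def
proof (intro CollectI conjI ballI)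
  show "x \<in> affine_points n" using x Xsub by blast
  fix q assume q: "q \<in> ideal_of n X"
  have "q (\<lambda>i. x i + t * x i) = 0" for t
    using q cone[OF x, of "1 + t"] by (simp add: ideal_of_def algebra_simps)
  then show "dd q x x = 0" by (subst dd_eqI[of 0]) auto
qed

lemma l_d\<beta>:
  assumes z: "z \<in> Z" and u: "u \<in> TZ z" shows "l (\<lambda>i. dd (b i) z u) = 0"
proof -
  have bU: "b i \<in> polyf UNIV" for i by (rule polyf_UNIV[OF b])
  have lb: "(\<lambda>v. l (\<lambda>i. b i v)) \<in> polyf {..<N}" by (rule polyf_subst[OF l_poly b])
  have "(\<lambda>v. l (\<lambda>i. b i v) - 1) \<in> ideal_of N Z"
    using lb l_\<beta> by (auto simp: ideal_of_def \<beta>_def intro!: polyf_diff polyf.const)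
  then have "dd (\<lambda>v. l (\<lambda>i. b i v) - 1) z u = 0" using u by (simp add: tangent_def)
  then have "dd (\<lambda>v. l (\<lambda>i. b i v)) z u = 0" by (simp add: dd_diff[OF polyf_UNIV[OF lb] polyf.const])
  then show ?thesis by (simp add: dd_chain[OF l_poly bU] dd_lin)
qed

text \<open>Differentiating \<open>a k (\<beta> z) = z k\<close> recovers \<open>u\<close> from its
  image.\<close>

lemma d\<beta>_inj:
  assumes z: "z \<in> Z" and u: "u \<in> TZ z" and 0: "\<And>i. dd (b i) z u = 0" shows "u = 0"
proof
  fix k
  show "u k = 0 k"
  proof (cases "k < N")
    case True
    have bU: "b i \<in> polyf UNIV" for i by (rule polyf_UNIV[OF b])
    have ab: "(\<lambda>v. a k (\<lambda>i. b i v)) \<in> polyf {..<N}" by (rule polyf_subst[OF a b])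
    have kN: "(\<lambda>v. v k) \<in> polyf {..<N}" using True by (intro polyf.var) auto
    have "(\<lambda>v. a k (\<lambda>i. b i v) - v k) \<in> ideal_of N Z"
      using a_\<beta> polyf_diff[OF ab kN] by (auto simp: ideal_of_def \<beta>_def)
    then have "dd (\<lambda>v. a k (\<lambda>i. b i v) - v k) z u = 0" using u by (simp add: tangent_def)
    then have "dd (a k) (\<lambda>i. b i z) (\<lambda>i. dd (b i) z u) - u k = 0"
      by (simp add: dd_diff[OF polyf_UNIV[OF ab] polyf_UNIV[OF kN]] dd_chain[OF a bU])
    then show ?thesis using polyf_UNIV[OF a[of k]] by (simp add: 0)
  next
    case False
    then show ?thesis using u by (auto simp: tangent_def affine_points_def)
  qed
qed

text \<open>The tangent space at \<open>x\<close> is the direct sum of the image of the tangent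
  space at \<open>\<alpha> x\<close> under the injective map \<open>F\<close>, on which
  \<open>l\<close> vanishes, and of the radial line spanned by \<open>x\<close>, on which it does
  not.\<close>

lemma dim_tangent:
  assumes x: "x \<in> X" "l x \<noteq> 0"
  shows "fvs.dim (TX x) = Suc (fvs.dim (TZ (\<alpha> x)))"
proof -
  let ?z = "\<alpha> x"
  have z: "?z \<in> Z" using x by (rule \<alpha>_Z)
  have subspace: "fvs.subspace (TX x)" "fvs.subspace (TZ ?z)"
    using ideal_UNIV by (auto intro!: tangent_subspace)
  define F where "F = (\<lambda>u i. l x * dd (b i) ?z u)"
  have bU: "b i \<in> polyf UNIV" for i by (rule polyf_UNIV[OF b])
  have lin: "Vector_Spaces.linear (\<lambda>c v i. c * v i) (\<lambda>c v i. c * v i) F"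
  proof
    show "F (u + v) = F u + F v" for u v
      unfolding F_def plus_fun_def by (rule ext) (simp add: dd_add_dir[OF bU] distrib_left)
    show "F (\<lambda>i. c * v i) = (\<lambda>i. c * F v i)" for c v
      unfolding F_def by (rule ext) (simp add: dd_scale_dir[OF bU])
  qed
  have x_eq: "(\<lambda>i. l x * \<beta> ?z i) = x" using \<beta>_\<alpha>[OF x] .
  have F_T: "F u \<in> TX x" if "u \<in> TZ ?z" for u
    using d\<beta>_tangent[OF z that, of "l x"] unfolding x_eq F_def .
  have F_l: "l (F u) = 0" if "u \<in> TZ ?z" for u using l_d\<beta>[OF z that] by (simp add: F_def lin_scale)
  have F_0: "u = 0" if "u \<in> TZ ?z" "F u = 0" for u
    using d\<beta>_inj[OF z that(1)] fun_cong[OF that(2)] x(2) by (simp add: F_def)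
  obtain B where B: "B \<subseteq> TZ ?z" "fvs.independent B" "TZ ?z \<subseteq> fvs.span B" "card B = fvs.dim (TZ ?z)"
    using fvs.basis_exists by blast
  have finB: "finite B" using B(1) by (intro finite_independent_affine[OF B(2)]) (auto simp: tangent_def)
  have spanB: "fvs.span B \<subseteq> TZ ?z" using B(1) subspace(2) by (rule fvs.span_minimal)
  have inj: "inj_on F (TZ ?z)"
  proof
    fix u v assume uv: "u \<in> TZ ?z" "v \<in> TZ ?z" "F u = F v"
    have "F (u - v) = F u - F v" using lin by (rule fvp.linear_diff)
    then have "F (u - v) = 0" by (simp only: uv(3) diff_self)
    moreover have "u - v \<in> TZ ?z" by (rule fvs.subspace_diff[OF subspace(2) uv(1,2)])
    ultimately have "u - v = 0" by (rule F_0[rotated])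
    then show "u = v" by (simp only: right_minus_eq)
  qed
  have indep: "fvs.independent (F ` B)"
    by (rule fvp.linear_independent_injective_image[OF lin B(2) inj_on_subset[OF inj spanB]])
  have "fvs.span (F ` B) \<subseteq> {w. l w = 0}"
  proof (rule fvs.span_minimal)
    show "F ` B \<subseteq> {w. l w = 0}" using F_l B(1) by auto
    show "fvs.subspace {w. l w = 0}"
      unfolding fvs.subspace_def using lin_add[of n lc] lin_scale[of n lc] by (auto simp: plus_fun_def lin_def)
  qed
  then have x_notin: "x \<notin> fvs.span (F ` B)" using x(2) by auto
  have "TX x \<subseteq> fvs.span (insert x (F ` B))"
  proof
    fix w assume w: "w \<in> TX x"
    have u: "d\<alpha> x w \<in> TZ ?z" using d\<alpha>_tangent[OF x w] .
    have w_eq: "w = F (d\<alpha> x w) + (\<lambda>i. (l w / l x) * x i)"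
      using tangent_decompose[OF x w] by (auto simp: F_def plus_fun_def)
    have "F (d\<alpha> x w) \<in> fvs.span (insert x (F ` B))"
    proof -
      have "F (d\<alpha> x w) \<in> F ` fvs.span B" using u B(3) by blast
      also have "F ` fvs.span B = fvs.span (F ` B)" using fvp.linear_span_image[OF lin] by simp
      also have "\<dots> \<subseteq> fvs.span (insert x (F ` B))" by (intro fvs.span_mono) auto
      finally show ?thesis .
    qed
    moreover have "(\<lambda>i. (l w / l x) * x i) \<in> fvs.span (insert x (F ` B))"
      by (intro fvs.span_scale fvs.span_base) auto
    ultimately show "w \<in> fvs.span (insert x (F ` B))" by (subst w_eq) (rule fvs.span_add)
  qed
  moreover have "insert x (F ` B) \<subseteq> TX x" using F_T B(1) radial_tangent[OF x(1)] by auto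
  moreover have "fvs.independent (insert x (F ` B))" using indep x_notin by (rule fvs.independent_insertI[rotated])
  ultimately have "fvs.dim (TX x) = card (insert x (F ` B))" by (intro fvs.dim_unique[OF _ _ _ refl])
  also have "\<dots> = Suc (card (F ` B))" using x_notin fvs.span_superset[of "F ` B"] finB by (intro card_insert_disjoint) blast+
  also have "card (F ` B) = card B" using inj_on_subset[OF inj B(1)] by (rule card_image)
  finally show ?thesis using B(4) by simp
qed

lemma generic_point:
  assumes q: "q \<in> polyf {..<n}" "y \<in> X" "q y \<noteq> 0" and p: "p \<in> polyf {..<N}" "z \<in> Z" "p z \<noteq> 0"
  obtains x where "x \<in> X" "l x \<noteq> 0" "q x \<noteq> 0" "p (\<alpha> x) \<noteq> 0"
proof -
  obtain m P where P: "P \<in> polyf {..<n}" "\<And>x. l x \<noteq> 0 \<Longrightarrow> P x = l x ^ m * p (\<alpha> x)"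
    by (rule polyf_homogenise[OF p(1)]) blast
  have lP: "(\<lambda>v. l v * P v) \<in> polyf {..<n}" by (rule polyf.mult[OF l_poly P(1)])
  have "l (\<beta> z) * P (\<beta> z) \<noteq> 0" using p P(2)[of "\<beta> z"] by (simp add: l_\<beta> \<alpha>_\<beta>)
  then obtain x where x: "x \<in> X" "q x \<noteq> 0" "l x * P x \<noteq> 0"
    using affine_variety_common_nonzero[OF X q(1) lP q(2,3) \<beta>_X[OF p(2)]] by metis
  then show thesis using that[of x] P(2)[of x] by auto
qed

text \<open>Both Krull dimensions are read off as tangent dimensions at a single point
  \<open>x\<close> that is regular on \<open>X\<close> and whose image \<open>\<alpha> x\<close> is
  regular on \<open>Z\<close>; irreducibility provides it.\<close>

lemma krull_dim_cone: "krull_dim (ztop (affvar n X)) = krull_dim (ztop (affvar N Z)) + 1"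
proof -
  obtain q y where q: "q \<in> polyf {..<n}" "y \<in> X" "q y \<noteq> 0" "\<And>z. z \<in> X \<Longrightarrow> q z \<noteq> 0 \<Longrightarrow> z \<in> regular_locus n X"
    by (rule regular_locus_generic[OF X]) blast
  obtain p z where p: "p \<in> polyf {..<N}" "z \<in> Z" "p z \<noteq> 0" "\<And>y. y \<in> Z \<Longrightarrow> p y \<noteq> 0 \<Longrightarrow> y \<in> regular_locus N Z"
    by (rule regular_locus_generic[OF Z]) blast
  obtain x where x: "x \<in> X" "l x \<noteq> 0" "q x \<noteq> 0" "p (\<alpha> x) \<noteq> 0" by (rule generic_point[OF q(1-3) p(1-3)])
  have "x \<in> regular_locus n X" "\<alpha> x \<in> regular_locus N Z" using q(4) p(4) x \<alpha>_Z by auto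
  then show ?thesis unfolding regular_locus_iff[OF Xsub] regular_locus_iff[OF Zsub]
    using dim_tangent[OF x(1,2)] by (simp flip: eSuc_enat plus_1_eSuc(2))
qed

lemma regular_locus_cone:
  assumes x: "x \<in> X" "l x \<noteq> 0"
  shows "x \<in> regular_locus n X \<longleftrightarrow> \<alpha> x \<in> regular_locus N Z"
  unfolding regular_locus_iff[OF Xsub] regular_locus_iff[OF Zsub] krull_dim_cone dim_tangent[OF x]
  using x \<alpha>_Z[OF x] by (simp add: plus_1_eSuc(2) flip: eSuc_enat)

end

section \<open>Lifting actions to the cone\<close>

lemma Ga_orbit_curve:
  fixes X :: "(nat \<Rightarrow> 'k::{alg_closed_field, field_char_0}) set"
  assumes X: "closedin (ztop (affine_space n)) X" and \<phi>: "Ga_action n X \<phi>" and x: "x \<in> X"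
  obtains \<rho> where "\<And>t k. poly (\<rho> k) t = \<phi> t x k"
proof -
  have "\<exists>p. \<forall>t. poly p t = \<phi> t x k" for k
  proof -
    obtain f where f: "f \<in> polyf {..<Suc n}" "\<And>t x. x \<in> X \<Longrightarrow> \<phi> t x k = f (case_nat t x)"
      by (rule Ga_action_polynomial[OF X \<phi>]) blast
    obtain d c where c: "\<And>t x. f (case_nat t x) = (\<Sum>k<d. c k x * t ^ k)"
      by (rule polyf_case_nat[OF f(1)]) blast
    show ?thesis
      by (rule exI[of _ "\<Sum>k<d. monom (c k x) k"]) (simp add: f(2)[OF x] c poly_sum poly_monom)
  qed
  then show thesis using that by metis
qed

context cone_chart
begin

lemma Xclosed: "closedin (ztop (affine_space n)) X" using X by (simp add: affine_variety_def)
lemma Zclosed: "closedin (ztop (affine_space N)) Z" using Z by (simp add: affine_variety_def)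

text \<open>The time is rescaled by a high power of the linear form, which clears all denominators and
  makes the action trivial where the form vanishes.\<close>

lemma ga_lift:
  assumes \<phi>: "Ga_action N Z \<phi>" and z: "z \<in> Z" and c: "c \<noteq> 0"
  shows "ga_step n X (\<lambda>i. c * \<beta> z i) (\<lambda>i. c * \<beta> (\<phi> t z) i)"
proof -
  have \<phi>Z: "\<phi> t z \<in> Z" if "z \<in> Z" for t z using Ga_action_sub[OF Zsub \<phi> that] .
  have "\<exists>g. g \<in> polyf {..<Suc N} \<and> (\<forall>t. \<forall>z\<in>Z. \<phi> t z k = g (case_nat t z))" for k
    by (rule Ga_action_polynomial[OF Zclosed \<phi>, of k]) blast
  then obtain g where g: "\<And>k. g k \<in> polyf {..<Suc N}" "\<And>k t z. z \<in> Z \<Longrightarrow> \<phi> t z k = g k (case_nat t z)" by metis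
  have "\<exists>d e. (\<forall>k. e k \<in> polyf {..<N}) \<and> (\<forall>t. \<forall>z\<in>Z. b j (\<phi> t z) = (\<Sum>k<d. e k z * t ^ k))" for j
  proof -
    have "(\<lambda>w. b j (\<lambda>k. g k w)) \<in> polyf {..<Suc N}" by (rule polyf_subst[OF b]) (rule g)
    then obtain d e where de: "\<And>k. e k \<in> polyf {..<N}"
        "\<And>t x. b j (\<lambda>k. g k (case_nat t x)) = (\<Sum>k<d. e k x * t ^ k)"
      by (rule polyf_case_nat) blast
    have "b j (\<phi> t z) = (\<Sum>k<d. e k z * t ^ k)" if "z \<in> Z" for t z
    proof -
      have "\<phi> t z = (\<lambda>k. g k (case_nat t z))" using g(2)[OF that] by auto
      then show ?thesis using de(2) by simp
    qed
    then show ?thesis using de(1) by blast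
  qed
  then obtain d e where e: "\<And>j k. e j k \<in> polyf {..<N}" "\<And>j t z. z \<in> Z \<Longrightarrow> b j (\<phi> t z) = (\<Sum>k<d j. e j k z * t ^ k)"
    by metis
  have "\<exists>m P. P \<in> polyf {..<n} \<and> (\<forall>x. l x \<noteq> 0 \<longrightarrow> P x = l x ^ m * e j k (\<alpha> x))" for j k
    by (rule polyf_homogenise[OF e(1)[of j k]]) blast
  then obtain m P where P: "\<And>j k. P j k \<in> polyf {..<n}" "\<And>j k x. l x \<noteq> 0 \<Longrightarrow> P j k x = l x ^ m j k * e j k (\<alpha> x)"
    by metis
  \<comment> \<open>The sum is a crude bound for all exponents needed to clear denominators.\<close>
  define K where "K = (\<Sum>j<n. \<Sum>k<d j. m j k)"
  have mK: "m j k \<le> K" if "j < n" "k < d j" for j k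
  proof -
    have "m j k \<le> (\<Sum>k<d j. m j k)" using that by (intro member_le_sum) auto
    also have "\<dots> \<le> K" unfolding K_def using that member_le_sum[of j "{..<n}" "\<lambda>j. \<Sum>k<d j. m j k"] by auto
    finally show ?thesis .
  qed
  define \<Phi> where "\<Phi> = (\<lambda>t x. if l x = 0 then x else (\<lambda>j. l x * \<beta> (\<phi> (l x ^ K * t) (\<alpha> x)) j))"
  \<comment> \<open>The term of order \<open>k\<close> in the time carries
    \<open>l * (l ^ K) ^ k\<close> from the radius and the rescaled time, and
    \<open>l ^ m j k\<close> is spent on the denominator. For \<open>k \<ge> 1\<close> the remaining
    exponent is positive, so these terms vanish with \<open>l\<close>; the term of order 0 is just
    \<open>x_j\<close>.\<close>
  define G where "G = (\<lambda>j w. w (Suc j) + (\<Sum>k\<in>{1..<d j}. w 0 ^ k * (l (\<lambda>i. w (Suc i)) ^ (K * k + 1 - m j k) * P j k (\<lambda>i. w (Suc i)))))"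
  have \<phi>0: "\<phi> 0 z = z" and \<phi>_add: "\<phi> (s + t) z = \<phi> s (\<phi> t z)" if "z \<in> Z" for z s t
    using \<phi> that by (auto simp: Ga_action_def)
  have \<Phi>X: "\<Phi> t x \<in> X" "l (\<Phi> t x) = l x" if x: "x \<in> X" for t x
    using x \<beta>_X[OF \<phi>Z[OF \<alpha>_Z]] l_\<beta>[OF \<phi>Z[OF \<alpha>_Z]] by (auto simp: \<Phi>_def lin_scale intro: cone)
  have \<alpha>\<Phi>: "\<alpha> (\<Phi> t x) = \<phi> (l x ^ K * t) (\<alpha> x)" if x: "x \<in> X" "l x \<noteq> 0" for t x
    using \<alpha>_scale(1)[OF \<phi>Z[OF \<alpha>_Z[OF x]] x(2)] x(2) by (simp add: \<Phi>_def)
  have G_\<Phi>: "\<Phi> t x j = G j (case_nat t x)" if x: "x \<in> X" and j: "j < n" for t x j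
  proof (cases "l x = 0")
    case True
    have zero: "l x ^ (K * k + 1 - m j k) = 0" if "k \<in> {1..<d j}" for k
    proof -
      have "m j k \<le> K" using mK[OF j] that by auto
      also have "K \<le> K * k" using that by auto
      finally show ?thesis by (simp add: Suc_diff_le True)
    qed
    have "(\<Sum>k\<in>{1..<d j}. t ^ k * (l x ^ (K * k + 1 - m j k) * P j k x)) = 0"
      by (intro sum.neutral ballI) (simp only: zero mult_zero_left mult_zero_right)
    then have "G j (case_nat t x) = x j" unfolding G_def by simp
    then show ?thesis using True by (simp add: \<Phi>_def)
  next
    case False
    have trm: "l x * (e j k (\<alpha> x) * (l x ^ K * t) ^ k) = t ^ k * (l x ^ (K * k + 1 - m j k) * P j k x)" if k: "k \<in> {1..<d j}" for k
    proof -
      have "m j k \<le> K" using mK[OF j] k by auto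
      also have "K \<le> K * k" using k by auto
      finally have "m j k \<le> K * k" .
      then have "l x ^ (K * k + 1 - m j k) * l x ^ m j k = l x * l x ^ (K * k)"
        by (simp flip: power_add)
      then show ?thesis unfolding P(2)[OF False] power_mult_distrib power_mult[symmetric]
        by (simp add: mult_ac)
    qed
    have z: "\<alpha> x \<in> Z" using \<alpha>_Z[OF x False] .
    \<comment> \<open>The coefficient of order 0 is the value at time 0. If \<open>d j = 0\<close>
      there is no such coefficient, but then \<open>b j\<close> vanishes at
      \<open>\<alpha> x\<close>.\<close>
    have split: "(\<Sum>k<d j. e j k (\<alpha> x) * \<tau> ^ k) = b j (\<alpha> x) + (\<Sum>k\<in>{1..<d j}. e j k (\<alpha> x) * \<tau> ^ k)" for \<tau>
    proof (cases "d j")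
      case 0
      then show ?thesis using e(2)[OF z, of j 0] \<phi>0[OF z] by simp
    next
      case (Suc d')
      have s0: "(\<Sum>k<d j. f k) = f 0 + (\<Sum>k\<in>{1..<d j}. f k)" for f :: "nat \<Rightarrow> 'k"
      proof -
        have "{..<d j} = insert 0 {1..<d j}" unfolding Suc by auto
        then show ?thesis by simp
      qed
      have "b j (\<alpha> x) = e j 0 (\<alpha> x)" using e(2)[OF z, of j 0] \<phi>0[OF z] unfolding s0 by simp
      then show ?thesis unfolding s0 by simp
    qed
    have "\<Phi> t x j = l x * (\<Sum>k<d j. e j k (\<alpha> x) * (l x ^ K * t) ^ k)"
      using False e(2)[OF z] by (simp add: \<Phi>_def \<beta>_def)
    also have "\<dots> = x j + (\<Sum>k\<in>{1..<d j}. l x * (e j k (\<alpha> x) * (l x ^ K * t) ^ k))"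
      unfolding split by (simp add: distrib_left b_\<alpha>[OF x False] sum_distrib_left)
    also have "\<dots> = G j (case_nat t x)" unfolding G_def by (simp add: trm)
    finally show ?thesis .
  qed
  have shift: "(\<lambda>w. f (\<lambda>i. w (Suc i))) \<in> polyf {..<Suc n}" if "f \<in> polyf {..<n}" for f :: "(nat \<Rightarrow> 'k) \<Rightarrow> 'k"
    by (rule polyf_subst[OF that, of "\<lambda>i w. w (Suc i)"]) (auto intro: polyf.var)
  have "Ga_action n X \<Phi>"
  proof (rule Ga_actionI[OF Xsub])
    show "\<Phi> t x \<in> X" if "x \<in> X" for t x using \<Phi>X that by blast
    show "\<exists>f\<in>polyf {..<Suc n}. \<forall>t. \<forall>x\<in>X. \<Phi> t x j = f (case_nat t x)" for j
    proof (cases "j < n")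
      case True
      have "G j \<in> polyf {..<Suc n}" unfolding G_def
        using True shift[OF l_poly] shift[OF P(1)] by (intro polyf_intros) auto
      then show ?thesis using G_\<Phi> True by blast
    next
      case False
      have "\<Phi> t x j = 0" if "x \<in> X" for t x
        using subsetD[OF Xsub \<Phi>X(1)[OF that, of t]] False by (simp add: affine_points_def)
      then show ?thesis by (intro bexI[of _ "\<lambda>v. 0"]) (auto intro: polyf.const)
    qed
    show "\<Phi> 0 x = x" if "x \<in> X" for x
      using \<phi>0[OF \<alpha>_Z[OF that]] \<beta>_\<alpha>[OF that] by (simp add: \<Phi>_def)
    show "\<Phi> (s + t) x = \<Phi> s (\<Phi> t x)" if x: "x \<in> X" for s t x
    proof (cases "l x = 0")
      case False
      have "\<Phi> s (\<Phi> t x) = (\<lambda>j. l x * \<beta> (\<phi> (l x ^ K * s) (\<phi> (l x ^ K * t) (\<alpha> x))) j)"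
        using \<Phi>X(2)[OF x] \<alpha>\<Phi>[OF x False] False by (simp add: \<Phi>_def[of] del: fun_upd_apply)
      also have "\<dots> = \<Phi> (s + t) x" using False by (simp add: \<Phi>_def distrib_left \<phi>_add[OF \<alpha>_Z[OF x False]])
      finally show ?thesis by simp
    qed (simp add: \<Phi>_def)
  qed
  \<comment> \<open>On the level \<open>l = c\<close> the rescaling multiplies the time by
    \<open>c ^ K\<close>, which is divided out.\<close>
  moreover have "\<Phi> (t / c ^ K) (\<lambda>i. c * \<beta> z i) = (\<lambda>i. c * \<beta> (\<phi> t z) i)"
    using \<alpha>_scale[OF z c] c by (simp add: \<Phi>_def)
  ultimately show ?thesis unfolding ga_step_def by metis
qed

lemma ga_steps_lift:
  assumes "(ga_step N Z)\<^sup>*\<^sup>* z z'" "z \<in> Z" "c \<noteq> 0"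
  shows "(ga_step n X)\<^sup>*\<^sup>* (\<lambda>i. c * \<beta> z i) (\<lambda>i. c * \<beta> z' i)"
  using assms(1)
proof (induction rule: rtranclp_induct)
  case (step y y')
  obtain \<phi> t where \<phi>: "Ga_action N Z \<phi>" "y' = \<phi> t y" using step.hyps(2) by (auto simp: ga_step_def)
  have "y \<in> Z" using ga_steps_sub[OF step.hyps(1) Zsub assms(2)] .
  then have "ga_step n X (\<lambda>i. c * \<beta> y i) (\<lambda>i. c * \<beta> y' i)" unfolding \<phi>(2) by (rule ga_lift[OF \<phi>(1) _ assms(3)])
  then show ?case using step.IH by (rule rtranclp.rtrancl_into_rtrancl[rotated])
qed simp

lemma level_connected:
  assumes "flexible N Z" and x: "x \<in> regular_locus n X" "l x \<noteq> 0" and y: "y \<in> regular_locus n X" "l y = l x"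
  shows "(ga_step n X)\<^sup>*\<^sup>* x y"
proof -
  have xX: "x \<in> X" "y \<in> X" and ly: "l y \<noteq> 0" using x y by (auto simp: regular_locus_def)
  have "\<alpha> x \<in> regular_locus N Z" "\<alpha> y \<in> regular_locus N Z"
    using regular_locus_cone xX x y ly by auto
  then have "(ga_step N Z)\<^sup>*\<^sup>* (\<alpha> x) (\<alpha> y)" using assms(1) flexible_iff[OF Z] by blast
  then have "(ga_step n X)\<^sup>*\<^sup>* (\<lambda>i. l x * \<beta> (\<alpha> x) i) (\<lambda>i. l x * \<beta> (\<alpha> y) i)"
    using \<alpha>_Z[OF xX(1) x(2)] x(2) by (rule ga_steps_lift)
  moreover have "(\<lambda>i. l x * \<beta> (\<alpha> x) i) = x" using \<beta>_\<alpha>[OF xX(1) x(2)] .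
  moreover have "(\<lambda>i. l x * \<beta> (\<alpha> y) i) = y" using \<beta>_\<alpha>[OF xX(2) ly] y(2) by simp
  ultimately show ?thesis by simp
qed

text \<open>A nonconstant polynomial curve in the affine chart has a limit point at infinity: the vector
  of its top coefficients.\<close>

lemma curve_limit:
  assumes \<gamma>: "\<And>t. (\<lambda>j. poly (\<gamma> j) t) \<in> X" "\<And>t. l (\<lambda>j. poly (\<gamma> j) t) = 1"
    and nonconst: "poly (\<gamma> j0) t0 \<noteq> poly (\<gamma> j0) 0"
  obtains e where "0 < e" "(\<lambda>j. coeff (\<gamma> j) e) \<in> X" "(\<lambda>j. coeff (\<gamma> j) e) \<noteq> (\<lambda>j. 0)" "l (\<lambda>j. coeff (\<gamma> j) e) = 0"
proof -
  have \<gamma>0: "\<gamma> j = 0" if "j \<ge> n" for j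
    by (rule poly_ext_UNIV) (use \<gamma>(1) Xsub that in \<open>auto simp: affine_points_def subset_iff\<close>)
  define e where "e = Max (insert 0 (degree ` \<gamma> ` {..<n}))"
  have deg: "degree (\<gamma> j) \<le> e" for j
    by (cases "j < n") (auto simp: e_def \<gamma>0 intro!: Max_ge)
  have j0: "degree (\<gamma> j0) > 0"
  proof (rule ccontr)
    assume "\<not> ?thesis"
    then obtain a where "\<gamma> j0 = [:a:]" using degree_eq_zeroE by blast
    then show False using nonconst by simp
  qed
  then have e: "0 < e" using deg[of j0] by simp
  have "e \<in> insert 0 (degree ` \<gamma> ` {..<n})" unfolding e_def by (rule Max_in) auto
  then obtain j1 where j1: "degree (\<gamma> j1) = e" using e by auto
  let ?w = "\<lambda>j. coeff (\<gamma> j) e"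
  have "?w j1 \<noteq> 0" using j1 e by (metis degree_0 leading_coeff_0_iff less_numeral_extra(3))
  then have w0: "?w \<noteq> (\<lambda>j. 0)" by metis
  \<comment> \<open>The reversed curve \<open>u ^ e * \<gamma> (1 / u)\<close>; it is polynomial in
    \<open>u\<close> and reaches the point at infinity at \<open>u = 0\<close>.\<close>
  define \<delta> where "\<delta> = (\<lambda>j. \<Sum>k\<le>e. monom (coeff (\<gamma> j) k) (e - k))"
  have \<delta>: "poly (\<delta> j) u = u ^ e * poly (\<gamma> j) (1 / u)" if "u \<noteq> 0" for j u
  proof -
    have "poly (\<delta> j) u = (\<Sum>k\<le>e. coeff (\<gamma> j) k * u ^ (e - k))" by (simp add: \<delta>_def poly_sum poly_monom)
    also have "\<dots> = (\<Sum>k\<le>e. u ^ e * (coeff (\<gamma> j) k * (1 / u) ^ k))"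
      by (intro sum.cong) (use that in \<open>auto simp: power_diff power_one_over field_simps\<close>)
    also have "\<dots> = u ^ e * (\<Sum>k\<le>e. coeff (\<gamma> j) k * (1 / u) ^ k)" by (simp add: sum_distrib_left)
    also have "(\<Sum>k\<le>e. coeff (\<gamma> j) k * (1 / u) ^ k) = poly (\<gamma> j) (1 / u)"
      unfolding poly_altdef using deg[of j]
      by (intro sum.mono_neutral_right) (auto simp: coeff_eq_0)
    finally show ?thesis .
  qed
  have \<delta>0: "poly (\<delta> j) 0 = ?w j" for j
  proof -
    have "poly (\<delta> j) 0 = (\<Sum>k\<le>e. coeff (\<gamma> j) k * 0 ^ (e - k))" by (simp add: \<delta>_def poly_sum poly_monom)
    also have "\<dots> = (\<Sum>k\<in>{e}. coeff (\<gamma> j) k * 0 ^ (e - k))" by (intro sum.mono_neutral_right) auto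
    finally show ?thesis by simp
  qed
  have inf: "infinite (- {0::'k})" using infinite_UNIV_field_char_0 by (simp add: Compl_eq_Diff_UNIV)
  have \<delta>X: "(\<lambda>j. poly (\<delta> j) u) = (\<lambda>j. u ^ e * poly (\<gamma> j) (1 / u))" if "u \<noteq> 0" for u
    using \<delta>[OF that] by auto
  \<comment> \<open>For \<open>u \<noteq> 0\<close> the reversed curve is a multiple of a point of
    the cone. An equation of \<open>X\<close> along it is a polynomial in \<open>u\<close> with
    infinitely many zeros, so it also holds at \<open>u = 0\<close>.\<close>
  have "?w \<in> vanishing n (ideal_of n X)" unfolding vanishing_def
  proof (intro CollectI conjI ballI)
    show "?w \<in> affine_points n" by (auto simp: affine_points_def \<gamma>0)
    fix q assume q: "q \<in> ideal_of n X"
    then obtain Q where Q: "\<forall>u. poly Q u = q (\<lambda>i. poly (\<delta> i) u)" using poly_curve[of q "{..<n}" \<delta>] by (auto simp: ideal_of_def)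
    have "poly Q u = poly 0 u" if "u \<in> - {0}" for u
    proof -
      have "(\<lambda>j. u ^ e * poly (\<gamma> j) (1 / u)) \<in> X" by (rule cone[OF \<gamma>(1)])
      then show ?thesis using Q \<delta>X[of u] that q by (simp add: ideal_of_def)
    qed
    then have "Q = 0" by (rule poly_ext_infinite[OF inf])
    then show "q ?w = 0" using Q \<delta>0 by (metis (no_types, lifting) ext poly_0)
  qed
  then have wX: "?w \<in> X" using Xclosed by (simp add: closedin_affine_iff)
  \<comment> \<open>Along the reversed curve \<open>l\<close> equals \<open>u ^ e\<close>, which
    vanishes at 0 because \<open>e > 0\<close>.\<close>
  obtain Q where Q: "\<forall>u. poly Q u = l (\<lambda>i. poly (\<delta> i) u)" using poly_curve[OF l_poly, of \<delta>] by auto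
  have "poly Q u = poly (monom 1 e) u" if "u \<in> - {0}" for u
    using Q \<delta>X[of u] that \<gamma>(2) by (simp add: lin_scale poly_monom)
  then have "Q = monom 1 e" by (rule poly_ext_infinite[OF inf])
  then have "l (\<lambda>i. poly (\<delta> i) 0) = 0" using Q e by (metis poly_monom mult_1 zero_power)
  then have "l ?w = 0" by (simp add: \<delta>0)
  then show thesis using that e wX w0 by blast
qed

end

section \<open>Cones covered by flexible charts\<close>

lemma dd_gradient:
  fixes x :: "nat \<Rightarrow> 'k::field_char_0"
  shows "f \<in> polyf {..<n} \<Longrightarrow> \<exists>c. \<forall>w. dd f x w = lin n c w"
proof (induction rule: polyf.induct)
  case (const c)
  show ?case by (intro exI[of _ "\<lambda>i. 0"]) (simp add: lin_def)
next
  case (var i)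
  then show ?case by (intro exI[of _ "\<lambda>k. if k = i then 1 else 0"]) (simp add: lin_def if_distrib[of "\<lambda>x. x * _"] cong: if_cong)
next
  case (add f g)
  then obtain c c' where "\<forall>w. dd f x w = lin n c w" "\<forall>w. dd g x w = lin n c' w" by blast
  then show ?case using add.hyps
    by (intro exI[of _ "\<lambda>i. c i + c' i"]) (simp add: dd_add polyf_UNIV[of _ "{..<n}"], simp add: lin_def sum.distrib algebra_simps)
next
  case (mult f g)
  then obtain c c' where "\<forall>w. dd f x w = lin n c w" "\<forall>w. dd g x w = lin n c' w" by blast
  then show ?case using mult.hyps
    by (intro exI[of _ "\<lambda>i. f x * c' i + g x * c i"])
       (simp add: dd_mult polyf_UNIV[of _ "{..<n}"], simp add: lin_def sum.distrib sum_distrib_left algebra_simps)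
qed

text \<open>An equation \<open>q\<close> of \<open>X\<close> vanishes on every line through the
  vertex and a point of \<open>X\<close>, so its linear part vanishes on \<open>X\<close>; as
  \<open>X\<close> lies in no hyperplane, that linear part is zero. The tangent space at the vertex
  is therefore everything, and regularity forces a basis of all \<open>n\<close> coordinates, that
  is, a zero ideal.\<close>

lemma vertex_regular:
  fixes X :: "(nat \<Rightarrow> 'k::{alg_closed_field, field_char_0}) set"
  assumes X: "affine_variety n X" and cone: "\<And>x c. x \<in> X \<Longrightarrow> (\<lambda>i. c * x i) \<in> X"
    and span: "\<And>c. (\<And>x. x \<in> X \<Longrightarrow> lin n c x = 0) \<Longrightarrow> (\<forall>j<n. c j = 0)"
    and reg: "(\<lambda>i. 0) \<in> regular_locus n X"
  shows "X = affine_points n"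
proof -
  note Xsub = affine_variety_sub[OF X]
  obtain S where S: "vbasis n X S" using vbasis_exists[OF X] .
  interpret A: poly_prime_ac n "ideal_of n X" using X by (rule variety_prime_ac)
  have "tangent n (ideal_of n X) (\<lambda>i. 0) = affine_points n"
  proof -
    have "dd q (\<lambda>i. 0) w = 0" if q: "q \<in> ideal_of n X" for q w
    proof -
      obtain c where c: "\<forall>w. dd q (\<lambda>i. 0) w = lin n c w"
        using dd_gradient[of q n "\<lambda>i. 0"] q by (auto simp: ideal_of_def)
      have "lin n c x = 0" if "x \<in> X" for x
      proof -
        have "dd q (\<lambda>i. 0) x = coeff 0 1"
          by (rule dd_eqI) (use q cone[OF that] in \<open>auto simp: ideal_of_def\<close>)
        then show ?thesis using c by simp
      qed
      then have "\<forall>j<n. c j = 0" by (rule span)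
      then show ?thesis using c by (simp add: lin_def)
    qed
    then show ?thesis by (auto simp: tangent_def)
  qed
  moreover have "fvs.dim (affine_points n :: (nat \<Rightarrow> 'k) set) = card {..<n}"
  proof (rule dim_by_coordinates)
    show "fvs.subspace (affine_points n :: (nat \<Rightarrow> 'k) set)" by (auto simp: fvs.subspace_def affine_points_def)
    show "\<exists>w\<in>affine_points n. \<forall>i\<in>{..<n}. w i = u i" for u :: "nat \<Rightarrow> 'k"
      by (intro bexI[of _ "trunc n u"]) (auto simp: trunc_def affine_points_def)
    show "w = 0" if "w \<in> affine_points n" "\<And>i. i \<in> {..<n} \<Longrightarrow> w i = 0" for w :: "nat \<Rightarrow> 'k"
      using that by (auto simp: affine_points_def fun_eq_iff not_less[symmetric])
  qed simp
  ultimately have "krull_dim (ztop (affvar n X)) = enat n"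
    using reg regular_locus_iff[OF Xsub, of "\<lambda>i. 0"] by simp
  then have "card S = n" using krull_dim_variety[OF X S] by simp
  moreover have "S \<subseteq> {..<n}" using S by (auto simp: A.basis_def A.indep_def)
  ultimately have "S = {..<n}" by (intro card_subset_eq) auto
  then have "ideal_of n X \<inter> polyf {..<n} = {\<lambda>v. 0}" using S by (auto simp: A.basis_def A.indep_def)
  then have "ideal_of n X \<subseteq> {\<lambda>v. 0}" by (auto simp: ideal_of_def)
  then have "vanishing n (ideal_of n X) = affine_points n" by (auto simp: vanishing_def)
  then show ?thesis using X by (simp add: affine_variety_iff)
qed

text \<open>Translation in the direction \<open>y - x\<close> carries \<open>x\<close> to
  \<open>y\<close> at time 1.\<close>

lemma affine_points_flexible:
  assumes "affine_variety n (affine_points n :: (nat \<Rightarrow> 'k::{alg_closed_field, field_char_0}) set)"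
  shows "flexible n (affine_points n :: (nat \<Rightarrow> 'k) set)"
  unfolding flexible_iff[OF assms]
proof (intro ballI)
  fix x y :: "nat \<Rightarrow> 'k" assume "x \<in> regular_locus n (affine_points n)" "y \<in> regular_locus n (affine_points n)"
  then have xy: "x \<in> affine_points n" "y \<in> affine_points n" by (auto simp: regular_locus_def)
  let ?\<phi> = "\<lambda>t v i. v i + t * (y i - x i)"
  have act: "Ga_action n (affine_points n) ?\<phi>"
  proof (rule Ga_actionI[OF order_refl])
    show "\<exists>f\<in>polyf {..<Suc n}. \<forall>t. \<forall>v\<in>affine_points n. v j + t * (y j - x j) = f (case_nat t v)" for j
    proof (cases "j < n")
      case True
      then have "(\<lambda>w. w (Suc j) + w 0 * (y j - x j)) \<in> polyf {..<Suc n}" by (intro polyf_intros) auto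
      then show ?thesis by (rule bexI[rotated]) auto
    next
      case False
      then show ?thesis using xy by (intro bexI[of _ "\<lambda>w. 0"]) (auto simp: affine_points_def polyf.const)
    qed
  qed (use xy in \<open>auto simp: affine_points_def algebra_simps\<close>)
  have "y = ?\<phi> 1 x" by auto
  then show "(ga_step n (affine_points n))\<^sup>*\<^sup>* x y" using ga_steps_action[OF act, of x 1] by simp
qed

lemma rtranclp_first_step:
  assumes "r\<^sup>*\<^sup>* x y" "x \<noteq> y" obtains z where "r x z" "z \<noteq> x"
proof -
  have "x = y \<or> (\<exists>z. r x z \<and> z \<noteq> x)" using assms(1)
    by (induction rule: converse_rtranclp_induct) auto
  then show thesis using assms(2) that by blast
qed

text \<open>The locus \<open>l \<noteq> 0\<close> then lies on the line through
  \<open>\<beta> z\<close>, hence so does \<open>X\<close> by irreducibility. Lying in no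
  hyperplane, it leaves room for one coordinate only.\<close>

lemma (in cone_chart) one_point_chart:
  assumes span: "\<And>c. (\<And>x. x \<in> X \<Longrightarrow> lin n c x = 0) \<Longrightarrow> (\<forall>j<n. c j = 0)" and Z: "Z = {z}"
  shows "X = affine_points n"
proof -
  let ?y = "\<beta> z"
  have y: "?y \<in> X" "l ?y = 1" using Z \<beta>_X l_\<beta> by auto
  have xy: "x = (\<lambda>i. l x * ?y i)" if "x \<in> X" "l x \<noteq> 0" for x
    using \<beta>_\<alpha>[OF that] \<alpha>_Z[OF that] Z by auto
  have "\<exists>i<n. ?y i \<noteq> 0"
  proof (rule ccontr)
    assume "\<not> ?thesis"
    then have "l ?y = 0" by (simp add: lin_def)
    then show False using y by simp
  qed
  then obtain i where i: "i < n" "?y i \<noteq> 0" by blast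
  have only: "k = i" if k: "k < n" for k
  proof (rule ccontr)
    assume ki: "k \<noteq> i"
    \<comment> \<open>A 2 by 2 minor: the form that vanishes on the line through
      \<open>\<beta> z\<close> and involves just the coordinates \<open>k\<close> and
      \<open>i\<close>.\<close>
    define c where "c = (\<lambda>j. if j = k then ?y i else if j = i then - ?y k else 0)"
    have c: "lin n c x = ?y i * x k - ?y k * x i" for x
    proof -
      have "lin n c x = (\<Sum>j\<in>{k, i}. c j * x j)" unfolding lin_def
        by (rule sum.mono_neutral_right) (use k i in \<open>auto simp: c_def\<close>)
      then show ?thesis using ki by (simp add: c_def)
    qed
    have lc: "lin n c x * l x = 0" if "x \<in> X" for x
    proof (cases "l x = 0")
      case False
      then have "x k = l x * ?y k" "x i = l x * ?y i" using xy[OF that] by metis+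
      then show ?thesis unfolding c by (simp add: algebra_simps)
    qed simp
    have "(\<forall>x\<in>X. lin n c x = 0) \<or> (\<forall>x\<in>X. l x = 0)"
      using affine_variety_mult_0[OF X lin_polyf l_poly lc] .
    then have "\<forall>x\<in>X. lin n c x = 0" using y by auto
    then have "\<forall>j<n. c j = 0" using span by blast
    then show False using i k by (auto simp: c_def)
  qed
  show ?thesis
  proof
    show "affine_points n \<subseteq> X"
    proof
      fix w :: "nat \<Rightarrow> 'k" assume w: "w \<in> affine_points n"
      have "w = (\<lambda>j. (w i / ?y i) * ?y j)"
      proof
        fix j
        show "w j = (w i / ?y i) * ?y j"
        proof (cases "j < n")
          case True
          then show ?thesis using only i by simp
        next
          case False
          then show ?thesis using w y(1) Xsub by (auto simp: affine_points_def)
        qed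
      qed
      then show "w \<in> X" using cone[OF y(1), of "w i / ?y i"] by simp
    qed
  qed (rule Xsub)
qed

text \<open>A second point \<open>z1\<close> of \<open>Z\<close> may be singular, but a coordinate
  that separates it from \<open>z\<close> is not constant on \<open>Z\<close>; by irreducibility it
  still differs from its value at \<open>z\<close> at some point where \<open>q\<close> is
  nonzero.\<close>

lemma (in cone_chart) regular_pair:
  assumes "\<And>z. Z \<noteq> {z}"
  obtains q z z' where "q \<in> polyf {..<N}" "\<And>y. y \<in> Z \<Longrightarrow> q y \<noteq> 0 \<Longrightarrow> y \<in> regular_locus N Z"
    "z \<in> Z" "q z \<noteq> 0" "z' \<in> regular_locus N Z" "z' \<noteq> z"
proof -
  obtain q z where q: "q \<in> polyf {..<N}" "z \<in> Z" "q z \<noteq> 0" "\<And>y. y \<in> Z \<Longrightarrow> q y \<noteq> 0 \<Longrightarrow> y \<in> regular_locus N Z"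
    by (rule regular_locus_generic[OF Z]) blast
  obtain z1 where z1: "z1 \<in> Z" "z1 \<noteq> z" using assms[of z] q(2) by blast
  then obtain k where k: "z1 k \<noteq> z k" by auto
  have "k < N"
  proof (rule ccontr)
    assume "\<not> k < N"
    then have "z1 k = 0" "z k = 0" using z1(1) q(2) Zsub by (auto simp: affine_points_def)
    then show False using k by simp
  qed
  then have f: "(\<lambda>v. v k - z k) \<in> polyf {..<N}" by (intro polyf_intros) auto
  have "z1 k - z k \<noteq> 0" using k by simp
  then obtain z' where z': "z' \<in> Z" "q z' \<noteq> 0" "z' k - z k \<noteq> 0"
    using affine_variety_common_nonzero[OF Z q(1) f q(2,3) z1(1)] by metis
  then have "z' \<noteq> z" by auto
  then show thesis using that q z' by blast
qed

theorem cone_flexible: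
  fixes X :: "(nat \<Rightarrow> 'k::{alg_closed_field, field_char_0}) set"
  assumes X: "affine_variety n X" and cone: "\<And>x c. x \<in> X \<Longrightarrow> (\<lambda>i. c * x i) \<in> X"
    and span: "\<And>c. (\<And>x. x \<in> X \<Longrightarrow> lin n c x = 0) \<Longrightarrow> (\<forall>j<n. c j = 0)"
    and chart: "\<And>i. i \<in> I \<Longrightarrow> cone_chart n (N i) X (Z i) (lc i) (a i) (b i) (M i)"
    and flex: "\<And>i. i \<in> I \<Longrightarrow> flexible (N i) (Z i)"
    and cover: "\<And>x. x \<in> X \<Longrightarrow> x \<noteq> (\<lambda>i. 0) \<Longrightarrow> \<exists>i\<in>I. lin n (lc i) x \<noteq> 0"
  shows "flexible n X"
proof (cases "X = affine_points n")
  case True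
  then show ?thesis using X affine_points_flexible by blast
next
  case False
  let ?R = "regular_locus n X" and ?l = "\<lambda>i. lin n (lc i)"
  have RX: "?R \<subseteq> X" by (auto simp: regular_locus_def)
  have sym: "(ga_step n X)\<^sup>*\<^sup>* y x" if "(ga_step n X)\<^sup>*\<^sup>* x y" "x \<in> ?R" for x y
    using ga_steps_sym[OF affine_variety_sub[OF X] that(1)] that(2) RX by blast
  have chart_connected: "(ga_step n X)\<^sup>*\<^sup>* x y"
    if i: "i \<in> I" and x: "x \<in> ?R" "?l i x \<noteq> 0" and y: "y \<in> ?R" "?l i y \<noteq> 0" for i x y
  proof -
    interpret cone_chart n "N i" X "Z i" "lc i" "a i" "b i" "M i" using chart[OF i] .
    have "Z i \<noteq> {z}" for z using one_point_chart[OF span] False by blast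
    then obtain q z z' where q: "q \<in> polyf {..<N i}" "\<And>y. y \<in> Z i \<Longrightarrow> q y \<noteq> 0 \<Longrightarrow> y \<in> regular_locus (N i) (Z i)"
      "z \<in> Z i" "q z \<noteq> 0" "z' \<in> regular_locus (N i) (Z i)" "z' \<noteq> z" by (rule regular_pair) blast
    have "(ga_step (N i) (Z i))\<^sup>*\<^sup>* z z'" using flex[OF i] q unfolding flexible_iff[OF Z] by blast
    \<comment> \<open>Flexibility joins \<open>z\<close> to another regular point, so some action
      moves \<open>z\<close> and its orbit is a nonconstant curve.\<close>
    then obtain z1 where "ga_step (N i) (Z i) z z1" "z1 \<noteq> z"
      by (rule rtranclp_first_step[OF _ q(6)[symmetric]])
    then obtain \<phi> t0 where \<phi>: "Ga_action (N i) (Z i) \<phi>" "\<phi> t0 z \<noteq> z" by (auto simp: ga_step_def)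
    obtain \<rho> where \<rho>: "\<And>t k. poly (\<rho> k) t = \<phi> t z k" using Ga_orbit_curve[OF Zclosed \<phi>(1) q(3)] by metis
    have \<rho>': "(\<lambda>k. poly (\<rho> k) t) = \<phi> t z" for t using \<rho> by auto
    have \<phi>Z: "\<phi> t z \<in> Z i" for t using Ga_action_sub[OF Zsub \<phi>(1) q(3)] .
    have "\<exists>p. \<forall>t. poly p t = b i j (\<phi> t z)" for j using poly_curve[OF b, where c = \<rho>] by (simp add: \<rho>')
    then obtain \<gamma> where \<gamma>: "\<And>j t. poly (\<gamma> j) t = b i j (\<phi> t z)" by metis
    have \<gamma>': "(\<lambda>j. poly (\<gamma> j) t) = \<beta> (\<phi> t z)" for t by (simp add: \<gamma> \<beta>_def)
    have "\<phi> 0 z = z" using \<phi>(1) q(3) by (simp add: Ga_action_def)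
    have "\<exists>j. poly (\<gamma> j) t0 \<noteq> poly (\<gamma> j) 0"
    proof (rule ccontr)
      assume "\<not> ?thesis"
      then have "\<beta> (\<phi> t0 z) = \<beta> (\<phi> 0 z)" unfolding \<gamma>'[symmetric] by auto
      then have "\<phi> t0 z = \<phi> 0 z" using \<alpha>_\<beta>[OF \<phi>Z] by metis
      then show False using \<phi>(2) \<open>\<phi> 0 z = z\<close> by simp
    qed
    then obtain j0 where j0: "poly (\<gamma> j0) t0 \<noteq> poly (\<gamma> j0) 0" by blast
    obtain e where e: "0 < e" "(\<lambda>j. coeff (\<gamma> j) e) \<in> X" "(\<lambda>j. coeff (\<gamma> j) e) \<noteq> (\<lambda>j. 0)"
      by (rule curve_limit[of \<gamma>, OF _ _ j0]) (use \<gamma>' \<beta>_X[OF \<phi>Z] l_\<beta>[OF \<phi>Z] in auto)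
    \<comment> \<open>The second chart is one that sees the limit point of the curve; its form is
      nonconstant along the curve because its coefficient of degree \<open>e > 0\<close> is
      nonzero.\<close>
    obtain j where j: "j \<in> I" "?l j (\<lambda>j. coeff (\<gamma> j) e) \<noteq> 0" using cover[OF e(2,3)] by blast
    define H where "H = (\<Sum>k<n. smult (lc j k) (\<gamma> k))"
    have H: "poly H t = ?l j (\<beta> (\<phi> t z))" for t
      unfolding H_def lin_def \<gamma>'[symmetric] by (simp add: poly_sum)
    have "coeff H e = ?l j (\<lambda>j. coeff (\<gamma> j) e)" unfolding H_def lin_def by (simp add: coeff_sum)
    then have degH: "0 < degree H" using j(2) e(1) le_degree[of H e] by auto
    have surj: "\<exists>t. poly H t = c" for c
    proof -
      have "degree (H + [:- c:]) = degree H" using degH by (intro degree_add_eq_left) auto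
      then obtain t where "poly (H + [:- c:]) t = 0" using alg_closed_imp_poly_has_root[of "H + [:- c:]"] degH by auto
      then show ?thesis by (intro exI[of _ t]) simp
    qed
    obtain Q where Q: "\<And>t. poly Q t = q (\<phi> t z)" using poly_curve[OF q(1), where c = \<rho>] by (auto simp: \<rho>')
    \<comment> \<open>Times at which the moving point may fail to be regular. They are finitely many
      because \<open>q\<close> is nonzero at the start \<open>z\<close>; this is why
      \<open>z\<close> was chosen with \<open>q z \<noteq> 0\<close> and not merely regular.\<close>
    define bad where "bad = {t. poly Q t = 0}"
    have "poly Q 0 \<noteq> 0" using Q q(4) \<open>\<phi> 0 z = z\<close> by simp
    then have fin: "finite bad" unfolding bad_def by (intro poly_roots_finite) auto
    \<comment> \<open>One value \<open>c\<close> of \<open>l_j\<close> must serve two levels of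
      \<open>l_i\<close>, those of \<open>x\<close> and of \<open>y\<close>. On the level
      \<open>d\<close> the value is \<open>d * H t\<close>, so the values at bad times are excluded
      for both, and 0 because levels of \<open>l_j\<close> are connected only away from 0.\<close>
    define avoid where "avoid = insert 0 ((\<lambda>t. ?l i x * poly H t) ` bad \<union> (\<lambda>t. ?l i y * poly H t) ` bad)"
    have "finite avoid" using fin by (simp add: avoid_def)
    then obtain c where c: "c \<notin> avoid" using ex_new_if_finite[OF infinite_UNIV_field_char_0] by blast
    have point: "\<exists>p\<in>?R. ?l i p = d \<and> ?l j p = c" if d: "d \<noteq> 0" "c \<notin> (\<lambda>t. d * poly H t) ` bad" for d
    proof -
      \<comment> \<open>On the level \<open>d\<close> of \<open>l_i\<close> the form
        \<open>l_j\<close> takes the value \<open>c\<close> exactly when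
        \<open>H t = c / d\<close>.\<close>
      obtain t where t: "poly H t = c / d" using surj by blast
      then have "c = d * poly H t" using d by simp
      then have "t \<notin> bad" using d(2) by blast
      then have "\<phi> t z \<in> regular_locus (N i) (Z i)" using q(2)[OF \<phi>Z] Q by (simp add: bad_def)
      moreover have "(\<lambda>k. d * \<beta> (\<phi> t z) k) \<in> X" by (rule cone[OF \<beta>_X[OF \<phi>Z]])
      ultimately have "(\<lambda>k. d * \<beta> (\<phi> t z) k) \<in> ?R"
        using regular_locus_cone \<alpha>_scale[OF \<phi>Z d(1)] d(1) by simp
      moreover have "?l i (\<lambda>k. d * \<beta> (\<phi> t z) k) = d" using \<alpha>_scale(2)[OF \<phi>Z d(1)] .
      moreover have "?l j (\<lambda>k. d * \<beta> (\<phi> t z) k) = c" using H t d by (simp add: lin_scale)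
      ultimately show ?thesis by blast
    qed
    obtain p where p: "p \<in> ?R" "?l i p = ?l i x" "?l j p = c" using point[OF x(2)] c by (auto simp: avoid_def)
    obtain p' where p': "p' \<in> ?R" "?l i p' = ?l i y" "?l j p' = c" using point[OF y(2)] c by (auto simp: avoid_def)
    have "c \<noteq> 0" using c by (simp add: avoid_def)
    \<comment> \<open>The outer steps stay on levels of \<open>l_i\<close>, the middle one on the
      level \<open>c\<close> of \<open>l_j\<close>; only the middle one changes
      \<open>l_i\<close>.\<close>
    have 1: "(ga_step n X)\<^sup>*\<^sup>* x p" by (rule level_connected[OF flex[OF i] x p(1,2)])
    have 2: "(ga_step n X)\<^sup>*\<^sup>* p p'"
      by (rule cone_chart.level_connected[OF chart[OF j(1)] flex[OF j(1)] p(1) _ p'(1)]) (use p p' \<open>c \<noteq> 0\<close> in auto)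
    have 3: "(ga_step n X)\<^sup>*\<^sup>* y p'" by (rule level_connected[OF flex[OF i] y p'(1,2)])
    show ?thesis using 1 2 sym[OF 3 y(1)] by (meson rtranclp_trans)
  qed
  show ?thesis unfolding flexible_iff[OF X]
  proof (intro ballI)
    fix x y assume xy: "x \<in> ?R" "y \<in> ?R"
    have "(\<lambda>i. 0) \<notin> ?R"
    proof
      assume r: "(\<lambda>i. 0) \<in> ?R"
      have "X = affine_points n" by (rule vertex_regular[OF X _ _ r]) (rule cone, assumption, rule span)
      then show False using False by simp
    qed
    then have "x \<noteq> (\<lambda>i. 0)" "y \<noteq> (\<lambda>i. 0)" using xy by metis+
    moreover have xyX: "x \<in> X" "y \<in> X" using xy RX by auto
    ultimately obtain i j where ij: "i \<in> I" "?l i x \<noteq> 0" "j \<in> I" "?l j y \<noteq> 0"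
      using cover[of x] cover[of y] by blast
    \<comment> \<open>By irreducibility any two charts share a point, and even a regular one,
      through which points of different charts are joined.\<close>
    obtain u where u: "u \<in> X" "?l i u \<noteq> 0" "?l j u \<noteq> 0"
      using affine_variety_common_nonzero[OF X lin_polyf lin_polyf xyX(1) ij(2) xyX(2) ij(4)] by metis
    obtain q v where q: "q \<in> polyf {..<n}" "v \<in> X" "q v \<noteq> 0" "\<And>z. z \<in> X \<Longrightarrow> q z \<noteq> 0 \<Longrightarrow> z \<in> regular_locus n X"
      by (rule regular_locus_generic[OF X]) blast
    have "?l i u * ?l j u \<noteq> 0" using u by simp
    then obtain w where w: "w \<in> X" "q w \<noteq> 0" "?l i w * ?l j w \<noteq> 0"
      using affine_variety_common_nonzero[OF X q(1) polyf.mult[OF lin_polyf lin_polyf] q(2,3) u(1)] by metis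
    then have "w \<in> ?R" using q(4) by blast
    then have "(ga_step n X)\<^sup>*\<^sup>* x w" "(ga_step n X)\<^sup>*\<^sup>* w y"
      using chart_connected[OF ij(1) xy(1) ij(2)] chart_connected[OF ij(3) _ _ xy(2) ij(4)] w(3) by auto
    then show "(ga_step n X)\<^sup>*\<^sup>* x y" by (rule rtranclp_trans)
  qed
qed

text \<open>As a rewrite rule it loops with associativity of multiplication.\<close>

declare fvs.scale_scale [simp del]

section \<open>Projective space\<close>

lemma monomial_degree_superset:
  assumes "finite K" "Poly_Mapping.keys m \<subseteq> K"
  shows "(\<Sum>i\<in>Poly_Mapping.keys m. Poly_Mapping.lookup m i :: nat) = (\<Sum>i\<in>K. Poly_Mapping.lookup m i)"
  by (rule sum.mono_neutral_left) (use assms in \<open>auto simp: in_keys_iff\<close>)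

lemma mp_homogeneous_eval:
  assumes "mp_homogeneous d p" shows "mp_eval p (\<lambda>i. c * v i) = c ^ d * mp_eval p v"
proof -
  have "(\<Prod>i\<in>Poly_Mapping.keys m. (c * v i) ^ Poly_Mapping.lookup m i)
      = c ^ d * (\<Prod>i\<in>Poly_Mapping.keys m. v i ^ Poly_Mapping.lookup m i)" if "m \<in> Poly_Mapping.keys p" for m
    using assms that by (simp add: mp_homogeneous_def power_mult_distrib prod.distrib flip: power_sum)
  then show ?thesis by (simp add: mp_eval_def sum_distrib_left mult_ac)
qed

lemma mp_homogeneous_mult:
  assumes "mp_homogeneous d p" "mp_homogeneous e q" shows "mp_homogeneous (d + e) (p * q)"
  unfolding mp_homogeneous_def
proof
  fix m assume "m \<in> Poly_Mapping.keys (p * q)"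
  then obtain a b where ab: "a \<in> Poly_Mapping.keys p" "b \<in> Poly_Mapping.keys q" "m = a + b"
    using keys_mult[of p q] by blast
  let ?K = "Poly_Mapping.keys a \<union> Poly_Mapping.keys b"
  have "Poly_Mapping.keys m \<subseteq> ?K" unfolding ab by (rule Poly_Mapping.keys_add)
  then have "(\<Sum>i\<in>Poly_Mapping.keys m. Poly_Mapping.lookup m i) = (\<Sum>i\<in>?K. Poly_Mapping.lookup a i + Poly_Mapping.lookup b i)"
    using monomial_degree_superset[of ?K m] by (simp add: ab lookup_add)
  also have "\<dots> = (\<Sum>i\<in>Poly_Mapping.keys a. Poly_Mapping.lookup a i) + (\<Sum>i\<in>Poly_Mapping.keys b. Poly_Mapping.lookup b i)"
    by (simp add: monomial_degree_superset[of ?K a] monomial_degree_superset[of ?K b] sum.distrib)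
  also have "\<dots> = d + e" using assms ab by (simp add: mp_homogeneous_def)
  finally show "(\<Sum>i\<in>Poly_Mapping.keys m. Poly_Mapping.lookup m i) = d + e" .
qed

lemma mp_homogeneous_add:
  "mp_homogeneous d p \<Longrightarrow> mp_homogeneous d q \<Longrightarrow> mp_homogeneous d (p + q)"
  using keys_add[of p q] unfolding mp_homogeneous_def by blast

lemma mp_homogeneous_const: "mp_homogeneous 0 (mp_const c)"
  by (simp add: mp_homogeneous_def mp_const_def)

lemma mp_homogeneous_var: "mp_homogeneous 1 (mp_var i)"
  by (simp add: mp_homogeneous_def mp_var_def)

lemma mp_homogeneous_0: "mp_homogeneous d 0"
  by (simp add: mp_homogeneous_def)

definition mp_lin :: "nat \<Rightarrow> (nat \<Rightarrow> 'k::field) \<Rightarrow> 'k mpol" where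
  "mp_lin n c = (\<Sum>i<n. mp_const (c i) * mp_var i)"

lemma mp_homogeneous_lin: "mp_homogeneous 1 (mp_lin n c)"
proof (induction n)
  case (Suc n)
  have "mp_homogeneous (0 + 1) (mp_const (c n) * mp_var n)"
    by (rule mp_homogeneous_mult[OF mp_homogeneous_const mp_homogeneous_var])
  then show ?case using Suc mp_homogeneous_add by (simp add: mp_lin_def)
qed (simp add: mp_lin_def mp_homogeneous_0)

lemma mp_eval_lin: "mp_eval (mp_lin n c) v = lin n c v"
  by (induction n) (simp_all add: mp_lin_def lin_def mp_eval_add mp_eval_mult)

lemma proj_point_self: "v \<in> proj_point v"
  unfolding proj_point_def by (intro CollectI exI[of _ 1]) simp

lemma proj_point_scale:
  assumes "c \<noteq> 0" shows "proj_point (\<lambda>i. c * v i) = proj_point v"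
proof
  show "proj_point (\<lambda>i. c * v i) \<subseteq> proj_point v"
  proof
    fix w assume "w \<in> proj_point (\<lambda>i. c * v i)"
    then obtain d where "d \<noteq> 0" "w = (\<lambda>i. d * (c * v i))" by (auto simp: proj_point_def)
    then have "w = (\<lambda>i. (d * c) * v i)" "d * c \<noteq> 0" using assms by (simp_all add: mult.assoc)
    then show "w \<in> proj_point v" unfolding proj_point_def by (intro CollectI exI[of _ "d * c"] conjI)
  qed
  show "proj_point v \<subseteq> proj_point (\<lambda>i. c * v i)"
  proof
    fix w assume "w \<in> proj_point v"
    then obtain d where "d \<noteq> 0" "w = (\<lambda>i. d * v i)" by (auto simp: proj_point_def)
    then have "w = (\<lambda>i. (d / c) * (c * v i))" "d / c \<noteq> 0" using assms by simp_all
    then show "w \<in> proj_point (\<lambda>i. c * v i)" unfolding proj_point_def by (intro CollectI exI[of _ "d / c"] conjI)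
  qed
qed

lemma proj_pointE:
  assumes "w \<in> proj_point v" obtains c where "c \<noteq> 0" "w = (\<lambda>i. c * v i)"
  using assms by (auto simp: proj_point_def)

lemma proj_pointsE:
  assumes "x \<in> proj_points n" obtains v where "v \<in> affine_points (Suc n)" "v \<noteq> (\<lambda>i. 0)" "x = proj_point v"
  using assms by (auto simp: proj_points_def)

lemma hom_nonzero_proj_point:
  assumes "mp_homogeneous d p" shows "(\<forall>w\<in>proj_point v. mp_eval p w \<noteq> 0) \<longleftrightarrow> mp_eval p v \<noteq> 0"
proof
  assume nz: "mp_eval p v \<noteq> 0"
  show "\<forall>w\<in>proj_point v. mp_eval p w \<noteq> 0"
  proof
    fix w assume "w \<in> proj_point v"
    then obtain c where "c \<noteq> 0" "w = (\<lambda>i. c * v i)" by (rule proj_pointE)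
    then show "mp_eval p w \<noteq> 0" using nz mp_homogeneous_eval[OF assms] by simp
  qed
qed (use proj_point_self[of v] in blast)

lemma hom_zero_iff:
  assumes "mp_homogeneous d p" "x \<in> proj_points n" "v \<in> x" "w \<in> x"
  shows "mp_eval p v = 0 \<longleftrightarrow> mp_eval p w = 0"
proof -
  obtain u where "x = proj_point u" using assms(2) by (rule proj_pointsE)
  then show ?thesis using assms mp_homogeneous_eval[OF assms(1)] by (auto elim!: proj_pointE)
qed

lemma proj_points_member: "x \<in> proj_points n \<Longrightarrow> \<exists>v. v \<in> x"
  using proj_point_self by (auto elim: proj_pointsE)

abbreviation pbasic :: "nat \<Rightarrow> 'k::field mpol \<Rightarrow> (nat \<Rightarrow> 'k) set set" where
  "pbasic n p \<equiv> {x \<in> proj_points n. \<forall>v\<in>x. mp_eval p v \<noteq> 0}"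

lemma pbasic_mult: "pbasic n (p * q) = pbasic n p \<inter> pbasic n q"
  by (auto simp: mp_eval_mult)

lemma ztop_proj: "ztop (proj_space n) = topology_generated_by {pbasic n p | p. \<exists>d. mp_homogeneous d p}"
  by (simp add: proj_space_def Let_def)

lemma topspace_proj [simp]: "topspace (ztop (proj_space n)) = (proj_points n :: (nat \<Rightarrow> 'k::field) set set)"
proof -
  have "pbasic n (mp_const (1::'k)) = proj_points n" by simp
  then have "proj_points n \<in> {pbasic n p | p :: 'k mpol. \<exists>d. mp_homogeneous d p}"
    using mp_homogeneous_const[of "1::'k"] by blast
  then show ?thesis unfolding ztop_proj topology_generated_by_topspace by auto
qed

lemma openin_proj:
  "openin (ztop (proj_space n)) U \<longleftrightarrow>
     (\<forall>x\<in>U. \<exists>p d. mp_homogeneous d p \<and> x \<in> pbasic n p \<and> pbasic n p \<subseteq> U)"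
proof -
  let ?B = "{pbasic n p | p :: 'a mpol. \<exists>d. mp_homogeneous d p}"
  have "openin (ztop (proj_space n)) U \<longleftrightarrow> (\<forall>x\<in>U. \<exists>A\<in>?B. x \<in> A \<and> A \<subseteq> U)"
    unfolding ztop_proj
  proof (rule openin_generated_base)
    fix A B assume "A \<in> ?B" "B \<in> ?B"
    then obtain p q d e where "A = pbasic n p" "B = pbasic n q" "mp_homogeneous d p" "mp_homogeneous e q" by blast
    then have "A \<inter> B = pbasic n (p * q)" "mp_homogeneous (d + e) (p * q)"
      using mp_homogeneous_mult by (simp_all add: pbasic_mult)
    then show "A \<inter> B \<in> ?B" by blast
  qed
  also have "\<dots> \<longleftrightarrow> (\<forall>x\<in>U. \<exists>p d. mp_homogeneous d p \<and> x \<in> pbasic n p \<and> pbasic n p \<subseteq> U)"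
  proof (rule ball_cong[OF refl])
    fix x
    show "(\<exists>A\<in>?B. x \<in> A \<and> A \<subseteq> U) \<longleftrightarrow> (\<exists>p d. mp_homogeneous d p \<and> x \<in> pbasic n p \<and> pbasic n p \<subseteq> U)"
      unfolding Bex_def mem_Collect_eq[of _ "\<lambda>A. \<exists>p. A = pbasic n p \<and> (\<exists>d. mp_homogeneous d p)"]
      by (rule iffI; elim exE conjE; blast)
  qed
  finally show ?thesis .
qed

lemma openin_pbasic: "mp_homogeneous d p \<Longrightarrow> openin (ztop (proj_space n)) (pbasic n p)"
  unfolding openin_proj by blast

section \<open>Regular functions on projective varieties as local fractions of forms\<close>

definition ploc_frac :: "nat \<Rightarrow> (nat \<Rightarrow> 'k::field) set set \<Rightarrow> ((nat \<Rightarrow> 'k) set \<Rightarrow> 'k) \<Rightarrow> bool" where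
  "ploc_frac n V f \<longleftrightarrow> (\<forall>x\<in>V. \<exists>p q d. mp_homogeneous d p \<and> mp_homogeneous d q \<and> (\<forall>v\<in>x. mp_eval q v \<noteq> 0) \<and>
     (\<forall>y\<in>V. \<forall>v\<in>y. mp_eval q v \<noteq> 0 \<longrightarrow> f y = mp_eval p v / mp_eval q v))"

lemma ploc_fracE:
  assumes "ploc_frac n V f" "x \<in> V"
  obtains p q d where "mp_homogeneous d p" "mp_homogeneous d q" "\<And>v. v \<in> x \<Longrightarrow> mp_eval q v \<noteq> 0"
    "\<And>y v. y \<in> V \<Longrightarrow> v \<in> y \<Longrightarrow> mp_eval q v \<noteq> 0 \<Longrightarrow> f y = mp_eval p v / mp_eval q v"
  using assms unfolding ploc_frac_def by meson

text \<open>A neighbourhood is cut out by a form \<open>h\<close>. Multiplying numerator and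
  denominator by \<open>h\<close> turns a fraction valid near \<open>x\<close> into one valid
  wherever its denominator is nonzero.\<close>

lemma ploc_fracI:
  assumes V: "V \<subseteq> proj_points n"
    and "\<And>x. x \<in> V \<Longrightarrow> \<exists>p q d e h. mp_homogeneous d p \<and> mp_homogeneous d q \<and> mp_homogeneous e h \<and>
      x \<in> pbasic n q \<and> x \<in> pbasic n h \<and>
      (\<forall>y\<in>V. \<forall>v\<in>y. mp_eval q v \<noteq> 0 \<and> y \<in> pbasic n h \<longrightarrow> f y = mp_eval p v / mp_eval q v)"
  shows "ploc_frac n V f"
  unfolding ploc_frac_def
proof
  fix x assume x: "x \<in> V"
  then obtain p q d e h where pq: "mp_homogeneous d p" "mp_homogeneous d q" "mp_homogeneous e h"
      "x \<in> pbasic n q" "x \<in> pbasic n h"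
      and pqh: "\<forall>y\<in>V. \<forall>v\<in>y. mp_eval q v \<noteq> 0 \<and> y \<in> pbasic n h \<longrightarrow> f y = mp_eval p v / mp_eval q v"
    using assms(2)[OF x] by (elim exE conjE) (rule that)
  show "\<exists>p q d. mp_homogeneous d p \<and> mp_homogeneous d q \<and> (\<forall>v\<in>x. mp_eval q v \<noteq> 0) \<and>
     (\<forall>y\<in>V. \<forall>v\<in>y. mp_eval q v \<noteq> 0 \<longrightarrow> f y = mp_eval p v / mp_eval q v)"
  proof (intro exI conjI ballI impI)
    show "mp_homogeneous (d + e) (p * h)" "mp_homogeneous (d + e) (q * h)" by (rule mp_homogeneous_mult[OF pq(1,3)], rule mp_homogeneous_mult[OF pq(2,3)])
    show "mp_eval (q * h) v \<noteq> 0" if "v \<in> x" for v using pq(4,5) that by (auto simp: mp_eval_mult)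
    fix y v assume y: "y \<in> V" "v \<in> y" "mp_eval (q * h) v \<noteq> 0"
    then have nz: "mp_eval q v \<noteq> 0" "mp_eval h v \<noteq> 0" by (auto simp: mp_eval_mult)
    have "y \<in> pbasic n h" using V y nz(2) hom_zero_iff[OF pq(3) _ y(2)] by auto
    then show "f y = mp_eval (p * h) v / mp_eval (q * h) v" using bspec[OF bspec[OF pqh y(1)] y(2)] nz by (simp add: mp_eval_mult)
  qed
qed

lemma regs_proj_space:
  "f \<in> regs (proj_space n) U \<longleftrightarrow> (\<forall>x\<in>U. \<exists>V p q d. openin (ztop (proj_space n)) V \<and> x \<in> V \<and> V \<subseteq> U \<and>
     mp_homogeneous d p \<and> mp_homogeneous d q \<and> (\<forall>y\<in>V. \<forall>v\<in>y. mp_eval q v \<noteq> 0 \<and> f y = mp_eval p v / mp_eval q v))"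
  by (simp add: proj_space_def Let_def)

lemma regs_subvar:
  "f \<in> regs (subvar P Z) V \<longleftrightarrow> (\<forall>x\<in>V. \<exists>W g. openin (ztop P) W \<and> x \<in> W \<and> g \<in> regs P W \<and> (\<forall>y\<in>W \<inter> V. f y = g y))"
  by (simp add: subvar_def)

text \<open>A function on lines has to pick a representative; for numerator and denominator of equal
  degree the choice does not affect the value.\<close>

definition pfrac :: "'k::field mpol \<Rightarrow> 'k mpol \<Rightarrow> (nat \<Rightarrow> 'k) set \<Rightarrow> 'k" where
  "pfrac p q x = (let v = (SOME v. v \<in> x) in mp_eval p v / mp_eval q v)"

lemma pfrac_eq:
  assumes p: "mp_homogeneous d p" and q: "mp_homogeneous d q" and x: "x \<in> proj_points n" "v \<in> x"
  shows "pfrac p q x = mp_eval p v / mp_eval q v"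
proof -
  obtain u where u: "x = proj_point u" using x(1) by (rule proj_pointsE)
  let ?w = "SOME v. v \<in> x"
  have w: "?w \<in> proj_point u" using someI[of "\<lambda>v. v \<in> x", OF x(2)] unfolding u .
  obtain c where c: "c \<noteq> 0" "?w = (\<lambda>i. c * u i)" using w by (rule proj_pointE)
  obtain c' where c': "c' \<noteq> 0" "v = (\<lambda>i. c' * u i)" using x(2) unfolding u by (rule proj_pointE)
  have "mp_eval p ?w / mp_eval q ?w = mp_eval p u / mp_eval q u"
    unfolding c(2) using mp_homogeneous_eval[OF p] mp_homogeneous_eval[OF q] c(1) by simp
  moreover have "mp_eval p v / mp_eval q v = mp_eval p u / mp_eval q u"
    unfolding c'(2) using mp_homogeneous_eval[OF p] mp_homogeneous_eval[OF q] c'(1) by simp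
  ultimately show ?thesis by (simp add: pfrac_def Let_def)
qed

lemma regs_proj_iff:
  assumes V: "V \<subseteq> proj_points n"
  shows "f \<in> regs (projvar n Y) V \<longleftrightarrow> ploc_frac n V f"
proof
  assume f: "f \<in> regs (projvar n Y) V"
  show "ploc_frac n V f"
  proof (rule ploc_fracI[OF V])
    fix x assume x: "x \<in> V"
    obtain W g where W: "openin (ztop (proj_space n)) W" "x \<in> W" "g \<in> regs (proj_space n) W" "\<forall>y\<in>W \<inter> V. f y = g y"
      using bspec[OF f[unfolded regs_subvar] x] by (elim exE conjE) (rule that)
    obtain V' p q d where V': "openin (ztop (proj_space n)) V'" "x \<in> V'" "V' \<subseteq> W" "mp_homogeneous d p" "mp_homogeneous d q"
        "\<forall>y\<in>V'. \<forall>v\<in>y. mp_eval q v \<noteq> 0 \<and> g y = mp_eval p v / mp_eval q v"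
      using bspec[OF W(3)[unfolded regs_proj_space] W(2)] by meson
    obtain h e where h: "mp_homogeneous e h" "x \<in> pbasic n h" "pbasic n h \<subseteq> V'"
      using bspec[OF V'(1)[unfolded openin_proj] V'(2)] by (elim exE conjE) (rule that)
    show "\<exists>p q d e h. mp_homogeneous d p \<and> mp_homogeneous d q \<and> mp_homogeneous e h \<and>
      x \<in> pbasic n q \<and> x \<in> pbasic n h \<and>
      (\<forall>y\<in>V. \<forall>v\<in>y. mp_eval q v \<noteq> 0 \<and> y \<in> pbasic n h \<longrightarrow> f y = mp_eval p v / mp_eval q v)"
    proof (rule exI[of _ p], rule exI[of _ q], rule exI[of _ d], rule exI[of _ e], rule exI[of _ h], intro conjI ballI impI)
      show "x \<in> pbasic n q" using x V V' by auto
      fix y v assume y: "y \<in> V" "v \<in> y" "mp_eval q v \<noteq> 0 \<and> y \<in> pbasic n h"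
      have yV': "y \<in> V'" using y(3) by (intro subsetD[OF h(3)]) blast
      then have "y \<in> W \<inter> V" using V'(3) y(1) by blast
      then have "f y = g y" using W(4) by blast
      then show "f y = mp_eval p v / mp_eval q v" using bspec[OF bspec[OF V'(6) yV'] y(2)] by simp
    qed (use V' h in blast)+
  qed
next
  assume f: "ploc_frac n V f"
  show "f \<in> regs (projvar n Y) V" unfolding regs_subvar
  proof
    fix x assume x: "x \<in> V"
    obtain p q d where pq: "mp_homogeneous d p" "mp_homogeneous d q" "\<And>v. v \<in> x \<Longrightarrow> mp_eval q v \<noteq> 0"
      "\<And>y v. y \<in> V \<Longrightarrow> v \<in> y \<Longrightarrow> mp_eval q v \<noteq> 0 \<Longrightarrow> f y = mp_eval p v / mp_eval q v"
      by (rule ploc_fracE[OF f x]) blast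
    define g where "g = pfrac p q"
    have g: "g y = mp_eval p v / mp_eval q v" if y: "y \<in> proj_points n" "v \<in> y" for y v
      unfolding g_def using pq(1,2) y by (rule pfrac_eq)
    let ?W = "pbasic n q"
    have W: "openin (ztop (proj_space n)) ?W" using pq(2) by (rule openin_pbasic)
    show "\<exists>W g. openin (ztop (proj_space n)) W \<and> x \<in> W \<and> g \<in> regs (proj_space n) W \<and> (\<forall>y\<in>W \<inter> V. f y = g y)"
    proof (rule exI[of _ ?W], rule exI[of _ g], intro conjI)
      show "x \<in> ?W" using x V pq(3) by blast
      show "g \<in> regs (proj_space n) ?W" unfolding regs_proj_space
      proof
        fix y assume y: "y \<in> ?W"
        show "\<exists>V p q d. openin (ztop (proj_space n)) V \<and> y \<in> V \<and> V \<subseteq> ?W \<and> mp_homogeneous d p \<and> mp_homogeneous d q \<and>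
            (\<forall>y\<in>V. \<forall>v\<in>y. mp_eval q v \<noteq> 0 \<and> g y = mp_eval p v / mp_eval q v)"
          using W y pq g by (intro exI[of _ ?W] exI[of _ p] exI[of _ q] exI[of _ d]) auto
      qed
      show "\<forall>y\<in>?W \<inter> V. f y = g y"
      proof
        fix y assume y: "y \<in> ?W \<inter> V"
        then obtain v where "v \<in> y" using proj_points_member[of y n] by auto
        then show "f y = g y" using y pq(4)[of y v] g[of y v] by auto
      qed
    qed (rule W)
  qed
qed

lemma pfrac_regs:
  assumes "mp_homogeneous d p" "mp_homogeneous d q" "V \<subseteq> pbasic n q"
  shows "pfrac p q \<in> regs (projvar n Y) V"
proof -
  have V: "V \<subseteq> proj_points n" using assms(3) by blast
  have "ploc_frac n V (pfrac p q)" unfolding ploc_frac_def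
  proof
    fix x assume x: "x \<in> V"
    have nz: "\<forall>v\<in>x. mp_eval q v \<noteq> 0" using x assms(3) by blast
    have eq: "\<forall>y\<in>V. \<forall>v\<in>y. mp_eval q v \<noteq> 0 \<longrightarrow> pfrac p q y = mp_eval p v / mp_eval q v"
      using V by (intro ballI impI pfrac_eq[OF assms(1,2)]) blast+
    show "\<exists>p' q' d. mp_homogeneous d p' \<and> mp_homogeneous d q' \<and> (\<forall>v\<in>x. mp_eval q' v \<noteq> 0) \<and>
       (\<forall>y\<in>V. \<forall>v\<in>y. mp_eval q' v \<noteq> 0 \<longrightarrow> pfrac p q y = mp_eval p' v / mp_eval q' v)"
      by (rule exI[of _ p], rule exI[of _ q], rule exI[of _ d]) (intro conjI assms(1,2) nz eq)
  qed
  then show ?thesis by (simp add: regs_proj_iff[OF V])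
qed

lemma regs_subvar_cong:
  assumes f: "f \<in> regs (subvar P Z) V" and eq: "\<And>y. y \<in> V \<Longrightarrow> f y = g y"
  shows "g \<in> regs (subvar P Z) V"
  unfolding regs_subvar
proof
  fix x assume "x \<in> V"
  then obtain W h where W: "openin (ztop P) W" "x \<in> W" "h \<in> regs P W" "\<forall>y\<in>W \<inter> V. f y = h y"
    using f[unfolded regs_subvar] by blast
  have "\<forall>y\<in>W \<inter> V. g y = h y" using W(4) eq by simp
  then show "\<exists>W h. openin (ztop P) W \<and> x \<in> W \<and> h \<in> regs P W \<and> (\<forall>y\<in>W \<inter> V. g y = h y)" using W by blast
qed

lemma regs_subvar_open:
  assumes "openin (ztop P) V" "f \<in> regs P V" shows "f \<in> regs (subvar P U) V"
  unfolding regs_subvar using assms by blast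

text \<open>The structure on \<open>U\<close> is induced from that on \<open>Y\<close>, which is
  itself induced from projective space; the two local extensions collapse into one fraction of
  forms.\<close>

lemma regs_open_projvar:
  assumes U: "U \<subseteq> Y" "Y \<subseteq> proj_points n" and f: "f \<in> regs (subvar (projvar n Y) U) U"
  shows "f \<in> regs (projvar n Y) U"
proof -
  have Un: "U \<subseteq> proj_points n" using U by blast
  have "ploc_frac n U f"
  proof (rule ploc_fracI[OF Un])
    fix x assume x: "x \<in> U"
    obtain W g where W: "openin (ztop (projvar n Y)) W" "x \<in> W" "g \<in> regs (projvar n Y) W" "\<forall>y\<in>W \<inter> U. f y = g y"
      using bspec[OF f[unfolded regs_subvar[of f "projvar n Y"]] x] by (elim exE conjE) (rule that)
    have "W \<subseteq> proj_points n" using openin_subset[OF W(1)] by auto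
    then have "ploc_frac n W g" using W(3) by (simp add: regs_proj_iff)
    then obtain p q d where pq: "mp_homogeneous d p" "mp_homogeneous d q" "\<And>v. v \<in> x \<Longrightarrow> mp_eval q v \<noteq> 0"
      "\<And>y v. y \<in> W \<Longrightarrow> v \<in> y \<Longrightarrow> mp_eval q v \<noteq> 0 \<Longrightarrow> g y = mp_eval p v / mp_eval q v"
      using W(2) by (rule ploc_fracE) blast
    obtain W' where W': "openin (ztop (proj_space n)) W'" "W = W' \<inter> Y" using W(1) by (auto simp: openin_subtopology)
    then have "x \<in> W'" using W(2) by blast
    obtain h e where h: "mp_homogeneous e h" "x \<in> pbasic n h" "pbasic n h \<subseteq> W'"
      using bspec[OF W'(1)[unfolded openin_proj] \<open>x \<in> W'\<close>] by (elim exE conjE) (rule that)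
    show "\<exists>p q d e h. mp_homogeneous d p \<and> mp_homogeneous d q \<and> mp_homogeneous e h \<and>
      x \<in> pbasic n q \<and> x \<in> pbasic n h \<and>
      (\<forall>y\<in>U. \<forall>v\<in>y. mp_eval q v \<noteq> 0 \<and> y \<in> pbasic n h \<longrightarrow> f y = mp_eval p v / mp_eval q v)"
    proof (rule exI[of _ p], rule exI[of _ q], rule exI[of _ d], rule exI[of _ e], rule exI[of _ h], intro conjI ballI impI)
      show "x \<in> pbasic n q" using x Un pq(3) by blast
      fix y v assume y: "y \<in> U" "v \<in> y" "mp_eval q v \<noteq> 0 \<and> y \<in> pbasic n h"
      have "y \<in> W'" using y(3) by (intro subsetD[OF h(3)]) blast
      then have "y \<in> W" using W'(2) U(1) y(1) by blast
      then show "f y = mp_eval p v / mp_eval q v" using W(4) pq(4)[of y v] y by simp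
    qed (use pq h in blast)+
  qed
  then show ?thesis using Un by (simp add: regs_proj_iff)
qed

section \<open>Rational functions on an irreducible space with functions\<close>

text \<open>The properties on which the calculus of rational functions and divisors rests. They are
  verified once for projective varieties, so that everything about sections is free of
  coordinates.\<close>

locale irr_fspace =
  fixes Y :: "('p, 'k::field) fspace"
  assumes irr: "irreducible_space (ztop Y)"
    and reg_const: "openin (ztop Y) V \<Longrightarrow> (\<lambda>x. c) \<in> regs Y V"
    and reg_add: "openin (ztop Y) V \<Longrightarrow> f \<in> regs Y V \<Longrightarrow> g \<in> regs Y V \<Longrightarrow> (\<lambda>x. f x + g x) \<in> regs Y V"
    and reg_mult: "openin (ztop Y) V \<Longrightarrow> f \<in> regs Y V \<Longrightarrow> g \<in> regs Y V \<Longrightarrow> (\<lambda>x. f x * g x) \<in> regs Y V"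
    and reg_inverse: "openin (ztop Y) V \<Longrightarrow> f \<in> regs Y V \<Longrightarrow> (\<And>x. x \<in> V \<Longrightarrow> f x \<noteq> 0) \<Longrightarrow> (\<lambda>x. inverse (f x)) \<in> regs Y V"
    and reg_restrict: "openin (ztop Y) V \<Longrightarrow> f \<in> regs Y V \<Longrightarrow> openin (ztop Y) W \<Longrightarrow> W \<subseteq> V \<Longrightarrow> f \<in> regs Y W"
    and reg_nonzero_open: "openin (ztop Y) V \<Longrightarrow> f \<in> regs Y V \<Longrightarrow> openin (ztop Y) {x \<in> V. f x \<noteq> 0}"

lemma ploc_frac_restrict: "ploc_frac n V f \<Longrightarrow> W \<subseteq> V \<Longrightarrow> ploc_frac n W f"
  unfolding ploc_frac_def by (meson subsetD)

lemma irr_fspace_projvar: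
  assumes "irreducible_space (ztop (projvar n Y))" and Y: "Y \<subseteq> proj_points n"
  shows "irr_fspace (projvar n Y)"
proof
  let ?T = "ztop (projvar n Y)"
  have VP: "V \<subseteq> proj_points n" if "openin ?T V" for V using openin_subset[OF that] by auto
  note iff = regs_proj_iff[OF VP]
  show "irreducible_space ?T" by fact
  fix V assume V: "openin ?T V"
  show "(\<lambda>x. c) \<in> regs (projvar n Y) V" for c
    unfolding iff[OF V] ploc_frac_def
  proof
    fix x
    show "\<exists>p q d. mp_homogeneous d p \<and> mp_homogeneous d q \<and> (\<forall>v\<in>x. mp_eval q v \<noteq> 0) \<and>
       (\<forall>y\<in>V. \<forall>v\<in>y. mp_eval q v \<noteq> 0 \<longrightarrow> c = mp_eval p v / mp_eval q v)"
      by (rule exI[of _ "mp_const c"], rule exI[of _ "mp_const 1"], rule exI[of _ 0]) (simp add: mp_homogeneous_const)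
  qed
  fix f assume f: "f \<in> regs (projvar n Y) V"
  then have fl: "ploc_frac n V f" unfolding iff[OF V] .
  show "f \<in> regs (projvar n Y) W" if W: "openin ?T W" "W \<subseteq> V" for W
    unfolding iff[OF W(1)] using fl W(2) by (rule ploc_frac_restrict)
  show "openin ?T {x \<in> V. f x \<noteq> 0}"
  proof (subst openin_subopen, intro ballI)
    fix x assume "x \<in> {x \<in> V. f x \<noteq> 0}"
    then have x: "x \<in> V" "f x \<noteq> 0" by auto
    obtain p q d where pq: "mp_homogeneous d p" "mp_homogeneous d q" "\<And>v. v \<in> x \<Longrightarrow> mp_eval q v \<noteq> 0"
      "\<And>y v. y \<in> V \<Longrightarrow> v \<in> y \<Longrightarrow> mp_eval q v \<noteq> 0 \<Longrightarrow> f y = mp_eval p v / mp_eval q v"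
      by (rule ploc_fracE[OF fl x(1)]) blast
    have "openin ?T (pbasic n (p * q) \<inter> Y)"
      unfolding ztop_subvar openin_subtopology using openin_pbasic[OF mp_homogeneous_mult[OF pq(1,2)]] by blast
    then have o: "openin ?T (pbasic n (p * q) \<inter> Y \<inter> V)" using V by (rule openin_Int)
    have "mp_eval (p * q) v \<noteq> 0" if "v \<in> x" for v
      using x(2) pq(3)[OF that] pq(4)[OF x(1) that] by (auto simp: mp_eval_mult)
    then have "x \<in> pbasic n (p * q)" using x(1) VP[OF V] by blast
    moreover have "x \<in> Y" using x(1) openin_subset[OF V] by auto
    moreover have "pbasic n (p * q) \<inter> Y \<inter> V \<subseteq> {x \<in> V. f x \<noteq> 0}"
    proof
      fix y assume y: "y \<in> pbasic n (p * q) \<inter> Y \<inter> V"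
      then obtain v where v: "v \<in> y" using proj_points_member[of y n] by auto
      then have "mp_eval p v \<noteq> 0" "mp_eval q v \<noteq> 0" using y by (auto simp: mp_eval_mult)
      then show "y \<in> {x \<in> V. f x \<noteq> 0}" using pq(4)[of y v] y v by auto
    qed
    ultimately show "\<exists>W. openin ?T W \<and> x \<in> W \<and> W \<subseteq> {x \<in> V. f x \<noteq> 0}"
      using o x(1) by (intro exI[of _ "pbasic n (p * q) \<inter> Y \<inter> V"]) auto
  qed
  show "(\<lambda>x. inverse (f x)) \<in> regs (projvar n Y) V" if nz: "\<And>x. x \<in> V \<Longrightarrow> f x \<noteq> 0"
    unfolding iff[OF V] ploc_frac_def
  proof
    fix x assume x: "x \<in> V"
    obtain p q d where pq: "mp_homogeneous d p" "mp_homogeneous d q" "\<And>v. v \<in> x \<Longrightarrow> mp_eval q v \<noteq> 0"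
      "\<And>y v. y \<in> V \<Longrightarrow> v \<in> y \<Longrightarrow> mp_eval q v \<noteq> 0 \<Longrightarrow> f y = mp_eval p v / mp_eval q v"
      by (rule ploc_fracE[OF fl x(1)]) blast
    show "\<exists>p q d. mp_homogeneous d p \<and> mp_homogeneous d q \<and> (\<forall>v\<in>x. mp_eval q v \<noteq> 0) \<and>
       (\<forall>y\<in>V. \<forall>v\<in>y. mp_eval q v \<noteq> 0 \<longrightarrow> inverse (f y) = mp_eval p v / mp_eval q v)"
    proof (rule exI[of _ "q * q"], rule exI[of _ "p * q"], rule exI[of _ "d + d"], intro conjI ballI impI)
      show "mp_homogeneous (d + d) (q * q)" "mp_homogeneous (d + d) (p * q)"
        by (rule mp_homogeneous_mult[OF pq(2,2)], rule mp_homogeneous_mult[OF pq(1,2)])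
      show "mp_eval (p * q) v \<noteq> 0" if "v \<in> x" for v using pq(3)[OF that] pq(4)[OF x that] nz[OF x] by (auto simp: mp_eval_mult)
      show "inverse (f y) = mp_eval (q * q) v / mp_eval (p * q) v" if "y \<in> V" "v \<in> y" "mp_eval (p * q) v \<noteq> 0" for y v
        using pq(4)[OF that(1,2)] that(3) by (auto simp: mp_eval_mult)
    qed
  qed
  fix g assume g: "g \<in> regs (projvar n Y) V"
  then have gl: "ploc_frac n V g" unfolding iff[OF V] .
  have comb: "\<exists>p r q d. mp_homogeneous d p \<and> mp_homogeneous d r \<and> mp_homogeneous d q \<and> (\<forall>v\<in>x. mp_eval q v \<noteq> 0) \<and>
       (\<forall>y\<in>V. \<forall>v\<in>y. mp_eval q v \<noteq> 0 \<longrightarrow> f y = mp_eval p v / mp_eval q v \<and> g y = mp_eval r v / mp_eval q v)" if x: "x \<in> V" for x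
  proof -
    obtain p q d where pq: "mp_homogeneous d p" "mp_homogeneous d q" "\<And>v. v \<in> x \<Longrightarrow> mp_eval q v \<noteq> 0"
      "\<And>y v. y \<in> V \<Longrightarrow> v \<in> y \<Longrightarrow> mp_eval q v \<noteq> 0 \<Longrightarrow> f y = mp_eval p v / mp_eval q v"
      by (rule ploc_fracE[OF fl x(1)]) blast
    obtain p' q' d' where pq': "mp_homogeneous d' p'" "mp_homogeneous d' q'" "\<And>v. v \<in> x \<Longrightarrow> mp_eval q' v \<noteq> 0"
      "\<And>y v. y \<in> V \<Longrightarrow> v \<in> y \<Longrightarrow> mp_eval q' v \<noteq> 0 \<Longrightarrow> g y = mp_eval p' v / mp_eval q' v"
      by (rule ploc_fracE[OF gl x(1)]) blast
    show ?thesis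
    proof (rule exI[of _ "p * q'"], rule exI[of _ "q * p'"], rule exI[of _ "q * q'"], rule exI[of _ "d + d'"], intro conjI ballI impI)
      show "mp_homogeneous (d + d') (p * q')" "mp_homogeneous (d + d') (q * p')" "mp_homogeneous (d + d') (q * q')"
        by (rule mp_homogeneous_mult[OF pq(1) pq'(2)], rule mp_homogeneous_mult[OF pq(2) pq'(1)],
            rule mp_homogeneous_mult[OF pq(2) pq'(2)])
      show "mp_eval (q * q') v \<noteq> 0" if "v \<in> x" for v using pq(3)[OF that] pq'(3)[OF that] by (simp add: mp_eval_mult)
      fix y v assume y: "y \<in> V" "v \<in> y" "mp_eval (q * q') v \<noteq> 0"
      then have "mp_eval q v \<noteq> 0" "mp_eval q' v \<noteq> 0" by (auto simp: mp_eval_mult)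
      then show "f y = mp_eval (p * q') v / mp_eval (q * q') v" "g y = mp_eval (q * p') v / mp_eval (q * q') v"
        using pq(4)[OF y(1,2)] pq'(4)[OF y(1,2)] by (simp_all add: mp_eval_mult)
    qed
  qed
  show "(\<lambda>x. f x + g x) \<in> regs (projvar n Y) V"
    unfolding iff[OF V] ploc_frac_def
  proof
    fix x assume x: "x \<in> V"
    obtain p r q d where c: "mp_homogeneous d p" "mp_homogeneous d r" "mp_homogeneous d q" "\<forall>v\<in>x. mp_eval q v \<noteq> 0"
       "\<forall>y\<in>V. \<forall>v\<in>y. mp_eval q v \<noteq> 0 \<longrightarrow> f y = mp_eval p v / mp_eval q v \<and> g y = mp_eval r v / mp_eval q v"
      using comb[OF x] by (elim exE conjE) (rule that)
    show "\<exists>p q d. mp_homogeneous d p \<and> mp_homogeneous d q \<and> (\<forall>v\<in>x. mp_eval q v \<noteq> 0) \<and>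
       (\<forall>y\<in>V. \<forall>v\<in>y. mp_eval q v \<noteq> 0 \<longrightarrow> f y + g y = mp_eval p v / mp_eval q v)"
      using c mp_homogeneous_add[OF c(1,2)]
      by (intro exI[of _ "p + r"] exI[of _ q] exI[of _ d]) (auto simp: mp_eval_add add_divide_distrib)
  qed
  show "(\<lambda>x. f x * g x) \<in> regs (projvar n Y) V"
    unfolding iff[OF V] ploc_frac_def
  proof
    fix x assume x: "x \<in> V"
    obtain p r q d where c: "mp_homogeneous d p" "mp_homogeneous d r" "mp_homogeneous d q" "\<forall>v\<in>x. mp_eval q v \<noteq> 0"
       "\<forall>y\<in>V. \<forall>v\<in>y. mp_eval q v \<noteq> 0 \<longrightarrow> f y = mp_eval p v / mp_eval q v \<and> g y = mp_eval r v / mp_eval q v"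
      using comb[OF x] by (elim exE conjE) (rule that)
    show "\<exists>p q d. mp_homogeneous d p \<and> mp_homogeneous d q \<and> (\<forall>v\<in>x. mp_eval q v \<noteq> 0) \<and>
       (\<forall>y\<in>V. \<forall>v\<in>y. mp_eval q v \<noteq> 0 \<longrightarrow> f y * g y = mp_eval p v / mp_eval q v)"
      using c mp_homogeneous_mult[OF c(1,2)] mp_homogeneous_mult[OF c(3,3)]
      by (intro exI[of _ "p * r"] exI[of _ "q * q"] exI[of _ "d + d"]) (auto simp: mp_eval_mult)
  qed
qed

section \<open>Values of rational functions at points\<close>

context irr_fspace
begin

lemma open_meet:
  assumes "openin (ztop Y) A" "openin (ztop Y) B" "A \<noteq> {}" "B \<noteq> {}" shows "A \<inter> B \<noteq> {}"
proof
  assume e: "A \<inter> B = {}"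
  have sub: "A \<subseteq> points Y" "B \<subseteq> points Y" using assms openin_subset by blast+
  have "(points Y - A) \<union> (points Y - B) = points Y" using e by blast
  moreover have "closedin (ztop Y) (points Y - A)" "closedin (ztop Y) (points Y - B)"
    using assms by (auto intro: closedin_diff)
  ultimately have "points Y - A = points Y \<or> points Y - B = points Y"
    using conjunct2[OF irr[unfolded irreducible_space_def]] by (elim allE impE) (intro conjI)
  then show False using sub assms(3,4) by blast
qed

lemma reg_polyf:
  assumes V: "openin (ztop Y) V" and G: "\<And>j. G j \<in> regs Y V"
  shows "f \<in> polyf W \<Longrightarrow> (\<lambda>y. f (\<lambda>j. G j y)) \<in> regs Y V"
  by (induction rule: polyf.induct) (auto intro: reg_const[OF V] G reg_add[OF V] reg_mult[OF V])

lemma reg_sum: "openin (ztop Y) V \<Longrightarrow> (\<And>j. j \<in> F \<Longrightarrow> f j \<in> regs Y V) \<Longrightarrow> (\<lambda>y. \<Sum>j\<in>F. f j y) \<in> regs Y V"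
  by (induction F rule: infinite_finite_induct) (auto intro: reg_const reg_add)

text \<open>The set where the two functions differ is open; if it were nonempty, it would meet
  \<open>W\<close> by irreducibility.\<close>

lemma reg_agree:
  assumes V: "openin (ztop Y) V" and fg: "f \<in> regs Y V" "g \<in> regs Y V"
    and W: "openin (ztop Y) W" "W \<noteq> {}" "W \<subseteq> V" "\<And>x. x \<in> W \<Longrightarrow> f x = g x" and x: "x \<in> V"
  shows "f x = g x"
proof (rule ccontr)
  assume ne: "f x \<noteq> g x"
  let ?h = "\<lambda>x. f x + (-1) * g x"
  have "?h \<in> regs Y V" by (intro reg_add reg_mult reg_const V fg)
  then have "openin (ztop Y) {x \<in> V. ?h x \<noteq> 0}" by (rule reg_nonzero_open[OF V])
  moreover have "{x \<in> V. ?h x \<noteq> 0} \<noteq> {}" using x ne by auto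
  ultimately have "{x \<in> V. ?h x \<noteq> 0} \<inter> W \<noteq> {}" using open_meet W by blast
  then show False using W(4) by auto
qed

text \<open>A relation, so that regularity, being a unit and the value are all handled by the same
  rules; the definite description \<open>rat_value\<close> is meaningful only where a value
  exists.\<close>

definition has_val :: "('p, 'k) ratfun \<Rightarrow> 'p \<Rightarrow> 'k \<Rightarrow> bool" where
  "has_val r x c \<longleftrightarrow> (\<exists>s\<in>ratfuns Y. rat_eq r s \<and> x \<in> fst s \<and> c = snd s x)"

lemma has_valE:
  assumes "has_val r x c"
  obtains s where "s \<in> ratfuns Y" "rat_eq r s" "x \<in> fst s" "c = snd s x"
  using assms unfolding has_val_def by (elim bexE conjE) (rule that)

lemma has_valI: "s \<in> ratfuns Y \<Longrightarrow> rat_eq r s \<Longrightarrow> x \<in> fst s \<Longrightarrow> c = snd s x \<Longrightarrow> has_val r x c"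
  unfolding has_val_def by (intro bexI conjI)

lemma rat_eqD: "rat_eq r s \<Longrightarrow> x \<in> fst r \<Longrightarrow> x \<in> fst s \<Longrightarrow> snd r x = snd s x"
  unfolding rat_eq_def by (erule bspec) simp

lemma ratfunsD: "s \<in> ratfuns Y \<Longrightarrow> openin (ztop Y) (fst s) \<and> fst s \<noteq> {} \<and> snd s \<in> regs Y (fst s)"
  by (auto simp: ratfuns_def)

lemma ratfunsI: "openin (ztop Y) U \<Longrightarrow> U \<noteq> {} \<Longrightarrow> f \<in> regs Y U \<Longrightarrow> (U, f) \<in> ratfuns Y"
  by (simp add: ratfuns_def)

text \<open>Representatives are compared only on the overlap of their domains, so this is not
  formal: \<open>s\<close> and \<open>t\<close> agree on the part of their overlap inside the domain
  of \<open>r\<close>, a nonempty open set, and hence on the whole overlap.\<close>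

lemma rat_eq_trans:
  assumes r: "r \<in> ratfuns Y" "s \<in> ratfuns Y" "t \<in> ratfuns Y" and eq: "rat_eq r s" "rat_eq r t"
  shows "rat_eq s t"
  unfolding rat_eq_def
proof
  fix x assume x: "x \<in> fst s \<inter> fst t"
  have o: "openin (ztop Y) (fst r)" "openin (ztop Y) (fst s)" "openin (ztop Y) (fst t)" and ne: "fst r \<noteq> {}"
    and g: "snd s \<in> regs Y (fst s)" "snd t \<in> regs Y (fst t)"
    using ratfunsD[OF r(1)] ratfunsD[OF r(2)] ratfunsD[OF r(3)] by simp_all
  have V: "openin (ztop Y) (fst s \<inter> fst t)" using o(2,3) by (rule openin_Int)
  show "snd s x = snd t x"
  proof (rule reg_agree[OF V _ _ _ _ _ _ x, of _ _ "fst r \<inter> (fst s \<inter> fst t)"])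
    show "snd s \<in> regs Y (fst s \<inter> fst t)" by (rule reg_restrict[OF o(2) g(1) V]) simp
    show "snd t \<in> regs Y (fst s \<inter> fst t)" by (rule reg_restrict[OF o(3) g(2) V]) simp
    show "openin (ztop Y) (fst r \<inter> (fst s \<inter> fst t))" by (rule openin_Int[OF o(1) V])
    show "fst r \<inter> (fst s \<inter> fst t) \<noteq> {}" by (rule open_meet[OF o(1) V ne]) (use x in blast)
    show "snd s y = snd t y" if "y \<in> fst r \<inter> (fst s \<inter> fst t)" for y
    proof -
      have "y \<in> fst r" "y \<in> fst s" "y \<in> fst t" using that by auto
      then show ?thesis using rat_eqD[OF eq(1), of y] rat_eqD[OF eq(2), of y] by simp
    qed
  qed blast
qed

lemma has_val_unique:
  assumes "r \<in> ratfuns Y" "has_val r x c" "has_val r x d" shows "c = d"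
proof -
  obtain s where s: "s \<in> ratfuns Y" "rat_eq r s" "x \<in> fst s" "c = snd s x" by (rule has_valE[OF assms(2)])
  obtain t where t: "t \<in> ratfuns Y" "rat_eq r t" "x \<in> fst t" "d = snd t x" by (rule has_valE[OF assms(3)])
  have "rat_eq s t" by (rule rat_eq_trans[OF assms(1) s(1) t(1) s(2) t(2)])
  then show ?thesis using rat_eqD[of s t x] s t by simp
qed

lemma rat_regular_iff: "rat_regular Y r x \<longleftrightarrow> (\<exists>c. has_val r x c)"
  unfolding rat_regular_def has_val_def by blast

lemma rat_unit_iff: "rat_unit Y r x \<longleftrightarrow> (\<exists>c. c \<noteq> 0 \<and> has_val r x c)"
  unfolding rat_unit_def has_val_def by blast

lemma rat_value_eq: "r \<in> ratfuns Y \<Longrightarrow> has_val r x c \<Longrightarrow> rat_value Y r x = c"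
  unfolding rat_value_def has_val_def[symmetric] using has_val_unique by (intro the_equality)

lemma has_val_cong:
  assumes "r \<in> ratfuns Y" "r' \<in> ratfuns Y" "rat_eq r r'" "has_val r x c" shows "has_val r' x c"
proof -
  obtain s where s: "s \<in> ratfuns Y" "rat_eq r s" "x \<in> fst s" "c = snd s x" by (rule has_valE[OF assms(4)])
  have "rat_eq r' s" by (rule rat_eq_trans[OF assms(1,2) s(1) assms(3) s(2)])
  then show ?thesis by (rule has_valI[OF s(1) _ s(3,4)])
qed

lemma has_val_self: "r \<in> ratfuns Y \<Longrightarrow> x \<in> fst r \<Longrightarrow> has_val r x (snd r x)"
  by (rule has_valI[of r]) (simp_all add: rat_eq_def)

lemma rat_mult_ratfuns:
  assumes "r \<in> ratfuns Y" "s \<in> ratfuns Y" shows "rat_mult r s \<in> ratfuns Y"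
proof -
  have o: "openin (ztop Y) (fst r)" "openin (ztop Y) (fst s)" and ne: "fst r \<noteq> {}" "fst s \<noteq> {}"
    and g: "snd r \<in> regs Y (fst r)" "snd s \<in> regs Y (fst s)"
    using ratfunsD[OF assms(1)] ratfunsD[OF assms(2)] by simp_all
  have V: "openin (ztop Y) (fst r \<inter> fst s)" by (rule openin_Int[OF o])
  show ?thesis unfolding rat_mult_def
    by (rule ratfunsI[OF V open_meet[OF o ne] reg_mult[OF V]])
       (rule reg_restrict[OF o(1) g(1) V] reg_restrict[OF o(2) g(2) V], simp)+
qed

lemma rat_div_ratfuns:
  assumes "r \<in> ratfuns Y" "s \<in> ratfuns Y" "rat_nonzero s" shows "rat_div r s \<in> ratfuns Y"
proof -
  have o: "openin (ztop Y) (fst r)" "openin (ztop Y) (fst s)" and ne: "fst r \<noteq> {}"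
    and g: "snd r \<in> regs Y (fst r)" "snd s \<in> regs Y (fst s)"
    using ratfunsD[OF assms(1)] ratfunsD[OF assms(2)] by simp_all
  let ?S = "{x \<in> fst s. snd s x \<noteq> 0}"
  have S: "openin (ztop Y) ?S" "?S \<noteq> {}" using reg_nonzero_open[OF o(2) g(2)] assms(3) by (auto simp: rat_nonzero_def)
  have W: "openin (ztop Y) (fst r \<inter> ?S)" "fst r \<inter> ?S \<noteq> {}"
    by (rule openin_Int[OF o(1) S(1)], rule open_meet[OF o(1) S(1) ne S(2)])
  have "(\<lambda>x. snd r x * inverse (snd s x)) \<in> regs Y (fst r \<inter> ?S)"
  proof (rule reg_mult[OF W(1)])
    show "snd r \<in> regs Y (fst r \<inter> ?S)" by (rule reg_restrict[OF o(1) g(1) W(1)]) simp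
    have "snd s \<in> regs Y (fst r \<inter> ?S)" by (rule reg_restrict[OF o(2) g(2) W(1)]) blast
    then show "(\<lambda>x. inverse (snd s x)) \<in> regs Y (fst r \<inter> ?S)" by (rule reg_inverse[OF W(1)]) simp
  qed
  then show ?thesis unfolding rat_div_def using W by (intro ratfunsI) (simp_all add: field_class.field_divide_inverse)
qed

lemma has_val_mult:
  assumes "has_val r x c" "has_val s x d" shows "has_val (rat_mult r s) x (c * d)"
proof -
  obtain r' where r: "r' \<in> ratfuns Y" "rat_eq r r'" "x \<in> fst r'" "c = snd r' x" by (rule has_valE[OF assms(1)])
  obtain s' where s: "s' \<in> ratfuns Y" "rat_eq s s'" "x \<in> fst s'" "d = snd s' x" by (rule has_valE[OF assms(2)])
  have "rat_eq (rat_mult r s) (rat_mult r' s')" unfolding rat_eq_def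
  proof
    fix y assume "y \<in> fst (rat_mult r s) \<inter> fst (rat_mult r' s')"
    then show "snd (rat_mult r s) y = snd (rat_mult r' s') y"
      using rat_eqD[OF r(2), of y] rat_eqD[OF s(2), of y] by (simp add: rat_mult_def)
  qed
  then show ?thesis
    by (rule has_valI[OF rat_mult_ratfuns[OF r(1) s(1)]]) (simp_all add: rat_mult_def r s)
qed

lemma has_val_div:
  assumes "has_val r x c" "has_val s x d" "d \<noteq> 0" shows "has_val (rat_div r s) x (c / d)"
proof -
  obtain r' where r: "r' \<in> ratfuns Y" "rat_eq r r'" "x \<in> fst r'" "c = snd r' x" by (rule has_valE[OF assms(1)])
  obtain s' where s: "s' \<in> ratfuns Y" "rat_eq s s'" "x \<in> fst s'" "d = snd s' x" by (rule has_valE[OF assms(2)])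
  have nz: "rat_nonzero s'" unfolding rat_nonzero_def using s assms(3) by (intro bexI[of _ x]) simp_all
  have "rat_eq (rat_div r s) (rat_div r' s')" unfolding rat_eq_def
  proof
    fix y assume "y \<in> fst (rat_div r s) \<inter> fst (rat_div r' s')"
    then show "snd (rat_div r s) y = snd (rat_div r' s') y"
      using rat_eqD[OF r(2), of y] rat_eqD[OF s(2), of y] by (simp add: rat_div_def)
  qed
  then show ?thesis
    by (rule has_valI[OF rat_div_ratfuns[OF r(1) s(1) nz]]) (use assms(3) r s in \<open>simp_all add: rat_div_def\<close>)
qed

lemma rat_lincomb_ratfuns:
  assumes "\<And>j. j \<le> n \<Longrightarrow> s j \<in> ratfuns Y" shows "rat_lincomb n c s \<in> ratfuns Y"
proof -
  note D = ratfunsD[OF assms]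
  have W: "openin (ztop Y) (\<Inter>j\<le>k. fst (s j)) \<and> (\<Inter>j\<le>k. fst (s j)) \<noteq> {}" if "k \<le> n" for k
    using that
  proof (induction k)
    case (Suc k)
    have "(\<Inter>j\<le>Suc k. fst (s j)) = fst (s (Suc k)) \<inter> (\<Inter>j\<le>k. fst (s j))" by (auto simp: atMost_Suc)
    then show ?case using Suc D[OF Suc.prems] open_meet[of "fst (s (Suc k))"] by auto
  qed (use D in auto)
  show ?thesis unfolding rat_lincomb_def
  proof (rule ratfunsI)
    show "(\<lambda>x. \<Sum>j\<le>n. c j * snd (s j) x) \<in> regs Y (\<Inter>j\<le>n. fst (s j))"
    proof (rule reg_sum)
      fix j assume j: "j \<in> {..n}"
      have "snd (s j) \<in> regs Y (\<Inter>j\<le>n. fst (s j))"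
        by (rule reg_restrict[of "fst (s j)"]) (use D[of j] j W[OF order_refl] in auto)
      then show "(\<lambda>y. c j * snd (s j) y) \<in> regs Y (\<Inter>j\<le>n. fst (s j))"
        using W[OF order_refl] by (intro reg_mult reg_const) auto
    qed (use W[OF order_refl] in blast)
  qed (use W[OF order_refl] in blast)+
qed

lemma has_val_lincomb:
  assumes "\<And>j. j \<le> n \<Longrightarrow> has_val (rat_mult (s j) h) x (v j)"
  shows "has_val (rat_mult (rat_lincomb n c s) h) x (\<Sum>j\<le>n. c j * v j)"
proof -
  have "\<forall>j. \<exists>t. j \<le> n \<longrightarrow> t \<in> ratfuns Y \<and> rat_eq (rat_mult (s j) h) t \<and> x \<in> fst t \<and> v j = snd t x"
    using assms unfolding has_val_def by blast
  then obtain t where t: "\<And>j. j \<le> n \<Longrightarrow> t j \<in> ratfuns Y \<and> rat_eq (rat_mult (s j) h) (t j) \<and> x \<in> fst (t j) \<and> v j = snd (t j) x"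
    by metis
  have "rat_lincomb n c t \<in> ratfuns Y" using t by (intro rat_lincomb_ratfuns) blast
  moreover have "rat_eq (rat_mult (rat_lincomb n c s) h) (rat_lincomb n c t)"
    unfolding rat_eq_def
  proof
    fix y assume y: "y \<in> fst (rat_mult (rat_lincomb n c s) h) \<inter> fst (rat_lincomb n c t)"
    have "snd (s j) y * snd h y = snd (t j) y" if "j \<le> n" for j
    proof -
      have "y \<in> fst (rat_mult (s j) h) \<inter> fst (t j)" using y that by (auto simp: rat_mult_def rat_lincomb_def)
      then have "snd (rat_mult (s j) h) y = snd (t j) y" using t[OF that] unfolding rat_eq_def by blast
      then show ?thesis by (simp add: rat_mult_def)
    qed
    then show "snd (rat_mult (rat_lincomb n c s) h) y = snd (rat_lincomb n c t) y"
      by (simp add: rat_mult_def rat_lincomb_def sum_distrib_right mult.assoc)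
  qed
  moreover have "x \<in> fst (rat_lincomb n c t)" "(\<Sum>j\<le>n. c j * v j) = snd (rat_lincomb n c t) x"
    using t by (auto simp: rat_lincomb_def)
  ultimately show ?thesis unfolding has_val_def by blast
qed

end

lemma isomorphismE:
  assumes "isomorphism X Y \<phi>"
  obtains \<psi> where "morphism X Y \<phi>" "morphism Y X \<psi>" "\<forall>x\<in>points X. \<psi> (\<phi> x) = x" "\<forall>y\<in>points Y. \<phi> (\<psi> y) = y"
  using assms unfolding isomorphism_def by (elim conjE exE) (rule that)

lemma morphism_points:
  assumes "morphism X Y \<phi>" "x \<in> points X" shows "\<phi> x \<in> points Y"
proof -
  have "\<phi> \<in> points X \<rightarrow> points Y" using assms(1) by (simp add: morphism_def continuous_map_def)
  then show ?thesis using assms(2) by (rule funcset_mem)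
qed

lemma morphism_regs:
  "morphism X Y \<phi> \<Longrightarrow> openin (ztop Y) V \<Longrightarrow> g \<in> regs Y V \<Longrightarrow> g \<circ> \<phi> \<in> regs X {x \<in> points X. \<phi> x \<in> V}"
  by (simp add: morphism_def)

section \<open>Sections and divisors\<close>

context irr_fspace
begin

definition sec_val :: "('p, 'k) divisor \<Rightarrow> nat \<Rightarrow> (nat \<Rightarrow> ('p, 'k) ratfun) \<Rightarrow> 'p \<Rightarrow> nat \<Rightarrow> 'k" where
  "sec_val H n s y j = (if j \<le> n then rat_value Y (rat_mult (s j) (H y)) y else 0)"

lemma linsys_map_sec_val: "linsys_map Y H n s = (\<lambda>y. proj_point (sec_val H n s y))"
  by (rule ext) (simp add: linsys_map_def sec_val_def[abs_def])

lemma rat_eq_sym: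
  assumes "rat_eq r s" shows "rat_eq s r"
  unfolding rat_eq_def
proof
  fix x assume "x \<in> fst s \<inter> fst r"
  then show "snd s x = snd r x" using rat_eqD[OF assms, of x] by simp
qed

lemma rat_eq_mult:
  assumes "rat_eq r s" shows "rat_eq (rat_mult r h) (rat_mult s h)"
  unfolding rat_eq_def
proof
  fix x assume "x \<in> fst (rat_mult r h) \<inter> fst (rat_mult s h)"
  then show "snd (rat_mult r h) x = snd (rat_mult s h) x" using rat_eqD[OF assms, of x] by (simp add: rat_mult_def)
qed

lemma cartierD: "cartier Y H \<Longrightarrow> y \<in> points Y \<Longrightarrow> H y \<in> ratfuns Y \<and> rat_nonzero (H y)"
  by (simp add: cartier_def)

lemma sectionsD: "r \<in> sections Y H \<Longrightarrow> r \<in> ratfuns Y \<and> (\<forall>y\<in>points Y. rat_regular Y (rat_mult r (H y)) y)"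
  by (simp add: sections_def)

lemma basisD: "section_basis Y H n s \<Longrightarrow> j \<le> n \<Longrightarrow> s j \<in> sections Y H"
  by (simp add: section_basis_def)

context
  fixes H n s
  assumes H: "cartier Y H" and s: "section_basis Y H n s"
begin

lemma basis_ratfun: "j \<le> n \<Longrightarrow> s j \<in> ratfuns Y"
  using basisD[OF s] sectionsD by blast

lemma has_val_basis:
  assumes "y \<in> points Y" "j \<le> n" shows "has_val (rat_mult (s j) (H y)) y (sec_val H n s y j)"
proof -
  have sj: "s j \<in> sections Y H" using basisD[OF s assms(2)] .
  then have "rat_regular Y (rat_mult (s j) (H y)) y" using sectionsD assms(1) by blast
  then obtain c where c: "has_val (rat_mult (s j) (H y)) y c" unfolding rat_regular_iff by blast
  have "rat_mult (s j) (H y) \<in> ratfuns Y"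
    using sectionsD[OF sj] cartierD[OF H assms(1)] by (intro rat_mult_ratfuns) simp_all
  then show ?thesis using rat_value_eq[OF _ c] c assms(2) by (simp add: sec_val_def)
qed

lemma has_val_lin:
  assumes y: "y \<in> points Y" and r: "r \<in> ratfuns Y" "rat_eq r (rat_lincomb n c s)"
  shows "has_val (rat_mult r (H y)) y (lin (Suc n) c (sec_val H n s y))"
proof -
  have Hy: "H y \<in> ratfuns Y" using cartierD[OF H y] by simp
  have L: "rat_lincomb n c s \<in> ratfuns Y" using basis_ratfun by (rule rat_lincomb_ratfuns)
  have "has_val (rat_mult (rat_lincomb n c s) (H y)) y (\<Sum>j\<le>n. c j * sec_val H n s y j)"
    using has_val_basis[OF y] by (rule has_val_lincomb)
  moreover have "rat_eq (rat_mult (rat_lincomb n c s) (H y)) (rat_mult r (H y))"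
    by (rule rat_eq_mult[OF rat_eq_sym[OF r(2)]])
  ultimately have "has_val (rat_mult r (H y)) y (\<Sum>j\<le>n. c j * sec_val H n s y j)"
    by (intro has_val_cong[OF rat_mult_ratfuns[OF L Hy] rat_mult_ratfuns[OF r(1) Hy]])
  then show ?thesis by (simp add: lin_def lessThan_Suc_atMost)
qed

lemma section_lincomb: "r \<in> sections Y H \<Longrightarrow> \<exists>c. rat_eq r (rat_lincomb n c s)"
  using s by (simp add: section_basis_def)

text \<open>The local equations of \<open>H\<close> change from point to point, but near a fixed
  \<open>x\<close> they differ from \<open>H x\<close> by units. At a nearby \<open>z\<close> where
  neither a nonzero combination nor \<open>H x\<close> vanishes, the combination trivialised by
  \<open>H z\<close> has a nonzero value; irreducibility provides such a \<open>z\<close>.\<close>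

lemma sec_val_span:
  assumes zero: "\<And>y. y \<in> points Y \<Longrightarrow> lin (Suc n) c (sec_val H n s y) = 0"
  shows "\<forall>j\<le>n. c j = 0"
proof (rule ccontr)
  assume "\<not> ?thesis"
  then have nz: "rat_nonzero (rat_lincomb n c s)" using s unfolding section_basis_def by blast
  let ?R = "rat_lincomb n c s"
  have R: "?R \<in> ratfuns Y" using basis_ratfun by (rule rat_lincomb_ratfuns)
  have "points Y \<noteq> {}" using irr by (simp add: irreducible_space_def)
  then obtain x where x: "x \<in> points Y" by blast
  have Hx: "H x \<in> ratfuns Y" "rat_nonzero (H x)" using cartierD[OF H x] by simp_all
  obtain V where V: "openin (ztop Y) V" "x \<in> V" "\<forall>z\<in>V. rat_unit Y (rat_div (H z) (H x)) z"
    using H x unfolding cartier_def by blast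
  let ?A = "{z \<in> fst ?R. snd ?R z \<noteq> 0}" and ?B = "{z \<in> fst (H x). snd (H x) z \<noteq> 0}"
  have A: "openin (ztop Y) ?A" "?A \<noteq> {}" using ratfunsD[OF R] nz by (auto simp: rat_nonzero_def intro: reg_nonzero_open)
  have B: "openin (ztop Y) ?B" "?B \<noteq> {}" using ratfunsD[OF Hx(1)] Hx(2) by (auto simp: rat_nonzero_def intro: reg_nonzero_open)
  have "V \<inter> (?A \<inter> ?B) \<noteq> {}"
    using V(2) by (intro open_meet[OF V(1) openin_Int[OF A(1) B(1)] _ open_meet[OF A(1) B(1) A(2) B(2)]]) blast
  then obtain z where z: "z \<in> V" "z \<in> fst ?R" "snd ?R z \<noteq> 0" "z \<in> fst (H x)" "snd (H x) z \<noteq> 0" by blast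
  have zY: "z \<in> points Y" using z(1) openin_subset[OF V(1)] by blast
  have Hz: "H z \<in> ratfuns Y" using cartierD[OF H zY] by simp
  obtain u where u: "u \<noteq> 0" "has_val (rat_div (H z) (H x)) z u" using V(3) z(1) unfolding rat_unit_iff by blast
  have "has_val (rat_mult ?R (H x)) z (snd ?R z * snd (H x) z)"
    by (rule has_val_mult[OF has_val_self[OF R z(2)] has_val_self[OF Hx(1) z(4)]])
  then have v: "has_val (rat_mult (rat_mult ?R (H x)) (rat_div (H z) (H x))) z (snd ?R z * snd (H x) z * u)"
    using u(2) by (rule has_val_mult)
  have eq: "rat_eq (rat_mult (rat_mult ?R (H x)) (rat_div (H z) (H x))) (rat_mult ?R (H z))"
    unfolding rat_eq_def
  proof
    fix w assume "w \<in> fst (rat_mult (rat_mult ?R (H x)) (rat_div (H z) (H x))) \<inter> fst (rat_mult ?R (H z))"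
    then have "snd (H x) w \<noteq> 0" by (simp add: rat_mult_def rat_div_def)
    then show "snd (rat_mult (rat_mult ?R (H x)) (rat_div (H z) (H x))) w = snd (rat_mult ?R (H z)) w"
      by (simp add: rat_mult_def rat_div_def)
  qed
  have "has_val (rat_mult ?R (H z)) z (snd ?R z * snd (H x) z * u)"
    by (rule has_val_cong[OF rat_mult_ratfuns[OF rat_mult_ratfuns[OF R Hx(1)] rat_div_ratfuns[OF Hz Hx]]
          rat_mult_ratfuns[OF R Hz] eq v])
  moreover have "has_val (rat_mult ?R (H z)) z (lin (Suc n) c (sec_val H n s z))"
    by (rule has_val_lin[OF zY R]) (simp add: rat_eq_def)
  ultimately have "snd ?R z * snd (H x) z * u = lin (Suc n) c (sec_val H n s z)"
    by (rule has_val_unique[OF rat_mult_ratfuns[OF R Hz]])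
  then show False using z u(1) zero[OF zY] by simp
qed

text \<open>If \<open>D = div r + H\<close> is effective, then \<open>r\<close> is a section of \<open>O(H)\<close> and \<open>D\<close> is its zero
  divisor.\<close>

lemma support_linear_form:
  assumes D: "cartier Y D" "effective Y D" "lin_equiv Y D H"
  obtains c where "\<And>y. y \<in> points Y \<Longrightarrow> lin (Suc n) c (sec_val H n s y) \<noteq> 0 \<longleftrightarrow> y \<notin> div_support Y D"
proof -
  obtain r where r: "r \<in> ratfuns Y" "rat_nonzero r"
    "\<And>x. x \<in> points Y \<Longrightarrow> rat_unit Y (rat_div (D x) (rat_mult r (H x))) x"
    using D(3) unfolding lin_equiv_def by blast
  \<comment> \<open>Linear equivalence makes \<open>D y\<close> a unit times \<open>r * H y\<close>,
    so the two are regular together and vanish together.\<close>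
  have key: "\<exists>d e. has_val (D y) y d \<and> has_val (rat_mult r (H y)) y e \<and> (e \<noteq> 0 \<longleftrightarrow> d \<noteq> 0)" if y: "y \<in> points Y" for y
  proof -
    let ?E = "rat_mult r (H y)"
    have Dy: "D y \<in> ratfuns Y" "rat_nonzero (D y)" using cartierD[OF D(1) y] by simp_all
    have Hy: "H y \<in> ratfuns Y" "rat_nonzero (H y)" using cartierD[OF H y] by simp_all
    have E: "?E \<in> ratfuns Y" using r(1) Hy(1) by (rule rat_mult_ratfuns)
    have nonzero_mult: "rat_nonzero (rat_mult a b)"
      if ab: "a \<in> ratfuns Y" "rat_nonzero a" "b \<in> ratfuns Y" "rat_nonzero b" for a b
    proof -
      let ?A = "{z \<in> fst a. snd a z \<noteq> 0}" and ?B = "{z \<in> fst b. snd b z \<noteq> 0}"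
      have A: "openin (ztop Y) ?A" "?A \<noteq> {}" using ratfunsD[OF ab(1)] ab(2) by (auto simp: rat_nonzero_def intro: reg_nonzero_open)
      have B: "openin (ztop Y) ?B" "?B \<noteq> {}" using ratfunsD[OF ab(3)] ab(4) by (auto simp: rat_nonzero_def intro: reg_nonzero_open)
      obtain z where "z \<in> ?A \<inter> ?B" using open_meet[OF A(1) B(1) A(2) B(2)] by blast
      then show ?thesis unfolding rat_nonzero_def by (intro bexI[of _ z]) (auto simp: rat_mult_def)
    qed
    have nE: "rat_nonzero ?E" using nonzero_mult[OF r(1,2) Hy] .
    have DE: "rat_div (D y) ?E \<in> ratfuns Y" using rat_div_ratfuns[OF Dy(1) E nE] .
    have "rat_nonzero (rat_mult (D y) ?E)" using nonzero_mult[OF Dy E nE] .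
    then obtain z where "z \<in> fst (rat_mult (D y) ?E)" "snd (rat_mult (D y) ?E) z \<noteq> 0" unfolding rat_nonzero_def by blast
    then have "z \<in> fst (D y) \<inter> fst ?E" "snd (D y) z \<noteq> 0" "snd ?E z \<noteq> 0" unfolding rat_mult_def[of "D y"] by simp_all
    then have nDE: "rat_nonzero (rat_div (D y) ?E)"
      unfolding rat_nonzero_def by (intro bexI[of _ z]) (simp_all add: rat_div_def)
    obtain d where d: "has_val (D y) y d" using D(2) y unfolding effective_def rat_regular_iff by blast
    obtain u where u: "u \<noteq> 0" "has_val (rat_div (D y) ?E) y u" using r(3)[OF y] unfolding rat_unit_iff by blast
    \<comment> \<open>\<open>r * H\<close> is recovered as \<open>D\<close> divided by the unit
      \<open>D / (r * H)\<close>, which shows that it is regular at \<open>y\<close> and gives its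
      value.\<close>
    have "has_val (rat_div (D y) (rat_div (D y) ?E)) y (d / u)" using d u(2,1) by (rule has_val_div)
    moreover have "rat_eq (rat_div (D y) (rat_div (D y) ?E)) ?E"
      unfolding rat_eq_def
    proof
      fix w assume "w \<in> fst (rat_div (D y) (rat_div (D y) ?E)) \<inter> fst ?E"
      then have "snd (D y) w / snd ?E w \<noteq> 0" by (simp add: rat_div_def)
      then show "snd (rat_div (D y) (rat_div (D y) ?E)) w = snd ?E w" by (simp add: rat_div_def)
    qed
    ultimately have "has_val ?E y (d / u)"
      by (intro has_val_cong[OF rat_div_ratfuns[OF Dy(1) DE nDE] E])
    then show ?thesis using d u(1) by (intro exI[of _ d] exI[of _ "d / u"]) simp
  qed
  have "r \<in> sections Y H"
    unfolding sections_def using r(1) key by (auto simp: rat_regular_iff)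
  then obtain c where c: "rat_eq r (rat_lincomb n c s)" using section_lincomb by blast
  have "lin (Suc n) c (sec_val H n s y) \<noteq> 0 \<longleftrightarrow> y \<notin> div_support Y D" if y: "y \<in> points Y" for y
  proof -
    have Dy: "D y \<in> ratfuns Y" using cartierD[OF D(1) y] by simp
    have E: "rat_mult r (H y) \<in> ratfuns Y" using r(1) cartierD[OF H y] by (intro rat_mult_ratfuns) simp_all
    obtain d e where de: "has_val (D y) y d" "has_val (rat_mult r (H y)) y e" "e \<noteq> 0 \<longleftrightarrow> d \<noteq> 0" using key[OF y] by blast
    have "lin (Suc n) c (sec_val H n s y) = e" using has_val_unique[OF E has_val_lin[OF y r(1) c] de(2)] .
    moreover have "rat_unit Y (D y) y \<longleftrightarrow> d \<noteq> 0"
      unfolding rat_unit_iff using has_val_unique[OF Dy _ de(1)] de(1) by blast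
    ultimately show ?thesis using de(3) y by (simp add: div_support_def)
  qed
  then show thesis by (rule that)
qed

end

text \<open>Each section of one basis is a combination of the other, and as both are trivialised at
  \<open>y\<close> by the same \<open>H y\<close>, the coefficients do not depend on
  \<open>y\<close>.\<close>

lemma sec_val_change_basis:
  assumes H: "cartier Y H" and s: "section_basis Y H n s" and s': "section_basis Y H n' s'"
  obtains A where "\<And>y j. y \<in> points Y \<Longrightarrow> sec_val H n s y j = lin (Suc n') (A j) (sec_val H n' s' y)"
proof -
  have "\<exists>c. \<forall>y\<in>points Y. sec_val H n s y j = lin (Suc n') c (sec_val H n' s' y)" for j
  proof (cases "j \<le> n")
    case True
    have sj: "s j \<in> sections Y H" using basisD[OF s True] .
    then have rj: "s j \<in> ratfuns Y" using sectionsD by blast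
    obtain c where c: "rat_eq (s j) (rat_lincomb n' c s')" using section_lincomb[OF H s' sj] by blast
    have "sec_val H n s y j = lin (Suc n') c (sec_val H n' s' y)" if y: "y \<in> points Y" for y
    proof (rule has_val_unique)
      show "rat_mult (s j) (H y) \<in> ratfuns Y" using rj cartierD[OF H y] by (intro rat_mult_ratfuns) simp_all
      show "has_val (rat_mult (s j) (H y)) y (sec_val H n s y j)" by (rule has_val_basis[OF H s y True])
      show "has_val (rat_mult (s j) (H y)) y (lin (Suc n') c (sec_val H n' s' y))" by (rule has_val_lin[OF H s' y rj c])
    qed
    then show ?thesis by blast
  next
    case False
    then show ?thesis by (intro exI[of _ "\<lambda>k. 0"]) (simp add: sec_val_def lin_def)
  qed
  then show thesis using that by metis
qed

end

section \<open>The cone over an embedded projective variety\<close>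

text \<open>\<open>u y\<close> and \<open>u' y\<close> are the values at \<open>y\<close> of two bases of sections: the one that defines the cone,
  and the one for which the linear system is known to be an embedding.\<close>

locale embedded_cone = irr_fspace "projvar m Y"
  for m :: nat and Y :: "(nat \<Rightarrow> 'k::{alg_closed_field, field_char_0}) set set" +
  fixes n n' :: nat and u u' :: "(nat \<Rightarrow> 'k) set \<Rightarrow> nat \<Rightarrow> 'k" and A B :: "nat \<Rightarrow> nat \<Rightarrow> 'k"
  assumes Y: "Y \<subseteq> proj_points m"
    and u_aff: "u y \<in> affine_points (Suc n)" and u'_aff: "u' y \<in> affine_points (Suc n')"
    and A: "y \<in> Y \<Longrightarrow> u y j = lin (Suc n') (A j) (u' y)" and B: "y \<in> Y \<Longrightarrow> u' y k = lin (Suc n) (B k) (u y)"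
    and emb: "closed_embedding (projvar m Y) n' (\<lambda>y. proj_point (u' y))"
begin

definition "X = insert (\<lambda>i. 0) (\<Union>y\<in>Y. proj_point (u y))"
definition "C' = (\<lambda>y. proj_point (u' y)) ` Y"
definition "Bm x = (\<lambda>k. if k < Suc n' then lin (Suc n) (B k) x else 0)"

lemma pts: "points (projvar m Y) = Y" using Y by auto

lemma Y_nonempty: "Y \<noteq> {}" using irr unfolding irreducible_space_def pts by simp

lemma C'_closed: "closedin (ztop (proj_space n')) C'"
  using emb unfolding closed_embedding_def pts C'_def by simp

lemma C'_sub: "C' \<subseteq> proj_points n'" using closedin_subset[OF C'_closed] by simp

lemma Bm_u: "y \<in> Y \<Longrightarrow> Bm (\<lambda>i. c * u y i) = (\<lambda>k. c * u' y k)"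
  using B[of y] u'_aff[of y] by (auto simp: Bm_def lin_scale affine_points_def)

lemma Bm_affine: "Bm x \<in> affine_points (Suc n')"
  by (simp add: Bm_def affine_points_def)

lemma Bm_polyf: "f \<in> polyf V \<Longrightarrow> (\<lambda>x. f (Bm x)) \<in> polyf {..<Suc n}"
proof -
  assume f: "f \<in> polyf V"
  have "(\<lambda>x. f (\<lambda>k. (if k < Suc n' then lin (Suc n) (B k) else (\<lambda>x. 0)) x)) \<in> polyf {..<Suc n}"
    by (rule polyf_subst[OF f]) (auto intro: lin_polyf polyf.const)
  moreover have "(\<lambda>k. (if k < Suc n' then lin (Suc n) (B k) else (\<lambda>x. 0)) x) = Bm x" for x
    by (auto simp: Bm_def)
  ultimately show ?thesis by simp
qed

lemma X_iff: "x \<in> X \<longleftrightarrow> (\<exists>y\<in>Y. \<exists>c. x = (\<lambda>i. c * u y i))"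
proof
  assume "x \<in> X"
  then consider "x = (\<lambda>i. 0)" | y where "y \<in> Y" "x \<in> proj_point (u y)" unfolding X_def by blast
  then show "\<exists>y\<in>Y. \<exists>c. x = (\<lambda>i. c * u y i)"
  proof cases
    case 1
    obtain y where "y \<in> Y" using Y_nonempty by blast
    then show ?thesis using 1 by (intro bexI[of _ y] exI[of _ 0]) simp_all
  next
    case 2
    then show ?thesis by (auto elim!: proj_pointE)
  qed
next
  assume "\<exists>y\<in>Y. \<exists>c. x = (\<lambda>i. c * u y i)"
  then obtain y c where y: "y \<in> Y" "x = (\<lambda>i. c * u y i)" by blast
  show "x \<in> X"
  proof (cases "c = 0")
    case False
    then have "x \<in> proj_point (u y)" unfolding proj_point_def using y(2) by blast
    then show ?thesis using y(1) unfolding X_def by blast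
  qed (use y in \<open>simp add: X_def\<close>)
qed

lemma X_cone: "x \<in> X \<Longrightarrow> (\<lambda>i. c * x i) \<in> X"
proof -
  assume "x \<in> X"
  then obtain y d where y: "y \<in> Y" "x = (\<lambda>i. d * u y i)" unfolding X_iff by blast
  then have "(\<lambda>i. c * x i) = (\<lambda>i. (c * d) * u y i)" by (simp add: mult.assoc)
  then show ?thesis unfolding X_iff using y(1) by blast
qed

lemma X_sub: "X \<subseteq> affine_points (Suc n)"
  using u_aff unfolding X_iff subset_iff by (auto simp: affine_points_def)

text \<open>\<open>F\<close> says that \<open>Bm x\<close> lies over the closed image
  \<open>C'\<close> or is zero, \<open>F'\<close> that \<open>x\<close> is recovered from
  \<open>Bm x\<close> by \<open>A\<close>. Together they make \<open>x\<close> a multiple of some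
  \<open>u y\<close>.\<close>

lemma X_closed: "closedin (ztop (affine_space (Suc n))) X"
proof -
  define F where "F = {(\<lambda>x. mp_eval p (Bm x)) | p d. mp_homogeneous d p \<and> (\<forall>y\<in>Y. mp_eval p (u' y) = 0)}"
  define F' where "F' = (\<lambda>j x. lin (Suc n') (A j) (Bm x) - x j) ` {..<Suc n}"
  have FF: "F \<union> F' \<subseteq> polyf {..<Suc n}"
  proof
    fix f assume "f \<in> F \<union> F'"
    then consider p where "f = (\<lambda>x. mp_eval p (Bm x))" | j where "j < Suc n" "f = (\<lambda>x. lin (Suc n') (A j) (Bm x) - x j)"
      unfolding F_def F'_def by blast
    then show "f \<in> polyf {..<Suc n}"
    proof cases
      case 1
      then show ?thesis using Bm_polyf[OF mp_eval_polyf] by simp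
    next
      case 2
      then show ?thesis using Bm_polyf[OF lin_polyf] by (auto intro!: polyf_diff polyf.var)
    qed
  qed
  have "X = vanishing (Suc n) (F \<union> F')"
  proof (intro equalityI subsetI)
    fix x assume x: "x \<in> X"
    then obtain y c where y: "y \<in> Y" "x = (\<lambda>i. c * u y i)" unfolding X_iff by blast
    have Bx: "Bm x = (\<lambda>k. c * u' y k)" using Bm_u[OF y(1)] y(2) by simp
    have "f x = 0" if f: "f \<in> F" for f
    proof -
      obtain p d where p: "f = (\<lambda>x. mp_eval p (Bm x))" "mp_homogeneous d p" "\<forall>y\<in>Y. mp_eval p (u' y) = 0"
        using f unfolding F_def by blast
      show ?thesis unfolding p(1) Bx using mp_homogeneous_eval[OF p(2)] p(3) y(1) by simp
    qed
    moreover have "f x = 0" if f: "f \<in> F'" for f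
    proof -
      obtain j where j: "f = (\<lambda>x. lin (Suc n') (A j) (Bm x) - x j)" using f unfolding F'_def by blast
      have "lin (Suc n') (A j) (Bm x) = c * lin (Suc n') (A j) (u' y)" unfolding Bx by (rule lin_scale)
      moreover have "x j = c * u y j" using y(2) by simp
      ultimately show ?thesis unfolding j using A[OF y(1), of j] by simp
    qed
    ultimately show "x \<in> vanishing (Suc n) (F \<union> F')" using x X_sub by (auto simp: vanishing_def)
  next
    fix x assume x: "x \<in> vanishing (Suc n) (F \<union> F')"
    have xa: "x \<in> affine_points (Suc n)" and x0: "\<forall>f\<in>F \<union> F'. f x = 0" using x unfolding vanishing_def by blast+
    have AB: "x j = lin (Suc n') (A j) (Bm x)" if "j < Suc n" for j
    proof -
      have "(\<lambda>x. lin (Suc n') (A j) (Bm x) - x j) \<in> F \<union> F'" unfolding F'_def using that by blast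
      from bspec[OF x0 this] have "lin (Suc n') (A j) (Bm x) - x j = 0" .
      then show ?thesis by simp
    qed
    show "x \<in> X"
    proof (cases "Bm x = (\<lambda>k. 0)")
      case True
      then have "x j = 0" if "j < Suc n" for j using AB[OF that] by (simp add: lin_def)
      then have "x = (\<lambda>i. 0)" using xa by (auto simp: affine_points_def fun_eq_iff not_less[symmetric])
      then show ?thesis by (simp add: X_def)
    next
      case False
      let ?v = "Bm x"
      have pv: "proj_point ?v \<in> proj_points n'" using False Bm_affine by (auto simp: proj_points_def)
      have "proj_point ?v \<in> C'"
      proof (rule ccontr)
        assume "proj_point ?v \<notin> C'"
        then have pC: "proj_point ?v \<in> proj_points n' - C'" using pv by blast
        have o: "openin (ztop (proj_space n')) (proj_points n' - C')" using C'_closed by (simp add: closedin_def)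
        obtain p d where p: "mp_homogeneous d p" "proj_point ?v \<in> pbasic n' p" "pbasic n' p \<subseteq> proj_points n' - C'"
          using bspec[OF o[unfolded openin_proj] pC] by (elim exE conjE) (rule that)
        have "mp_eval p (u' y) = 0" if y: "y \<in> Y" for y
        proof (rule ccontr)
          assume "mp_eval p (u' y) \<noteq> 0"
          then have "\<forall>w\<in>proj_point (u' y). mp_eval p w \<noteq> 0" using hom_nonzero_proj_point[OF p(1)] by blast
          moreover have yC: "proj_point (u' y) \<in> C'" using y by (simp add: C'_def)
          ultimately have "proj_point (u' y) \<in> pbasic n' p" using C'_sub by blast
          then show False using p(3) yC by blast
        qed
        then have "(\<lambda>x. mp_eval p (Bm x)) \<in> F \<union> F'" unfolding F_def using p(1) by blast
        from bspec[OF x0 this] have "mp_eval p (Bm x) = 0" .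
        then show False using p(2) proj_point_self[of ?v] by blast
      qed
      then obtain y where y: "y \<in> Y" "proj_point ?v = proj_point (u' y)" unfolding C'_def by blast
      then have "?v \<in> proj_point (u' y)" using proj_point_self[of ?v] by simp
      then obtain c where c: "?v = (\<lambda>i. c * u' y i)" by (rule proj_pointE)
      have "x = (\<lambda>i. c * u y i)"
      proof
        fix j
        show "x j = c * u y j"
        proof (cases "j < Suc n")
          case True
          then show ?thesis using AB[OF True] A[OF y(1), of j] unfolding c by (simp add: lin_scale)
        next
          case False
          then show ?thesis using xa u_aff[of y] by (simp add: affine_points_def)
        qed
      qed
      then show ?thesis unfolding X_iff using y(1) by blast
    qed
  qed
  then show ?thesis using closedin_vanishing[OF FF] by simp
qed

text \<open>The transpose of \<open>A\<close>: the linear form \<open>lc\<close> rewritten in the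
  coordinates \<open>u'\<close> in which the embedding is known.\<close>

definition "pull lc = (\<lambda>k. \<Sum>j<Suc n. lc j * A j k)"

lemma lin_pull: "y \<in> Y \<Longrightarrow> lin (Suc n') (pull lc) (u' y) = lin (Suc n) lc (u y)"
proof -
  assume y: "y \<in> Y"
  have "lin (Suc n') (pull lc) (u' y) = (\<Sum>k<Suc n'. \<Sum>j<Suc n. lc j * A j k * u' y k)"
    by (simp add: lin_def pull_def sum_distrib_right del: sum.lessThan_Suc)
  also have "\<dots> = (\<Sum>j<Suc n. \<Sum>k<Suc n'. lc j * A j k * u' y k)" by (rule sum.swap)
  also have "\<dots> = (\<Sum>j<Suc n. lc j * lin (Suc n') (A j) (u' y))"
    by (simp add: lin_def sum_distrib_left mult.assoc del: sum.lessThan_Suc)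
  also have "\<dots> = lin (Suc n) lc (u y)" unfolding lin_def[of "Suc n"] by (simp add: A[OF y, symmetric] del: sum.lessThan_Suc)
  finally show ?thesis .
qed

lemma emb_iso: "isomorphism (projvar m Y) (projvar n' C') (\<lambda>y. proj_point (u' y))"
  using emb unfolding closed_embedding_def pts C'_def by (rule conjunct2)

lemma emb_morphism: "morphism (projvar m Y) (projvar n' C') (\<lambda>y. proj_point (u' y))"
  by (rule isomorphismE[OF emb_iso])

lemma emb_inverse:
  obtains \<Psi> where "morphism (projvar n' C') (projvar m Y) \<Psi>" "\<forall>y\<in>Y. \<Psi> (proj_point (u' y)) = y"
proof -
  obtain \<psi> where "morphism (projvar n' C') (projvar m Y) \<psi>" "\<forall>x\<in>points (projvar m Y). \<psi> (proj_point (u' x)) = x"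
    by (rule isomorphismE[OF emb_iso])
  then show thesis unfolding pts by (rule that)
qed

context
  fixes U lc
  assumes U: "openin (ztop (projvar m Y)) U" and U_iff: "\<And>y. y \<in> Y \<Longrightarrow> lin (Suc n) lc (u y) \<noteq> 0 \<longleftrightarrow> y \<in> U"
begin

abbreviation "l \<equiv> lin (Suc n) lc"

lemma U_sub: "U \<subseteq> Y" using openin_subset[OF U] pts by simp

text \<open>In the coordinates \<open>u'\<close> the ratio is a quotient of two linear forms on the
  embedded variety; the embedding is a morphism and pulls it back.\<close>

lemma coord_regular: "(\<lambda>y. u y j / l (u y)) \<in> regs (projvar m Y) U"
proof -
  let ?p = "mp_lin (Suc n') (A j)" and ?q = "mp_lin (Suc n') (pull lc)"
  let ?D = "C' \<inter> pbasic n' ?q"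
  have reg: "pfrac ?p ?q \<in> regs (projvar n' C') ?D"
    by (rule pfrac_regs[OF mp_homogeneous_lin mp_homogeneous_lin]) blast
  have "openin (ztop (projvar n' C')) ?D"
    unfolding ztop_subvar openin_subtopology using openin_pbasic[OF mp_homogeneous_lin, of n' "Suc n'" "pull lc"] by blast
  then have "pfrac ?p ?q \<circ> (\<lambda>y. proj_point (u' y)) \<in> regs (projvar m Y) {y \<in> Y. proj_point (u' y) \<in> ?D}"
    using morphism_regs[OF emb_morphism] reg unfolding pts by blast
  moreover have "{y \<in> Y. proj_point (u' y) \<in> ?D} = U"
  proof -
    have "proj_point (u' y) \<in> ?D \<longleftrightarrow> y \<in> U" if y: "y \<in> Y" for y
    proof -
      have yC: "proj_point (u' y) \<in> C'" "proj_point (u' y) \<in> proj_points n'" using y C'_sub by (auto simp: C'_def)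
      have "(\<forall>w\<in>proj_point (u' y). mp_eval ?q w \<noteq> 0) \<longleftrightarrow> l (u y) \<noteq> 0"
      proof -
        have "(\<forall>w\<in>proj_point (u' y). mp_eval ?q w \<noteq> 0) \<longleftrightarrow> mp_eval ?q (u' y) \<noteq> 0"
          by (rule hom_nonzero_proj_point[OF mp_homogeneous_lin])
        then show ?thesis by (simp only: mp_eval_lin lin_pull[OF y])
      qed
      then show ?thesis using yC U_iff[OF y] by blast
    qed
    then show ?thesis using U_sub by blast
  qed
  ultimately have "pfrac ?p ?q \<circ> (\<lambda>y. proj_point (u' y)) \<in> regs (projvar m Y) U" by simp
  then show ?thesis
  proof (rule regs_subvar_cong)
    fix y assume "y \<in> U"
    then have y: "y \<in> Y" using U_sub by blast
    then have "proj_point (u' y) \<in> proj_points n'" using C'_sub by (auto simp: C'_def)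
    then have "pfrac ?p ?q (proj_point (u' y)) = mp_eval ?p (u' y) / mp_eval ?q (u' y)"
      using proj_point_self by (rule pfrac_eq[OF mp_homogeneous_lin mp_homogeneous_lin])
    then show "(pfrac ?p ?q \<circ> (\<lambda>y. proj_point (u' y))) y = u y j / l (u y)"
      by (simp add: mp_eval_lin lin_pull[OF y] A[OF y])
  qed
qed

lemma nonvanishing_on_line_open:
  assumes f: "f \<in> polyf W"
  shows "openin (ztop (projvar m Y)) {y \<in> U. f (\<lambda>j. c * (u y j / l (u y))) \<noteq> 0}"
proof -
  have "(\<lambda>v. f (\<lambda>j. c * v j)) \<in> polyf UNIV"
    by (rule polyf_subst[OF f]) (intro polyf_intros UNIV_I)
  then have "(\<lambda>y. f (\<lambda>j. c * (u y j / l (u y)))) \<in> regs (projvar m Y) U"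
    using reg_polyf[OF U coord_regular, of "\<lambda>v. f (\<lambda>j. c * v j)" UNIV] by simp
  then show ?thesis by (rule reg_nonzero_open[OF U])
qed

end

text \<open>On the line through \<open>u y\<close> a product vanishes only if one factor does, since
  both are polynomials in one parameter. So \<open>Y\<close> is the union of two closed sets, and
  irreducibility of \<open>Y\<close> makes one factor vanish on all lines.\<close>

lemma X_variety:
  assumes cover: "\<And>y. y \<in> Y \<Longrightarrow> \<exists>U lc. openin (ztop (projvar m Y)) U \<and> y \<in> U \<and>
     (\<forall>y\<in>Y. lin (Suc n) lc (u y) \<noteq> 0 \<longleftrightarrow> y \<in> U)"
  shows "affine_variety (Suc n) X"
proof -
  let ?T = "ztop (projvar m Y)"
  interpret I: poly_ideal "Suc n" "ideal_of (Suc n) X" by (rule poly_ideal_ideal_of)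
  have "poly_prime (Suc n) (ideal_of (Suc n) X)"
  proof
    show "(\<lambda>v. 1) \<notin> ideal_of (Suc n) X" by (simp add: ideal_of_def X_def)
    fix f g assume f: "f \<in> polyf {..<Suc n}" and g: "g \<in> polyf {..<Suc n}" and fg: "(\<lambda>v. f v * g v) \<in> ideal_of (Suc n) X"
    \<comment> \<open>The points whose whole line consists of zeros of \<open>h\<close>.\<close>
    define Z where "Z = (\<lambda>h :: (nat \<Rightarrow> 'k) \<Rightarrow> 'k. {y \<in> Y. \<forall>c. h (\<lambda>i. c * u y i) = 0})"
    have closed: "closedin ?T (Z h)" if h: "h \<in> polyf {..<Suc n}" for h
      unfolding closedin_def pts
    proof
      show "Z h \<subseteq> Y" by (auto simp: Z_def)
      show "openin ?T (Y - Z h)"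
      proof (subst openin_subopen, intro ballI)
        fix y assume "y \<in> Y - Z h"
        then obtain c where y: "y \<in> Y" "h (\<lambda>i. c * u y i) \<noteq> 0" by (auto simp: Z_def)
        obtain U lc where U: "openin ?T U" "y \<in> U" "\<And>y. y \<in> Y \<Longrightarrow> lin (Suc n) lc (u y) \<noteq> 0 \<longleftrightarrow> y \<in> U"
          using cover[OF y(1)] by blast
        let ?l = "lin (Suc n) lc"
        have ly: "?l (u y) \<noteq> 0" using U(3)[OF y(1)] U(2) by blast
        \<comment> \<open>The entries of \<open>u\<close> depend on the chosen local equations and
          need not be regular, whereas their ratios to the linear form are. The factor
          \<open>?l (u y)\<close> makes the resulting vector equal to \<open>c * u y\<close> at
          \<open>z = y\<close>.\<close>
        let ?W = "{z \<in> U. h (\<lambda>j. (c * ?l (u y)) * (u z j / ?l (u z))) \<noteq> 0}"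
        have "openin ?T ?W" by (rule nonvanishing_on_line_open[OF U(1,3) h])
        moreover have "y \<in> ?W" using U(2) y(2) ly by simp
        moreover have "?W \<subseteq> Y - Z h"
        proof
          fix z assume z: "z \<in> ?W"
          then have "z \<in> Y" using openin_subset[OF U(1)] pts by blast
          have "(\<lambda>j. (c * ?l (u y)) * (u z j / ?l (u z))) = (\<lambda>j. (c * ?l (u y) / ?l (u z)) * u z j)" by auto
          then have "h (\<lambda>j. (c * ?l (u y) / ?l (u z)) * u z j) \<noteq> 0" using z by simp
          then show "z \<in> Y - Z h" using \<open>z \<in> Y\<close> unfolding Z_def by blast
        qed
        ultimately show "\<exists>W. openin ?T W \<and> y \<in> W \<and> W \<subseteq> Y - Z h" by blast
      qed
    qed
    have "Z f \<union> Z g = Y"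
    proof
      show "Y \<subseteq> Z f \<union> Z g"
      proof
        fix y assume y: "y \<in> Y"
        have cu: "(\<lambda>i. 0 + c * u y i) = (\<lambda>i. c * u y i)" for c by simp
        obtain p where p: "\<And>c. poly p c = f (\<lambda>i. c * u y i)" using polyf_line[OF f, of "\<lambda>i. 0" "u y"] unfolding cu by blast
        obtain q where q: "\<And>c. poly q c = g (\<lambda>i. c * u y i)" using polyf_line[OF g, of "\<lambda>i. 0" "u y"] unfolding cu by blast
        have "poly (p * q) c = poly 0 c" for c
        proof -
          have "(\<lambda>i. c * u y i) \<in> X" unfolding X_iff using y by blast
          then show ?thesis using fg by (simp add: p q ideal_of_def)
        qed
        then have "p * q = 0" by (rule poly_ext_UNIV)
        then have "p = 0 \<or> q = 0" by simp
        then show "y \<in> Z f \<union> Z g" using y p q by (auto simp: Z_def)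
      qed
    qed (auto simp: Z_def)
    then have "Z f = Y \<or> Z g = Y"
      using conjunct2[OF irr[unfolded irreducible_space_def], rule_format, of "Z f" "Z g"] closed[OF f] closed[OF g]
      unfolding pts by blast
    moreover have "h \<in> ideal_of (Suc n) X" if "Z h = Y" "h \<in> polyf {..<Suc n}" for h
      unfolding ideal_of_def
    proof (intro CollectI conjI ballI)
      fix x assume "x \<in> X"
      then obtain y c where y: "y \<in> Y" "x = (\<lambda>i. c * u y i)" unfolding X_iff by blast
      have "y \<in> Z h" using y(1) that(1) by simp
      then show "h x = 0" using y(2) by (simp add: Z_def)
    qed (rule that)
    ultimately show "f \<in> ideal_of (Suc n) X \<or> g \<in> ideal_of (Suc n) X" using f g by blast
  qed
  then show ?thesis using X_closed by (simp add: affine_variety_iff closedin_affine_iff)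
qed

text \<open>Going down, a point of the cone is sent to its point of \<open>Y\<close> through the
  inverse of the embedding and then into \<open>Z\<close>; this is regular where the form is
  nonzero, hence a polynomial over a power of it. Going up, a point of \<open>Z\<close> is sent to
  the representative of its line on which the form equals 1; this is regular on an affine variety,
  hence polynomial.\<close>

lemma chart_exists:
  assumes X: "affine_variety (Suc n) X"
    and U: "openin (ztop (projvar m Y)) U" and U_iff: "\<And>y. y \<in> Y \<Longrightarrow> lin (Suc n) lc (u y) \<noteq> 0 \<longleftrightarrow> y \<in> U"
    and flex: "flexible_affine (subvar (projvar m Y) U)"
  shows "\<exists>N Z a b M. cone_chart (Suc n) N X Z lc a b M \<and> flexible N Z"
proof -
  let ?l = "lin (Suc n) lc" and ?Yv = "projvar m Y"
  obtain N Z \<phi> where Z: "flexible N Z" and iso: "isomorphism (subvar ?Yv U) (affvar N Z) \<phi>"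
    using flex unfolding flexible_affine_def by blast
  have Zv: "affine_variety N Z" using Z by (simp add: flexible_def)
  note Zsub = affine_variety_sub[OF Zv]
  have UY: "U \<subseteq> Y" using openin_subset[OF U] pts by simp
  have ptsU: "points (subvar ?Yv U) = U" using UY pts by auto
  have ptsZ: "points (affvar N Z) = Z" using Zsub by auto
  obtain \<psi> where \<phi>: "morphism (subvar ?Yv U) (affvar N Z) \<phi>" and \<psi>: "morphism (affvar N Z) (subvar ?Yv U) \<psi>"
    and inv: "\<forall>y\<in>U. \<psi> (\<phi> y) = y" "\<forall>z\<in>Z. \<phi> (\<psi> z) = z"
    by (rule isomorphismE[OF iso, unfolded ptsU ptsZ])
  note \<psi>\<phi> = bspec[OF inv(1)] and \<phi>\<psi> = bspec[OF inv(2)]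
  have \<phi>Z: "\<phi> y \<in> Z" if "y \<in> U" for y
    using morphism_points[OF \<phi>, of y] that unfolding ptsU ptsZ .
  have \<psi>U: "\<psi> z \<in> U" if "z \<in> Z" for z
    using morphism_points[OF \<psi>, of z] that unfolding ptsU ptsZ .
  obtain \<Psi> where \<Psi>: "morphism (projvar n' C') ?Yv \<Psi>" and \<Psi>inv: "\<forall>y\<in>Y. \<Psi> (proj_point (u' y)) = y"
    by (rule emb_inverse)
  note \<Psi>u = bspec[OF \<Psi>inv]
  \<comment> \<open>The point of \<open>Y\<close> whose line contains \<open>x\<close>, reached
    through the second basis because that is the one with an inverse morphism.\<close>
  define pt where "pt = (\<lambda>x. \<Psi> (proj_point (Bm x)))"
  have pt: "proj_point (Bm (\<lambda>i. c * u y i)) = proj_point (u' y)" "pt (\<lambda>i. c * u y i) = y" if "y \<in> Y" "c \<noteq> 0" for y c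
  proof -
    show "proj_point (Bm (\<lambda>i. c * u y i)) = proj_point (u' y)"
      unfolding Bm_u[OF that(1)] using that(2) by (rule proj_point_scale)
    then show "pt (\<lambda>i. c * u y i) = y" unfolding pt_def by (simp only: \<Psi>u[OF that(1)])
  qed
  have rep: "\<exists>y\<in>U. \<exists>c. c \<noteq> 0 \<and> x = (\<lambda>i. c * u y i)" if x: "x \<in> X" "?l x \<noteq> 0" for x
  proof -
    obtain y c where y: "y \<in> Y" "x = (\<lambda>i. c * u y i)" using x(1) unfolding X_iff by blast
    have "?l x = c * ?l (u y)" unfolding y(2) by (rule lin_scale)
    then have "c * ?l (u y) \<noteq> 0" using x(2) by simp
    then have "c \<noteq> 0" "y \<in> U" using U_iff[OF y(1)] by auto
    then show ?thesis using y(2) by blast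
  qed
  have lu: "?l (u y) \<noteq> 0" if "y \<in> U" for y using U_iff that UY by blast
  have opU: "openin (ztop (subvar ?Yv U)) U" using openin_topspace[of "ztop (subvar ?Yv U)"] ptsU by simp
  have opZ: "openin (ztop (affvar N Z)) Z" using openin_topspace[of "ztop (affvar N Z)"] ptsZ by simp
  have Zcl: "closedin (ztop (affine_space N)) Z" using Zv by (simp add: affine_variety_def)
  have "\<exists>p M. p \<in> polyf {..<Suc n} \<and> (\<forall>x\<in>X. ?l x \<noteq> 0 \<longrightarrow> ?l x ^ M * \<phi> (pt x) k = p x)" for k
  proof (cases "k < N")
    case True
    let ?g = "\<lambda>y. \<phi> y k"
    have "(\<lambda>v. v k) \<in> regs (affvar N Z) Z"
      using True Zsub by (subst regs_affine_iff) (auto intro: loc_frac_polyf polyf.var)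
    then have "(\<lambda>v. v k) \<circ> \<phi> \<in> regs (subvar ?Yv U) {y \<in> U. \<phi> y \<in> Z}"
      using morphism_regs[OF \<phi> opZ] unfolding ptsU by blast
    moreover have "{y \<in> U. \<phi> y \<in> Z} = U" using \<phi>Z by blast
    ultimately have "?g \<in> regs (subvar ?Yv U) U" by (simp add: comp_def)
    then have "?g \<in> regs ?Yv U" by (rule regs_open_projvar[OF UY Y])
    then have reg: "?g \<circ> \<Psi> \<in> regs (projvar n' C') {c \<in> points (projvar n' C'). \<Psi> c \<in> U}"
      by (rule morphism_regs[OF \<Psi> U])
    have ptsC: "points (projvar n' C') = C'" using C'_sub by auto
    have "{c \<in> C'. \<Psi> c \<in> U} \<subseteq> proj_points n'" using C'_sub by blast
    from regs_proj_iff[OF this] have pl: "ploc_frac n' {c \<in> C'. \<Psi> c \<in> U} (?g \<circ> \<Psi>)"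
      using reg unfolding ptsC by blast
    have mem: "proj_point (Bm x) \<in> {c \<in> C'. \<Psi> c \<in> U}" if x: "x \<in> X" "?l x \<noteq> 0" for x
    proof -
      obtain y c where y: "y \<in> U" "c \<noteq> 0" "x = (\<lambda>i. c * u y i)" using rep[OF x] by blast
      then have yY: "y \<in> Y" using UY by blast
      show ?thesis unfolding y(3) pt(1)[OF yY y(2)] using y(1) yY by (auto simp: C'_def \<Psi>u)
    qed
    have "loc_frac (Suc n) {x \<in> X. ?l x \<noteq> 0} (\<lambda>x. \<phi> (pt x) k)"
      unfolding loc_frac_def
    proof
      fix x assume "x \<in> {x \<in> X. ?l x \<noteq> 0}"
      then have x: "x \<in> X" "?l x \<noteq> 0" by auto
      obtain p q d where pq: "mp_homogeneous d p" "mp_homogeneous d q" "\<And>v. v \<in> proj_point (Bm x) \<Longrightarrow> mp_eval q v \<noteq> 0"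
        "\<And>y v. y \<in> {c \<in> C'. \<Psi> c \<in> U} \<Longrightarrow> v \<in> y \<Longrightarrow> mp_eval q v \<noteq> 0 \<Longrightarrow> (?g \<circ> \<Psi>) y = mp_eval p v / mp_eval q v"
        by (rule ploc_fracE[OF pl mem[OF x]]) blast
      show "\<exists>p\<in>polyf {..<Suc n}. \<exists>q\<in>polyf {..<Suc n}. q x \<noteq> 0 \<and>
         (\<forall>y\<in>{x \<in> X. ?l x \<noteq> 0}. q y \<noteq> 0 \<longrightarrow> \<phi> (pt y) k = p y / q y)"
      proof (intro bexI conjI ballI impI)
        show "mp_eval q (Bm x) \<noteq> 0" using pq(3) proj_point_self by blast
        fix y assume y: "y \<in> {x \<in> X. ?l x \<noteq> 0}" "mp_eval q (Bm y) \<noteq> 0"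
        then have "proj_point (Bm y) \<in> {c \<in> C'. \<Psi> c \<in> U}" by (intro mem) auto
        then show "\<phi> (pt y) k = mp_eval p (Bm y) / mp_eval q (Bm y)"
          using pq(4)[OF _ proj_point_self y(2)] by (simp add: pt_def)
      qed (rule Bm_polyf[OF mp_eval_polyf])+
    qed
    then obtain M p where "p \<in> polyf {..<Suc n}" "\<And>x. x \<in> X \<Longrightarrow> ?l x \<noteq> 0 \<Longrightarrow> ?l x ^ M * \<phi> (pt x) k = p x"
      by (rule loc_frac_principal_open[OF X_closed lin_polyf]) blast
    then show ?thesis by blast
  next
    case False
    have "\<phi> (pt x) k = 0" if x: "x \<in> X" "?l x \<noteq> 0" for x
    proof -
      obtain y c where y: "y \<in> U" "c \<noteq> 0" "x = (\<lambda>i. c * u y i)" using rep[OF x] by blast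
      then have "pt x = y" using pt(2) UY by blast
      then show ?thesis using subsetD[OF Zsub \<phi>Z[OF y(1)]] False by (simp add: affine_points_def)
    qed
    then show ?thesis by (intro exI[of _ "\<lambda>x. 0"]) (simp add: polyf.const)
  qed
  then obtain P Mk where P: "\<And>k. P k \<in> polyf {..<Suc n}"
      "\<And>k x. x \<in> X \<Longrightarrow> ?l x \<noteq> 0 \<Longrightarrow> ?l x ^ Mk k * \<phi> (pt x) k = P k x" by metis
  \<comment> \<open>A common exponent for all coordinates; coordinates that need a smaller one are
    padded with powers of the form.\<close>
  define M where "M = (\<Sum>k<N. Mk k)"
  have Mk: "Mk k \<le> M" if "k < N" for k unfolding M_def using that by (intro member_le_sum) auto
  define a where "a = (\<lambda>k. if k < N then (\<lambda>x. ?l x ^ (M - Mk k) * P k x) else (\<lambda>x. 0))"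
  have a_eq: "a k x = ?l x ^ M * \<phi> y k" if y: "y \<in> U" and c: "c \<noteq> 0" and x: "x = (\<lambda>i. c * u y i)" for k x y c
  proof -
    have yY: "y \<in> Y" using y UY by blast
    have xX: "x \<in> X" unfolding X_iff using yY x by blast
    have lx: "?l x \<noteq> 0" unfolding x lin_scale using lu[OF y] c by simp
    have ptx: "pt x = y" unfolding x by (rule pt(2)[OF yY c])
    show ?thesis
    proof (cases "k < N")
      case True
      have "?l x ^ (M - Mk k) * P k x = ?l x ^ (M - Mk k) * ?l x ^ Mk k * \<phi> y k"
        using P(2)[OF xX lx, of k] ptx by (simp only: mult.assoc)
      also have "\<dots> = ?l x ^ M * \<phi> y k" using Mk[OF True] by (simp flip: power_add)
      finally show ?thesis using True by (simp add: a_def)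
    next
      case False
      then show ?thesis using subsetD[OF Zsub \<phi>Z[OF y]] by (simp add: a_def affine_points_def)
    qed
  qed
  have "\<exists>f\<in>polyf {..<N}. \<forall>z\<in>Z. u (\<psi> z) j / ?l (u (\<psi> z)) = f z" for j
  proof -
    have "(\<lambda>y. u y j / ?l (u y)) \<in> regs (subvar ?Yv U) U"
      by (rule regs_subvar_open[OF U coord_regular[OF U U_iff]])
    then have "(\<lambda>y. u y j / ?l (u y)) \<circ> \<psi> \<in> regs (affvar N Z) {z \<in> Z. \<psi> z \<in> U}"
      using morphism_regs[OF \<psi> opU] unfolding ptsZ by blast
    moreover have "{z \<in> Z. \<psi> z \<in> U} = Z" using \<psi>U by blast
    ultimately have "loc_frac N Z (\<lambda>z. u (\<psi> z) j / ?l (u (\<psi> z)))" using Zsub by (simp add: regs_affine_iff comp_def)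
    then obtain f where "f \<in> polyf {..<N}" "\<And>z. z \<in> Z \<Longrightarrow> u (\<psi> z) j / ?l (u (\<psi> z)) = f z"
      by (rule loc_frac_global[OF Zcl]) blast
    then show ?thesis by blast
  qed
  then obtain b0 where b0: "\<And>j. b0 j \<in> polyf {..<N}" "\<And>j z. z \<in> Z \<Longrightarrow> u (\<psi> z) j / ?l (u (\<psi> z)) = b0 j z" by metis
  \<comment> \<open>From index \<open>n + 1\<close> on the functions are set to zero explicitly,
    since \<open>b0\<close> is known to vanish there only at points of \<open>Z\<close>.\<close>
  define b where "b = (\<lambda>j. if j < Suc n then b0 j else (\<lambda>z. 0))"
  have b_eq: "b j z = (1 / ?l (u (\<psi> z))) * u (\<psi> z) j" if "z \<in> Z" for j z
    using b0(2)[OF that, of j] u_aff[of "\<psi> z"] by (auto simp: b_def affine_points_def)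
  have b_fun: "(\<lambda>j. b j z) = (\<lambda>j. (1 / ?l (u (\<psi> z))) * u (\<psi> z) j)" if "z \<in> Z" for z
    using b_eq[OF that] by blast
  have alpha: "(\<lambda>k. a k x / ?l x ^ M) = \<phi> y"
    if y: "y \<in> U" and c: "c \<noteq> 0" and x: "x = (\<lambda>i. c * u y i)" for x y c
  proof -
    have "?l x \<noteq> 0" unfolding x lin_scale using lu[OF y] c by simp
    then show ?thesis using a_eq[OF that] by simp
  qed
  have "cone_chart (Suc n) N X Z lc a b M"
  proof
    show "affine_variety (Suc n) X" "affine_variety N Z" by fact+
    show "(\<lambda>i. c * x i) \<in> X" if "x \<in> X" for x c using that by (rule X_cone)
    show "a k \<in> polyf {..<Suc n}" for k
      unfolding a_def by (auto intro!: polyf.mult polyf_power lin_polyf P(1) polyf.const)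
    show "a k = (\<lambda>v. 0)" if "N \<le> k" for k using that by (simp add: a_def)
    show "b j \<in> polyf {..<N}" for j using b0(1) by (auto simp: b_def polyf.const)
    show "b j = (\<lambda>v. 0)" if "Suc n \<le> j" for j using that by (simp add: b_def)
    show "(\<lambda>k. a k x / ?l x ^ M) \<in> Z" if x: "x \<in> X" "?l x \<noteq> 0" for x
    proof -
      obtain y c where y: "y \<in> U" "c \<noteq> 0" "x = (\<lambda>i. c * u y i)" using rep[OF x] by blast
      show ?thesis unfolding alpha[OF y] using \<phi>Z[OF y(1)] .
    qed
    show "(\<lambda>j. b j z) \<in> X" if z: "z \<in> Z" for z
      unfolding b_fun[OF z] X_iff using \<psi>U[OF z] UY by blast
    show "?l (\<lambda>j. b j z) = 1" if z: "z \<in> Z" for z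
      unfolding b_fun[OF z] lin_scale using lu[OF \<psi>U[OF z]] by simp
    show "a k (\<lambda>j. b j z) = z k" if z: "z \<in> Z" for z k
    proof -
      have l1: "?l (\<lambda>j. b j z) = 1" unfolding b_fun[OF z] lin_scale using lu[OF \<psi>U[OF z]] by simp
      have "1 / ?l (u (\<psi> z)) \<noteq> 0" using lu[OF \<psi>U[OF z]] by simp
      then have "a k (\<lambda>j. b j z) = ?l (\<lambda>j. b j z) ^ M * \<phi> (\<psi> z) k" using b_fun[OF z] by (rule a_eq[OF \<psi>U[OF z]])
      then show ?thesis unfolding l1 \<phi>\<psi>[OF z] by simp
    qed
    show "?l x * b j (\<lambda>k. a k x / ?l x ^ M) = x j" if x: "x \<in> X" "?l x \<noteq> 0" for x j
    proof -
      obtain y c where y: "y \<in> U" "c \<noteq> 0" "x = (\<lambda>i. c * u y i)" using rep[OF x] by blast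
      have "b j (\<phi> y) = (1 / ?l (u y)) * u y j" using b_eq[OF \<phi>Z[OF y(1)], of j] unfolding \<psi>\<phi>[OF y(1)] .
      then show ?thesis unfolding alpha[OF y] using lu[OF y(1)] by (simp add: y(3) lin_scale)
    qed
  qed
  then show ?thesis using Z by blast
qed

end

theorem theorem1p4:
  fixes Y :: "(nat \<Rightarrow> 'k::{alg_closed_field, field_char_0}) set set"
    and m n :: nat
    and I :: "'i set"
    and U :: "'i \<Rightarrow> (nat \<Rightarrow> 'k) set set"
    and D :: "'i \<Rightarrow> ((nat \<Rightarrow> 'k) set, 'k) divisor"
    and H :: "((nat \<Rightarrow> 'k) set, 'k) divisor"
    and s :: "nat \<Rightarrow> ((nat \<Rightarrow> 'k) set, 'k) ratfun"
  assumes "projective_variety m Y"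
    and "\<forall>i\<in>I. openin (ztop (projvar m Y)) (U i)"
    and "(\<Union>i\<in>I. U i) = Y"
    and "\<forall>i\<in>I. flexible_affine (subvar (projvar m Y) (U i)) \<and>
               normal_variety (subvar (projvar m Y) (U i))"
    and "very_ample (projvar m Y) H"
    and "\<forall>i\<in>I. cartier (projvar m Y) (D i) \<and> effective (projvar m Y) (D i) \<and>
               div_support (projvar m Y) (D i) = Y - U i \<and>
               lin_equiv (projvar m Y) (D i) H"
    and "section_basis (projvar m Y) H n s"
  shows "flexible (Suc n) (aff_cone (projvar m Y) H n s)"
proof -
  let ?Yv = "projvar m Y"
  have Yp: "Y \<subseteq> proj_points m" using assms(1) closedin_subset[of "ztop (proj_space m)" Y] by (simp add: projective_variety_def)
  have irrY: "irreducible_space (ztop ?Yv)" using assms(1) by (simp add: projective_variety_def)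
  interpret F: irr_fspace ?Yv by (rule irr_fspace_projvar[OF irrY Yp])
  have pts: "points ?Yv = Y" using Yp by auto
  have H: "cartier ?Yv H" using assms(5) by (simp add: very_ample_def)
  obtain n' s' where s': "section_basis ?Yv H n' s'" and emb: "closed_embedding ?Yv n' (linsys_map ?Yv H n' s')"
    using assms(5) unfolding very_ample_def by blast
  let ?u = "F.sec_val H n s" and ?u' = "F.sec_val H n' s'"
  obtain A where A: "\<And>y j. y \<in> Y \<Longrightarrow> ?u y j = lin (Suc n') (A j) (?u' y)"
    by (rule F.sec_val_change_basis[OF H assms(7) s']) (simp only: pts)
  obtain B where B: "\<And>y j. y \<in> Y \<Longrightarrow> ?u' y j = lin (Suc n) (B j) (?u y)"
    by (rule F.sec_val_change_basis[OF H s' assms(7)]) (simp only: pts)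
  interpret E: embedded_cone m Y n n' ?u ?u' A B
  proof
    show "?u y \<in> affine_points (Suc n)" for y by (simp add: F.sec_val_def affine_points_def)
    show "?u' y \<in> affine_points (Suc n')" for y by (simp add: F.sec_val_def affine_points_def)
    show "closed_embedding ?Yv n' (\<lambda>y. proj_point (?u' y))" using emb by (simp only: F.linsys_map_sec_val)
  qed (use Yp A B in blast)+
  \<comment> \<open>The divisor \<open>D i\<close> is the zero divisor of a section of
    \<open>H\<close>, that is, of a linear form on the cone; its nonvanishing locus is the part over
    \<open>U i\<close>.\<close>
  have "\<exists>c. \<forall>y\<in>Y. lin (Suc n) c (?u y) \<noteq> 0 \<longleftrightarrow> y \<in> U i" if i: "i \<in> I" for i
  proof -
    have D: "cartier ?Yv (D i)" "effective ?Yv (D i)" "lin_equiv ?Yv (D i) H" and supp: "div_support ?Yv (D i) = Y - U i"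
      using assms(6) i by blast+
    obtain c where "\<And>y. y \<in> points ?Yv \<Longrightarrow> lin (Suc n) c (?u y) \<noteq> 0 \<longleftrightarrow> y \<notin> div_support ?Yv (D i)"
      by (rule F.support_linear_form[OF H assms(7) D]) blast
    then show ?thesis unfolding pts supp by blast
  qed
  then obtain lc where lc: "\<And>i y. i \<in> I \<Longrightarrow> y \<in> Y \<Longrightarrow> lin (Suc n) (lc i) (?u y) \<noteq> 0 \<longleftrightarrow> y \<in> U i" by metis
  have opn: "openin (ztop ?Yv) (U i)" if "i \<in> I" for i using assms(2) that by blast
  have X: "affine_variety (Suc n) E.X"
  proof (rule E.X_variety)
    fix y assume "y \<in> Y"
    then obtain i where i: "i \<in> I" "y \<in> U i" using assms(3) by blast
    show "\<exists>U lc. openin (ztop ?Yv) U \<and> y \<in> U \<and> (\<forall>y\<in>Y. lin (Suc n) lc (?u y) \<noteq> 0 \<longleftrightarrow> y \<in> U)"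
      using opn[OF i(1)] i(2) lc[OF i(1)] by blast
  qed
  have "\<exists>N Z a b M. cone_chart (Suc n) N E.X Z (lc i) a b M \<and> flexible N Z" if i: "i \<in> I" for i
    using assms(4) i by (intro E.chart_exists[OF X opn[OF i] lc[OF i]]) blast+
  then obtain N Z a b M where chart: "\<And>i. i \<in> I \<Longrightarrow> cone_chart (Suc n) (N i) E.X (Z i) (lc i) (a i) (b i) (M i)"
    and flex: "\<And>i. i \<in> I \<Longrightarrow> flexible (N i) (Z i)" by metis
  have "flexible (Suc n) E.X"
  proof (rule cone_flexible[OF X E.X_cone _ chart flex])
    fix c assume c: "\<And>x. x \<in> E.X \<Longrightarrow> lin (Suc n) c x = 0"
    have "lin (Suc n) c (?u y) = 0" if "y \<in> points ?Yv" for y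
    proof -
      have "(\<lambda>i. 1 * ?u y i) \<in> E.X" unfolding E.X_iff using that pts by blast
      then show ?thesis using c by simp
    qed
    then have "\<forall>j\<le>n. c j = 0" by (rule F.sec_val_span[OF H assms(7)])
    then show "\<forall>j<Suc n. c j = 0" by (simp add: less_Suc_eq_le)
  next
    fix x assume x: "x \<in> E.X" "x \<noteq> (\<lambda>i. 0)"
    then obtain y c where y: "y \<in> Y" "x = (\<lambda>i. c * ?u y i)" unfolding E.X_iff by blast
    then have "c \<noteq> 0" using x(2) by auto
    obtain i where i: "i \<in> I" "y \<in> U i" using y(1) assms(3) by blast
    have "lin (Suc n) (lc i) x \<noteq> 0" unfolding y(2) lin_scale using lc[OF i(1) y(1)] i(2) \<open>c \<noteq> 0\<close> by simp
    then show "\<exists>i\<in>I. lin (Suc n) (lc i) x \<noteq> 0" using i(1) by blast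
  qed
  moreover have "aff_cone ?Yv H n s = E.X"
    unfolding aff_cone_def E.X_def pts F.linsys_map_sec_val ..
  ultimately show ?thesis by simp
qed

end
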